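(* Let $V$ be an irreducible integrable module for the twisted toroidal extended affine Lie algebra $\mathcal T$ such that $K_0$ acts as a scalar $C_0\in\mathbb Z_{>0}$ and $K_i$ acts trivially for $1\le i\le n$, and let $M=\{v\in V:\mathcal T^+v=0\}=\bigoplus_{k\in\mathbb Z^n}M_k$. Let $\Lambda\in\mathcal H^*$ be the fixed weight of $M$ and $\bar\lambda=\Lambda|_{\mathfrak h(0)}$ as in the context. Then: (a) $t^rK_0v\neq0$ for all $r\in\Gamma$ and all $0\neq v\in M$. (b) For $r,s\in\Gamma$ one has $t^rK_0\,t^sK_0=\lambda_{r,s}\,t^{r+s}K_0$ on $M$ for scalars $\lambda_{r,s}$, where for some constants $\lambda,\mu\in\mathbb C$: $\lambda_{r,s}=\lambda$ for all $r\neq0$, $s\neq0$, $r+s\neq0$; $\lambda_{r,-r}=\mu$ for all $r\neq0$; and $\lambda_{0,r}=C_0$ for all $r\in\Gamma$. Further, $\mu C_0=\lambda^2\neq0$. (c) $\dim M_k=\dim M_{k+r}=:p_k$ for all $k\in\mathbb Z^n$, $r\in\Gamma$. Suppose $v_1(k),\dots,v_{p_k}(k)$ is a basis of $M_k$, where $0\le k_i<m_i$ for $1\le i\le n$. Let $v_i(k+s)=\frac1\lambda\,t^sK_0\,v_i(k)$ for all $i$ and all $0\neq s\in\Gamma$. Then $v_1(k+s),\dots,v_{p_k}(k+s)$ is a basis of $M_{k+s}$. (d) For $0\neq r\in\Gamma$ and $s\in\Gamma$, $t^rK_0\,(v_1(k+s),\dots,v_{p_k}(k+s))=\lambda\,(v_1(k+s+r),\dots,v_{p_k}(k+s+r))$.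 (e) Let $\alpha_1^\vee,\dots,\alpha_l^\vee$ be the simple coroots of $\mathfrak g(\bar0,\bar0)$ in $\mathfrak h(0)$. There exists $\alpha\in\mathfrak h(0)^*$ such that, writing $h(r)=h\otimes t^r$ for $h\in\mathfrak h(0)$, $$h(r)\,(v_1(k+s),\dots,v_{p_k}(k+s))=\alpha(h)\,(v_1(k+s+r),\dots,v_{p_k}(k+s+r))\quad\text{for all } 0\neq r\in\Gamma,\ s\in\Gamma,$$ and $\alpha(\alpha_i^\vee)=0$ if and only if $\bar\lambda(\alpha_i^\vee)=0$. (f) There is $\Lambda_d\in\mathbb C$ such that $t^rd_0\,(v_1(k+s),\dots,v_{p_k}(k+s))=\Lambda_d\,(v_1(k+s+r),\dots,v_{p_k}(k+s+r))$ for all $0\neq r\in\Gamma$, $s\in\Gamma$ and all $k$, and $d_0v(k)=\Lambda(d_0)v(k)$ for all $v(k)\in M_k$. (In (d)–(f) the $v_i(\cdot)$ are the bases from (c). Operators applied to a tuple act componentwise.)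
   Context: **The algebra $\mathcal T$.** Let $n\ge 2$, let $\mathfrak g$ be a finite-dimensional simple Lie algebra over $\mathbb C$ with invariant form $(\cdot|\cdot)$, and let $\sigma_0,\dots,\sigma_n$ be commuting automorphisms of $\mathfrak g$ of finite orders $m_0,\dots,m_n$. Put $m=(m_1,\dots,m_n)$, $\Gamma_0=m_0\mathbb Z$, $\Gamma=m_1\mathbb Z\oplus\dots\oplus m_n\mathbb Z$; bars on integer vectors denote classes in $\mathbb Z/\Gamma_0$ and $\mathbb Z^n/\Gamma$. With $\xi_i$ a primitive $m_i$-th root of unity, $\mathfrak g(\bar k_0,\bar k)=\{X\in\mathfrak g:\sigma_iX=\xi_i^{k_i}X,\ 0\le i\le n\}$. Let $LT=\bigoplus_{(k_0,k)\in\mathbb Z\times\mathbb Z^n}\mathfrak g(\bar k_0,\bar k)\otimes t_0^{k_0}t^k$ and assume $LT$ is a Lie torus, i.e.: (1) $\mathfrak g(\bar0,\bar0)$ is simple; (2) if $(\bar k_0,\bar k)\ne(0,0)$ and $\mathfrak g(\bar k_0,\bar k)\neq0$, then as $\mathfrak g(\bar0,\bar0)$-module it is $U\oplus W$ with $U$ trivial and $W$ either zero or irreducible of dimension $>1$ with all weights in $\Delta_{0,\mathrm{en}}$; (3) the order of the group generated by $\sigma_0,\dots,\sigma_n$ is $m_0m_1\cdots m_n$. Here $\mathfrak h(0)$ is a Cartan subalgebra of $\mathfrak g(\bar0,\bar0)$, $\Delta_0^\times$ is the root system of $(\mathfrak g(\bar0,\bar0),\mathfrak h(0))$, and $\Delta_{0,\mathrm{en}}=\Delta_{0,\mathrm{en}}^\times\cup\{0\}$,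 where $\Delta_{0,\mathrm{en}}^\times$ is $\Delta_0^\times\cup2\{\text{short roots}\}$ if $\Delta_0^\times$ has type $B_l$ ($l\ge1$, $B_1=A_1$), and is $\Delta_0^\times$ otherwise. Let $A(m_0,m)=\mathbb C[t_0^{\pm m_0},\dots,t_n^{\pm m_n}]$. For $r\in\mathbb Z^{n+1}$ write $t^r$ for the monomial of degree $r$; for $r\in\mathbb Z^n$, $t^r=t_1^{r_1}\cdots t_n^{r_n}$. $\Omega_{A(m_0,m)}/d_{A(m_0,m)}$ is the span of symbols $t^rK_i$ ($r\in\Gamma_0\oplus\Gamma$, $0\le i\le n$) modulo the relations $\sum_{i=0}^n r_it^rK_i=0$. With $d_i=t_i\partial/\partial t_i$ and $D(u,r)=\sum_i u_it^rd_i$, let $\mathcal S_{n+1}(m_0,m)=\mathrm{span}\{D(u,r):u\in\mathbb C^{n+1},r\in\Gamma_0\oplus\Gamma,(u|r)=0\}$, with $(\cdot|\cdot)$ the standard bilinear form. Then $\mathcal T=LT\oplus\Omega_{A(m_0,m)}/d_{A(m_0,m)}\oplus\mathcal S_{n+1}(m_0,m)$ with the brackets $[X\otimes t^p,Y\otimes t^q]=[X,Y]\otimes t^{p+q}+(X|Y)\sum_cp_ct^{p+q}K_c$; $[t^pd_a,X\otimes t^q]=q_aX\otimes t^{p+q}$; $[t^pd_a,t^qK_b]=q_at^{p+q}K_b+\delta_{ab}\sum_cp_ct^{p+q}K_c$; $[t^pd_a,t^qd_b]=q_at^{p+q}d_b-p_bt^{p+q}d_a+\phi(t^pd_a,t^qd_b)$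 (extended linearly and restricted to $\mathcal S_{n+1}(m_0,m)$); all other brackets zero. Here $\phi$ is a fixed linear combination of $\phi_1(t^pd_a,t^qd_b)=-q_ap_b\sum_cp_ct^{p+q}K_c$ and $\phi_2(t^pd_a,t^qd_b)=-p_aq_b\sum_cp_ct^{p+q}K_c$. **Integrable modules.** $\mathcal H=\mathfrak h(0)\oplus\sum_{i=0}^n\mathbb CK_i\oplus\sum_{i=0}^n\mathbb Cd_i$. For $\alpha\in\mathfrak h(0)^*$ put $\mathfrak g(\bar k_0,\bar k,\alpha)=\{x\in\mathfrak g(\bar k_0,\bar k):[h,x]=\alpha(h)x\ \forall h\in\mathfrak h(0)\}$. A $\mathcal T$-module $V$ is integrable if it is the direct sum of its $\mathcal H$-weight spaces, these are finite-dimensional, and $\mathfrak g(\bar k_0,\bar k,\alpha)\otimes t_0^{k_0}t^k$ acts locally nilpotently for every $0\neq\alpha\in\Delta_{0,\mathrm{en}}$. **The space $M$.** For $0\le i\le n$ let $\delta_i\in\mathcal H^*$ be $0$ on $\mathfrak h(0)$ and all $K_j$, with $\delta_i(d_j)=\delta_{ij}$; for $k\in\mathbb Z^n$ put $\delta_k=\sum_{i=1}^nk_i\delta_i$. Extend elements of $\mathfrak h(0)^*$ by $0$ on the $K_i,d_i$. Let $\alpha_1,\dots,\alpha_q$ be simple roots of $\mathfrak g(\bar0,\bar0)$, $\beta_0$ the maximal root in $\Delta_{0,\mathrm{en}}$, $\alpha_0=-\beta_0+\delta_0$; write $\eta>0$ if $0\neq\eta\in\bigoplus_{i=0}^q\mathbb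 N\alpha_i$. $\mathcal T^+$ is the sum of all $\mathfrak g(\bar k_0,\bar k,\alpha)\otimes t_0^{k_0}t^k$ with $\alpha+k_0\delta_0>0$, of all $\mathbb Ct_0^{s_0}t^sK_i$ with $s_0>0$, and of the span of all $D(u,r)\in\mathcal S_{n+1}(m_0,m)$ with $r_0>0$. $\mathcal T^0$ is the sum of all $\mathfrak g(\bar0,\bar k,0)\otimes t^k$ ($k\in\mathbb Z^n$), of all $\mathbb Ct^sK_i$ ($s\in\Gamma$, $0\le i\le n$), and of the span of all $D(u,r)\in\mathcal S_{n+1}(m_0,m)$ with $r_0=0$. The space $M=\{v\in V:\mathcal T^+v=0\}$ is a non-zero irreducible $\mathcal T^0$-module. Fix a weight $\Lambda\in\mathcal H^*$ of $M$; then all weights of $M$ are of the form $\Lambda+\delta_k$, $k\in\mathbb Z^n$, and $M_k$ denotes the weight space of weight $\Lambda+\delta_k$, i.e. $M$ is $\mathbb Z^n$-graded by $d_1,\dots,d_n$. $\mathfrak h(0)$ acts on $M$ by the scalars $\bar\lambda=\Lambda|_{\mathfrak h(0)}$. *)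

theory Defs
  imports
    "HOL-Analysis.Cartesian_Space"
    "HOL-Analysis.Product_Vector"
    "HOL-Library.Poly_Mapping"
    "HOL-Algebra.Bij"
    "HOL-Algebra.Generated_Groups"
begin

section \<open>Lie algebras\<close>

text \<open>
  The ambient Lie algebra occupies a whole type \<open>'g\<close>; its scalar multiplication by complex
  numbers and its bracket are explicit parameters \<open>sc\<close> and \<open>br\<close>.  Subalgebras are subsets.
\<close>

definition lie_algebra ::
  "(complex \<Rightarrow> 'g::ab_group_add \<Rightarrow> 'g) \<Rightarrow> ('g \<Rightarrow> 'g \<Rightarrow> 'g) \<Rightarrow> bool" where
  "lie_algebra sc br \<longleftrightarrow>
     vector_space sc \<and>
     (\<forall>x. Vector_Spaces.linear sc sc (br x)) \<and>
     (\<forall>y. Vector_Spaces.linear sc sc (\<lambda>x. br x y)) \<and>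
     (\<forall>x. br x x = 0) \<and>
     (\<forall>x y z. br x (br y z) + br y (br z x) + br z (br x y) = 0)"

definition lie_subalgebra ::
  "(complex \<Rightarrow> 'g::ab_group_add \<Rightarrow> 'g) \<Rightarrow> ('g \<Rightarrow> 'g \<Rightarrow> 'g) \<Rightarrow> 'g set \<Rightarrow> bool" where
  "lie_subalgebra sc br L \<longleftrightarrow> module.subspace sc L \<and> (\<forall>x\<in>L. \<forall>y\<in>L. br x y \<in> L)"

definition simple_lie ::
  "(complex \<Rightarrow> 'g::ab_group_add \<Rightarrow> 'g) \<Rightarrow> ('g \<Rightarrow> 'g \<Rightarrow> 'g) \<Rightarrow> 'g set \<Rightarrow> bool" where
  "simple_lie sc br L \<longleftrightarrow>
     lie_subalgebra sc br L \<and>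
     (\<exists>x\<in>L. \<exists>y\<in>L. br x y \<noteq> 0) \<and>
     (\<forall>I. module.subspace sc I \<and> I \<subseteq> L \<and> (\<forall>x\<in>L. \<forall>y\<in>I. br x y \<in> I) \<longrightarrow> I = {0} \<or> I = L)"

primrec lower_central ::
  "(complex \<Rightarrow> 'g::ab_group_add \<Rightarrow> 'g) \<Rightarrow> ('g \<Rightarrow> 'g \<Rightarrow> 'g) \<Rightarrow> 'g set \<Rightarrow> nat \<Rightarrow> 'g set" where
  "lower_central sc br L 0 = L"
| "lower_central sc br L (Suc j) =
     module.span sc {br x y | x y. x \<in> L \<and> y \<in> lower_central sc br L j}"

definition cartan_subalgebra ::
  "(complex \<Rightarrow> 'g::ab_group_add \<Rightarrow> 'g) \<Rightarrow> ('g \<Rightarrow> 'g \<Rightarrow> 'g) \<Rightarrow> 'g set \<Rightarrow> 'g set \<Rightarrow> bool" where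
  "cartan_subalgebra sc br L H \<longleftrightarrow>
     lie_subalgebra sc br H \<and> H \<subseteq> L \<and>
     (\<exists>j. lower_central sc br H j = {0}) \<and>
     {x \<in> L. \<forall>h\<in>H. br x h \<in> H} = H"

definition lie_automorphism ::
  "(complex \<Rightarrow> 'g::ab_group_add \<Rightarrow> 'g) \<Rightarrow> ('g \<Rightarrow> 'g \<Rightarrow> 'g) \<Rightarrow> ('g \<Rightarrow> 'g) \<Rightarrow> bool" where
  "lie_automorphism sc br f \<longleftrightarrow>
     Vector_Spaces.linear sc sc f \<and> bij f \<and> (\<forall>x y. f (br x y) = br (f x) (f y))"

definition invariant_form ::
  "(complex \<Rightarrow> 'g::ab_group_add \<Rightarrow> 'g) \<Rightarrow> ('g \<Rightarrow> 'g \<Rightarrow> 'g) \<Rightarrow> ('g \<Rightarrow> 'g \<Rightarrow> complex) \<Rightarrow> bool" where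
  "invariant_form sc br B \<longleftrightarrow>
     (\<forall>x. Vector_Spaces.linear sc (*) (B x)) \<and>
     (\<forall>x y. B x y = B y x) \<and>
     (\<forall>x y z. B (br x y) z = B x (br y z)) \<and>
     (\<forall>x. (\<forall>y. B x y = 0) \<longrightarrow> x = 0)"

text \<open>
  Linear functionals on a subspace \<open>H\<close> are represented by functions that vanish outside \<open>H\<close>, so
  that equality of functionals on \<open>H\<close> is equality of functions.
\<close>

definition dual_space ::
  "(complex \<Rightarrow> 'a::ab_group_add \<Rightarrow> 'a) \<Rightarrow> 'a set \<Rightarrow> ('a \<Rightarrow> complex) set" where
  "dual_space sc H = {f.
     (\<forall>x\<in>H. \<forall>y\<in>H. f (x + y) = f x + f y) \<and>
     (\<forall>c. \<forall>x\<in>H. f (sc c x) = c * f x) \<and>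
     (\<forall>x. x \<notin> H \<longrightarrow> f x = 0)}"

section \<open>Degrees\<close>

text \<open>
  The indices \<open>1, \<dots>, n\<close> are the elements of a finite type \<open>'n\<close> and the index \<open>0\<close> is \<open>None\<close>; thus
  \<open>'n option\<close> is the index set \<open>0, \<dots>, n\<close>.  A degree \<open>(k\<^sub>0, k)\<close> is a pair.
\<close>

type_synonym 'n deg = "int \<times> (int ^ 'n)"

fun dcomp :: "'n::finite deg \<Rightarrow> 'n option \<Rightarrow> int" where
  "dcomp (k0, k) None = k0"
| "dcomp (k0, k) (Some i) = k $ i"

definition cvec :: "'n::finite deg \<Rightarrow> complex ^ ('n option)" where
  "cvec k = (\<chi> i. of_int (dcomp k i))"

lemma dcomp_add: "dcomp (p + q) i = dcomp p i + dcomp q i"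
  by (cases p; cases q; cases i) (auto simp: plus_prod_def)

lemma cvec_add: "cvec (p + q) = cvec p + cvec q"
  by (simp add: cvec_def vec_eq_iff dcomp_add)

text \<open>The standard bilinear (not Hermitian) form.\<close>

definition dot :: "complex ^ 'i \<Rightarrow> complex ^ 'i \<Rightarrow> complex" where
  "dot u v = (\<Sum>i\<in>UNIV. u $ i * v $ i)"

lemma dot_add_right: "dot u (v + w) = dot u v + dot u w"
  by (simp add: dot_def algebra_simps sum.distrib)

lemma dot_scale_right: "dot u (c *s v) = c * dot u v"
  by (simp add: dot_def sum_distrib_left mult_ac)

lemma dot_zero_right: "dot u 0 = 0"
  by (simp add: dot_def)

section \<open>Finitely supported families of coefficients\<close>

text \<open>
  \<open>'n deg \<Rightarrow>\<^sub>0 'a\<close> is the space of Laurent polynomials in \<open>t\<^sub>0, \<dots>, t\<^sub>n\<close> with coefficients in \<open>'a\<close>;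
  \<open>Poly_Mapping.single k a\<close> is \<open>a \<otimes> t\<^sup>k\<close>.
\<close>

definition pm_scale :: "(complex \<Rightarrow> 'a \<Rightarrow> 'a) \<Rightarrow> complex \<Rightarrow> ('k \<Rightarrow>\<^sub>0 'a::ab_group_add) \<Rightarrow> ('k \<Rightarrow>\<^sub>0 'a)" where
  "pm_scale sc c f = Poly_Mapping.map (sc c) f"

definition pm_sum :: "('k \<Rightarrow> 'a \<Rightarrow> 'b::comm_monoid_add) \<Rightarrow> ('k \<Rightarrow>\<^sub>0 'a::zero) \<Rightarrow> 'b" where
  "pm_sum F f = (\<Sum>k\<in>Poly_Mapping.keys f. F k (Poly_Mapping.lookup f k))"

definition pm_bisum ::
  "('k \<Rightarrow> 'a \<Rightarrow> 'k \<Rightarrow> 'b \<Rightarrow> 'c::comm_monoid_add) \<Rightarrow> ('k \<Rightarrow>\<^sub>0 'a::zero) \<Rightarrow> ('k \<Rightarrow>\<^sub>0 'b::zero) \<Rightarrow> 'c" where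
  "pm_bisum F f g = pm_sum (\<lambda>p a. pm_sum (\<lambda>q b. F p a q b) g) f"

lemma lookup_pm_scale:
  assumes "sc c 0 = 0"
  shows "Poly_Mapping.lookup (pm_scale sc c f) k = sc c (Poly_Mapping.lookup f k)"
  using assms by (simp add: pm_scale_def Poly_Mapping.map.rep_eq when_def)

lemma vector_space_pm_scale:
  fixes sc :: "complex \<Rightarrow> 'a::ab_group_add \<Rightarrow> 'a"
  assumes "vector_space sc"
  shows "vector_space (pm_scale sc :: complex \<Rightarrow> ('k \<Rightarrow>\<^sub>0 'a) \<Rightarrow> _)"
proof -
  interpret V: vector_space sc by fact
  have l: "Poly_Mapping.lookup (pm_scale sc c f) k = sc c (Poly_Mapping.lookup f k)"
    for c k and f :: "'k \<Rightarrow>\<^sub>0 'a"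
    by (rule lookup_pm_scale) simp
  show ?thesis
    by unfold_locales
       (auto intro!: poly_mapping_eqI simp: l lookup_add V.scale_right_distrib V.scale_left_distrib)
qed

lemma pm_sum_superset:
  assumes "finite A" "Poly_Mapping.keys f \<subseteq> A" "\<And>k. F k 0 = 0"
  shows "pm_sum F f = (\<Sum>k\<in>A. F k (Poly_Mapping.lookup f k))"
  unfolding pm_sum_def
  by (rule sum.mono_neutral_left) (use assms in \<open>auto simp: in_keys_iff\<close>)

lemma pm_sum_zero [simp]: "pm_sum F 0 = 0"
  by (simp add: pm_sum_def)

lemma pm_sum_single:
  assumes "F k 0 = 0"
  shows "pm_sum F (Poly_Mapping.single k a) = F k a"
  using assms by (cases "a = 0") (auto simp: pm_sum_def)

lemma pm_sum_add:
  fixes f g :: "'k \<Rightarrow>\<^sub>0 'a::comm_monoid_add"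
  assumes "\<And>k a b. F k (a + b) = F k a + F k b" "\<And>k. F k 0 = 0"
  shows "pm_sum F (f + g) = pm_sum F f + pm_sum F g"
proof -
  let ?A = "Poly_Mapping.keys f \<union> Poly_Mapping.keys g"
  have "Poly_Mapping.keys (f + g) \<subseteq> ?A"
    by (rule Poly_Mapping.keys_add)
  then have "pm_sum F (f + g) = (\<Sum>k\<in>?A. F k (Poly_Mapping.lookup (f + g) k))"
    by (intro pm_sum_superset) (auto simp: assms)
  also have "\<dots> = (\<Sum>k\<in>?A. F k (Poly_Mapping.lookup f k)) + (\<Sum>k\<in>?A. F k (Poly_Mapping.lookup g k))"
    by (simp add: lookup_add assms sum.distrib)
  also have "\<dots> = pm_sum F f + pm_sum F g"
    by (subst (1 2) pm_sum_superset[where A = ?A]) (auto simp: assms)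
  finally show ?thesis .
qed

section \<open>Differentials modulo exact ones\<close>

text \<open>
  In \<open>'n deg \<Rightarrow>\<^sub>0 complex ^ 'n option\<close> the element \<open>single r w\<close> stands for \<open>\<Sum>\<^sub>i w\<^sub>i t\<^sup>r K\<^sub>i\<close>.  The quotient is
  formed over all degrees at once.  The relations are homogeneous, so the span of the \<open>t\<^sup>r K\<^sub>i\<close> with
  \<open>r\<close> in a given sublattice is the quotient belonging to that sublattice.
\<close>

abbreviation symb_scale ::
  "complex \<Rightarrow> ('n::finite deg \<Rightarrow>\<^sub>0 complex ^ 'n option) \<Rightarrow> ('n deg \<Rightarrow>\<^sub>0 complex ^ 'n option)" where
  "symb_scale \<equiv> pm_scale (*s)"

definition exact_forms :: "('n::finite deg \<Rightarrow>\<^sub>0 complex ^ 'n option) set" where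
  "exact_forms = module.span symb_scale {Poly_Mapping.single r (cvec r) | r. True}"

definition omega_rel ::
  "('n::finite deg \<Rightarrow>\<^sub>0 complex ^ 'n option) \<Rightarrow> ('n deg \<Rightarrow>\<^sub>0 complex ^ 'n option) \<Rightarrow> bool" where
  "omega_rel f g \<longleftrightarrow> f - g \<in> exact_forms"

interpretation symb: vector_space
  "symb_scale :: complex \<Rightarrow> ('n::finite deg \<Rightarrow>\<^sub>0 complex ^ 'n option) \<Rightarrow> _"
  by (rule vector_space_pm_scale) (rule vec.vector_space_axioms)

lemma symb_scale_single: "symb_scale c (Poly_Mapping.single k w) = Poly_Mapping.single k (c *s w)"
  by (rule poly_mapping_eqI) (simp add: lookup_pm_scale lookup_single when_def)

lemma exact_forms_zero: "0 \<in> exact_forms"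
  and exact_forms_add: "f \<in> exact_forms \<Longrightarrow> g \<in> exact_forms \<Longrightarrow> f + g \<in> exact_forms"
  and exact_forms_diff: "f \<in> exact_forms \<Longrightarrow> g \<in> exact_forms \<Longrightarrow> f - g \<in> exact_forms"
  and exact_forms_neg: "f \<in> exact_forms \<Longrightarrow> - f \<in> exact_forms"
  and exact_forms_scale: "f \<in> exact_forms \<Longrightarrow> symb_scale c f \<in> exact_forms"
  unfolding exact_forms_def
  by (auto intro: symb.span_zero symb.span_add symb.span_diff symb.span_neg symb.span_scale)

lemma equivp_omega_rel:
  "equivp (omega_rel :: ('n::finite deg \<Rightarrow>\<^sub>0 complex ^ 'n option) \<Rightarrow> _)"
proof (rule equivpI)
  show "reflp (omega_rel :: ('n deg \<Rightarrow>\<^sub>0 complex ^ 'n option) \<Rightarrow> _)"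
    by (auto intro!: reflpI simp: omega_rel_def exact_forms_zero)
  show "symp (omega_rel :: ('n deg \<Rightarrow>\<^sub>0 complex ^ 'n option) \<Rightarrow> _)"
    by (rule sympI) (metis exact_forms_neg minus_diff_eq omega_rel_def)
  show "transp (omega_rel :: ('n deg \<Rightarrow>\<^sub>0 complex ^ 'n option) \<Rightarrow> _)"
  proof (rule transpI)
    fix f g h :: "'n deg \<Rightarrow>\<^sub>0 complex ^ 'n option"
    assume "omega_rel f g" "omega_rel g h"
    moreover have "f - h = (f - g) + (g - h)" by simp
    ultimately show "omega_rel f h"
      unfolding omega_rel_def by (simp only: exact_forms_add)
  qed
qed

quotient_type 'n omega = "'n::finite deg \<Rightarrow>\<^sub>0 complex ^ 'n option" / omega_rel
  by (rule equivp_omega_rel)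

instantiation omega :: (finite) ab_group_add
begin

lift_definition zero_omega :: "'a omega" is 0 .

lift_definition plus_omega :: "'a omega \<Rightarrow> 'a omega \<Rightarrow> 'a omega" is "(+)"
  by (simp add: omega_rel_def add_diff_add exact_forms_add)

lift_definition uminus_omega :: "'a omega \<Rightarrow> 'a omega" is uminus
proof -
  fix f g :: "'a deg \<Rightarrow>\<^sub>0 complex ^ 'a option"
  assume "omega_rel f g"
  moreover have "- f - - g = - (f - g)" by simp
  ultimately show "omega_rel (- f) (- g)"
    unfolding omega_rel_def by (simp only: exact_forms_neg)
qed

lift_definition minus_omega :: "'a omega \<Rightarrow> 'a omega \<Rightarrow> 'a omega" is "(-)"
proof -
  fix f g f' g' :: "'a deg \<Rightarrow>\<^sub>0 complex ^ 'a option"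
  assume "omega_rel f g" "omega_rel f' g'"
  moreover have "(f - f') - (g - g') = (f - g) - (f' - g')" by (simp add: algebra_simps)
  ultimately show "omega_rel (f - f') (g - g')"
    unfolding omega_rel_def by (simp only: exact_forms_diff)
qed

instance
  by standard (transfer, simp add: omega_rel_def exact_forms_zero algebra_simps)+

end

lift_definition omega_scale :: "complex \<Rightarrow> 'n::finite omega \<Rightarrow> 'n omega" is symb_scale
  unfolding omega_rel_def symb.scale_right_diff_distrib[symmetric] by (rule exact_forms_scale)

text \<open>
  The action of vector fields on differentials:
  \<open>D(u,p) \<cdot> \<Sum>\<^sub>b w\<^sub>b t\<^sup>q K\<^sub>b = \<Sum>\<^sub>b w\<^sub>b (u|q) t\<^bsup>p+q\<^esup> K\<^sub>b + (u|w) \<Sum>\<^sub>c p\<^sub>c t\<^bsup>p+q\<^esup> K\<^sub>c\<close>.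
\<close>

definition symb_act ::
  "('n::finite deg \<Rightarrow>\<^sub>0 complex ^ 'n option) \<Rightarrow> ('n deg \<Rightarrow>\<^sub>0 complex ^ 'n option) \<Rightarrow>
   ('n deg \<Rightarrow>\<^sub>0 complex ^ 'n option)" where
  "symb_act = pm_bisum (\<lambda>p u q w.
     Poly_Mapping.single (p + q) (dot u (cvec q) *s w + dot u w *s cvec p))"

lemma symb_act_add: "symb_act D (f + g) = symb_act D f + symb_act D g"
  unfolding symb_act_def pm_bisum_def
  by (subst pm_sum_add)
     (auto simp: pm_sum_def sum.distrib dot_add_right vec.scale_left_distrib
        vec.scale_right_distrib single_add[symmetric] add_ac dot_zero_right)

lemma symb_act_scale: "symb_act D (symb_scale c f) = symb_scale c (symb_act D f)"
proof -
  have "pm_sum F (symb_scale c f) = symb_scale c (pm_sum F f)"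
    if "\<And>q w. F q (c *s w) = symb_scale c (F q w)" "\<And>q. F q 0 = 0"
    for F :: "'a deg \<Rightarrow> complex ^ 'a option \<Rightarrow> 'a deg \<Rightarrow>\<^sub>0 complex ^ 'a option"
  proof -
    have "Poly_Mapping.keys (symb_scale c f) \<subseteq> Poly_Mapping.keys f"
      by (auto simp: in_keys_iff lookup_pm_scale)
    then have "pm_sum F (symb_scale c f) =
        (\<Sum>q\<in>Poly_Mapping.keys f. F q (Poly_Mapping.lookup (symb_scale c f) q))"
      by (intro pm_sum_superset) (auto simp: that)
    also have "\<dots> = symb_scale c (pm_sum F f)"
      by (simp add: lookup_pm_scale that pm_sum_def symb.scale_sum_right)
    finally show ?thesis .
  qed
  then show ?thesis
    unfolding symb_act_def pm_bisum_def pm_sum_def[where f = D] symb.scale_sum_right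
    by (intro sum.cong refl)
       (simp add: dot_scale_right symb_scale_single vec.scale_right_distrib mult_ac dot_zero_right)
qed

lemma symb_act_exact: "f \<in> exact_forms \<Longrightarrow> symb_act D f \<in> exact_forms"
  unfolding exact_forms_def
proof (induction rule: symb.span_induct_alt)
  case base
  then show ?case
    by (simp add: symb_act_def pm_bisum_def pm_sum_def symb.span_zero)
next
  case (step c x y)
  from step(1) obtain r where x: "x = Poly_Mapping.single r (cvec r)" by auto
  have "symb_act D x = (\<Sum>p\<in>Poly_Mapping.keys D.
      symb_scale (dot (Poly_Mapping.lookup D p) (cvec r)) (Poly_Mapping.single (p + r) (cvec (p + r))))"
    unfolding symb_act_def pm_bisum_def x
    by (subst pm_sum_single)
       (auto simp: pm_sum_def dot_zero_right cvec_add vec.scale_right_distrib add_ac symb_scale_single)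
  also have "\<dots> \<in> module.span symb_scale {Poly_Mapping.single r (cvec r) | r. True}"
    by (intro symb.span_sum symb.span_scale symb.span_base) blast
  finally have "symb_act D x \<in> module.span symb_scale {Poly_Mapping.single r (cvec r) | r. True}" .
  then show ?case
    using step by (simp add: symb_act_add symb_act_scale symb.span_add symb.span_scale)
qed

lift_definition omega_act ::
  "('n::finite deg \<Rightarrow>\<^sub>0 complex ^ 'n option) \<Rightarrow> 'n omega \<Rightarrow> 'n omega" is symb_act
proof -
  fix D f g :: "'n deg \<Rightarrow>\<^sub>0 complex ^ 'n option"
  assume "omega_rel f g"
  then have "symb_act D (f - g) \<in> exact_forms"
    by (simp add: omega_rel_def symb_act_exact)
  moreover have "symb_act D f = symb_act D (f - g) + symb_act D g"
    by (simp add: symb_act_add[symmetric])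
  ultimately show "omega_rel (symb_act D f) (symb_act D g)"
    by (simp add: omega_rel_def)
qed

section \<open>The defining data\<close>

text \<open>
  \<open>autom i\<close> is \<open>\<sigma>\<^sub>i\<close>, \<open>period i\<close> is its order \<open>m\<^sub>i\<close>, \<open>xi i\<close> is \<open>\<xi>\<^sub>i\<close>.  \<open>cartan\<close> is the Cartan subalgebra of the
  fixed point algebra and \<open>simple_root 1, \<dots>, simple_root rk\<close> are its simple roots.  The cocycle is
  \<open>coeff1 \<cdot> \<phi>\<^sub>1 + coeff2 \<cdot> \<phi>\<^sub>2\<close>.
\<close>

record ('g, 'n) datum =
  scal :: "complex \<Rightarrow> 'g \<Rightarrow> 'g"
  lie :: "'g \<Rightarrow> 'g \<Rightarrow> 'g"
  iform :: "'g \<Rightarrow> 'g \<Rightarrow> complex"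
  autom :: "'n option \<Rightarrow> 'g \<Rightarrow> 'g"
  period :: "'n option \<Rightarrow> nat"
  xi :: "'n option \<Rightarrow> complex"
  cartan :: "'g set"
  rk :: nat
  simple_root :: "nat \<Rightarrow> 'g \<Rightarrow> complex"
  max_root :: "'g \<Rightarrow> complex"
  coeff1 :: complex
  coeff2 :: complex

definition lat :: "('g, 'n::finite) datum \<Rightarrow> 'n deg set" where
  "lat X = {r. \<forall>i. int (period X i) dvd dcomp r i}"

definition Gam :: "('g, 'n::finite) datum \<Rightarrow> (int ^ 'n) set" where
  "Gam X = {r. \<forall>i. int (period X (Some i)) dvd r $ i}"

definition gdeg :: "('g, 'n::finite) datum \<Rightarrow> 'n deg \<Rightarrow> 'g set" where
  "gdeg X k = {x. \<forall>i. autom X i x = scal X (xi X i powi dcomp k i) x}"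

abbreviation gfix :: "('g, 'n::finite) datum \<Rightarrow> 'g set" where
  "gfix X \<equiv> gdeg X 0"

definition gwt :: "('g, 'n::finite) datum \<Rightarrow> 'n deg \<Rightarrow> ('g \<Rightarrow> complex) \<Rightarrow> 'g set" where
  "gwt X k \<alpha> = {x \<in> gdeg X k. \<forall>h\<in>cartan X. lie X h x = scal X (\<alpha> h) x}"

subsection \<open>Roots of the fixed point algebra\<close>

definition roots :: "('g::ab_group_add, 'n::finite) datum \<Rightarrow> ('g \<Rightarrow> complex) set" where
  "roots X = {\<alpha> \<in> dual_space (scal X) (cartan X). \<alpha> \<noteq> (\<lambda>_. 0) \<and> (\<exists>x\<in>gwt X 0 \<alpha>. x \<noteq> 0)}"

definition nat_comb :: "nat \<Rightarrow> (nat \<Rightarrow> 'g \<Rightarrow> complex) \<Rightarrow> ('g \<Rightarrow> complex) \<Rightarrow> bool" where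
  "nat_comb l a \<beta> \<longleftrightarrow> (\<exists>c::nat \<Rightarrow> nat. \<beta> = (\<lambda>h. \<Sum>i=1..l. of_nat (c i) * a i h))"

definition root_base ::
  "('g::ab_group_add, 'n::finite) datum \<Rightarrow> nat \<Rightarrow> (nat \<Rightarrow> 'g \<Rightarrow> complex) \<Rightarrow> bool" where
  "root_base X l a \<longleftrightarrow>
     (\<forall>i\<in>{1..l}. a i \<in> roots X) \<and>
     (\<forall>c::nat \<Rightarrow> complex. (\<forall>h\<in>cartan X. (\<Sum>i=1..l. c i * a i h) = 0) \<longrightarrow> (\<forall>i\<in>{1..l}. c i = 0)) \<and>
     (\<forall>\<beta>\<in>roots X. nat_comb l a \<beta> \<or> nat_comb l a (\<lambda>h. - \<beta> h))"

text \<open>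
  The element of \<open>cartan X\<close> that represents \<open>\<alpha>\<close> with respect to the form; the induced form on the
  dual space is \<open>(\<alpha>|\<beta>) = \<alpha> (dual_vec X \<beta>)\<close>.
\<close>

definition dual_vec :: "('g, 'n) datum \<Rightarrow> ('g \<Rightarrow> complex) \<Rightarrow> 'g" where
  "dual_vec X \<alpha> = (THE t. t \<in> cartan X \<and> (\<forall>h\<in>cartan X. iform X t h = \<alpha> h))"

definition root_form :: "('g, 'n) datum \<Rightarrow> ('g \<Rightarrow> complex) \<Rightarrow> ('g \<Rightarrow> complex) \<Rightarrow> complex" where
  "root_form X \<alpha> \<beta> = \<alpha> (dual_vec X \<beta>)"

definition coroot :: "('g, 'n) datum \<Rightarrow> ('g \<Rightarrow> complex) \<Rightarrow> 'g" where
  "coroot X \<alpha> = scal X (2 / root_form X \<alpha> \<alpha>) (dual_vec X \<alpha>)"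

text \<open>
  The form is only determined up to a non-zero complex factor, hence lengths of roots are compared
  through their ratios, which are positive rationals.  In the simply laced case all roots are short.
\<close>

definition short_root :: "('g::ab_group_add, 'n::finite) datum \<Rightarrow> ('g \<Rightarrow> complex) \<Rightarrow> bool" where
  "short_root X \<alpha> \<longleftrightarrow>
     \<alpha> \<in> roots X \<and> (\<forall>\<beta>\<in>roots X. Re (root_form X \<beta> \<beta> / root_form X \<alpha> \<alpha>) \<ge> 1)"

text \<open>
  The Cartan matrix of type \<open>B\<^sub>l\<close> with entries \<open>\<langle>a\<^sub>i, a\<^sub>j\<^sup>\<or>\<rangle>\<close>, the last simple root being the short one;
  for \<open>l = 1\<close> it is the matrix of \<open>A\<^sub>1\<close>.
\<close>

definition type_B :: "('g::ab_group_add, 'n::finite) datum \<Rightarrow> bool" where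
  "type_B X \<longleftrightarrow> (\<exists>l a. l \<ge> 1 \<and> root_base X l a \<and>
     (\<forall>i\<in>{1..l}. \<forall>j\<in>{1..l}. a i (coroot X (a j)) =
        (if i = j then 2
         else if j = l \<and> i + 1 = j then -2
         else if i + 1 = j \<or> j + 1 = i then -1
         else 0)))"

text \<open>\<open>\<Delta>\<^bsub>0,en\<^esub>\<close>, which contains \<open>0\<close>.\<close>

definition roots_en :: "('g::ab_group_add, 'n::finite) datum \<Rightarrow> ('g \<Rightarrow> complex) set" where
  "roots_en X = insert (\<lambda>_. 0)
     (roots X \<union> (if type_B X then {(\<lambda>h. 2 * \<alpha> h) | \<alpha>. short_root X \<alpha>} else {}))"

definition is_max_root :: "('g::ab_group_add, 'n::finite) datum \<Rightarrow> ('g \<Rightarrow> complex) \<Rightarrow> bool" where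
  "is_max_root X \<beta> \<longleftrightarrow>
     \<beta> \<in> roots_en X \<and> (\<forall>\<gamma>\<in>roots_en X. nat_comb (rk X) (simple_root X) (\<lambda>h. \<beta> h - \<gamma> h))"

subsection \<open>Lie tori\<close>

definition gfix_submodule :: "('g::ab_group_add, 'n::finite) datum \<Rightarrow> 'g set \<Rightarrow> bool" where
  "gfix_submodule X W \<longleftrightarrow> module.subspace (scal X) W \<and> (\<forall>x\<in>gfix X. \<forall>w\<in>W. lie X x w \<in> W)"

definition lie_torus_module :: "('g::ab_group_add, 'n::finite) datum \<Rightarrow> 'g set \<Rightarrow> bool" where
  "lie_torus_module X N \<longleftrightarrow> (\<exists>U W.
     gfix_submodule X U \<and> gfix_submodule X W \<and>
     U \<inter> W = {0} \<and> {u + w | u w. u \<in> U \<and> w \<in> W} = N \<and>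
     (\<forall>x\<in>gfix X. \<forall>u\<in>U. lie X x u = 0) \<and>
     (W = {0} \<or>
       (vector_space.dim (scal X) W > 1 \<and>
        (\<forall>Z. gfix_submodule X Z \<and> Z \<subseteq> W \<longrightarrow> Z = {0} \<or> Z = W) \<and>
        (\<forall>\<mu>\<in>dual_space (scal X) (cartan X).
           (\<exists>w\<in>W. w \<noteq> 0 \<and> (\<forall>h\<in>cartan X. lie X h w = scal X (\<mu> h) w)) \<longrightarrow> \<mu> \<in> roots_en X))))"

definition primitive_unity :: "nat \<Rightarrow> complex \<Rightarrow> bool" where
  "primitive_unity k z \<longleftrightarrow> z ^ k = 1 \<and> (\<forall>j. 0 < j \<and> j < k \<longrightarrow> z ^ j \<noteq> 1)"

definition has_order :: "('g \<Rightarrow> 'g) \<Rightarrow> nat \<Rightarrow> bool" where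
  "has_order f k \<longleftrightarrow> k > 0 \<and> f ^^ k = id \<and> (\<forall>j. 0 < j \<and> j < k \<longrightarrow> f ^^ j \<noteq> id)"

definition lie_torus_datum :: "('g::ab_group_add, 'n::finite) datum \<Rightarrow> bool" where
  "lie_torus_datum X \<longleftrightarrow>
     lie_algebra (scal X) (lie X) \<and>
     (\<exists>B. finite_dimensional_vector_space (scal X) B) \<and>
     simple_lie (scal X) (lie X) UNIV \<and>
     invariant_form (scal X) (lie X) (iform X) \<and>
     (\<forall>i. lie_automorphism (scal X) (lie X) (autom X i)) \<and>
     (\<forall>i j. autom X i \<circ> autom X j = autom X j \<circ> autom X i) \<and>
     (\<forall>i. has_order (autom X i) (period X i)) \<and>
     (\<forall>i. primitive_unity (period X i) (xi X i)) \<and>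
     cartan_subalgebra (scal X) (lie X) (gfix X) (cartan X) \<and>
     root_base X (rk X) (simple_root X) \<and>
     is_max_root X (max_root X) \<and>
     simple_lie (scal X) (lie X) (gfix X) \<and>
     (\<forall>k. k \<notin> lat X \<and> gdeg X k \<noteq> {0} \<longrightarrow> lie_torus_module X (gdeg X k)) \<and>
     card (generate (BijGroup UNIV) (range (autom X))) = (\<Prod>i\<in>UNIV. period X i)"

section \<open>The twisted toroidal extended affine Lie algebra\<close>

text \<open>
  The components of an element are its multiloop part, its part in the differentials modulo exact
  ones, and its vector field part, where \<open>single r u\<close> stands for \<open>D(u,r) = \<Sum>\<^sub>i u\<^sub>i t\<^sup>r d\<^sub>i\<close>.  The type is a larger
  space than the algebra itself, which is the subset \<open>tor\<close> below.
\<close>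

type_synonym ('g, 'n) tor =
  "('n deg \<Rightarrow>\<^sub>0 'g) \<times> 'n omega \<times> ('n deg \<Rightarrow>\<^sub>0 complex ^ 'n option)"

definition tscale ::
  "('g::ab_group_add, 'n::finite) datum \<Rightarrow> complex \<Rightarrow> ('g, 'n) tor \<Rightarrow> ('g, 'n) tor" where
  "tscale X c = (\<lambda>(x, w, D). (pm_scale (scal X) c x, omega_scale c w, symb_scale c D))"

definition tX :: "'g \<Rightarrow> 'n::finite deg \<Rightarrow> ('g::ab_group_add, 'n) tor" where
  "tX x k = (Poly_Mapping.single k x, 0, 0)"

definition tK :: "'n::finite deg \<Rightarrow> 'n option \<Rightarrow> ('g::ab_group_add, 'n) tor" where
  "tK r i = (0, abs_omega (Poly_Mapping.single r (axis i 1)), 0)"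

definition tD :: "complex ^ 'n option \<Rightarrow> 'n::finite deg \<Rightarrow> ('g::ab_group_add, 'n) tor" where
  "tD u r = (0, 0, Poly_Mapping.single r u)"

definition tor :: "('g::ab_group_add, 'n::finite) datum \<Rightarrow> ('g, 'n) tor set" where
  "tor X = module.span (tscale X)
     ({tX x k | x k. x \<in> gdeg X k} \<union>
      {tK r i | r i. r \<in> lat X} \<union>
      {tD u r | u r. r \<in> lat X \<and> dot u (cvec r) = 0})"

text \<open>
  The coefficient vector, in degree \<open>p + q\<close>, of \<open>\<phi>(D(u,p), D(v,q))\<close>.
\<close>

definition cocycle ::
  "('g, 'n::finite) datum \<Rightarrow> 'n deg \<Rightarrow> complex ^ 'n option \<Rightarrow> 'n deg \<Rightarrow> complex ^ 'n option \<Rightarrow>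
   complex ^ 'n option" where
  "cocycle X p u q v =
     (coeff1 X * - (dot u (cvec q) * dot v (cvec p)) +
      coeff2 X * - (dot u (cvec p) * dot v (cvec q))) *s cvec p"

definition tbracket ::
  "('g::ab_group_add, 'n::finite) datum \<Rightarrow> ('g, 'n) tor \<Rightarrow> ('g, 'n) tor \<Rightarrow> ('g, 'n) tor" where
  "tbracket X = (\<lambda>(x, w, D) (y, z, E).
     (pm_bisum (\<lambda>p a q b. Poly_Mapping.single (p + q) (lie X a b)) x y
        + pm_bisum (\<lambda>p u q b. Poly_Mapping.single (p + q) (scal X (dot u (cvec q)) b)) D y
        - pm_bisum (\<lambda>p u q b. Poly_Mapping.single (p + q) (scal X (dot u (cvec q)) b)) E x,
      abs_omega (pm_bisum (\<lambda>p a q b. Poly_Mapping.single (p + q) (iform X a b *s cvec p)) x y)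
        + omega_act D z - omega_act E w
        + abs_omega (pm_bisum (\<lambda>p u q v. Poly_Mapping.single (p + q) (cocycle X p u q v)) D E),
      pm_bisum (\<lambda>p u q v. Poly_Mapping.single (p + q)
        (dot u (cvec q) *s v - dot v (cvec p) *s u)) D E))"

text \<open>On generators the bracket takes the expected form.\<close>

lemma pm_bisum_single:
  assumes "\<And>p a q. F p a q 0 = 0" "\<And>p q b. F p 0 q b = 0"
  shows "pm_bisum F (Poly_Mapping.single p a) (Poly_Mapping.single q b) = F p a q b"
  by (simp add: pm_bisum_def pm_sum_single assms)

lemma pm_bisum_zero [simp]: "pm_bisum F 0 g = 0" "pm_bisum F f 0 = 0"
  by (simp_all add: pm_bisum_def pm_sum_def)

lemma omega_act_zero_right [simp]: "omega_act D 0 = 0"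
  by transfer (simp add: symb_act_def omega_rel_def exact_forms_zero)

lemma omega_act_zero_left [simp]: "omega_act 0 w = 0"
  by transfer (simp add: symb_act_def omega_rel_def exact_forms_zero)

lemma dot_zero_left: "dot 0 v = 0"
  by (simp add: dot_def)

lemma tbracket_tX_tX:
  assumes "lie_algebra (scal X) (lie X)" "invariant_form (scal X) (lie X) (iform X)"
  shows "tbracket X (tX x p) (tX y q) =
    (Poly_Mapping.single (p + q) (lie X x y),
     abs_omega (Poly_Mapping.single (p + q) (iform X x y *s cvec p)), 0)"
proof -
  have zero: "f 0 = 0" if "Vector_Spaces.linear s1 s2 f" for s1 s2 and f :: "_ \<Rightarrow> 'x::ab_group_add"
    using that by (rule module_hom.zero[OF linear_iff_module_hom[THEN iffD1]])
  have "lie X a 0 = 0" "iform X a 0 = 0" for a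
    using assms zero unfolding lie_algebra_def invariant_form_def by blast+
  moreover have "lie X 0 a = 0" for a
    using assms zero[of _ _ "\<lambda>x. lie X x a"] unfolding lie_algebra_def by blast
  moreover have "iform X 0 a = 0" for a
    using assms(2) calculation(2)[of a] unfolding invariant_form_def by metis
  ultimately show ?thesis
    by (simp add: tbracket_def tX_def pm_bisum_single flip: zero_omega.abs_eq)
qed

lemma tbracket_tD_tX:
  assumes "lie_algebra (scal X) (lie X)"
  shows "tbracket X (tD u p) (tX y q) = tX (scal X (dot u (cvec q)) y) (p + q)"
proof -
  have "vector_space (scal X)"
    using assms by (simp add: lie_algebra_def)
  then interpret V: vector_space "scal X" .
  show ?thesis
    by (simp add: tbracket_def tX_def tD_def pm_bisum_single dot_zero_left flip: zero_omega.abs_eq)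
qed

lemma tbracket_tD_tK:
  "tbracket X (tD u p) (tK q b) =
    (0, abs_omega (Poly_Mapping.single (p + q) (dot u (cvec q) *s axis b 1 + u $ b *s cvec p)), 0)"
proof -
  have "dot u (axis b 1) = u $ b"
    by (simp add: dot_def axis_def if_distrib cong: if_cong)
  then show ?thesis
    by (simp add: tbracket_def tK_def tD_def omega_act.abs_eq symb_act_def pm_bisum_single
        dot_zero_left dot_zero_right flip: zero_omega.abs_eq)
qed

lemma tbracket_tD_tD:
  "tbracket X (tD u p) (tD v q) =
    (0, abs_omega (Poly_Mapping.single (p + q) (cocycle X p u q v)),
     Poly_Mapping.single (p + q) (dot u (cvec q) *s v - dot v (cvec p) *s u))"
  by (simp add: tbracket_def tD_def pm_bisum_single dot_zero_left dot_zero_right cocycle_def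
      flip: zero_omega.abs_eq)

subsection \<open>The subalgebra \<open>\<H>\<close> and its dual\<close>

abbreviation td :: "'n::finite option \<Rightarrow> ('g::ab_group_add, 'n) tor" where
  "td i \<equiv> tD (axis i 1) 0"

definition HH :: "('g::ab_group_add, 'n::finite) datum \<Rightarrow> ('g, 'n) tor set" where
  "HH X = module.span (tscale X)
     ({tX h 0 | h. h \<in> cartan X} \<union> range (tK 0) \<union> range td)"

definition ext_fun ::
  "('g::ab_group_add, 'n::finite) datum \<Rightarrow> ('g \<Rightarrow> complex) \<Rightarrow> ('g, 'n) tor \<Rightarrow> complex" where
  "ext_fun X \<alpha> h = (if h \<in> HH X then \<alpha> (Poly_Mapping.lookup (fst h) 0) else 0)"

definition delta ::
  "('g::ab_group_add, 'n::finite) datum \<Rightarrow> 'n option \<Rightarrow> ('g, 'n) tor \<Rightarrow> complex" where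
  "delta X i h = (if h \<in> HH X then Poly_Mapping.lookup (snd (snd h)) 0 $ i else 0)"

definition delta_vec ::
  "('g::ab_group_add, 'n::finite) datum \<Rightarrow> int ^ 'n \<Rightarrow> ('g, 'n) tor \<Rightarrow> complex" where
  "delta_vec X k h = (\<Sum>i\<in>UNIV. of_int (k $ i) * delta X (Some i) h)"

definition affine_simple ::
  "('g::ab_group_add, 'n::finite) datum \<Rightarrow> nat \<Rightarrow> ('g, 'n) tor \<Rightarrow> complex" where
  "affine_simple X i = (if i = 0 then (\<lambda>h. - ext_fun X (max_root X) h + delta X None h)
     else ext_fun X (simple_root X i))"

definition pos :: "('g::ab_group_add, 'n::finite) datum \<Rightarrow> (('g, 'n) tor \<Rightarrow> complex) \<Rightarrow> bool" where
  "pos X \<eta> \<longleftrightarrow> \<eta> \<noteq> (\<lambda>_. 0) \<and>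
     (\<exists>c::nat \<Rightarrow> nat. \<eta> = (\<lambda>h. \<Sum>i=0..rk X. of_nat (c i) * affine_simple X i h))"

definition tor_plus :: "('g::ab_group_add, 'n::finite) datum \<Rightarrow> ('g, 'n) tor set" where
  "tor_plus X = module.span (tscale X)
     ({tX x (k0, k) | x k0 k \<alpha>. \<alpha> \<in> dual_space (scal X) (cartan X) \<and> x \<in> gwt X (k0, k) \<alpha> \<and>
         pos X (\<lambda>h. ext_fun X \<alpha> h + of_int k0 * delta X None h)} \<union>
      {tK (s0, s) i | s0 s i. (s0, s) \<in> lat X \<and> s0 > 0} \<union>
      {tD u (r0, r) | u r0 r. (r0, r) \<in> lat X \<and> dot u (cvec (r0, r)) = 0 \<and> r0 > 0})"

section \<open>Modules\<close>

definition tor_module ::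
  "('g::ab_group_add, 'n::finite) datum \<Rightarrow> (complex \<Rightarrow> 'v::ab_group_add \<Rightarrow> 'v) \<Rightarrow>
   (('g, 'n) tor \<Rightarrow> 'v \<Rightarrow> 'v) \<Rightarrow> bool" where
  "tor_module X sV \<rho> \<longleftrightarrow>
     vector_space sV \<and>
     (\<forall>x\<in>tor X. Vector_Spaces.linear sV sV (\<rho> x)) \<and>
     (\<forall>x\<in>tor X. \<forall>y\<in>tor X. \<forall>v. \<rho> (x + y) v = \<rho> x v + \<rho> y v) \<and>
     (\<forall>c. \<forall>x\<in>tor X. \<forall>v. \<rho> (tscale X c x) v = sV c (\<rho> x v)) \<and>
     (\<forall>x\<in>tor X. \<forall>y\<in>tor X. \<forall>v. \<rho> (tbracket X x y) v = \<rho> x (\<rho> y v) - \<rho> y (\<rho> x v))"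

definition irreducible_module ::
  "('g::ab_group_add, 'n::finite) datum \<Rightarrow> (complex \<Rightarrow> 'v::ab_group_add \<Rightarrow> 'v) \<Rightarrow>
   (('g, 'n) tor \<Rightarrow> 'v \<Rightarrow> 'v) \<Rightarrow> bool" where
  "irreducible_module X sV \<rho> \<longleftrightarrow>
     (\<exists>v::'v. v \<noteq> 0) \<and>
     (\<forall>W. module.subspace sV W \<and> (\<forall>x\<in>tor X. \<forall>w\<in>W. \<rho> x w \<in> W) \<longrightarrow> W = {0} \<or> W = UNIV)"

definition weight_space ::
  "('g::ab_group_add, 'n::finite) datum \<Rightarrow> (complex \<Rightarrow> 'v::ab_group_add \<Rightarrow> 'v) \<Rightarrow>
   (('g, 'n) tor \<Rightarrow> 'v \<Rightarrow> 'v) \<Rightarrow> (('g, 'n) tor \<Rightarrow> complex) \<Rightarrow> 'v set" where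
  "weight_space X sV \<rho> \<Lambda> = {v. \<forall>h\<in>HH X. \<rho> h v = sV (\<Lambda> h) v}"

text \<open>The whole space is the direct sum of the subspaces \<open>W i\<close>, \<open>i \<in> I\<close>.\<close>

definition is_direct_sum :: "'i set \<Rightarrow> ('i \<Rightarrow> 'v::ab_group_add set) \<Rightarrow> bool" where
  "is_direct_sum I W \<longleftrightarrow> (\<forall>v. \<exists>!c. (\<forall>i\<in>I. c i \<in> W i) \<and> (\<forall>i. i \<notin> I \<longrightarrow> c i = 0) \<and>
     finite {i. c i \<noteq> 0} \<and> v = (\<Sum>i | c i \<noteq> 0. c i))"

definition integrable_module ::
  "('g::ab_group_add, 'n::finite) datum \<Rightarrow> (complex \<Rightarrow> 'v::ab_group_add \<Rightarrow> 'v) \<Rightarrow>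
   (('g, 'n) tor \<Rightarrow> 'v \<Rightarrow> 'v) \<Rightarrow> bool" where
  "integrable_module X sV \<rho> \<longleftrightarrow>
     is_direct_sum (dual_space (tscale X) (HH X)) (weight_space X sV \<rho>) \<and>
     (\<forall>\<Lambda>\<in>dual_space (tscale X) (HH X). \<exists>B. finite B \<and> module.span sV B = weight_space X sV \<rho> \<Lambda>) \<and>
     (\<forall>\<alpha>\<in>roots_en X. \<alpha> \<noteq> (\<lambda>_. 0) \<longrightarrow>
        (\<forall>k. \<forall>x\<in>gwt X k \<alpha>. \<forall>v. \<exists>N. (\<rho> (tX x k) ^^ N) v = 0))"

definition M_space ::
  "('g::ab_group_add, 'n::finite) datum \<Rightarrow> (('g, 'n) tor \<Rightarrow> 'v::ab_group_add \<Rightarrow> 'v) \<Rightarrow> 'v set" where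
  "M_space X \<rho> = {v. \<forall>x\<in>tor_plus X. \<rho> x v = 0}"

definition M_weight ::
  "('g::ab_group_add, 'n::finite) datum \<Rightarrow> (complex \<Rightarrow> 'v::ab_group_add \<Rightarrow> 'v) \<Rightarrow>
   (('g, 'n) tor \<Rightarrow> 'v \<Rightarrow> 'v) \<Rightarrow> (('g, 'n) tor \<Rightarrow> complex) \<Rightarrow> bool" where
  "M_weight X sV \<rho> \<Lambda> \<longleftrightarrow> \<Lambda> \<in> dual_space (tscale X) (HH X) \<and>
     (\<exists>v\<in>M_space X \<rho> \<inter> weight_space X sV \<rho> \<Lambda>. v \<noteq> 0)"

definition M_deg ::
  "('g::ab_group_add, 'n::finite) datum \<Rightarrow> (complex \<Rightarrow> 'v::ab_group_add \<Rightarrow> 'v) \<Rightarrow>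
   (('g, 'n) tor \<Rightarrow> 'v \<Rightarrow> 'v) \<Rightarrow> (('g, 'n) tor \<Rightarrow> complex) \<Rightarrow> int ^ 'n \<Rightarrow> 'v set" where
  "M_deg X sV \<rho> \<Lambda> k = M_space X \<rho> \<inter> weight_space X sV \<rho> (\<lambda>h. \<Lambda> h + delta_vec X k h)"

definition indexed_basis ::
  "(complex \<Rightarrow> 'v::ab_group_add \<Rightarrow> 'v) \<Rightarrow> nat \<Rightarrow> (nat \<Rightarrow> 'v) \<Rightarrow> 'v set \<Rightarrow> bool" where
  "indexed_basis sV p v W \<longleftrightarrow>
     inj_on v {1..p} \<and> \<not> module.dependent sV (v ` {1..p}) \<and> module.span sV (v ` {1..p}) = W"

text \<open>The \<open>k\<close> with \<open>0 \<le> k\<^sub>i < m\<^sub>i\<close>.\<close>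

definition fund_box :: "('g, 'n::finite) datum \<Rightarrow> (int ^ 'n) set" where
  "fund_box X = {k. \<forall>i. 0 \<le> k $ i \<and> k $ i < int (period X (Some i))}"

end

(* A commutative algebra of operators on M that is stable under commutators with T^0 has a
   dichotomy: by irreducibility of M, an operator in it is either injective or locally nilpotent.
   If it is homogeneous and not injective, then neither is its commutator with a homogeneous
   element of T^0, since otherwise its nilpotency order would grow without bound along an orbit,
   contrary to the finite dimension of the M_k.

   For every r in Gamma some t^(mr) K_0 and t^(-mr) K_0 with m > 0 are injective: otherwise vectors
   h(-m_0, mr) h(-m_0, -mr) v would be infinitely many independent vectors of one weight.
   Commutators with divergence-free fields of degree in Gamma then make all t^r K_0 injective, force
   t^r K_i to vanish on M for i >= 1, and show that t^r K_0 t^s K_0 depends only on r + s when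
   r, s are non-zero.  The same principle shows that the families h(r), t^r d_0 and
   t^p K_0 t^(r-p) K_0 are proportional to t^r K_0 for r <> 0.

   A Gram matrix of the vectors y(-m_0, mr) t^(-mr) K_0 v, which lie in one weight space, is constant
   on and off the diagonal, hence has equal entries.  This identifies alpha with the restriction of
   the highest weight to h(0) (and lambda with C_0), which gives the statement on coroots. *)
theory Submission
  imports Defs "HOL-Computational_Algebra.Fundamental_Theorem_Algebra"
begin

section \<open>Operators on finite-dimensional subspaces\<close>

text \<open>The obstacle is that only divergence-free fields are available: a field D(u, a) takes
  \<open>z r\<close> to degree a + r with factor (u|r), under the constraint (u|a) = 0. A property
  therefore passes directly from degree r to degree s only when r and s are not parallel; parallel
  degrees are connected through a generic intermediate lattice point, which exists because n >= 2.
  The same constraint gives factor 0 whenever a + r = 0, so identities can be closed under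
  commutators on the non-zero degrees alone, and degree 0 keeps constants of its own.

  Several background facts must be extracted from the definitions. The Cartan subalgebra is given as
  nilpotent and self-normalizing; that it is commutative and acts diagonalizably on g is read off
  from V, a weight module on which the multiloop part is faithful because K_0 is a non-zero scalar.
  The form is preserved by the automorphisms because it is a multiple of the trace form.
  Irreducibility of M is deduced from that of V by means of the grading operator h1 + cc
  d_0.\<close>

locale cvs = vector_space sc for sc :: "complex \<Rightarrow> 'a::ab_group_add \<Rightarrow> 'a"
begin

text \<open>Linearity relative to a subset: operators are total functions of which often only the
  action on a subspace, such as M or one of its graded components, is controlled.\<close>

definition lin_on :: "'a set \<Rightarrow> ('a \<Rightarrow> 'a) \<Rightarrow> bool" where
  "lin_on E f \<longleftrightarrow> (\<forall>x\<in>E. \<forall>y\<in>E. f (x + y) = f x + f y) \<and> (\<forall>c. \<forall>x\<in>E. f (sc c x) = sc c (f x))"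

abbreviation maps :: "'a set \<Rightarrow> ('a \<Rightarrow> 'a) \<Rightarrow> bool" where
  "maps E f \<equiv> (\<forall>x\<in>E. f x \<in> E)"

definition fdim :: "'a set \<Rightarrow> bool" where
  "fdim E \<longleftrightarrow> subspace E \<and> (\<exists>B. finite B \<and> E \<subseteq> span B)"

lemma fdim_subspace: "fdim E \<Longrightarrow> subspace E"
  by (simp add: fdim_def)

lemma fdim_subset: "fdim E \<Longrightarrow> subspace F \<Longrightarrow> F \<subseteq> E \<Longrightarrow> fdim F"
  by (auto simp: fdim_def)

lemma lin_on_subset: "lin_on E f \<Longrightarrow> F \<subseteq> E \<Longrightarrow> lin_on F f"
  unfolding lin_on_def by blast

lemma lin_on_add: "lin_on E f \<Longrightarrow> x \<in> E \<Longrightarrow> y \<in> E \<Longrightarrow> f (x + y) = f x + f y"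
  and lin_on_scale: "lin_on E f \<Longrightarrow> x \<in> E \<Longrightarrow> f (sc c x) = sc c (f x)"
  by (auto simp: lin_on_def)

lemma lin_on_zero: "lin_on E f \<Longrightarrow> subspace E \<Longrightarrow> f 0 = 0"
  using lin_on_scale[of E f 0 0] subspace_0[of E] by simp

lemma lin_on_diff: "lin_on E f \<Longrightarrow> subspace E \<Longrightarrow> x \<in> E \<Longrightarrow> y \<in> E \<Longrightarrow> f (x - y) = f x - f y"
  using lin_on_add[of E f x "sc (-1) y"] lin_on_scale[of E f y "-1"] subspace_scale[of E y "-1"]
  by simp

lemma lin_on_sum:
  assumes "lin_on E f" "subspace E" "finite I" "\<And>i. i \<in> I \<Longrightarrow> g i \<in> E"
  shows "f (\<Sum>i\<in>I. g i) = (\<Sum>i\<in>I. f (g i))"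
  using assms(3,4)
proof (induction I rule: finite_induct)
  case empty
  then show ?case using lin_on_zero assms by simp
next
  case (insert i I)
  have "f (g i + sum g I) = f (g i) + f (sum g I)"
    by (rule lin_on_add[OF assms(1)], simp add: insert.prems, rule subspace_sum[OF assms(2)], simp add: insert.prems)
  moreover have "f (sum g I) = (\<Sum>i\<in>I. f (g i))" by (rule insert.IH) (use insert.prems in auto)
  ultimately show ?case using insert.hyps by simp
qed

lemma lin_on_linear: "Vector_Spaces.linear sc sc f \<Longrightarrow> lin_on E f"
  unfolding lin_on_def by (metis Vector_Spaces.linear_iff)

lemma maps_funpow: "maps E f \<Longrightarrow> x \<in> E \<Longrightarrow> (f ^^ n) x \<in> E"
  by (induction n) auto

lemma lin_on_funpow: "lin_on E f \<Longrightarrow> maps E f \<Longrightarrow> lin_on E (f ^^ n)"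
  by (induction n) (auto simp: lin_on_def maps_funpow)

lemma fdim_dim_less:
  assumes "fdim E" "subspace F" "F \<subseteq> E" "F \<noteq> E"
  shows "dim F < dim E"
proof -
  obtain B0 where B0: "finite B0" "E \<subseteq> span B0" using assms by (auto simp: fdim_def)
  obtain B where B: "B \<subseteq> F" "independent B" "F \<subseteq> span B" "card B = dim F" using basis_exists by blast
  obtain C where C: "C \<subseteq> E" "independent C" "E \<subseteq> span C" "card C = dim E" using basis_exists by blast
  have "B \<subseteq> span B0" "C \<subseteq> span B0" using B(1) C(1) B0(2) assms(3) by auto
  then have fB: "finite B" "finite C"
    using independent_span_bound[OF B0(1) B(2)] independent_span_bound[OF B0(1) C(2)] by (simp_all only:)
  obtain x where x: "x \<in> E" "x \<notin> F" using assms by blast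
  have "span B = F" using B assms(2) by (simp add: span_subspace)
  then have xB: "x \<notin> span B" using x by simp
  then have "independent (insert x B)" using B by (simp add: independent_insertI)
  moreover have "insert x B \<subseteq> span C" using x B C assms(3) by blast
  ultimately have "card (insert x B) \<le> card C" using independent_span_bound[OF fB(2)] by blast
  moreover have "x \<notin> B" using xB span_base by blast
  ultimately show ?thesis using fB B C by simp
qed

text \<open>Stated for families instead of sets, so that a repetition counts as a relation; orbits
  such as \<open>(A ^^ i) x0\<close> may well repeat.\<close>

lemma dep_family:
  assumes "finite B" "finite I" "\<And>i. i \<in> I \<Longrightarrow> f i \<in> span B" "card B < card I"
  shows "\<exists>c. (\<exists>i\<in>I. c i \<noteq> 0) \<and> (\<Sum>i\<in>I. sc (c i) (f i)) = 0"
proof (cases "inj_on f I")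
  case False
  then obtain i j where ij: "i \<in> I" "j \<in> I" "i \<noteq> j" "f i = f j" by (auto simp: inj_on_def)
  let ?c = "\<lambda>k. if k = i then 1 else if k = j then -1 else (0::complex)"
  have "(\<Sum>k\<in>I. sc (?c k) (f k)) = (\<Sum>k\<in>{i,j}. sc (?c k) (f k))"
    by (rule sum.mono_neutral_right) (simp_all add: assms(2) ij(1,2))
  also have "\<dots> = 0" using ij by simp
  finally show ?thesis using ij by (intro exI[of _ ?c]) auto
next
  case True
  then have "card (f ` I) = card I" by (simp add: card_image)
  then have "dependent (f ` I)"
    using independent_span_bound[OF assms(1), of "f ` I"] assms by (auto simp: image_subset_iff)
  then obtain u where u: "\<exists>v\<in>f ` I. u v \<noteq> 0" "(\<Sum>v\<in>f ` I. sc (u v) v) = 0"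
    using dependent_finite[of "f ` I"] assms(2) by auto
  have "(\<Sum>i\<in>I. sc (u (f i)) (f i)) = 0"
    using u(2) True by (simp add: sum.reindex)
  then show ?thesis using u(1) by (intro exI[of _ "\<lambda>i. u (f i)"]) auto
qed

text \<open>A polynomial of least degree annihilating the sequence modulo \<open>F\<close> splits off a linear factor.\<close>

lemma seq_eigen:
  assumes "finite B" "\<And>i. x i \<in> span B" "subspace F" "x (0::nat) \<notin> F"
  shows "\<exists>n c \<mu>. (\<Sum>i\<le>n. sc (c i) (x i)) \<notin> F \<and>
    (\<Sum>i\<le>n. sc (c i) (x (Suc i))) - sc \<mu> (\<Sum>i\<le>n. sc (c i) (x i)) \<in> F"
proof -
  define S where "S p = (\<Sum>i\<le>degree p. sc (coeff p i) (x i))" for p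
  have S: "S p = (\<Sum>i\<le>N. sc (coeff p i) (x i))" if "degree p \<le> N" for p N
    unfolding S_def by (rule sum.mono_neutral_left) (use that in \<open>auto simp: coeff_eq_0\<close>)
  have "\<exists>p. p \<noteq> 0 \<and> S p \<in> F"
  proof -
    obtain c where c: "\<exists>i\<in>{..card B}. c i \<noteq> 0" "(\<Sum>i\<in>{..card B}. sc (c i) (x i)) = 0"
      using dep_family[of B "{..card B}" x] assms(1,2) by auto
    define p where "p = (\<Sum>i\<le>card B. monom (c i) i)"
    have cp: "coeff p i = (if i \<le> card B then c i else 0)" for i
      by (simp add: p_def coeff_sum if_distrib cong: if_cong)
    have "degree p \<le> card B" by (rule degree_le) (simp add: cp)
    then have "S p = (\<Sum>i\<le>card B. sc (c i) (x i))" by (subst S) (auto simp: cp)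
    then have "S p \<in> F" using c assms(3) by (simp add: subspace_0)
    moreover have "p \<noteq> 0" using c cp by (metis atMost_iff coeff_0)
    ultimately show ?thesis by blast
  qed
  then obtain p where p: "p \<noteq> 0" "S p \<in> F"
    and min: "\<And>q. q \<noteq> 0 \<Longrightarrow> S q \<in> F \<Longrightarrow> degree p \<le> degree q"
    using ex_has_least_nat[of "\<lambda>p. p \<noteq> 0 \<and> S p \<in> F" _ degree] by metis
  have "degree p \<noteq> 0"
  proof
    assume "degree p = 0"
    then obtain c where pc: "p = [:c:]" by (meson degree_eq_zeroE)
    then have "c \<noteq> 0" "sc c (x 0) \<in> F" using p by (auto simp: S_def)
    then have "sc (1 / c) (sc c (x 0)) \<in> F" using subspace_scale[OF assms(3)] by blast
    then show False using assms(4) \<open>c \<noteq> 0\<close> by simp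
  qed
  then have "\<not> constant (poly p)" by (simp add: constant_degree)
  then obtain \<mu> where "poly p \<mu> = 0" using fundamental_theorem_of_algebra by blast
  then obtain q where pq: "p = [:-\<mu>, 1:] * q" by (auto simp: poly_eq_0_iff_dvd)
  have q0: "q \<noteq> 0" using p pq by auto
  have dp: "degree p = Suc (degree q)" unfolding pq using q0 by (subst degree_mult_eq) auto
  have Sq: "S q \<notin> F" using min[OF q0] dp by auto
  let ?n = "degree q"
  have "S p = (\<Sum>i\<le>Suc ?n. sc (coeff (pCons 0 q) i) (x i)) - (\<Sum>i\<le>Suc ?n. sc (\<mu> * coeff q i) (x i))"
    unfolding S[OF eq_refl[OF dp]] sum_subtractf[symmetric] scale_left_diff_distrib[symmetric]
    by (rule sum.cong) (auto simp: pq)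
  also have "(\<Sum>i\<le>Suc ?n. sc (coeff (pCons 0 q) i) (x i)) = (\<Sum>i\<le>?n. sc (coeff q i) (x (Suc i)))"
    by (simp add: sum.atMost_Suc_shift del: sum.atMost_Suc)
  also have "(\<Sum>i\<le>Suc ?n. sc (\<mu> * coeff q i) (x i)) = sc \<mu> (\<Sum>i\<le>?n. sc (coeff q i) (x i))"
    by (simp add: scale_sum_right coeff_eq_0)
  finally show ?thesis
    using p(2) Sq unfolding S_def[of q] by (intro exI[of _ ?n] exI[of _ "coeff q"] exI[of _ \<mu>]) simp
qed

text \<open>An eigenvector of A in the quotient E / F, stated without forming the quotient:
  \<open>seq_eigen\<close> applied to the orbit of \<open>x0\<close>.\<close>

lemma rel_eigen:
  assumes "fdim E" "subspace F" "lin_on E A" "maps E A" "x0 \<in> E" "x0 \<notin> F"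
  shows "\<exists>x\<in>E. x \<notin> F \<and> (\<exists>\<mu>. A x - sc \<mu> x \<in> F)"
proof -
  obtain B where B: "finite B" "E \<subseteq> span B" using assms by (auto simp: fdim_def)
  note E = fdim_subspace[OF assms(1)]
  have xi: "(A ^^ i) x0 \<in> E" for i using maps_funpow assms by blast
  have "\<And>i. (A ^^ i) x0 \<in> span B" "(A ^^ 0) x0 \<notin> F" using xi B(2) assms(6) by auto
  from seq_eigen[OF B(1), of "\<lambda>i. (A ^^ i) x0" F, OF this(1) assms(2) this(2)]
  obtain n c \<mu> where *: "(\<Sum>i\<le>n. sc (c i) ((A ^^ i) x0)) \<notin> F"
    "(\<Sum>i\<le>n. sc (c i) ((A ^^ Suc i) x0)) - sc \<mu> (\<Sum>i\<le>n. sc (c i) ((A ^^ i) x0)) \<in> F"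
    by (elim exE conjE)
  let ?y = "\<Sum>i\<le>n. sc (c i) ((A ^^ i) x0)"
  have "A ?y = (\<Sum>i\<le>n. A (sc (c i) ((A ^^ i) x0)))"
    by (rule lin_on_sum[OF assms(3) E]) (auto intro: subspace_scale[OF E] xi)
  also have "\<dots> = (\<Sum>i\<le>n. sc (c i) ((A ^^ Suc i) x0))"
    using lin_on_scale[OF assms(3) xi] by simp
  finally have "A ?y - sc \<mu> ?y \<in> F" using *(2) by simp
  moreover have "?y \<in> E" by (intro subspace_sum[OF E] subspace_scale[OF E] xi)
  ultimately show ?thesis using *(1) by blast
qed

text \<open>An eigenvector of the pencil f - \<mu> g. A choice s with g (s x) = f x is not linear,
  but \<open>seq_eigen\<close> asks only for a sequence, and along \<open>x i\<close> the relation g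
  (x (i + 1)) = f (x i) is all that enters.\<close>

lemma pencil:
  assumes "fdim E" "lin_on E f" "lin_on E g" "\<And>x. x \<in> E \<Longrightarrow> f x \<in> g ` E" "x0 \<in> E" "x0 \<noteq> 0"
  shows "\<exists>x\<in>E. x \<noteq> 0 \<and> (\<exists>\<mu>. f x = sc \<mu> (g x))"
proof -
  obtain B where B: "finite B" "E \<subseteq> span B" using assms by (auto simp: fdim_def)
  note E = fdim_subspace[OF assms(1)]
  have "\<forall>x\<in>E. \<exists>y. y \<in> E \<and> g y = f x"
  proof
    fix x assume "x \<in> E"
    then have "f x \<in> g ` E" by (rule assms(4))
    then show "\<exists>y. y \<in> E \<and> g y = f x" by (elim imageE) auto
  qed
  then obtain s where s: "\<And>x. x \<in> E \<Longrightarrow> s x \<in> E \<and> g (s x) = f x"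
    using bchoice[of E "\<lambda>x y. y \<in> E \<and> g y = f x"] by blast
  define x where "x i = (s ^^ i) x0" for i
  have xi: "x i \<in> E" for i by (induction i) (auto simp: x_def assms s)
  have gx: "g (x (Suc i)) = f (x i)" for i using s[OF xi[of i]] by (simp add: x_def)
  have "\<And>i. x i \<in> span B" "x 0 \<notin> {0}" using xi B(2) assms(6) by (auto simp: x_def)
  from seq_eigen[OF B(1), of x "{0}", OF this(1) subspace_single_0 this(2)]
  obtain n c \<mu> where *: "(\<Sum>i\<le>n. sc (c i) (x i)) \<noteq> 0"
    "(\<Sum>i\<le>n. sc (c i) (x (Suc i))) - sc \<mu> (\<Sum>i\<le>n. sc (c i) (x i)) = 0"
    unfolding singleton_iff by (elim exE conjE)
  let ?y = "\<Sum>i\<le>n. sc (c i) (x i)"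
  have "f ?y = (\<Sum>i\<le>n. sc (c i) (f (x i)))"
    by (subst lin_on_sum[OF assms(2) E]) (auto intro: subspace_scale[OF E] xi simp: lin_on_scale[OF assms(2) xi])
  also have "\<dots> = g (\<Sum>i\<le>n. sc (c i) (x (Suc i)))"
    by (subst lin_on_sum[OF assms(3) E]) (auto intro: subspace_scale[OF E] xi simp: lin_on_scale[OF assms(3) xi] gx)
  also have "\<dots> = g (sc \<mu> ?y)" using *(2) by simp
  finally have "f ?y = sc \<mu> (g ?y)"
    using lin_on_scale[OF assms(3), of ?y] by (simp add: subspace_sum[OF E] subspace_scale[OF E] xi)
  moreover have "?y \<in> E" by (intro subspace_sum[OF E] subspace_scale[OF E] xi)
  ultimately show ?thesis using *(1) by blast
qed

text \<open>A vector of nilpotency order i + 1 modulo F generates i + 1 independent vectors under N,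
  so the order is bounded by the dimension.\<close>

lemma rel_order_bound:
  assumes "finite B" "E \<subseteq> span B" "subspace E" "subspace F" "lin_on E N" "maps E N" "maps F N"
    "v \<in> E" "(N ^^ i) v \<notin> F" "(N ^^ Suc i) v \<in> F"
  shows "i < card B"
proof (rule ccontr)
  assume "\<not> i < card B"
  then have "card B < card {..i}" by simp
  then obtain c where c: "\<exists>j\<in>{..i}. c j \<noteq> 0" "(\<Sum>j\<in>{..i}. sc (c j) ((N ^^ j) v)) = 0"
    using dep_family[OF assms(1), of "{..i}" "\<lambda>j. (N ^^ j) v"] maps_funpow[OF assms(6,8)] assms(2)
    by blast
  define j0 where "j0 = (LEAST j. c j \<noteq> 0)"
  have j0: "c j0 \<noteq> 0" "\<And>j. j < j0 \<Longrightarrow> c j = 0" "j0 \<le> i"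
  proof -
    obtain j where j: "j \<le> i" "c j \<noteq> 0" using c(1) by blast
    show "c j0 \<noteq> 0" unfolding j0_def by (rule LeastI) (rule j(2))
    show "j0 \<le> i" unfolding j0_def by (rule order_trans[OF Least_le]) (rule j(2), rule j(1))
    show "\<And>j. j < j0 \<Longrightarrow> c j = 0" using not_less_Least unfolding j0_def by blast
  qed
  have high: "(N ^^ j) v \<in> F" if "j > i" for j
  proof -
    obtain d where "j = d + Suc i" using \<open>j > i\<close> less_imp_Suc_add by (metis add.commute add_Suc)
    then show ?thesis using maps_funpow[OF assms(7,10), of d] by (simp only: funpow_add o_apply)
  qed
  \<comment> \<open>This power turns the lowest term of the relation into a multiple of N^i v and
    sends all later terms into F.\<close>
  let ?M = "N ^^ (i - j0)"
  have "0 = ?M (\<Sum>j\<in>{..i}. sc (c j) ((N ^^ j) v))"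
    using c(2) lin_on_zero[OF lin_on_funpow[OF assms(5,6)] assms(3)] by simp
  also have "\<dots> = (\<Sum>j\<in>{..i}. ?M (sc (c j) ((N ^^ j) v)))"
    by (rule lin_on_sum[OF lin_on_funpow[OF assms(5,6)] assms(3)])
       (auto intro: subspace_scale[OF assms(3)] maps_funpow[OF assms(6,8)])
  also have "\<dots> = (\<Sum>j\<in>{..i}. sc (c j) ((N ^^ (i - j0 + j)) v))"
    by (intro sum.cong refl)
       (simp add: lin_on_scale[OF lin_on_funpow[OF assms(5,6)] maps_funpow[OF assms(6,8)]] funpow_add)
  also have "\<dots> = sc (c j0) ((N ^^ i) v) + (\<Sum>j\<in>{..i} - {j0}. sc (c j) ((N ^^ (i - j0 + j)) v))"
    using j0 by (subst sum.remove[of _ j0]) auto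
  finally have "sc (c j0) ((N ^^ i) v) = - (\<Sum>j\<in>{..i} - {j0}. sc (c j) ((N ^^ (i - j0 + j)) v))"
    by (simp add: eq_neg_iff_add_eq_0)
  moreover have low: "sc (c j) ((N ^^ (i - j0 + j)) v) \<in> F" if "j \<in> {..i} - {j0}" for j
  proof (cases "j < j0")
    case True then show ?thesis using j0 assms(4) by (simp add: subspace_0)
  next
    case False
    then show ?thesis using that j0(3) by (intro subspace_scale[OF assms(4)] high) auto
  qed
  ultimately have "sc (c j0) ((N ^^ i) v) \<in> F"
    using subspace_neg[OF assms(4) subspace_sum[OF assms(4) low]] by (simp only:)
  then have "sc (1 / c j0) (sc (c j0) ((N ^^ i) v)) \<in> F" using subspace_scale[OF assms(4)] by blast
  then show False using j0(1) assms(9) by simp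
qed

lemma nilpotent_bound:
  assumes "finite B" "E \<subseteq> span B" "subspace E" "lin_on E N" "maps E N" "v \<in> E" "(N ^^ n) v = 0"
  shows "(N ^^ card B) v = 0"
proof (rule ccontr)
  assume nz: "(N ^^ card B) v \<noteq> 0"
  have z: "(N ^^ (k + n)) v = 0" for k
    using assms(7) lin_on_zero[OF lin_on_funpow[OF assms(4,5)] assms(3)] by (simp add: funpow_add)
  define i where "i = (LEAST m. (N ^^ m) v = 0)"
  have i: "(N ^^ i) v = 0" unfolding i_def using assms(7) by (rule LeastI)
  have zi: "(N ^^ (k + i)) v = 0" for k
    using i lin_on_zero[OF lin_on_funpow[OF assms(4,5)] assms(3)] by (simp add: funpow_add)
  have "card B < i"
  proof (rule ccontr)
    assume "\<not> card B < i"
    then have "card B = (card B - i) + i" by simp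
    then show False using zi nz by metis
  qed
  then obtain i' where i': "i = Suc i'" by (cases i) auto
  have "(N ^^ i') v \<noteq> 0" using not_less_Least[of i' "\<lambda>m. (N ^^ m) v = 0"] i' by (simp add: i_def)
  then have "i' < card B"
    using rel_order_bound[OF assms(1,2,3), of "{0}" N v i'] assms i i' lin_on_zero[OF assms(4,3)] by auto
  then show False using \<open>card B < i\<close> i' by simp
qed

text \<open>On a finite-dimensional quotient, [A, B] = c forces c = 0. Instead of a trace: let v be
  an eigenvector of A modulo F and N = A - \<mu>. Then N B^i v = i c B^(i-1) v modulo F, so for c
  \<noteq> 0 the vector B^i v would have nilpotency order exactly i + 1 for every i, against
  \<open>rel_order_bound\<close>.\<close>

lemma rel_comm:
  assumes "fdim E" "subspace F" "F \<subseteq> E" "lin_on E A" "maps E A" "maps F A"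
    "lin_on E B" "maps E B" "maps F B" "x0 \<in> E" "x0 \<notin> F"
    and comm: "\<And>x. x \<in> E \<Longrightarrow> A (B x) - B (A x) - sc c x \<in> F"
  shows "c = 0"
proof (rule ccontr)
  assume c: "c \<noteq> 0"
  note E = fdim_subspace[OF assms(1)]
  obtain Bs where Bs: "finite Bs" "E \<subseteq> span Bs" using assms by (auto simp: fdim_def)
  obtain v \<mu> where v: "v \<in> E" "v \<notin> F" "A v - sc \<mu> v \<in> F"
    using rel_eigen[OF assms(1,2,4,5,10,11)] by blast
  define N where "N x = A x - sc \<mu> x" for x
  have N: "lin_on E N" "maps E N" "maps F N"
    using assms E by (auto simp: N_def lin_on_def algebra_simps scale_left_commute
      subspace_diff subspace_scale)
  have N0: "lin_on F N" using N(1) assms(3) lin_on_subset by blast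
  have NB: "N (B x) - B (N x) - sc c x \<in> F" if "x \<in> E" for x
  proof -
    have "B (N x) = B (A x) - sc \<mu> (B x)"
      unfolding N_def using assms that E
      by (simp add: lin_on_diff[OF assms(7)] lin_on_scale[OF assms(7)] subspace_scale)
    then have "N (B x) - B (N x) - sc c x = A (B x) - B (A x) - sc c x"
      by (simp add: N_def)
    then show ?thesis using comm[OF that] by simp
  qed
  have Bv: "(B ^^ i) v \<in> E" for i using maps_funpow assms(8) v by blast
  have step: "N ((B ^^ Suc i) v) - sc (of_nat (Suc i) * c) ((B ^^ i) v) \<in> F" for i
  proof (induction i)
    case 0
    have "N v \<in> F" using v by (simp add: N_def)
    then have "B (N v) \<in> F" using assms(9) by blast
    then have "(N (B v) - B (N v) - sc c v) + B (N v) \<in> F" using NB[OF v(1)] subspace_add[OF assms(2)] by blast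
    then show ?case by simp
  next
    case (Suc i)
    let ?w = "(B ^^ Suc i) v"
    have "N (B ?w) - B (N ?w) - sc c ?w \<in> F" using NB Bv by blast
    moreover have "B (N ?w - sc (of_nat (Suc i) * c) ((B ^^ i) v)) \<in> F" using Suc assms(9) by blast
    moreover have "B (N ?w - sc (of_nat (Suc i) * c) ((B ^^ i) v)) = B (N ?w) - sc (of_nat (Suc i) * c) ?w"
      using Bv[of i] Bv[of "Suc i"] N(2) E
      by (simp add: lin_on_diff[OF assms(7) E] lin_on_scale[OF assms(7)] subspace_scale)
    ultimately have "(N (B ?w) - B (N ?w) - sc c ?w) + (B (N ?w) - sc (of_nat (Suc i) * c) ?w) \<in> F"
      using subspace_add[OF assms(2)] by metis
    moreover have "(N (B ?w) - B (N ?w) - sc c ?w) + (B (N ?w) - sc (of_nat (Suc i) * c) ?w) =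
        N ((B ^^ Suc (Suc i)) v) - sc (of_nat (Suc (Suc i)) * c) ?w"
    proof -
      have "sc (of_nat (Suc (Suc i)) * c) ?w = sc c ?w + sc (of_nat (Suc i) * c) ?w"
        by (simp only: scale_left_distrib[symmetric]) (simp add: algebra_simps)
      moreover have "B ?w = (B ^^ Suc (Suc i)) v" by simp
      ultimately show ?thesis by (simp del: of_nat_Suc funpow.simps)
    qed
    ultimately show ?case by (simp only:)
  qed
  have ord: "(N ^^ i) ((B ^^ i) v) \<notin> F \<and> (N ^^ Suc i) ((B ^^ i) v) \<in> F" for i
  proof (induction i)
    case 0
    then show ?case using v by (simp add: N_def)
  next
    case (Suc i)
    have eq: "(N ^^ Suc k) ((B ^^ Suc i) v) - sc (of_nat (Suc i) * c) ((N ^^ k) ((B ^^ i) v)) \<in> F" for k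
    proof -
      have "(N ^^ k) (N ((B ^^ Suc i) v) - sc (of_nat (Suc i) * c) ((B ^^ i) v)) \<in> F"
        using step maps_funpow[OF N(3)] by blast
      moreover have "(N ^^ k) (N ((B ^^ Suc i) v) - sc (of_nat (Suc i) * c) ((B ^^ i) v)) =
          (N ^^ k) (N ((B ^^ Suc i) v)) - sc (of_nat (Suc i) * c) ((N ^^ k) ((B ^^ i) v))"
        using lin_on_diff[OF lin_on_funpow[OF N(1,2)] E] lin_on_scale[OF lin_on_funpow[OF N(1,2)]] Bv N(2)
          subspace_scale[OF E] by metis
      ultimately show ?thesis by (simp add: funpow_swap1)
    qed
    have 1: "(N ^^ Suc (Suc i)) ((B ^^ Suc i) v) \<in> F"
      using subspace_add[OF assms(2) eq[of "Suc i"] subspace_scale[OF assms(2), of _ "of_nat (Suc i) * c"]] Suc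
      by fastforce
    moreover have "(N ^^ Suc i) ((B ^^ Suc i) v) \<notin> F"
    proof
      assume "(N ^^ Suc i) ((B ^^ Suc i) v) \<in> F"
      then have "sc (of_nat (Suc i) * c) ((N ^^ i) ((B ^^ i) v)) \<in> F"
        using subspace_diff[OF assms(2) _ eq[of i]] by fastforce
      then have "sc (1 / (of_nat (Suc i) * c)) (sc (of_nat (Suc i) * c) ((N ^^ i) ((B ^^ i) v))) \<in> F"
        using subspace_scale[OF assms(2)] by blast
      then show False using Suc c by (simp del: of_nat_Suc)
    qed
    ultimately show ?case by blast
  qed
  have "card Bs < card Bs"
    using rel_order_bound[OF Bs E assms(2) N(1,2,3) Bv] ord[of "card Bs"] by blast
  then show False by simp
qed

section \<open>Common kernels and simultaneous diagonalization\<close>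

lemma subspace_kernel_on:
  assumes "subspace E" "lin_on E f"
  shows "subspace {x \<in> E. f x = sc c x}"
  using assms by (auto simp: subspace_def lin_on_def algebra_simps scale_left_commute intro: lin_on_zero)

text \<open>Induction on the dimension: the kernel of an operator that is not zero on E is a proper
  subspace, non-zero by nilpotency and stable under the commuting family.\<close>

lemma common_kernel:
  assumes "fdim E" "x0 \<in> E" "x0 \<noteq> 0"
    "\<And>f. f \<in> FF \<Longrightarrow> lin_on E f \<and> maps E f" "\<And>f g x. f \<in> FF \<Longrightarrow> g \<in> FF \<Longrightarrow> x \<in> E \<Longrightarrow> f (g x) = g (f x)"
    "\<And>f x. f \<in> FF \<Longrightarrow> x \<in> E \<Longrightarrow> \<exists>n. (f ^^ n) x = 0"
  shows "\<exists>v\<in>E. v \<noteq> 0 \<and> (\<forall>f\<in>FF. f v = 0)"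
  using assms
proof (induction "dim E" arbitrary: E x0 rule: less_induct)
  case less
  note E = fdim_subspace[OF less.prems(1)]
  show ?case
  proof (cases "\<forall>f\<in>FF. \<forall>x\<in>E. f x = 0")
    case True
    then show ?thesis using less.prems by blast
  next
    case False
    then obtain f x where f: "f \<in> FF" "x \<in> E" "f x \<noteq> 0" by blast
    define K where "K = {x \<in> E. f x = 0}"
    have K: "subspace K" using subspace_kernel_on[OF E, of f 0] less.prems(4) f by (auto simp: K_def)
    have "K \<subseteq> E" "K \<noteq> E" using f by (auto simp: K_def)
    obtain n where n: "(f ^^ n) x = 0" using less.prems(6) f by blast
    define i where "i = (LEAST m. (f ^^ m) x = 0)"
    have i: "(f ^^ i) x = 0" unfolding i_def using n by (rule LeastI)
    have "i \<noteq> 0" using i f lin_on_zero[OF _ E, of f] less.prems(4) by (intro notI) auto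
    then obtain i' where i': "i = Suc i'" by (cases i) auto
    have y0: "(f ^^ i') x \<noteq> 0" using not_less_Least[of i' "\<lambda>m. (f ^^ m) x = 0"] i' by (simp add: i_def)
    have "(f ^^ i') x \<in> E" using maps_funpow less.prems(4) f by blast
    then have yK: "(f ^^ i') x \<in> K" using i i' by (simp add: K_def)
    have "\<exists>v\<in>K. v \<noteq> 0 \<and> (\<forall>f\<in>FF. f v = 0)"
    proof (rule less.hyps[of K])
      show "dim K < dim E" using fdim_dim_less[OF less.prems(1) K] \<open>K \<subseteq> E\<close> \<open>K \<noteq> E\<close> by blast
      show "fdim K" using fdim_subset less.prems(1) K \<open>K \<subseteq> E\<close> by blast
      show "lin_on K g \<and> maps K g" if "g \<in> FF" for g
      proof
        show "lin_on K g" using that less.prems(4) lin_on_subset \<open>K \<subseteq> E\<close> by blast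
        have "g 0 = 0" using lin_on_zero[OF _ E] less.prems(4) that by blast
        then show "maps K g" using that less.prems(4) less.prems(5)[OF f(1) that] by (auto simp: K_def)
      qed
    qed (use yK y0 less.prems(5,6) \<open>K \<subseteq> E\<close> in blast)+
    then show ?thesis using \<open>K \<subseteq> E\<close> by blast
  qed
qed

text \<open>The last hypothesis excludes Jordan chains of length two. If the eigenvectors spanned
  only a proper subspace S, there would be an eigenvector modulo S. Its defect can be removed on
  every eigenspace inside S except the one for \<mu>, and what remains there is excluded by the
  hypothesis.\<close>

lemma semisimple_span:
  assumes "fdim E" "lin_on E A" "maps E A"
    "\<And>x y \<mu>. x \<in> E \<Longrightarrow> y = A x - sc \<mu> x \<Longrightarrow> A y = sc \<mu> y \<Longrightarrow> y = 0"
  shows "E = span {x \<in> E. \<exists>c. A x = sc c x}"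
proof (rule ccontr)
  note E = fdim_subspace[OF assms(1)]
  let ?G = "{x \<in> E. \<exists>c. A x = sc c x}"
  define S where "S = span ?G"
  assume "E \<noteq> span ?G"
  have "S \<subseteq> E" unfolding S_def by (rule span_minimal[OF _ E]) auto
  then obtain x0 where "x0 \<in> E" "x0 \<notin> S" using \<open>E \<noteq> span ?G\<close> by (auto simp: S_def)
  then obtain x \<mu> where x: "x \<in> E" "x \<notin> S" "A x - sc \<mu> x \<in> S"
    using rel_eigen[OF assms(1), of S A x0] assms by (auto simp: S_def)
  \<comment> \<open>correct \<open>x\<close> by an element of \<open>S\<close> so that the defect lies in the \<open>\<mu>\<close>-eigenspace\<close>
  have "\<exists>t\<in>S. \<exists>s\<in>S. A s = sc \<mu> s \<and> y - (A t - sc \<mu> t) = s" if "y \<in> S" for y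
    using that unfolding S_def
  proof (induction rule: span_induct_alt)
    case base
    have "A 0 = 0" using lin_on_zero[OF assms(2) E] .
    then show ?case by (intro bexI[of _ 0]) (auto simp: span_zero)
  next
    case (step c g y)
    then obtain t where t: "t \<in> S" "y - (A t - sc \<mu> t) \<in> S"
      "A (y - (A t - sc \<mu> t)) = sc \<mu> (y - (A t - sc \<mu> t))" unfolding S_def by blast
    from step obtain \<nu> where g: "g \<in> E" "A g = sc \<nu> g" by blast
    have gS: "g \<in> S" unfolding S_def using g by (auto intro: span_base)
    have sE: "\<And>z. z \<in> S \<Longrightarrow> z \<in> E" using \<open>S \<subseteq> E\<close> by blast
    show ?case
    proof (cases "\<nu> = \<mu>")
      case True
      have "A (sc c g + (y - (A t - sc \<mu> t))) = sc \<mu> (sc c g + (y - (A t - sc \<mu> t)))"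
        using g t True sE E
        by (subst lin_on_add[OF assms(2)])
           (auto simp: subspace_scale lin_on_scale[OF assms(2)] scale_right_distrib scale_left_commute)
      moreover have "sc c g + (y - (A t - sc \<mu> t)) \<in> S"
        using gS t(2) unfolding S_def by (intro span_add span_scale)
      ultimately show ?thesis using t(1) unfolding S_def
        by (intro bexI[of _ t] bexI[of _ "sc c g + (y - (A t - sc \<mu> t))"]) auto
    next
      case False
      \<comment> \<open>On the eigenvector g the operator A - \<mu> is the non-zero scalar \<nu> -
        \<mu>, so c g is the image of this multiple of g.\<close>
      let ?t = "t + sc (c / (\<nu> - \<mu>)) g"
      have "A ?t = A t + sc (c / (\<nu> - \<mu>)) (sc \<nu> g)"
        using g t sE E by (simp add: lin_on_add[OF assms(2)] lin_on_scale[OF assms(2)] subspace_scale)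
      then have "A ?t - sc \<mu> ?t = (A t - sc \<mu> t) + sc (c / (\<nu> - \<mu>) * (\<nu> - \<mu>)) g"
        by (simp add: scale_right_distrib left_diff_distrib scale_left_diff_distrib mult.commute[of "c / (\<nu> - \<mu>)"]
            del: times_divide_eq_left times_divide_eq_right)
      then have "A ?t - sc \<mu> ?t = (A t - sc \<mu> t) + sc c g" using False by simp
      then have "sc c g + y - (A ?t - sc \<mu> ?t) = y - (A t - sc \<mu> t)" by simp
      moreover have "?t \<in> S" using gS t(1) unfolding S_def by (intro span_add span_scale)
      ultimately show ?thesis using t unfolding S_def by (metis (no_types, lifting))
    qed
  qed
  from this[OF x(3)] obtain t s where ts: "t \<in> S" "s \<in> S" "A s = sc \<mu> s"
    "A x - sc \<mu> x - (A t - sc \<mu> t) = s" by blast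
  have tE: "t \<in> E" using ts \<open>S \<subseteq> E\<close> by blast
  have "s = A (x - t) - sc \<mu> (x - t)"
    using ts(4) x(1) tE E by (simp add: lin_on_diff[OF assms(2) E] scale_right_diff_distrib algebra_simps)
  then have "s = 0" using assms(4)[of "x - t" s \<mu>] ts(3) x(1) tE E by (simp add: subspace_diff)
  then have "A (x - t) = sc \<mu> (x - t)" using \<open>s = A (x - t) - sc \<mu> (x - t)\<close> by simp
  then have "x - t \<in> S" unfolding S_def using x(1) tE E by (intro span_base) (auto simp: subspace_diff)
  then have "(x - t) + t \<in> S" using ts(1) unfolding S_def by (intro span_add)
  then show False using x(2) by simp
qed

text \<open>Induction on the dimension: if some f does not consist of one eigenspace, then all its
  eigenspaces are proper, are preserved by the commuting family and inherit the hypotheses.\<close>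

lemma simultaneous_span:
  assumes "fdim E"
    "\<And>f. f \<in> FF \<Longrightarrow> lin_on E f \<and> maps E f" "\<And>f g x. f \<in> FF \<Longrightarrow> g \<in> FF \<Longrightarrow> x \<in> E \<Longrightarrow> f (g x) = g (f x)"
    "\<And>f x y \<mu>. f \<in> FF \<Longrightarrow> x \<in> E \<Longrightarrow> y = f x - sc \<mu> x \<Longrightarrow> f y = sc \<mu> y \<Longrightarrow> y = 0"
  shows "E = span {x \<in> E. \<forall>f\<in>FF. \<exists>c. f x = sc c x}"
  using assms
proof (induction "dim E" arbitrary: E rule: less_induct)
  case less
  note E = fdim_subspace[OF less.prems(1)]
  let ?G = "\<lambda>E. {x \<in> E. \<forall>f\<in>FF. \<exists>c. f x = sc c x}"
  have le: "span (?G E) \<subseteq> E" by (rule span_minimal[OF _ E]) auto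
  show ?case
  proof (cases "?G E = E")
    case True
    then show ?thesis using E by (metis span_eq_iff)
  next
    case False
    then obtain f x where f: "f \<in> FF" "x \<in> E" "\<nexists>c. f x = sc c x" by blast
    have fE: "lin_on E f" "maps E f" using less.prems(2) f by auto
    have "E = span {x \<in> E. \<exists>c. f x = sc c x}"
      using semisimple_span[OF less.prems(1) fE] less.prems(4)[OF f(1)] by blast
    also have "\<dots> \<subseteq> span (?G E)"
    proof (rule span_minimal[OF _ subspace_span], rule subsetI)
      fix z assume "z \<in> {x \<in> E. \<exists>c. f x = sc c x}"
      then obtain c where z: "z \<in> E" "f z = sc c z" by blast
      define K where "K = {x \<in> E. f x = sc c x}"
      have K: "subspace K" unfolding K_def by (rule subspace_kernel_on[OF E fE(1)])
      have KE: "K \<subseteq> E" "K \<noteq> E" using f by (auto simp: K_def)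
      have K1: "K = span (?G K)"
      proof (rule less.hyps)
        show "dim K < dim E" using fdim_dim_less[OF less.prems(1) K] KE by blast
        show "fdim K" using fdim_subset less.prems(1) K KE by blast
        show "lin_on K g \<and> maps K g" if "g \<in> FF" for g
        proof
          show "lin_on K g" using that less.prems(2) lin_on_subset KE by blast
          show "maps K g" using that less.prems(2)[OF that] less.prems(3)[OF f(1) that]
            by (auto simp: K_def lin_on_scale)
        qed
        show "g (h x) = h (g x)" if "g \<in> FF" "h \<in> FF" "x \<in> K" for g h x
          using less.prems(3) that KE by blast
        show "y = 0" if "g \<in> FF" "x \<in> K" "y = g x - sc \<mu> x" "g y = sc \<mu> y" for g x y \<mu>
          using less.prems(4) that KE by blast
      qed
      have KG: "span (?G K) \<subseteq> span (?G E)" using KE by (intro span_mono) auto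
      have zK: "z \<in> K" using z by (simp add: K_def)
      have "z \<in> span (?G K)" by (simp only: K1[symmetric] zK)
      then show "z \<in> span (?G E)" by (rule subsetD[OF KG])
    qed
    finally show ?thesis using le by blast
  qed
qed

text \<open>Linearly independent functionals take any prescribed values. Inductively the first l
  functionals have dual vectors \<open>e j\<close>; independence says that the last functional is
  not its own interpolation by the first l of them, and a point where it differs yields a vector
  dual to it.\<close>

lemma dual_vectors:
  fixes f :: "nat \<Rightarrow> 'a \<Rightarrow> complex"
  assumes "subspace H"
    "\<And>i x y. i \<in> {1..l} \<Longrightarrow> x \<in> H \<Longrightarrow> y \<in> H \<Longrightarrow> f i (x + y) = f i x + f i y"
    "\<And>i c x. i \<in> {1..l} \<Longrightarrow> x \<in> H \<Longrightarrow> f i (sc c x) = c * f i x"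
    "\<And>c. (\<forall>h\<in>H. (\<Sum>i=1..l. c i * f i h) = 0) \<Longrightarrow> (\<forall>i\<in>{1..l}. c i = 0)"
  shows "\<exists>h\<in>H. \<forall>i\<in>{1..l}. f i h = d i"
  using assms(2-4)
proof (induction l arbitrary: d)
  case 0
  then show ?case using subspace_0[OF assms(1)] by auto
next
  case (Suc l)
  note H = assms(1)
  have ind: "\<forall>i\<in>{1..l}. c i = 0" if "\<forall>h\<in>H. (\<Sum>i=1..l. c i * f i h) = 0" for c
  proof
    fix i assume "i \<in> {1..l}"
    then show "c i = 0"
      using Suc.prems(3)[of "\<lambda>i. if i \<le> l then c i else 0"] that by (simp split: if_splits)
  qed
  have IH: "\<exists>h\<in>H. \<forall>i\<in>{1..l}. f i h = d i" for d
  proof (rule Suc.IH)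
    show "f i (x + y) = f i x + f i y" if "i \<in> {1..l}" "x \<in> H" "y \<in> H" for i x y
      using that by (intro Suc.prems(1)) auto
    show "f i (sc c x) = c * f i x" if "i \<in> {1..l}" "x \<in> H" for i c x
      using that by (intro Suc.prems(2)) auto
    show "\<forall>i\<in>{1..l}. c i = 0" if "\<forall>h\<in>H. (\<Sum>i=1..l. c i * f i h) = 0" for c
      by (rule ind[OF that])
  qed
  have "\<forall>j. \<exists>h. h \<in> H \<and> (\<forall>i\<in>{1..l}. f i h = (if i = j then 1 else 0))"
  proof
    fix j show "\<exists>h. h \<in> H \<and> (\<forall>i\<in>{1..l}. f i h = (if i = j then 1 else 0))"
      using IH[of "\<lambda>i. if i = j then 1 else 0"] by blast
  qed
  from choice[OF this] obtain e where e: "\<And>j. e j \<in> H" "\<And>i j. i \<in> {1..l} \<Longrightarrow> f i (e j) = (if i = j then 1 else 0)"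
    by blast
  let ?L = "Suc l"
  have fsum: "f i (\<Sum>j\<in>J. sc (a j) (e j)) = (\<Sum>j\<in>J. a j * f i (e j))" if "i \<in> {1..?L}" "finite J" for i a J
    using that(2)
  proof (induction J rule: finite_induct)
    case empty
    have "f i (sc 0 0) = 0 * f i 0" using Suc.prems(2) subspace_0[OF H] that by blast
    then show ?case by simp
  next
    case (insert j J)
    then show ?case
      using Suc.prems(1)[OF that(1), of "sc (a j) (e j)" "\<Sum>j\<in>J. sc (a j) (e j)"] Suc.prems(2)[OF that(1)] e(1)
      by (simp add: subspace_scale[OF H] subspace_sum[OF H])
  qed
  have "\<exists>h\<in>H. f ?L h - (\<Sum>i=1..l. f ?L (e i) * f i h) \<noteq> 0"
  proof (rule ccontr)
    assume "\<not> ?thesis"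
    then have "\<forall>h\<in>H. (\<Sum>i=1..?L. (if i = ?L then 1 else - f ?L (e i)) * f i h) = 0"
      by (simp add: sum_negf)
    then have "\<forall>i\<in>{1..?L}. (if i = ?L then 1 else - f ?L (e i)) = 0" by (rule Suc.prems(3))
    then have "(if ?L = ?L then 1 else - f ?L (e ?L)) = (0::complex)" by (rule bspec) simp
    then show False by simp
  qed
  then obtain h where h: "h \<in> H" "f ?L h - (\<Sum>i=1..l. f ?L (e i) * f i h) \<noteq> 0" by blast
  let ?g = "f ?L h - (\<Sum>i=1..l. f ?L (e i) * f i h)"
  let ?s = "\<Sum>j=1..l. sc (f j h) (e j)"
  \<comment> \<open>Subtracting the interpolation makes the first l functionals vanish at
    \<open>h'\<close>; the factor normalizes the last one to 1.\<close>
  define h' where "h' = sc (1 / ?g) (h - ?s)"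
  have sH: "?s \<in> H" by (intro subspace_sum[OF H] subspace_scale[OF H] e)
  have fd: "f i (h - ?s) = f i h - (\<Sum>j=1..l. f j h * f i (e j))" if "i \<in> {1..?L}" for i
    using Suc.prems(1)[OF that, of h "sc (-1) ?s"] Suc.prems(2)[OF that sH, of "-1"] fsum[OF that, of "{1..l}"]
      subspace_scale[OF H sH, of "-1"] h by simp
  have h'H: "h' \<in> H" unfolding h'_def using h sH by (intro subspace_scale[OF H] subspace_diff[OF H])
  have f1: "f i h' = 0" if "i \<in> {1..l}" for i
  proof -
    have "(\<Sum>j=1..l. f j h * f i (e j)) = (\<Sum>j=1..l. if j = i then f j h else 0)"
      using that by (intro sum.cong) (auto simp: e)
    also have "\<dots> = f i h" using that by simp
    finally show ?thesis using fd[of i] that h sH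
      by (simp add: h'_def Suc.prems(2) subspace_diff[OF H])
  qed
  have f2: "f ?L h' = 1"
    using fd[of ?L] h sH by (simp add: h'_def Suc.prems(2) subspace_diff[OF H] mult.commute)
  obtain k where k: "k \<in> H" "\<forall>i\<in>{1..l}. f i k = d i" using IH by blast
  let ?k = "k + sc (d ?L - f ?L k) h'"
  have exact_K: "f i ?k = f i k + (d ?L - f ?L k) * f i h'" if "i \<in> {1..?L}" for i
    using Suc.prems(1)[OF that k(1) subspace_scale[OF H h'H]] Suc.prems(2)[OF that h'H] by simp
  have "f i ?k = d i" if i: "i \<in> {1..?L}" for i
  proof (cases "i = ?L")
    case True then show ?thesis using exact_K[OF i] f2 by simp
  next
    case False
    then have "i \<in> {1..l}" using i by auto
    then show ?thesis using exact_K[OF i] f1 k by simp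
  qed
  moreover have "?k \<in> H" using k h'H by (intro subspace_add[OF H] subspace_scale[OF H])
  ultimately show ?case by blast
qed

subsection \<open>Traces\<close>

definition tr :: "'a set \<Rightarrow> ('a \<Rightarrow> 'a) \<Rightarrow> complex" where
  "tr B f = (\<Sum>b\<in>B. representation B (f b) b)"

lemma tr_commute:
  assumes "finite B" "independent B" "span B = UNIV" "lin_on UNIV f" "lin_on UNIV g"
  shows "tr B (\<lambda>x. f (g x)) = tr B (\<lambda>x. g (f x))"
proof -
  have *: "tr B (\<lambda>x. f (g x)) = (\<Sum>b\<in>B. \<Sum>c\<in>B. representation B (g b) c * representation B (f c) b)"
    if "lin_on UNIV f" for f g
  proof -
    have "representation B (f (g b)) b = (\<Sum>c\<in>B. representation B (g b) c * representation B (f c) b)" for b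
    proof -
      have "g b = (\<Sum>c\<in>B. sc (representation B (g b) c) c)"
        using sum_representation_eq[OF assms(2) _ assms(1) order_refl, of "g b"] assms(3) by simp
      then have "f (g b) = f (\<Sum>c\<in>B. sc (representation B (g b) c) c)" by simp
      also have "\<dots> = (\<Sum>c\<in>B. sc (representation B (g b) c) (f c))"
        using lin_on_sum[OF that subspace_UNIV assms(1)] lin_on_scale[OF that] by simp
      finally have "f (g b) = (\<Sum>c\<in>B. sc (representation B (g b) c) (f c))" .
      then show ?thesis using assms
        by (simp add: representation_sum representation_scale)
    qed
    then show ?thesis by (simp add: tr_def)
  qed
  show ?thesis
    unfolding *[OF assms(4)] *[OF assms(5)] by (subst sum.swap) (simp add: mult.commute)
qed

lemma tr_add:
  assumes "independent B" "span B = UNIV"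
  shows "tr B (\<lambda>x. f x + g x) = tr B f + tr B g"
  using assms by (simp add: tr_def representation_add sum.distrib)

lemma tr_diff:
  assumes "independent B" "span B = UNIV"
  shows "tr B (\<lambda>x. f x - g x) = tr B f - tr B g"
  using assms by (simp add: tr_def representation_diff sum_subtractf)

lemma tr_scale:
  assumes "independent B" "span B = UNIV"
  shows "tr B (\<lambda>x. sc c (f x)) = c * tr B f"
  using assms by (simp add: tr_def representation_scale sum_distrib_left)

lemma span_take_stable:
  assumes "lin_on UNIV A" "\<And>i. i < length bs \<Longrightarrow> A (bs ! i) - sc (d i) (bs ! i) \<in> span (set (take i bs))"
    "n \<le> length bs" "x \<in> span (set (take n bs))"
  shows "A x \<in> span (set (take n bs))"
  using assms(4)
proof (induction rule: span_induct_alt)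
  case base
  then show ?case using lin_on_zero[OF assms(1) subspace_UNIV] by (simp add: span_zero)
next
  case (step c x y)
  then obtain i where i: "i < n" "x = bs ! i" using assms(3) by (auto simp: in_set_conv_nth)
  have "set (take i bs) \<subseteq> set (take n bs)" using i by (intro set_take_subset_set_take) simp
  then have "span (set (take i bs)) \<subseteq> span (set (take n bs))" by (rule span_mono)
  moreover have "A x - sc (d i) x \<in> span (set (take i bs))" using assms(2)[of i] i assms(3) by simp
  ultimately have "A x - sc (d i) x \<in> span (set (take n bs))" by (rule subsetD)
  then have "(A x - sc (d i) x) + sc (d i) x \<in> span (set (take n bs))"
    using step(1) by (intro span_add span_scale) (auto intro: span_base)
  then have "A x \<in> span (set (take n bs))" by simp
  then show ?case
    using step(2) lin_on_add[OF assms(1)] lin_on_scale[OF assms(1)]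
    by (simp add: span_add span_scale)
qed

text \<open>Triangular form: a longest list that is triangular for A must span, since an eigenvector
  modulo its span would extend it.\<close>

lemma flag_basis:
  assumes "finite B0" "span B0 = UNIV" "lin_on UNIV A"
  shows "\<exists>bs d. distinct bs \<and> independent (set bs) \<and> span (set bs) = UNIV \<and>
    (\<forall>i<length bs. A (bs ! i) - sc (d i) (bs ! i) \<in> span (set (take i bs)))"
proof -
  let ?P = "\<lambda>bs. distinct bs \<and> independent (set bs) \<and>
    (\<exists>d. \<forall>i<length bs. A (bs ! i) - sc (d i) (bs ! i) \<in> span (set (take i bs)))"
  have bound: "length bs \<le> card B0" if "?P bs" for bs
    using independent_span_bound[OF assms(1), of "set bs"] that assms(2) distinct_card[of bs] by auto
  have "?P []" by (auto simp: independent_empty)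
  then obtain bs where bs: "?P bs" and max: "\<And>cs. ?P cs \<Longrightarrow> length cs \<le> length bs"
    using ex_has_greatest_nat[of ?P "[]" length "Suc (card B0)"] bound by (auto simp: less_Suc_eq_le)
  then obtain d where d: "\<forall>i<length bs. A (bs ! i) - sc (d i) (bs ! i) \<in> span (set (take i bs))" by blast
  have "span (set bs) = UNIV"
  proof (rule ccontr)
    assume "span (set bs) \<noteq> UNIV"
    then obtain x0 where "x0 \<notin> span (set bs)" by blast
    moreover have "fdim UNIV" using assms by (auto simp: fdim_def)
    ultimately obtain x \<mu> where x: "x \<notin> span (set bs)" "A x - sc \<mu> x \<in> span (set bs)"
      using rel_eigen[of UNIV "span (set bs)" A x0] assms(3) by auto
    have "?P (bs @ [x])"
    proof (intro conjI exI[of _ "d(length bs := \<mu>)"] allI impI)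
      show "distinct (bs @ [x])" using bs x span_base by auto
      show "independent (set (bs @ [x]))" using bs independent_insertI[OF x(1)] by simp
      fix i assume "i < length (bs @ [x])"
      then show "A ((bs @ [x]) ! i) - sc ((d(length bs := \<mu>)) i) ((bs @ [x]) ! i) \<in> span (set (take i (bs @ [x])))"
        using d x by (cases "i = length bs") (auto simp: nth_append)
    qed
    then show False using max[of "bs @ [x]"] by simp
  qed
  then show ?thesis using bs d by blast
qed

text \<open>The diagonal entries of a triangular form are exactly the eigenvalues. This turns the
  trace form of an element with integral eigenvalues into a sum of squares of integers.\<close>

lemma tr_square_flag:
  assumes "lin_on UNIV A" "distinct bs" "independent (set bs)" "span (set bs) = UNIV"
    and fl: "\<And>i. i < length bs \<Longrightarrow> A (bs ! i) - sc (d i) (bs ! i) \<in> span (set (take i bs))"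
  shows "tr (set bs) (\<lambda>x. A (A x)) = (\<Sum>i<length bs. d i ^ 2)"
    and "i < length bs \<Longrightarrow> \<exists>x. x \<noteq> 0 \<and> A x = sc (d i) x"
    and "x \<noteq> 0 \<Longrightarrow> A x = sc \<mu> x \<Longrightarrow> \<exists>i<length bs. d i = \<mu>"
proof -
  have bi: "bs ! i \<notin> set (take i bs)" if "i < length bs" for i
    using that assms(2) by (auto simp: in_set_conv_nth nth_eq_iff_index_eq)
  have rep0: "representation (set bs) y (bs ! i) = 0" if "y \<in> span (set (take i bs))" "i < length bs" for y i
  proof -
    have "representation (set bs) y = representation (set (take i bs)) y"
      using representation_extend[OF assms(3) that(1)] set_take_subset by metis
    then show ?thesis using representation_ne_zero[of "set (take i bs)" y "bs ! i"] bi that by auto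
  qed
  have rep1: "representation (set bs) (A (A (bs ! i))) (bs ! i) = d i ^ 2" if i: "i < length bs" for i
  proof -
    let ?b = "bs ! i" and ?y = "A (bs ! i) - sc (d i) (bs ! i)"
    have "A ?y = A (A ?b) - sc (d i) (A ?b)"
      by (simp add: lin_on_diff[OF assms(1) subspace_UNIV] lin_on_scale[OF assms(1)])
    then have "A (A ?b) = A ?y + sc (d i) ?y + sc (d i ^ 2) ?b"
      by (simp add: scale_right_diff_distrib power2_eq_square)
    moreover have "A ?y + sc (d i) ?y \<in> span (set (take i bs))"
      using fl[OF i] span_take_stable[OF assms(1) fl _ fl[OF i]] i by (intro span_add span_scale) auto
    ultimately show ?thesis
      using assms(3,4) rep0[OF _ i, of "A ?y + sc (d i) ?y"] representation_basis[OF assms(3), of ?b] i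
      by (simp add: representation_add[OF assms(3)] representation_scale[OF assms(3)])
  qed
  have "tr (set bs) (\<lambda>x. A (A x)) = (\<Sum>i<length bs. representation (set bs) (A (A (bs ! i))) (bs ! i))"
    unfolding tr_def by (rule sum.reindex_bij_betw[symmetric], rule bij_betw_nth) (auto simp: assms)
  then show "tr (set bs) (\<lambda>x. A (A x)) = (\<Sum>i<length bs. d i ^ 2)" using rep1 by simp
  show "\<exists>x. x \<noteq> 0 \<and> A x = sc (d i) x" if i: "i < length bs"
  proof (rule ccontr)
    assume neg: "\<nexists>x. x \<noteq> 0 \<and> A x = sc (d i) x"
    \<comment> \<open>\<open>N\<close> sends the span of the first i + 1 vectors into the span of
      the first i, so it cannot be injective.\<close>
    define N where "N x = A x - sc (d i) x" for x
    have N: "Vector_Spaces.linear sc sc N"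
      using assms(1) vector_space_axioms unfolding Vector_Spaces.linear_iff
      by (auto simp: N_def lin_on_def algebra_simps scale_left_commute)
    interpret NN: Vector_Spaces.linear sc sc N by (rule N)
    have injN: "inj N"
      unfolding NN.inj_iff_eq_0 using neg by (auto simp: N_def)
    let ?S = "set (take (Suc i) bs)"
    have "N ` ?S \<subseteq> span (set (take i bs))"
    proof
      fix y assume "y \<in> N ` ?S"
      then obtain j where j: "j \<le> i" "y = N (bs ! j)" using i by (auto simp: in_set_conv_nth less_Suc_eq_le)
      show "y \<in> span (set (take i bs))"
      proof (cases "j = i")
        case True then show ?thesis using fl[OF i] j by (simp add: N_def)
      next
        case False
        then have "bs ! j \<in> set (take i bs)" using j i by (auto simp: in_set_conv_nth intro!: exI[of _ j])
        then have b: "bs ! j \<in> span (set (take i bs))" by (rule span_base)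
        then have "A (bs ! j) \<in> span (set (take i bs))" using span_take_stable[OF assms(1) fl] i by simp
        then show ?thesis unfolding j N_def using b by (intro span_diff span_scale)
      qed
    qed
    moreover have "independent (N ` ?S)"
    proof -
      have "independent ?S" using assms(3) by (rule independent_mono) (rule set_take_subset)
      show ?thesis using NN.independent_injective_image[OF \<open>independent ?S\<close>] injN by (meson inj_on_subset subset_UNIV)
    qed
    ultimately have "card (N ` ?S) \<le> card (set (take i bs))"
      using independent_span_bound[of "set (take i bs)"] by blast
    moreover have "card (N ` ?S) = Suc i"
      using injN i assms(2) by (subst card_image) (auto simp: distinct_card inj_on_def)
    moreover have "card (set (take i bs)) = i" using i assms(2) by (simp add: distinct_card)
    ultimately show False by simp
  qed
  show "\<exists>i<length bs. d i = \<mu>" if x: "x \<noteq> 0" "A x = sc \<mu> x"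
  proof -
    \<comment> \<open>The first member of the flag containing x: there x has a non-zero coefficient
      at the last basis vector, and comparing this coefficient in A x = \<mu> x identifies \<mu>
      with a diagonal entry.\<close>
    define n where "n = (LEAST n. x \<in> span (set (take n bs)))"
    have "x \<in> span (set (take (length bs) bs))" using assms(4) by simp
    then have n: "x \<in> span (set (take n bs))" "n \<le> length bs"
      unfolding n_def by (rule LeastI, rule Least_le)
    have "n \<noteq> 0" using n x by (intro notI) simp
    then obtain i where i: "n = Suc i" by (cases n) auto
    then have il: "i < length bs" using n by simp
    have xi: "x \<notin> span (set (take i bs))"
      using not_less_Least[of i "\<lambda>n. x \<in> span (set (take n bs))"] i unfolding n_def[symmetric] by simp
    have "take n bs = take i bs @ [bs ! i]" using i il by (simp add: take_Suc_conv_app_nth)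
    then have "x \<in> span (insert (bs ! i) (set (take i bs)))" using n by simp
    then obtain k where k: "x - sc k (bs ! i) \<in> span (set (take i bs))" using span_breakdown_eq by blast
    have k0: "k \<noteq> 0" using k xi by (intro notI) simp
    let ?F = "span (set (take i bs))"
    let ?y = "x - sc k (bs ! i)"
    have "A ?y \<in> ?F" using span_take_stable[OF assms(1) fl _ k] il by simp
    moreover have "A ?y = sc \<mu> x - sc k (A (bs ! i))"
      using lin_on_diff[OF assms(1) subspace_UNIV] lin_on_scale[OF assms(1)] x by simp
    ultimately have 1: "sc \<mu> x - sc k (A (bs ! i)) \<in> ?F" by simp
    have 2: "sc k (A (bs ! i) - sc (d i) (bs ! i)) \<in> ?F" using fl[OF il] by (rule span_scale)
    have 3: "sc \<mu> ?y \<in> ?F" using k by (rule span_scale)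
    have "(sc \<mu> x - sc k (A (bs ! i))) + sc k (A (bs ! i) - sc (d i) (bs ! i)) - sc \<mu> ?y \<in> ?F"
      by (rule span_diff[OF span_add[OF 1 2] 3])
    moreover have "(sc \<mu> x - sc k (A (bs ! i))) + sc k (A (bs ! i) - sc (d i) (bs ! i)) - sc \<mu> ?y =
        sc (k * (\<mu> - d i)) (bs ! i)" by (simp add: algebra_simps)
    ultimately have 4: "sc (k * (\<mu> - d i)) (bs ! i) \<in> ?F" by simp
    have "k * (\<mu> - d i) = 0"
    proof (rule ccontr)
      assume nz: "k * (\<mu> - d i) \<noteq> 0"
      then have "sc (1 / (k * (\<mu> - d i))) (sc (k * (\<mu> - d i)) (bs ! i)) \<in> ?F" using 4 span_scale by blast
      then have "bs ! i \<in> ?F" using nz by (simp del: mult_eq_0_iff)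
      then show False
        using rep0[OF _ il, of "bs ! i"] representation_basis[OF assms(3), of "bs ! i"] il by simp
    qed
    then show ?thesis using k0 il by auto
  qed
qed

end

section \<open>Lie algebra preliminaries\<close>

locale lie_torus =
  fixes X :: "('g::ab_group_add, 'n::finite) datum"
  assumes datum: "lie_torus_datum X"
begin

abbreviation "br \<equiv> lie X"
abbreviation "scl \<equiv> scal X"
abbreviation "H \<equiv> cartan X"
abbreviation "ifm \<equiv> iform X"

lemma lie_alg: "lie_algebra scl br"
  using datum by (simp add: lie_torus_datum_def)

sublocale G: cvs "scal X"
  using lie_alg by (simp add: lie_algebra_def cvs_def)

lemma br_linear_right: "Vector_Spaces.linear scl scl (br x)"
  and br_linear_left: "Vector_Spaces.linear scl scl (\<lambda>x. br x y)"
  using lie_alg by (auto simp: lie_algebra_def)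

lemma br_add_right: "br x (y + z) = br x y + br x z"
  and br_scale_right: "br x (scl c y) = scl c (br x y)"
  and br_add_left: "br (x + y) z = br x z + br y z"
  and br_scale_left: "br (scl c x) z = scl c (br x z)"
  using br_linear_right br_linear_left by (auto simp: Vector_Spaces.linear_iff)

lemma br_zero_right [simp]: "br x 0 = 0"
  using br_scale_right[of x 0 0] by simp

lemma br_zero_left [simp]: "br 0 x = 0"
  using br_scale_left[of 0 0 x] by simp

lemma br_diff_right: "br x (y - z) = br x y - br x z"
  using br_add_right[of x "y - z" z] by (simp add: algebra_simps)

lemma br_self: "br x x = 0"
  using lie_alg by (simp add: lie_algebra_def)

lemma br_anti: "br x y = - br y x"
proof -
  have "br (x + y) (x + y) = 0" by (rule br_self)
  then have "br x y + br y x = 0"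
    unfolding br_add_left br_add_right by (simp add: br_self add.commute)
  then show ?thesis by (simp add: eq_neg_iff_add_eq_0)
qed

lemma br_neg_right: "br x (- y) = - br x y"
  using br_diff_right[of x 0 y] by simp

lemma br_jacobi: "br x (br y z) = br (br x y) z + br y (br x z)"
proof -
  have "br x (br y z) + br y (br z x) + br z (br x y) = 0"
    using lie_alg unfolding lie_algebra_def by blast
  moreover have "br y (br z x) = - br y (br x z)" using br_anti[of z x] br_neg_right by simp
  moreover have "br z (br x y) = - br (br x y) z" by (rule br_anti)
  ultimately show ?thesis by (simp add: algebra_simps)
qed

lemma lin_br: "G.lin_on E (br x)"
  by (rule G.lin_on_linear[OF br_linear_right])

lemma form: "invariant_form scl br ifm"
  using datum by (simp add: lie_torus_datum_def)

lemma ifm_add_right: "ifm x (y + z) = ifm x y + ifm x z"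
  and ifm_scale_right: "ifm x (scl c y) = c * ifm x y"
  using form by (auto simp: invariant_form_def Vector_Spaces.linear_iff)

lemma ifm_sym: "ifm x y = ifm y x"
  using form unfolding invariant_form_def by (elim conjE allE)

lemma ifm_inv: "ifm (br x y) z = ifm x (br y z)"
  using form unfolding invariant_form_def by blast

lemma ifm_nondeg: "(\<And>y. ifm x y = 0) \<Longrightarrow> x = 0"
  using form by (simp add: invariant_form_def)

lemma ifm_add_left: "ifm (x + y) z = ifm x z + ifm y z"
  by (simp add: ifm_sym[of _ z] ifm_add_right)

lemma ifm_scale_left: "ifm (scl c x) z = c * ifm x z"
  by (simp add: ifm_sym[of _ z] ifm_scale_right)

lemma ifm_zero_right [simp]: "ifm x 0 = 0"
  using ifm_scale_right[of x 0 0] by simp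

lemma fin_dim: "\<exists>Bs. finite_dimensional_vector_space scl Bs"
  using datum by (simp add: lie_torus_datum_def)

lemma fdim_UNIV: "G.fdim UNIV"
proof -
  obtain Bs where "finite_dimensional_vector_space scl Bs" using fin_dim by blast
  then interpret F: finite_dimensional_vector_space scl Bs .
  show ?thesis unfolding G.fdim_def using F.finite_Basis F.span_Basis by auto
qed

lemma fdim_sub: "G.subspace E \<Longrightarrow> G.fdim E"
  using G.fdim_subset[OF fdim_UNIV] by simp

lemma simple_g: "simple_lie scl br UNIV"
  and simple_fix: "simple_lie scl br (gfix X)"
  using datum by (auto simp: lie_torus_datum_def)

lemma ideal_UNIV:
  assumes "G.subspace I" "\<And>x y. y \<in> I \<Longrightarrow> br x y \<in> I" "z \<in> I" "z \<noteq> 0"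
  shows "I = UNIV"
  using simple_g assms unfolding simple_lie_def by blast

lemma cartan: "cartan_subalgebra scl br (gfix X) H"
  using datum by (simp add: lie_torus_datum_def)

lemma H_subspace: "G.subspace H"
  and H_fix: "H \<subseteq> gfix X"
  and H_nilp: "\<exists>j. lower_central scl br H j = {0}"
  using cartan by (auto simp: cartan_subalgebra_def lie_subalgebra_def)

lemma H_closed: "x \<in> H \<Longrightarrow> y \<in> H \<Longrightarrow> br x y \<in> H"
  using cartan by (simp add: cartan_subalgebra_def lie_subalgebra_def)

lemma H_norm: "x \<in> gfix X \<Longrightarrow> (\<And>h. h \<in> H \<Longrightarrow> br x h \<in> H) \<Longrightarrow> x \<in> H"
  using cartan unfolding cartan_subalgebra_def by blast

lemma lc_in_H: "lower_central scl br H j \<subseteq> H"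
proof (induction j)
  case (Suc j)
  have "{br x y |x y. x \<in> H \<and> y \<in> lower_central scl br H j} \<subseteq> H" using Suc H_closed by blast
  then show ?case using G.span_minimal[OF _ H_subspace] by simp
qed simp

lemma lc_step: "h \<in> H \<Longrightarrow> y \<in> lower_central scl br H j \<Longrightarrow> br h y \<in> lower_central scl br H (Suc j)"
  by (auto intro: G.span_base)

subsection \<open>Weight vectors of the Cartan subalgebra\<close>

definition Hstable :: "'g set \<Rightarrow> bool" where
  "Hstable E \<longleftrightarrow> (\<forall>h\<in>H. \<forall>x\<in>E. br h x \<in> E)"

text \<open>The theorem of Lie for the nilpotent algebra H acting on E / F. On a stable E1 of
  minimal dimension every element of H is a scalar modulo F, by going up the lower central series
  from {0}: if all [h, y] are scalars, these scalars vanish by \<open>rel_comm\<close>, so an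
  eigenspace of y modulo F is H-stable and by minimality is all of E1.\<close>

lemma rel_joint_eigen:
  assumes "G.subspace E" "G.subspace F" "F \<subseteq> E" "Hstable E" "Hstable F" "x0 \<in> E" "x0 \<notin> F"
  shows "\<exists>x\<in>E. x \<notin> F \<and> (\<exists>l. \<forall>h\<in>H. br h x - scl (l h) x \<in> F)"
proof -
  let ?P = "\<lambda>E1. G.subspace E1 \<and> F \<subseteq> E1 \<and> E1 \<subseteq> E \<and> E1 \<noteq> F \<and> Hstable E1"
  have "?P E" using assms by blast
  then obtain E1 where E1: "?P E1" and min: "\<And>E2. ?P E2 \<Longrightarrow> G.dim E1 \<le> G.dim E2"
    using ex_has_least_nat[of ?P E G.dim] by blast
  obtain x1 where x1: "x1 \<in> E1" "x1 \<notin> F" using E1 by blast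
  obtain J where J: "lower_central scl br H J = {0}" using H_nilp by blast
  have st: "\<And>h. h \<in> H \<Longrightarrow> \<forall>x\<in>E1. br h x \<in> E1" "\<And>h. h \<in> H \<Longrightarrow> \<forall>x\<in>F. br h x \<in> F"
    using E1 assms(5) by (auto simp: Hstable_def)
  have "\<forall>y\<in>lower_central scl br H (J - d). \<exists>c. \<forall>x\<in>E1. br y x - scl c x \<in> F" if "d \<le> J" for d
    using that
  proof (induction d)
    case 0
    have "br 0 x - scl 0 x \<in> F" for x using G.subspace_0[OF assms(2)] by simp
    then show ?case using J by (simp del: G.scale_zero_left) blast
  next
    case (Suc d)
    let ?j = "J - Suc d"
    have j: "Suc ?j = J - d" using Suc.prems by simp
    show ?case
    proof
      fix y assume y: "y \<in> lower_central scl br H ?j"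
      then have yH: "y \<in> H" using lc_in_H by blast
      have c0: "br (br h y) x \<in> F" if h: "h \<in> H" and x: "x \<in> E1" for h x
      proof -
        have "br h y \<in> lower_central scl br H (J - d)" using lc_step[OF h y] j by simp
        then obtain c where c: "\<forall>x\<in>E1. br (br h y) x - scl c x \<in> F" using Suc by force
        have "c = 0"
        proof (rule G.rel_comm[OF fdim_sub assms(2)])
          show "G.subspace E1" "F \<subseteq> E1" using E1 by auto
          show "br h (br y x) - br y (br h x) - scl c x \<in> F" if "x \<in> E1" for x
            using c that br_jacobi[of h y x] by simp
        qed (use st h yH x1 lin_br in auto)
        then show ?thesis using c x by fastforce
      qed
      obtain v \<mu> where v: "v \<in> E1" "v \<notin> F" "br y v - scl \<mu> v \<in> F"
        using G.rel_eigen[OF fdim_sub assms(2) lin_br[of E1 y] st(1)[OF yH] x1] E1 by blast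
      define E2 where "E2 = {x \<in> E1. br y x - scl \<mu> x \<in> F}"
      have sub: "G.subspace E2"
      proof (rule G.subspaceI)
        show "0 \<in> E2" using E1 G.subspace_0[OF assms(2)] G.subspace_0 by (auto simp: E2_def)
        show "x + z \<in> E2" if "x \<in> E2" "z \<in> E2" for x z
        proof -
          have "br y (x + z) - scl \<mu> (x + z) = (br y x - scl \<mu> x) + (br y z - scl \<mu> z)"
            by (simp add: br_add_right G.scale_right_distrib)
          then show ?thesis using that E1 G.subspace_add[OF assms(2)] G.subspace_add[of E1] by (auto simp: E2_def)
        qed
        show "scl c x \<in> E2" if "x \<in> E2" for c x
        proof -
          have "br y (scl c x) - scl \<mu> (scl c x) = scl c (br y x - scl \<mu> x)"
            by (simp add: br_scale_right G.scale_right_diff_distrib mult.commute)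
          then show ?thesis using that E1 G.subspace_scale[OF assms(2)] G.subspace_scale[of E1] by (auto simp: E2_def)
        qed
      qed
      have "F \<subseteq> E2"
        using E1 st(2)[OF yH] G.subspace_diff[OF assms(2)] G.subspace_scale[OF assms(2)] by (auto simp: E2_def)
      have "Hstable E2"
        unfolding Hstable_def
      proof (intro ballI)
        fix h x assume h: "h \<in> H" and x: "x \<in> E2"
        have x1: "x \<in> E1" "br y x - scl \<mu> x \<in> F" using x by (auto simp: E2_def)
        have "br y (br h x) - scl \<mu> (br h x) = br h (br y x - scl \<mu> x) - br (br h y) x"
          using br_jacobi[of h y x] by (simp add: br_diff_right br_scale_right)
        moreover have "\<dots> \<in> F" using st(2)[OF h] x1 c0[OF h] G.subspace_diff[OF assms(2)] by blast
        ultimately show "br h x \<in> E2" using st(1)[OF h] x1 by (simp add: E2_def)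
      qed
      have "E2 \<subseteq> E1" by (auto simp: E2_def)
      have "?P E2" using sub \<open>F \<subseteq> E2\<close> \<open>Hstable E2\<close> \<open>E2 \<subseteq> E1\<close> v E1 by (auto simp: E2_def)
      then have "G.dim E1 \<le> G.dim E2" by (rule min)
      then have "E2 = E1"
        using G.fdim_dim_less[OF fdim_sub sub \<open>E2 \<subseteq> E1\<close>] E1 by fastforce
      then show "\<exists>c. \<forall>x\<in>E1. br y x - scl c x \<in> F" by (auto simp: E2_def)
    qed
  qed
  from this[of J] have "\<forall>y\<in>H. \<exists>c. \<forall>x\<in>E1. br y x - scl c x \<in> F" by simp
  then obtain l where "\<forall>y\<in>H. \<forall>x\<in>E1. br y x - scl (l y) x \<in> F" using bchoice by metis
  then show ?thesis using x1 E1 by blast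
qed

definition wvec :: "('g \<Rightarrow> complex) \<Rightarrow> 'g \<Rightarrow> bool" where
  "wvec l x \<longleftrightarrow> (\<forall>h\<in>H. br h x = scl (l h) x)"

lemma wvec_dual:
  assumes "wvec l x" "x \<noteq> 0"
  shows "(\<lambda>h. if h \<in> H then l h else 0) \<in> dual_space scl H"
proof -
  have add: "l (h + k) = l h + l k" if "h \<in> H" "k \<in> H" for h k
  proof -
    have "scl (l (h + k)) x = br (h + k) x" using assms(1) that G.subspace_add[OF H_subspace] by (simp add: wvec_def)
    also have "\<dots> = scl (l h + l k) x" using assms(1) that by (simp add: wvec_def br_add_left G.scale_left_distrib)
    finally show ?thesis using assms(2) by simp
  qed
  have scale: "l (scl c h) = c * l h" if "h \<in> H" for c h
  proof -
    have "scl (l (scl c h)) x = br (scl c h) x" using assms(1) that G.subspace_scale[OF H_subspace] by (simp add: wvec_def)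
    also have "\<dots> = scl (c * l h) x" using assms(1) that by (simp add: wvec_def br_scale_left)
    finally show ?thesis using assms(2) by simp
  qed
  show ?thesis
    using add scale G.subspace_add[OF H_subspace] G.subspace_scale[OF H_subspace]
    by (simp add: dual_space_def)
qed

lemma ad_nilpotent_H:
  assumes "h0 \<in> H"
  shows "\<exists>J. \<forall>h\<in>H. ((br h0) ^^ J) h = 0"
proof -
  obtain J where J: "lower_central scl br H J = {0}" using H_nilp by blast
  have "((br h0) ^^ j) h \<in> lower_central scl br H j" if "h \<in> H" for j h
  proof (induction j)
    case 0 then show ?case using that by simp
  next
    case (Suc j)
    then show ?case using lc_step[OF assms Suc] by simp
  qed
  then show ?thesis using J by (metis singletonD)
qed

text \<open>Again from the end of the lower central series upwards, with an inner induction on the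
  exponent: A (y x) = [h0, y] x + y (A x), where [h0, y] lies one term deeper and A x has smaller
  exponent.\<close>

lemma gen_eigenspace_Hstable:
  fixes \<mu> :: complex
  assumes "h0 \<in> H"
  defines "A \<equiv> \<lambda>x. br h0 x - scl \<mu> x"
  assumes "y \<in> H" "(A ^^ N) x = 0"
  shows "\<exists>N. (A ^^ N) (br y x) = 0"
proof -
  obtain J where J: "lower_central scl br H J = {0}" using H_nilp by blast
  have linA: "G.lin_on UNIV A"
    by (auto simp: G.lin_on_def A_def br_add_right br_scale_right algebra_simps)
  have A0: "(A ^^ n) 0 = 0" for n
    by (induction n) (auto simp: A_def)
  have sum: "\<exists>N. (A ^^ N) (u + v) = 0" if u: "(A ^^ m) u = 0" and v: "(A ^^ n) v = 0" for u v m n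
  proof -
    have l: "G.lin_on UNIV (A ^^ k)" for k by (rule G.lin_on_funpow[OF linA]) simp
    have "(A ^^ (m + n)) u = (A ^^ n) ((A ^^ m) u)" by (subst add.commute) (simp add: funpow_add)
    moreover have "(A ^^ (m + n)) v = (A ^^ m) ((A ^^ n) v)" by (simp add: funpow_add)
    ultimately have "(A ^^ (m + n)) (u + v) = 0"
      using G.lin_on_add[OF l] u v A0 by simp
    then show ?thesis by blast
  qed
  have "\<forall>y\<in>lower_central scl br H (J - d). \<forall>N x. (A ^^ N) x = 0 \<longrightarrow> (\<exists>N. (A ^^ N) (br y x) = 0)" if "d \<le> J" for d
    using that
  proof (induction d)
    case 0
    then show ?case using J A0 by auto
  next
    case (Suc d)
    let ?j = "J - Suc d"
    have j: "Suc ?j = J - d" using Suc.prems by simp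
    show ?case
    proof (intro ballI allI)
      fix y N x assume y: "y \<in> lower_central scl br H ?j"
      show "(A ^^ N) x = 0 \<longrightarrow> (\<exists>N. (A ^^ N) (br y x) = 0)"
      proof (induction N arbitrary: x)
        case 0
        then show ?case using A0[of 0] by (auto intro: exI[of _ 0])
      next
        case (Suc N)
        show ?case
        proof
          assume x: "(A ^^ Suc N) x = 0"
          have "br h0 y \<in> lower_central scl br H (J - d)" using lc_step[OF assms(1) y] j by simp
          then obtain N1 where 1: "(A ^^ N1) (br (br h0 y) x) = 0"
            using Suc.prems x \<open>Suc d \<le> J\<close> \<open>d \<le> J \<Longrightarrow> \<forall>y\<in>lower_central scl br H (J - d). \<forall>N x. (A ^^ N) x = 0 \<longrightarrow> (\<exists>N. (A ^^ N) (br y x) = 0)\<close>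
            by (meson Suc_leD)
          have "(A ^^ N) (A x) = 0" using x by (simp add: funpow_swap1)
          then obtain N2 where 2: "(A ^^ N2) (br y (A x)) = 0" using Suc.IH by blast
          have "A (br y x) = br (br h0 y) x + br y (A x)"
            using br_jacobi[of h0 y x] by (simp add: A_def br_diff_right br_scale_right)
          then obtain N3 where "(A ^^ N3) (A (br y x)) = 0" using sum[OF 1 2] by auto
          then have "(A ^^ Suc N3) (br y x) = 0" by (simp add: funpow_swap1)
          then show "\<exists>N. (A ^^ N) (br y x) = 0" by blast
        qed
      qed
    qed
  qed
  from this[of J] show ?thesis using assms(3,4) by simp
qed

text \<open>Every eigenvalue of a single \<open>h0\<close> is the value of a weight at
  \<open>h0\<close>: \<open>rel_joint_eigen\<close> is applied inside the generalized eigenspace, on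
  which the only possible value is \<mu>.\<close>

lemma joint_eigen_at:
  assumes "G.subspace E" "Hstable E" "h0 \<in> H" "x0 \<in> E" "x0 \<noteq> 0" "br h0 x0 = scl \<mu> x0"
  shows "\<exists>x\<in>E. x \<noteq> 0 \<and> (\<exists>l\<in>dual_space scl H. wvec l x \<and> l h0 = \<mu>)"
proof -
  define A where "A = (\<lambda>x. br h0 x - scl \<mu> x)"
  have linA: "G.lin_on UNIV A"
    by (auto simp: G.lin_on_def A_def br_add_right br_scale_right algebra_simps)
  have linN: "G.lin_on UNIV (A ^^ k)" for k by (rule G.lin_on_funpow[OF linA]) simp
  have A0: "(A ^^ n) 0 = 0" for n
    by (induction n) (auto simp: A_def)
  define E0 where "E0 = {x \<in> E. \<exists>N. (A ^^ N) x = 0}"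
  have sub: "G.subspace E0"
  proof (rule G.subspaceI)
    show "0 \<in> E0" using G.subspace_0[OF assms(1)] A0 by (auto simp: E0_def)
    show "x + y \<in> E0" if "x \<in> E0" "y \<in> E0" for x y
    proof -
      obtain m n where mn: "(A ^^ m) x = 0" "(A ^^ n) y = 0" using \<open>x \<in> E0\<close> \<open>y \<in> E0\<close> by (auto simp: E0_def)
      have "(A ^^ (m + n)) x = (A ^^ n) ((A ^^ m) x)" by (subst add.commute) (simp add: funpow_add)
      moreover have "(A ^^ (m + n)) y = (A ^^ m) ((A ^^ n) y)" by (simp add: funpow_add)
      ultimately have "(A ^^ (m + n)) (x + y) = 0" using mn A0 G.lin_on_add[OF linN] by simp
      then show ?thesis using that G.subspace_add[OF assms(1)] by (auto simp: E0_def)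
    qed
    show "scl c x \<in> E0" if "x \<in> E0" for c x
      using that G.subspace_scale[OF assms(1)] G.lin_on_scale[OF linN] by (fastforce simp: E0_def)
  qed
  have x0: "x0 \<in> E0"
    using assms(4,6) by (auto simp: E0_def A_def intro!: exI[of _ 1])
  have stab: "Hstable E0"
    unfolding Hstable_def
  proof (intro ballI)
    fix h x assume h: "h \<in> H" and x: "x \<in> E0"
    then obtain N where "(A ^^ N) x = 0" by (auto simp: E0_def)
    then have "\<exists>N. (A ^^ N) (br h x) = 0"
      unfolding A_def by (rule gen_eigenspace_Hstable[OF assms(3) h])
    then show "br h x \<in> E0" using x h assms(2) by (auto simp: E0_def Hstable_def)
  qed
  have s0: "Hstable {0}" by (simp add: Hstable_def)
  have "{0} \<subseteq> E0" using G.subspace_0[OF sub] by simp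
  from rel_joint_eigen[OF sub G.subspace_single_0 this stab s0 x0]
  obtain x l where xl: "x \<in> E0" "x \<noteq> 0" "\<forall>h\<in>H. br h x - scl (l h) x \<in> {0}"
    using assms(5) by auto
  then have wv: "wvec l x" by (simp add: wvec_def)
  obtain N where N: "(A ^^ N) x = 0" using xl by (auto simp: E0_def)
  have "(A ^^ N) x = scl ((l h0 - \<mu>) ^ N) x"
  proof (induction N)
    case (Suc N)
    have "A x = scl (l h0 - \<mu>) x" using wv assms(3) by (simp add: A_def wvec_def G.scale_left_diff_distrib)
    then show ?case using Suc G.lin_on_scale[OF linA] by (simp add: mult.commute)
  qed simp
  then have "l h0 = \<mu>" using N xl(2) by simp
  moreover have "wvec (\<lambda>h. if h \<in> H then l h else 0) x" using wv by (simp add: wvec_def)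
  ultimately show ?thesis
    using xl wvec_dual[OF wv xl(2)] assms(3) by (intro bexI[of _ x] conjI bexI[of _ "\<lambda>h. if h \<in> H then l h else 0"])
      (auto simp: E0_def)
qed

subsection \<open>The grading by the automorphisms\<close>

abbreviation "\<sigma> \<equiv> autom X"

lemma sigma_aut: "lie_automorphism scl br (\<sigma> i)"
  and sigma_order: "has_order (\<sigma> i) (period X i)"
  and xi_prim: "primitive_unity (period X i) (xi X i)"
  using datum by (auto simp: lie_torus_datum_def)

lemma sigma_comm: "\<sigma> i (\<sigma> j x) = \<sigma> j (\<sigma> i x)"
  using datum unfolding lie_torus_datum_def by (metis comp_apply)

lemma period_pos: "period X i > 0"
  using sigma_order by (auto simp: has_order_def)

lemma sigma_linear: "Vector_Spaces.linear scl scl (\<sigma> i)"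
  and sigma_br: "\<sigma> i (br x y) = br (\<sigma> i x) (\<sigma> i y)"
  and sigma_bij: "bij (\<sigma> i)"
  using sigma_aut by (auto simp: lie_automorphism_def)

lemma sigma_add: "\<sigma> i (x + y) = \<sigma> i x + \<sigma> i y"
  and sigma_scale: "\<sigma> i (scl c x) = scl c (\<sigma> i x)"
  using sigma_linear[of i] by (auto simp: Vector_Spaces.linear_iff)

lemma sigma_zero: "\<sigma> i 0 = 0"
  using sigma_scale[of i 0 0] by simp

lemma sigma_power: "(\<sigma> i ^^ period X i) x = x"
  using sigma_order[of i] by (simp add: has_order_def)

lemma xi_power: "xi X i ^ period X i = 1"
  using xi_prim[of i] by (simp add: primitive_unity_def)

lemma xi_nz: "xi X i \<noteq> 0"
  using xi_power[of i] period_pos[of i] by (metis power_0_left zero_neq_one not_gr_zero)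

lemma xi_powi_eq_1: "xi X i powi k = 1 \<longleftrightarrow> int (period X i) dvd k"
proof
  let ?m = "period X i"
  have split: "xi X i powi k = xi X i ^ nat (k mod ?m)"
  proof -
    have "xi X i powi k = xi X i powi (int ?m * (k div int ?m) + k mod int ?m)" by simp
    also have "\<dots> = xi X i powi (int ?m * (k div int ?m)) * xi X i powi (k mod int ?m)"
      by (rule power_int_add) (simp add: xi_nz)
    also have "xi X i powi (int ?m * (k div int ?m)) = 1"
      by (simp add: power_int_mult xi_power)
    finally show ?thesis using period_pos[of i] by (simp add: power_int_def)
  qed
  show "int ?m dvd k" if "xi X i powi k = 1"
  proof (rule ccontr)
    assume "\<not> int ?m dvd k"
    then have "k mod int ?m \<noteq> 0" by (simp add: dvd_eq_mod_eq_0)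
    moreover have "0 \<le> k mod int ?m" "k mod int ?m < int ?m"
      using period_pos[of i] by simp_all
    ultimately have 1: "0 < nat (k mod ?m)" "nat (k mod ?m) < ?m"
      by (simp_all add: nat_less_iff)
    have "xi X i ^ nat (k mod ?m) = 1" using that split by simp
    then show False using 1 xi_prim[of i] unfolding primitive_unity_def by blast
  qed
  show "xi X i powi k = 1" if "int ?m dvd k"
    using that split by (simp add: dvd_eq_mod_eq_0)
qed

text \<open>By counting: the first m powers of a primitive root are distinct, and there are only m
  solutions of z^m = 1.\<close>

lemma root_of_unity_xi:
  assumes "c ^ period X i = 1"
  shows "\<exists>k::nat. c = xi X i ^ k"
proof -
  let ?m = "period X i" and ?x = "xi X i"
  have inj: "inj_on (\<lambda>k. ?x ^ k) {..<?m}"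
  proof (rule linorder_inj_onI')
    fix a b assume ab: "a \<in> {..<?m}" "b \<in> {..<?m}" "a < b"
    show "?x ^ a \<noteq> ?x ^ b"
    proof
      assume "?x ^ a = ?x ^ b"
      moreover have "?x ^ b = ?x ^ a * ?x ^ (b - a)"
        using ab by (simp only: power_add[symmetric]) simp
      ultimately have "?x ^ a * ?x ^ (b - a) = ?x ^ a * 1" by simp
      then have "?x ^ (b - a) = 1" using xi_nz by simp
      moreover have "0 < b - a" "b - a < ?m" using ab by auto
      ultimately show False using xi_prim[of i] by (auto simp: primitive_unity_def)
    qed
  qed
  have "(\<lambda>k. ?x ^ k) ` {..<?m} = {z. z ^ ?m = 1}"
  proof (rule card_subset_eq)
    show "finite {z::complex. z ^ ?m = 1}" using period_pos[of i] by (intro finite_roots_unity) auto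
    show "(\<lambda>k. ?x ^ k) ` {..<?m} \<subseteq> {z. z ^ ?m = 1}"
      using xi_power[of i] by (auto simp: power_mult[symmetric] mult.commute[of _ ?m]) (simp add: power_mult)
    show "card ((\<lambda>k. ?x ^ k) ` {..<?m}) = card {z::complex. z ^ ?m = 1}"
      using inj period_pos[of i] by (simp add: card_image card_roots_unity_eq)
  qed
  then show ?thesis using assms by blast
qed

lemma gdeg_subspace: "G.subspace (gdeg X k)"
  by (auto simp: G.subspace_def gdeg_def sigma_add sigma_scale sigma_zero G.scale_right_distrib G.scale_left_commute)

lemma gdeg_br: "x \<in> gdeg X k \<Longrightarrow> y \<in> gdeg X l \<Longrightarrow> br x y \<in> gdeg X (k + l)"
  by (auto simp: gdeg_def sigma_br br_scale_left br_scale_right dcomp_add power_int_add xi_nz mult.commute)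

lemma gdeg_cong:
  assumes "\<And>i. int (period X i) dvd dcomp k i - dcomp l i"
  shows "gdeg X k = gdeg X l"
proof -
  have "xi X i powi dcomp k i = xi X i powi dcomp l i" for i
  proof -
    have "xi X i powi dcomp k i = xi X i powi (dcomp k i - dcomp l i) * xi X i powi dcomp l i"
      using xi_nz[of i] by (simp add: power_int_add[symmetric])
    then show ?thesis using xi_powi_eq_1[of i "dcomp k i - dcomp l i"] assms by simp
  qed
  then show ?thesis by (simp add: gdeg_def)
qed

lemma gdeg_add_lat: "r \<in> lat X \<Longrightarrow> gdeg X (k + r) = gdeg X k"
  by (rule gdeg_cong) (simp add: dcomp_add lat_def)

lemma gdeg_lat: "r \<in> lat X \<Longrightarrow> gdeg X r = gfix X"
  using gdeg_add_lat[of r 0] by simp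

lemma H_gdeg_stable: "Hstable (gdeg X k)"
  unfolding Hstable_def using gdeg_br[of _ 0 _ k] H_fix by auto

text \<open>An operator of finite order has no Jordan chains in characteristic 0, and its
  eigenvalues are powers of \<open>xi\<close>; the joint eigenspaces of the automorphisms are the
  \<open>gdeg X k\<close>.\<close>

lemma gdeg_decomp:
  assumes "G.subspace E" "\<And>i x. x \<in> E \<Longrightarrow> \<sigma> i x \<in> E"
  shows "E = G.span {x \<in> E. \<exists>k. x \<in> gdeg X k}"
proof -
  have "E = G.span {x \<in> E. \<forall>f\<in>range \<sigma>. \<exists>c. f x = scl c x}"
  proof (rule G.simultaneous_span[OF fdim_sub[OF assms(1)]])
    show "G.lin_on E f \<and> (\<forall>x\<in>E. f x \<in> E)" if "f \<in> range \<sigma>" for f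
      using that assms(2) G.lin_on_linear[OF sigma_linear] by auto
    show "f (g x) = g (f x)" if "f \<in> range \<sigma>" "g \<in> range \<sigma>" for f g x
      using that sigma_comm by auto
    fix f x y \<mu> assume f: "f \<in> range \<sigma>" and y: "y = f x - scl \<mu> x" "f y = scl \<mu> y"
    then obtain i where i: "f = \<sigma> i" by blast
    have fx: "f x = scl \<mu> x + y" using y by simp
    \<comment> \<open>The binomial formula for a chain of length two. At j = m, where f^m is the
      identity, it leaves m \<mu>^(m-1) y = 0.\<close>
    have pw: "(f ^^ j) x = scl (\<mu> ^ j) x + scl (of_nat j * \<mu> ^ (j - 1)) y" for j
    proof (induction j)
      case (Suc j)
      have "(f ^^ Suc j) x = scl (\<mu> ^ j) (scl \<mu> x + y) + scl (of_nat j * \<mu> ^ (j - 1)) (scl \<mu> y)"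
        using Suc fx y(2) by (simp add: i sigma_add sigma_scale)
      also have "\<dots> = scl (\<mu> ^ Suc j) x + scl (\<mu> ^ j + of_nat j * (\<mu> ^ (j - 1) * \<mu>)) y"
        by (simp add: algebra_simps)
      also have "of_nat j * (\<mu> ^ (j - 1) * \<mu>) = of_nat j * \<mu> ^ j" by (cases j) auto
      finally show ?case by (simp add: algebra_simps)
    qed simp
    have py: "(f ^^ j) y = scl (\<mu> ^ j) y" for j
      by (induction j) (auto simp: i sigma_scale y(2)[unfolded i] mult.commute)
    show "y = 0"
    proof (rule ccontr)
      assume "y \<noteq> 0"
      let ?m = "period X i"
      have "scl (\<mu> ^ ?m) y = scl 1 y" using py[of ?m] sigma_power[of i y] i by simp
      then have mu: "\<mu> ^ ?m = 1" using \<open>y \<noteq> 0\<close> G.scale_cancel_right by blast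
      have "x = scl (\<mu> ^ ?m) x + scl (of_nat ?m * \<mu> ^ (?m - 1)) y" using pw[of ?m] sigma_power[of i x] i by simp
      then have "scl (of_nat ?m * \<mu> ^ (?m - 1)) y = 0" using mu by simp
      moreover have "\<mu> \<noteq> 0" using mu period_pos[of i] by (metis power_0_left zero_neq_one not_gr_zero)
      ultimately show False using \<open>y \<noteq> 0\<close> period_pos[of i] by simp
    qed
  qed
  also have "\<dots> \<subseteq> G.span {x \<in> E. \<exists>k. x \<in> gdeg X k}"
  proof (rule G.span_mono, rule subsetI)
    fix x assume x: "x \<in> {x \<in> E. \<forall>f\<in>range \<sigma>. \<exists>c. f x = scl c x}"
    show "x \<in> {x \<in> E. \<exists>k. x \<in> gdeg X k}"
    proof (cases "x = 0")
      case True then show ?thesis using x G.subspace_0[OF gdeg_subspace] by blast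
    next
      case False
      have "\<exists>k::nat. \<sigma> i x = scl (xi X i ^ k) x" for i
      proof -
        obtain c where c: "\<sigma> i x = scl c x" using x by blast
        have "(\<sigma> i ^^ j) x = scl (c ^ j) x" for j
          by (induction j) (auto simp: sigma_scale c mult.commute)
        then have "scl (c ^ period X i) x = scl 1 x" using sigma_power[of i x] by simp
        then have "c ^ period X i = 1" using False G.scale_cancel_right by blast
        then show ?thesis using root_of_unity_xi c by blast
      qed
      then obtain k :: "'n option \<Rightarrow> nat" where k: "\<And>i. \<sigma> i x = scl (xi X i ^ k i) x" by metis
      have "dcomp (int (k None), \<chi> i. int (k (Some i))) i = int (k i)" for i by (cases i) auto
      then have "x \<in> gdeg X (int (k None), \<chi> i. int (k (Some i)))" using k by (simp add: gdeg_def)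
      then show ?thesis using x by blast
    qed
  qed
  finally show ?thesis
    using G.span_minimal[OF _ assms(1), of "{x \<in> E. \<exists>k. x \<in> gdeg X k}"] by auto
qed

subsection \<open>Roots\<close>

lemma base: "root_base X (rk X) (simple_root X)"
  and max_rt: "is_max_root X (max_root X)"
  using datum by (auto simp: lie_torus_datum_def)

lemma gfix_perfect: "gfix X = G.span {br x y |x y. x \<in> gfix X \<and> y \<in> gfix X}" (is "_ = G.span ?S")
proof -
  have sub: "G.span ?S \<subseteq> gfix X"
    by (rule G.span_minimal) (use gdeg_br[of _ 0 _ 0] gdeg_subspace in auto)
  have "\<forall>x\<in>gfix X. \<forall>y\<in>G.span ?S. br x y \<in> G.span ?S"
    using sub by (blast intro: G.span_base)
  then have "G.span ?S = {0} \<or> G.span ?S = gfix X"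
    using simple_fix sub G.subspace_span[of ?S] unfolding simple_lie_def by blast
  moreover have "G.span ?S \<noteq> {0}"
  proof -
    obtain x y where "x \<in> gfix X" "y \<in> gfix X" "br x y \<noteq> 0" using simple_fix unfolding simple_lie_def by blast
    moreover then have "br x y \<in> G.span ?S" by (blast intro: G.span_base)
    ultimately show ?thesis by blast
  qed
  ultimately show ?thesis by simp
qed

text \<open>H is nilpotent and the fixed point algebra is perfect, so they differ and there is a
  joint eigenvector modulo H. Its weight is not zero, as otherwise it would normalize H.\<close>

lemma roots_nonempty: "\<exists>l. l \<in> roots X"
proof -
  have "H \<noteq> gfix X"
  proof
    assume eq: "H = gfix X"
    have "lower_central scl br H j = gfix X" for j
      by (induction j) (use eq gfix_perfect in auto)
    then have "gfix X = {0}" using H_nilp by simp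
    moreover obtain x y where "x \<in> gfix X" "y \<in> gfix X" "br x y \<noteq> 0"
      using simple_fix unfolding simple_lie_def by blast
    ultimately show False by simp
  qed
  then obtain x0 where "x0 \<in> gfix X" "x0 \<notin> H" using H_fix by blast
  moreover have "Hstable H" using H_closed by (simp add: Hstable_def)
  ultimately obtain x l where x: "x \<in> gfix X" "x \<notin> H" "\<forall>h\<in>H. br h x - scl (l h) x \<in> H"
    using rel_joint_eigen[OF gdeg_subspace H_subspace H_fix H_gdeg_stable] by blast
  have "\<exists>h\<in>H. l h \<noteq> 0"
  proof (rule ccontr)
    assume "\<not> ?thesis"
    then have "\<forall>h\<in>H. br h x \<in> H" using x(3) by fastforce
    then have "\<And>h. h \<in> H \<Longrightarrow> br x h \<in> H" using br_anti G.subspace_neg[OF H_subspace] by metis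
    then show False using H_norm x by blast
  qed
  then obtain h0 where h0: "h0 \<in> H" "l h0 \<noteq> 0" by blast
  obtain J where J: "\<forall>h\<in>H. ((br h0) ^^ J) h = 0" using ad_nilpotent_H[OF h0(1)] by blast
  \<comment> \<open>ad h0 is nilpotent on H, so its J-th power kills the error term in H and turns
    the eigenvector modulo H into a true one.\<close>
  let ?A = "br h0" and ?x = "((br h0) ^^ J) x"
  have linJ: "G.lin_on UNIV (?A ^^ j)" for j by (rule G.lin_on_funpow[OF lin_br]) simp
  have "(?A ^^ J) (br h0 x - scl (l h0) x) = 0" using J x(3) h0 by blast
  then have "br h0 ?x = scl (l h0) ?x"
    using G.lin_on_diff[OF linJ G.subspace_UNIV] G.lin_on_scale[OF linJ]
    by (simp add: funpow_swap1)
  moreover have "(?A ^^ j) x - scl (l h0 ^ j) x \<in> H" for j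
  proof (induction j)
    case 0 then show ?case using G.subspace_0[OF H_subspace] by simp
  next
    case (Suc j)
    have "br h0 ((?A ^^ j) x - scl (l h0 ^ j) x) \<in> H" using Suc H_closed h0 by blast
    moreover have "scl (l h0 ^ j) (br h0 x - scl (l h0) x) \<in> H"
      using x(3) h0 G.subspace_scale[OF H_subspace] by blast
    ultimately have "br h0 ((?A ^^ j) x - scl (l h0 ^ j) x) + scl (l h0 ^ j) (br h0 x - scl (l h0) x) \<in> H"
      using G.subspace_add[OF H_subspace] by blast
    then show ?case by (simp add: br_diff_right br_scale_right G.scale_right_diff_distrib mult.commute)
  qed
  then have "?x \<noteq> 0"
  proof -
    have "?x - scl (l h0 ^ J) x \<in> H" by fact
    show "?x \<noteq> 0"
    proof
      assume "?x = 0"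
      then have "scl (l h0 ^ J) x \<in> H"
        using \<open>?x - scl (l h0 ^ J) x \<in> H\<close> G.subspace_neg[OF H_subspace] by fastforce
      then have "scl (1 / l h0 ^ J) (scl (l h0 ^ J) x) \<in> H" using G.subspace_scale[OF H_subspace] by blast
      then show False using h0 x by simp
    qed
  qed
  moreover have "?x \<in> gfix X"
  proof -
    have "\<forall>x\<in>gfix X. br h0 x \<in> gfix X" using H_gdeg_stable h0 by (auto simp: Hstable_def)
    then show ?thesis using G.maps_funpow x(1) by blast
  qed
  ultimately obtain y m where y: "y \<in> gfix X" "y \<noteq> 0" "m \<in> dual_space scl H" "wvec m y" "m h0 = l h0"
    using joint_eigen_at[OF gdeg_subspace H_gdeg_stable h0(1)] by blast
  have "m \<in> roots X"
    using y h0 by (auto simp: roots_def gwt_def wvec_def)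
  then show ?thesis by blast
qed

lemma rk_pos: "rk X \<ge> 1"
proof (rule ccontr)
  assume "\<not> rk X \<ge> 1"
  then have rk: "rk X = 0" by simp
  obtain l where l: "l \<in> roots X" using roots_nonempty by blast
  then have "nat_comb 0 (simple_root X) l \<or> nat_comb 0 (simple_root X) (\<lambda>h. - l h)"
    using base rk by (auto simp: root_base_def)
  then have "l = (\<lambda>_. 0)" by (auto simp: nat_comb_def fun_eq_iff)
  then show False using l by (simp add: roots_def)
qed

lemma simple_root_root: "i \<in> {1..rk X} \<Longrightarrow> simple_root X i \<in> roots X"
  using base by (auto simp: root_base_def)

lemma rho_check: "\<exists>h\<in>H. \<forall>i\<in>{1..rk X}. simple_root X i h = 1"
proof (rule G.dual_vectors[OF H_subspace])
  fix i assume "i \<in> {1..rk X}"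
  then have d: "simple_root X i \<in> dual_space scl H" using simple_root_root by (auto simp: roots_def)
  show "simple_root X i (x + y) = simple_root X i x + simple_root X i y" if "x \<in> H" "y \<in> H" for x y
    using d that by (simp add: dual_space_def)
  show "simple_root X i (scl c x) = c * simple_root X i x" if "x \<in> H" for c x
    using d that by (simp add: dual_space_def)
next
  show "\<forall>i\<in>{1..rk X}. c i = 0" if "\<forall>h\<in>H. (\<Sum>i=1..rk X. c i * simple_root X i h) = 0" for c
    using base that unfolding root_base_def by blast
qed

text \<open>The coweight \<rho>^\<or> of the fixed point algebra: its value at a root is the height.
  Integrality of heights serves twice, for the positivity of the trace form at \<open>h1\<close> and
  for the integral grading by levels.\<close>

definition h1 :: 'g where
  "h1 = (SOME h. h \<in> H \<and> (\<forall>i\<in>{1..rk X}. simple_root X i h = 1))"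

lemma h1_H: "h1 \<in> H"
  and h1_simple: "i \<in> {1..rk X} \<Longrightarrow> simple_root X i h1 = 1"
proof -
  have "h1 \<in> H \<and> (\<forall>i\<in>{1..rk X}. simple_root X i h1 = 1)"
    unfolding h1_def by (rule someI_ex) (use rho_check in blast)
  then show "h1 \<in> H" "i \<in> {1..rk X} \<Longrightarrow> simple_root X i h1 = 1" by auto
qed

abbreviation ncomb :: "('g \<Rightarrow> complex) \<Rightarrow> bool" where
  "ncomb \<equiv> nat_comb (rk X) (simple_root X)"

lemma ncomb_h1: "ncomb a \<Longrightarrow> \<exists>n::nat. a h1 = of_nat n \<and> (n = 0 \<longrightarrow> a = (\<lambda>_. 0))"
proof -
  assume "ncomb a"
  then obtain c :: "nat \<Rightarrow> nat" where c: "a = (\<lambda>h. \<Sum>i=1..rk X. of_nat (c i) * simple_root X i h)"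
    by (auto simp: nat_comb_def)
  have "a h1 = of_nat (\<Sum>i=1..rk X. c i)" unfolding c by (simp add: h1_simple)
  moreover have "a = (\<lambda>_. 0)" if "(\<Sum>i=1..rk X. c i) = 0"
    using that unfolding c by (simp add: fun_eq_iff)
  ultimately show ?thesis by (intro exI[of _ "\<Sum>i=1..rk X. c i"]) simp
qed

lemma ncomb_add: "ncomb a \<Longrightarrow> ncomb b \<Longrightarrow> ncomb (\<lambda>h. a h + b h)"
proof -
  assume "ncomb a" "ncomb b"
  then obtain c d :: "nat \<Rightarrow> nat" where
    "a = (\<lambda>h. \<Sum>i=1..rk X. of_nat (c i) * simple_root X i h)" "b = (\<lambda>h. \<Sum>i=1..rk X. of_nat (d i) * simple_root X i h)"
    by (auto simp: nat_comb_def)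
  then show ?thesis unfolding nat_comb_def
    by (intro exI[of _ "\<lambda>i. c i + d i"]) (simp add: algebra_simps sum.distrib fun_eq_iff)
qed

lemma ncomb_0: "ncomb (\<lambda>_. 0)"
  unfolding nat_comb_def by (intro exI[of _ "\<lambda>_. 0"]) simp

lemma ncomb_mult: "ncomb a \<Longrightarrow> ncomb (\<lambda>h. of_nat n * a h)"
proof (induction n)
  case 0 then show ?case using ncomb_0 by simp
next
  case (Suc n)
  then show ?case using ncomb_add[of "\<lambda>h. of_nat n * a h" a] by (simp add: algebra_simps)
qed

lemma roots_en_ncomb:
  assumes "a \<in> roots_en X"
  shows "ncomb a \<or> ncomb (\<lambda>h. - a h)"
proof -
  have r: "ncomb b \<or> ncomb (\<lambda>h. - b h)" if "b \<in> roots X" for b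
    using base that by (auto simp: root_base_def)
  consider "a = (\<lambda>_. 0)" | "a \<in> roots X" | b where "b \<in> roots X" "a = (\<lambda>h. 2 * b h)"
    using assms by (auto simp: roots_en_def short_root_def split: if_splits)
  then show ?thesis
  proof cases
    case 1 then show ?thesis using ncomb_0 by simp
  next
    case 2 then show ?thesis using r by blast
  next
    case 3
    then show ?thesis using r[OF 3(1)] ncomb_mult[of b 2] ncomb_mult[of "\<lambda>h. - b h" 2] by auto
  qed
qed

lemma roots_en_int:
  assumes "a \<in> roots_en X"
  shows "\<exists>n::int. a h1 = of_int n"
proof -
  consider n where "a h1 = of_nat n" | n where "- a h1 = of_nat n"
    using roots_en_ncomb[OF assms] ncomb_h1 by blast
  then show ?thesis
  proof cases
    case 1 then show ?thesis by (intro exI[of _ "int n"]) simp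
  next
    case 2 then show ?thesis by (intro exI[of _ "- int n"]) (simp add: minus_equation_iff)
  qed
qed

text \<open>In a lattice degree a non-zero weight is a root. Otherwise the Lie torus condition
  splits x = u + w with u in the trivial part; the action of H gives l(h) u in both summands, so u =
  0 when l \<noteq> 0, and x is a weight vector of the irreducible part.\<close>

lemma weight_roots_en:
  assumes "x \<in> gdeg X k" "x \<noteq> 0" "l \<in> dual_space scl H" "wvec l x"
  shows "l \<in> roots_en X"
proof (cases "l = (\<lambda>_. 0)")
  case True
  then show ?thesis by (simp add: roots_en_def)
next
  case l0: False
  show ?thesis
  proof (cases "k \<in> lat X")
    case True
    then have "x \<in> gwt X 0 l" using assms gdeg_lat by (auto simp: gwt_def wvec_def)
    then have "l \<in> roots X" using assms l0 by (auto simp: roots_def)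
    then show ?thesis by (simp add: roots_en_def)
  next
    case False
    then have "lie_torus_module X (gdeg X k)"
      using datum assms(1,2) unfolding lie_torus_datum_def by blast
    then obtain U W where UW0: "gfix_submodule X U \<and> gfix_submodule X W \<and>
     U \<inter> W = {0} \<and> {u + w | u w. u \<in> U \<and> w \<in> W} = gdeg X k \<and>
     (\<forall>x\<in>gfix X. \<forall>u\<in>U. br x u = 0) \<and>
     (W = {0} \<or> (G.dim W > 1 \<and>
        (\<forall>Z. gfix_submodule X Z \<and> Z \<subseteq> W \<longrightarrow> Z = {0} \<or> Z = W) \<and>
        (\<forall>\<mu>\<in>dual_space scl H.
           (\<exists>w\<in>W. w \<noteq> 0 \<and> (\<forall>h\<in>H. br h w = scl (\<mu> h) w)) \<longrightarrow> \<mu> \<in> roots_en X)))"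
      unfolding lie_torus_module_def by (elim exE) (rule that)
    then have UW: "gfix_submodule X W" "gfix_submodule X U" "U \<inter> W = {0}"
      "{u + w | u w. u \<in> U \<and> w \<in> W} = gdeg X k" "\<forall>x\<in>gfix X. \<forall>u\<in>U. br x u = 0"
      by simp_all
    have UW6: "W = {0} \<or> (\<forall>\<mu>\<in>dual_space scl H.
           (\<exists>w\<in>W. w \<noteq> 0 \<and> (\<forall>h\<in>H. br h w = scl (\<mu> h) w)) \<longrightarrow> \<mu> \<in> roots_en X)"
      using UW0 by (elim conjE disjE) simp_all
    have "x \<in> {u + w | u w. u \<in> U \<and> w \<in> W}" using UW(4) assms(1) by simp
    then obtain u w where uw: "u \<in> U" "w \<in> W" "x = u + w" by blast
    have sub: "G.subspace U" "G.subspace W" using UW by (auto simp: gfix_submodule_def)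
    have eq: "br h w = scl (l h) u + scl (l h) w" if "h \<in> H" for h
      using assms(4) that UW(5) uw H_fix by (simp add: wvec_def br_add_right G.scale_right_distrib subset_iff)
    have "\<exists>h0\<in>H. l h0 \<noteq> 0"
      using l0 assms(3) by (auto simp: dual_space_def fun_eq_iff)
    then obtain h0 where h0: "h0 \<in> H" "l h0 \<noteq> 0" by blast
    have u0: "scl (l h) u = 0" if h: "h \<in> H" for h
    proof -
      have "br h w \<in> W" using UW(1) h uw H_fix by (auto simp: gfix_submodule_def)
      then have "scl (l h) u \<in> W"
        using eq[OF h] G.subspace_diff[OF sub(2) _ G.subspace_scale[OF sub(2) uw(2)], of "br h w" "l h"] by simp
      moreover have "scl (l h) u \<in> U" using uw sub G.subspace_scale by blast
      ultimately show ?thesis using UW(3) by blast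
    qed
    from u0[OF h0(1)] h0(2) have "u = 0" by simp
    then have w: "w \<noteq> 0" "\<forall>h\<in>H. br h w = scl (l h) w" using uw assms(2) eq by auto
    then have "W \<noteq> {0}" using uw(2) by blast
    with UW6 have "\<forall>\<mu>\<in>dual_space scl H.
           (\<exists>w\<in>W. w \<noteq> 0 \<and> (\<forall>h\<in>H. br h w = scl (\<mu> h) w)) \<longrightarrow> \<mu> \<in> roots_en X" by simp
    from bspec[OF this assms(3)] show ?thesis using w uw(2) by blast
  qed
qed

lemma dcomp_zero: "dcomp 0 i = 0"
  by (cases i) (simp_all add: zero_prod_def)

text \<open>The eigenspace is stable under the automorphisms, which fix \<open>h1\<close>, so it
  contains a homogeneous eigenvector; then \<mu> is the value at \<open>h1\<close> of a weight in
  \<open>roots_en\<close>.\<close>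

lemma h1_eigen_int:
  assumes "x \<noteq> 0" "br h1 x = scl \<mu> x"
  shows "\<exists>n::int. \<mu> = of_int n"
proof -
  define E where "E = {x. br h1 x = scl \<mu> x}"
  have sub: "G.subspace E"
    by (auto simp: E_def G.subspace_def br_add_right br_scale_right G.scale_right_distrib G.scale_left_commute)
  have "\<sigma> i x \<in> E" if "x \<in> E" for i x
  proof -
    have "h1 \<in> gfix X" using h1_H H_fix by (rule subsetD[rotated])
    then have "\<sigma> i h1 = scl (xi X i powi dcomp 0 i) h1" by (simp add: gdeg_def)
    then have "\<sigma> i h1 = h1" by (simp add: dcomp_zero)
    then show ?thesis using that sigma_br[of i h1 x] by (simp add: E_def sigma_scale)
  qed
  then have "E = G.span {x \<in> E. \<exists>k. x \<in> gdeg X k}" by (rule gdeg_decomp[OF sub])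
  moreover have "x \<in> E" using assms by (simp add: E_def)
  ultimately have "\<exists>y\<in>E. y \<noteq> 0 \<and> (\<exists>k. y \<in> gdeg X k)"
  proof -
    assume *: "E = G.span {x \<in> E. \<exists>k. x \<in> gdeg X k}" "x \<in> E"
    show ?thesis
    proof (rule ccontr)
      assume "\<not> ?thesis"
      then have "{x \<in> E. \<exists>k. x \<in> gdeg X k} \<subseteq> {0}" by blast
      then have "G.span {x \<in> E. \<exists>k. x \<in> gdeg X k} \<subseteq> {0}" using G.span_minimal G.subspace_single_0 by blast
      then show False using * assms(1) by blast
    qed
  qed
  then obtain y k where y: "y \<noteq> 0" "y \<in> gdeg X k" "br h1 y = scl \<mu> y" by (auto simp: E_def)
  obtain z l where z: "z \<in> gdeg X k" "z \<noteq> 0" "l \<in> dual_space scl H" "wvec l z" "l h1 = \<mu>"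
    using joint_eigen_at[OF gdeg_subspace H_gdeg_stable h1_H y(2,1,3)] by blast
  then show ?thesis using roots_en_int[OF weight_roots_en] by blast
qed

subsection \<open>Invariance of the form under the automorphisms\<close>

text \<open>The trace form does not vanish on \<open>h1\<close>, hence is nondegenerate, hence a multiple of the given form.\<close>

lemma form_sigma: "ifm (\<sigma> i x) (\<sigma> i y) = ifm x y"
proof -
  obtain B0 where "finite_dimensional_vector_space scl B0" using fin_dim by blast
  then interpret F0: finite_dimensional_vector_space scl B0 .
  obtain bs d where bs: "distinct bs" "G.independent (set bs)" "G.span (set bs) = UNIV"
    "\<And>i. i < length bs \<Longrightarrow> br h1 (bs ! i) - scl (d i) (bs ! i) \<in> G.span (set (take i bs))"
    using G.flag_basis[OF F0.finite_Basis F0.span_Basis lin_br] by blast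
  let ?B = "set bs"
  define K where "K x y = G.tr ?B (\<lambda>z. br x (br y z))" for x y
  have trc: "G.tr ?B (\<lambda>x. f (g x)) = G.tr ?B (\<lambda>x. g (f x))" if "G.lin_on UNIV f" "G.lin_on UNIV g" for f g
    by (rule G.tr_commute) (use bs that in auto)
  have lbb: "G.lin_on UNIV (\<lambda>z. br x (br y z))" for x y
    by (auto simp: G.lin_on_def br_add_right br_scale_right)
  have Kadd: "K x (y + z) = K x y + K x z" for x y z
    unfolding K_def by (simp add: br_add_left br_add_right G.tr_add[OF bs(2,3)])
  have Kscale: "K x (scl c y) = c * K x y" for x y c
    unfolding K_def by (simp add: br_scale_left br_scale_right G.tr_scale[OF bs(2,3)])
  have Ksym: "K x y = K y x" for x y
    unfolding K_def by (rule trc[OF lin_br lin_br])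
  have Kinv: "K (br x y) z = K x (br y z)" for x y z
  proof -
    have "K (br x y) z = G.tr ?B (\<lambda>w. br x (br y (br z w)) - br y (br x (br z w)))"
      unfolding K_def by (intro arg_cong[of _ _ "G.tr ?B"] ext) (simp add: br_jacobi[of x y])
    also have "\<dots> = G.tr ?B (\<lambda>w. br x (br y (br z w))) - G.tr ?B (\<lambda>w. br y (br x (br z w)))"
      by (rule G.tr_diff[OF bs(2,3)])
    also have "G.tr ?B (\<lambda>w. br y (br x (br z w))) = G.tr ?B (\<lambda>w. br x (br z (br y w)))"
      by (rule trc[OF lin_br lbb])
    also have "G.tr ?B (\<lambda>w. br x (br y (br z w))) - \<dots> = G.tr ?B (\<lambda>w. br x (br y (br z w)) - br x (br z (br y w)))"
      by (rule G.tr_diff[OF bs(2,3), symmetric])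
    also have "\<dots> = K x (br y z)"
      unfolding K_def by (intro arg_cong[of _ _ "G.tr ?B"] ext) (simp add: br_jacobi[of y z] br_add_right)
    finally show ?thesis .
  qed
  have flag1: "G.tr ?B (\<lambda>x. br h1 (br h1 x)) = (\<Sum>i<length bs. d i ^ 2)"
    by (rule G.tr_square_flag(1)[OF lin_br bs(1,2,3)]) (rule bs(4))
  have flag2: "\<exists>x. x \<noteq> 0 \<and> br h1 x = scl (d i) x" if "i < length bs" for i
    by (rule G.tr_square_flag(2)[OF lin_br bs(1,2,3) _ that]) (rule bs(4))
  have flag3: "\<exists>i<length bs. d i = \<mu>" if "x \<noteq> 0" "br h1 x = scl \<mu> x" for x \<mu>
    by (rule G.tr_square_flag(3)[OF lin_br bs(1,2,3) _ that]) (rule bs(4))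
  \<comment> \<open>The trace of (ad h1)^2 is a sum of squares of integers, one of which is 1
    because of a simple root vector.\<close>
  have "K h1 h1 \<noteq> 0"
  proof -
    have "\<forall>i\<in>{..<length bs}. \<exists>n::int. d i = of_int n" using flag2 h1_eigen_int by blast
    then obtain n :: "nat \<Rightarrow> int" where n: "\<And>i. i < length bs \<Longrightarrow> d i = of_int (n i)"
      using bchoice[of "{..<length bs}" "\<lambda>i n. d i = of_int n"] by auto
    have "simple_root X 1 \<in> roots X" using simple_root_root rk_pos by simp
    then obtain x where x: "x \<in> gwt X 0 (simple_root X 1)" "x \<noteq> 0" by (auto simp: roots_def)
    then have "br h1 x = scl 1 x" using h1_H h1_simple[of 1] rk_pos by (simp add: gwt_def)
    then obtain j where j: "j < length bs" "d j = 1" using flag3[of x 1] x(2) by blast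
    have "K h1 h1 = of_int (\<Sum>i<length bs. n i ^ 2)"
      using flag1 by (simp add: K_def n)
    moreover have "n j ^ 2 \<le> (\<Sum>i<length bs. n i ^ 2)" by (rule member_le_sum) (use j in auto)
    moreover have "n j = 1" using n[OF j(1)] j(2) by simp
    ultimately have "(\<Sum>i<length bs. n i ^ 2) \<noteq> 0" by simp
    then have "complex_of_int (\<Sum>i<length bs. n i ^ 2) \<noteq> 0" by (simp only: of_int_eq_0_iff not_False_eq_True)
    then show ?thesis using \<open>K h1 h1 = of_int (\<Sum>i<length bs. n i ^ 2)\<close> by simp
  qed
  have Kadd': "K (x + y) z = K x z + K y z" "K (scl c x) z = c * K x z" for x y z c
    by (simp_all add: Ksym[of _ z] Kadd Kscale)
  have ideal: "{x. \<forall>y. f x y = 0} = UNIV"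
    if f: "\<And>x y z. f (x + y) z = f x z + f y z" "\<And>c x z. f (scl c x) z = c * f x z"
      "\<And>x y z. f (br x y) z = f x (br y z)" "\<And>y. f z y = 0" "z \<noteq> 0" for f :: "'g \<Rightarrow> 'g \<Rightarrow> complex" and z
  proof (rule ideal_UNIV)
    have "f 0 y = 0" for y using f(2)[of 0 0 y] by simp
    then show "G.subspace {x. \<forall>y. f x y = 0}"
      by (auto simp: G.subspace_def f(1,2))
    show "br x y \<in> {x. \<forall>y. f x y = 0}" if "y \<in> {x. \<forall>y. f x y = 0}" for x y
    proof -
      have "br x y = scl (-1) (br y x)" using br_anti[of x y] by simp
      have "f (br x y) z = 0" for z
        unfolding \<open>br x y = scl (-1) (br y x)\<close> f(2,3) using that by simp
      then show ?thesis by simp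
    qed
  qed (use f in auto)
  have Knd: "x = 0" if "\<And>y. K x y = 0" for x
  proof (rule ccontr)
    assume "x \<noteq> 0"
    then have "{x. \<forall>y. K x y = 0} = UNIV" using ideal[of K x] Kadd' Kinv that by blast
    then show False using \<open>K h1 h1 \<noteq> 0\<close> by blast
  qed
  \<comment> \<open>\<open>T f x\<close> records the functional f x by its values on the basis. Two
    bilinear forms thereby become two linear maps, and \<open>pencil\<close> finds a combination of
    the forms that is degenerate at some \<open>x0\<close>.\<close>
  define T where "T f x = (\<Sum>b\<in>?B. scl (f x b) b)" for f :: "'g \<Rightarrow> 'g \<Rightarrow> complex" and x
  have linT: "G.lin_on UNIV (T f)"
    if "\<And>x y z. f (x + y) z = f x z + f y z" "\<And>c x z. f (scl c x) z = c * f x z" for f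
    by (auto simp: G.lin_on_def T_def that G.scale_left_distrib sum.distrib G.scale_sum_right)
  have linTK: "Vector_Spaces.linear scl scl (T K)"
    using linT[of K, OF Kadd'] G.vector_space_axioms by (simp add: G.lin_on_def Vector_Spaces.linear_iff)
  have ext: "f x y = 0" if "\<And>b. b \<in> ?B \<Longrightarrow> f x b = 0"
    "\<And>x y z. f x (y + z) = f x y + f x z" "\<And>c x z. f x (scl c z) = c * f x z"
    for f :: "'g \<Rightarrow> 'g \<Rightarrow> complex" and x y
  proof -
    have "y \<in> G.span ?B" using bs by simp
    then show ?thesis
    proof (induction rule: G.span_induct_alt)
      case base
      show ?case using that(3)[of x 0 0] by simp
    next
      case (step c b z)
      then show ?case by (simp add: that)
    qed
  qed
  have T0: "f x b = 0" if "T f x = 0" "b \<in> ?B" for f x b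
    using G.independentD[OF bs(2), of ?B "f x" b] that by (simp add: T_def)
  have "inj (T K)"
    unfolding module_hom.inj_iff_eq_0[OF linear_iff_module_hom[THEN iffD1, OF linTK]]
  proof (intro allI impI)
    fix x assume "T K x = 0"
    then have "\<And>b. b \<in> ?B \<Longrightarrow> K x b = 0" by (rule T0)
    then have "K x y = 0" for y by (rule ext[of K x]) (simp_all add: Kadd Kscale)
    then show "x = 0" by (rule Knd)
  qed
  then have surj: "surj (T K)" by (rule F0.linear_inj_imp_surj[OF linTK])
  obtain x0 \<mu> where x0: "x0 \<noteq> 0" "T ifm x0 = scl \<mu> (T K x0)"
  proof -
    have "h1 \<noteq> 0" using h1_simple[of 1] rk_pos simple_root_root[of 1]
      by (auto simp: roots_def dual_space_def) (metis G.scale_zero_right G.subspace_0 H_subspace h1_H mult_zero_left zero_neq_one G.scale_zero_left)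
    then show thesis
      using G.pencil[OF fdim_UNIV linT[of ifm] linT[of K], of h1] surj that ifm_add_left ifm_scale_left Kadd' by auto
  qed
  define D where "D x y = ifm x y - \<mu> * K x y" for x y
  have Dp: "D (x + y) z = D x z + D y z" "D (scl c x) z = c * D x z" "D (br x y) z = D x (br y z)"
    "D x (y + z) = D x y + D x z" "D x (scl c z) = c * D x z" for x y z c
    by (simp_all add: D_def ifm_add_left ifm_scale_left ifm_add_right ifm_scale_right ifm_inv Kadd' Kinv Kadd Kscale algebra_simps)
  have "T D x0 = 0"
  proof -
    have "T D x0 = T ifm x0 - scl \<mu> (T K x0)"
      by (simp add: T_def D_def G.scale_left_diff_distrib sum_subtractf G.scale_sum_right)
    then show ?thesis using x0 by simp
  qed
  then have "\<And>b. b \<in> ?B \<Longrightarrow> D x0 b = 0" by (rule T0)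
  then have "\<And>y. D x0 y = 0" by (rule ext) (auto simp: Dp)
  \<comment> \<open>The radical of an invariant form is an ideal; this one contains
    \<open>x0 \<noteq> 0\<close>, so it is everything.\<close>
  then have "{x. \<forall>y. D x y = 0} = UNIV" using ideal[of D x0] Dp x0(1) by blast
  then have eq: "ifm x y = \<mu> * K x y" for x y by (auto simp: D_def)
  have "K (\<sigma> i x) (\<sigma> i y) = K x y"
  proof -
    let ?s = "inv_into UNIV (\<sigma> i)"
    have s: "\<sigma> i (?s z) = z" "?s (\<sigma> i z) = z" for z
      using sigma_bij[of i] by (auto simp: bij_def surj_f_inv_f)
    have ls: "G.lin_on UNIV (\<sigma> i)" by (rule G.lin_on_linear[OF sigma_linear])
    have li: "G.lin_on UNIV (\<lambda>z. br x (br y (?s z)))"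
    proof -
      have "?s (u + v) = ?s u + ?s v" for u v
        using s sigma_add by metis
      moreover have "?s (scl c u) = scl c (?s u)" for c u
        using s sigma_scale by metis
      ultimately show ?thesis by (auto simp: G.lin_on_def br_add_right br_scale_right)
    qed
    \<comment> \<open>ad (\<sigma> x) is the conjugate of ad x by \<sigma>, and traces do not change
      under conjugation.\<close>
    have "K (\<sigma> i x) (\<sigma> i y) = G.tr ?B (\<lambda>z. \<sigma> i (br x (br y (?s z))))"
      unfolding K_def by (simp add: sigma_br s)
    also have "\<dots> = G.tr ?B (\<lambda>z. br x (br y (?s (\<sigma> i z))))" by (rule trc[OF ls li])
    finally show ?thesis by (simp add: s K_def)
  qed
  then show ?thesis by (simp add: eq)
qed

text \<open>Invariance multiplies the value by a power of \<open>xi\<close> in each direction. The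
  lemma keeps the central term of a bracket of multiloop elements inside \<open>tor X\<close>, where
  only lattice degrees occur.\<close>

lemma form_lat:
  assumes "x \<in> gdeg X k" "y \<in> gdeg X l" "ifm x y \<noteq> 0"
  shows "k + l \<in> lat X"
proof -
  have "int (period X i) dvd dcomp (k + l) i" for i
  proof -
    have "ifm (\<sigma> i x) (\<sigma> i y) = xi X i powi dcomp (k + l) i * ifm x y"
      using assms(1,2) by (simp add: gdeg_def ifm_scale_left ifm_scale_right dcomp_add power_int_add xi_nz)
    then have "xi X i powi dcomp (k + l) i = 1" using assms(3) by (simp add: form_sigma)
    then show ?thesis by (simp add: xi_powi_eq_1)
  qed
  then show ?thesis by (simp add: lat_def)
qed

end

section \<open>Brackets of generators\<close>

lemma omega_rel_refl: "f = g \<Longrightarrow> omega_rel f g"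
  by (simp add: omega_rel_def exact_forms_zero)

lemma vector_space_omega_scale: "vector_space (omega_scale :: complex \<Rightarrow> 'n::finite omega \<Rightarrow> 'n omega)"
proof
  fix a b :: complex and x y :: "'n omega"
  show "omega_scale a (x + y) = omega_scale a x + omega_scale a y"
    by transfer (rule omega_rel_refl, rule symb.scale_right_distrib)
  show "omega_scale (a + b) x = omega_scale a x + omega_scale b x"
    by transfer (rule omega_rel_refl, rule symb.scale_left_distrib)
  show "omega_scale a (omega_scale b x) = omega_scale (a * b) x"
    by transfer (rule omega_rel_refl, rule symb.scale_scale)
  show "omega_scale 1 x = x"
    by transfer (rule omega_rel_refl, rule symb.scale_one)
qed

text \<open>A whole combination of the t^r K_i with coefficient vector w, because brackets produce
  combinations; the relations become \<open>tKw_cvec\<close>.\<close>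

definition tKw :: "complex ^ 'n option \<Rightarrow> 'n::finite deg \<Rightarrow> ('g::ab_group_add, 'n) tor" where
  "tKw w r = (0, abs_omega (Poly_Mapping.single r w), 0)"

lemma tK_tKw: "tK r i = tKw (axis i 1) r"
  by (simp add: tK_def tKw_def)

lemma tKw_add: "tKw (v + w) r = tKw v r + tKw w r"
  by (simp add: tKw_def single_add plus_omega.abs_eq)

lemma tKw_zero: "tKw 0 r = 0"
  by (simp add: tKw_def zero_prod_def zero_omega.abs_eq)

lemma tKw_cvec: "tKw (cvec r) r = 0"
proof -
  have "omega_rel (Poly_Mapping.single r (cvec r)) 0"
    unfolding omega_rel_def exact_forms_def diff_zero by (rule symb.span_base) blast
  then show ?thesis by (simp add: tKw_def zero_prod_def zero_omega.abs_eq omega.abs_eq_iff)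
qed

lemma tX_zero: "tX 0 k = 0"
  by (simp add: tX_def zero_prod_def)

lemma tD_zero: "tD 0 k = 0"
  by (simp add: tD_def zero_prod_def)

lemma tX_add: "tX (x + y) k = tX x k + tX y k"
  by (simp add: tX_def single_add)

lemma cvec_zero: "cvec 0 = 0"
proof -
  have "cvec (0 + 0 :: 'a deg) = cvec 0 + cvec 0" by (rule cvec_add)
  then show ?thesis by simp
qed

lemma dot_diff_left: "dot (u - v) w = dot u w - dot v w"
  by (simp add: dot_def algebra_simps sum_subtractf)

lemma dot_scale_left: "dot (c *s u) w = c * dot u w"
  by (simp add: dot_def sum_distrib_left mult_ac)

lemma dot_axis_left: "dot (axis i 1) w = w $ i"
  by (simp add: dot_def axis_def if_distrib[of "\<lambda>x. x * _"] cong: if_cong)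

lemma dot_axis_right: "dot w (axis i 1) = w $ i"
  by (simp add: dot_def axis_def if_distrib[of "\<lambda>x. _ * x"] cong: if_cong)

lemma tbracket_tD_tKw:
  "tbracket X (tD u p) (tKw w q) = tKw (dot u (cvec q) *s w + dot u w *s cvec p) (p + q)"
  by (simp add: tbracket_def tKw_def tD_def omega_act.abs_eq symb_act_def pm_bisum_single
        dot_zero_left dot_zero_right flip: zero_omega.abs_eq)

lemma tbracket_tKw_tKw: "tbracket X (tKw w p) (tKw v q) = 0"
  by (simp add: tbracket_def tKw_def zero_prod_def flip: zero_omega.abs_eq)

lemma tbracket_tKw_tX: "tbracket X (tKw w p) (tX y q) = 0"
  by (simp add: tbracket_def tKw_def tX_def zero_prod_def flip: zero_omega.abs_eq)

lemma tbracket_tD_tD':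
  "tbracket X (tD u p) (tD v q) =
    tD (dot u (cvec q) *s v - dot v (cvec p) *s u) (p + q) + tKw (cocycle X p u q v) (p + q)"
  unfolding tbracket_tD_tD by (simp add: tD_def tKw_def flip: zero_omega.abs_eq)

context lie_torus
begin

lemma vector_space_tscale: "vector_space (tscale X)"
proof -
  have "vector_space (pm_scale scl :: complex \<Rightarrow> ('n deg \<Rightarrow>\<^sub>0 'g) \<Rightarrow> _)"
    by (rule vector_space_pm_scale) (rule G.vector_space_axioms)
  note a = vector_space.vector_space_assms[OF this]
  note o = vector_space.vector_space_assms[OF vector_space_omega_scale]
  show ?thesis
    unfolding vector_space_def
    by (auto simp: tscale_def a o symb.scale_right_distrib symb.scale_left_distrib)
qed

sublocale T: vector_space "tscale X"
  by (rule vector_space_tscale)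

lemma tscale_tX: "tscale X c (tX x k) = tX (scl c x) k"
proof -
  have "pm_scale scl c (Poly_Mapping.single k x) = Poly_Mapping.single k (scl c x)"
    by (rule poly_mapping_eqI) (simp add: lookup_pm_scale lookup_single when_def)
  moreover have "omega_scale c 0 = 0" by transfer (simp add: omega_rel_def exact_forms_zero)
  ultimately show ?thesis by (simp add: tscale_def tX_def)
qed

lemma tscale_tD: "tscale X c (tD u k) = tD (c *s u) k"
proof -
  have "pm_scale scl c 0 = 0" by (rule poly_mapping_eqI) (simp add: lookup_pm_scale)
  moreover have "omega_scale c 0 = 0" by transfer (simp add: omega_rel_def exact_forms_zero)
  ultimately show ?thesis by (simp add: tscale_def tD_def symb_scale_single)
qed

lemma tscale_tKw: "tscale X c (tKw w r) = tKw (c *s w) r"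
proof -
  have "pm_scale scl c 0 = 0" by (rule poly_mapping_eqI) (simp add: lookup_pm_scale)
  then show ?thesis by (simp add: tscale_def tKw_def symb_scale_single omega_scale.abs_eq)
qed

lemma tX_in_tor: "x \<in> gdeg X k \<Longrightarrow> tX x k \<in> tor X"
  and tK_in_tor: "r \<in> lat X \<Longrightarrow> tK r i \<in> tor X"
  and tD_in_tor: "r \<in> lat X \<Longrightarrow> dot u (cvec r) = 0 \<Longrightarrow> tD u r \<in> tor X"
  unfolding tor_def by (blast intro: T.span_base)+

lemma tor_subspace: "T.subspace (tor X)"
  unfolding tor_def by (rule T.subspace_span)

lemma tKw_expand: "tKw w r = (\<Sum>i\<in>UNIV. tscale X (w $ i) (tK r i))"
proof -
  have sum: "tKw (\<Sum>i\<in>I. f i) r = (\<Sum>i\<in>I. tKw (f i) r)" if "finite I" for I :: "'n option set" and f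
    using that by (induction I rule: finite_induct) (simp_all add: tKw_zero tKw_add)
  have "w = (\<Sum>i\<in>UNIV. w $ i *s axis i 1)" by (simp add: basis_expansion)
  then have "tKw w r = tKw (\<Sum>i\<in>UNIV. w $ i *s axis i 1) r" by simp
  then show ?thesis by (simp add: sum tscale_tKw tK_tKw)
qed

lemma tKw_in_tor: "r \<in> lat X \<Longrightarrow> tKw w r \<in> tor X"
  unfolding tKw_expand
  by (intro T.subspace_sum[OF tor_subspace] T.subspace_scale[OF tor_subspace] tK_in_tor)

lemma tbracket_tX_tX':
  "tbracket X (tX x p) (tX y q) = tX (br x y) (p + q) + tKw (ifm x y *s cvec p) (p + q)"
  unfolding tbracket_tX_tX[OF lie_alg form] by (simp add: tX_def tKw_def flip: zero_omega.abs_eq)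

lemma pairing: "x \<noteq> 0 \<Longrightarrow> \<exists>l y. y \<in> gdeg X l \<and> ifm x y \<noteq> 0"
proof (rule ccontr)
  assume x: "x \<noteq> 0" and *: "\<nexists>l y. y \<in> gdeg X l \<and> ifm x y \<noteq> 0"
  have "ifm x y = 0" for y
  proof -
    have "UNIV = G.span {x \<in> UNIV. \<exists>k. x \<in> gdeg X k}" by (rule gdeg_decomp) auto
    then have "y \<in> G.span {x. \<exists>k. x \<in> gdeg X k}" by auto
    then show ?thesis
      by (induction rule: G.span_induct_alt) (use * in \<open>auto simp: ifm_add_right ifm_scale_right\<close>)
  qed
  then show False using ifm_nondeg x by blast
qed

lemma pairing_neg:
  assumes "x \<in> gdeg X k" "x \<noteq> 0"
  shows "\<exists>y\<in>gdeg X (- k). ifm x y \<noteq> 0"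
proof -
  obtain l y where y: "y \<in> gdeg X l" "ifm x y \<noteq> 0" using pairing assms by blast
  then have kl: "k + l \<in> lat X" using form_lat assms by blast
  have "gdeg X (- k + (k + l)) = gdeg X (- k)" by (rule gdeg_add_lat[OF kl])
  then show ?thesis using y by auto
qed

lemma h1_nz: "h1 \<noteq> 0"
proof
  assume "h1 = 0"
  have d: "simple_root X 1 \<in> dual_space scl H" using simple_root_root[of 1] rk_pos by (simp add: roots_def)
  have "simple_root X 1 (scl 0 h1) = 0 * simple_root X 1 h1"
    using d h1_H unfolding dual_space_def by blast
  then show False using h1_simple[of 1] rk_pos \<open>h1 = 0\<close> by simp
qed

lemma zero_lat: "0 \<in> lat X"
  by (simp add: lat_def dcomp_zero)

lemma lat_add: "r \<in> lat X \<Longrightarrow> s \<in> lat X \<Longrightarrow> r + s \<in> lat X"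
  by (simp add: lat_def dcomp_add)

lemma dcomp_neg: "dcomp (- k) i = - dcomp k i"
  using dcomp_add[of k "- k" i] by (simp add: dcomp_zero)

lemma lat_neg: "r \<in> lat X \<Longrightarrow> - r \<in> lat X"
  by (simp add: lat_def dcomp_neg)

lemma Gam_lat: "r \<in> Gam X \<longleftrightarrow> (0, r) \<in> lat X"
  by (simp add: Gam_def lat_def split_option_all)

lemma gfix_ideal:
  assumes "G.subspace I" "I \<subseteq> gfix X" "\<And>x y. x \<in> gfix X \<Longrightarrow> y \<in> I \<Longrightarrow> br x y \<in> I"
  shows "I = {0} \<or> I = gfix X"
  using simple_fix assms unfolding simple_lie_def by blast

lemma gfix_centre:
  assumes "u \<in> gfix X" "\<And>a. a \<in> gfix X \<Longrightarrow> br a u = 0"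
  shows "u = 0"
proof -
  define Z where "Z = {u \<in> gfix X. \<forall>a\<in>gfix X. br a u = 0}"
  have sub: "G.subspace Z"
    using gdeg_subspace[of 0] by (auto simp: Z_def G.subspace_def br_add_right br_scale_right)
  have "Z = {0} \<or> Z = gfix X"
  proof (rule gfix_ideal[OF sub])
    show "Z \<subseteq> gfix X" by (auto simp: Z_def)
    show "br x y \<in> Z" if "x \<in> gfix X" "y \<in> Z" for x y
      using that G.subspace_0[OF sub] by (auto simp: Z_def)
  qed
  moreover have "Z \<noteq> gfix X"
  proof -
    obtain x y where "x \<in> gfix X" "y \<in> gfix X" "br x y \<noteq> 0" using simple_fix unfolding simple_lie_def by blast
    then have "y \<notin> Z" by (auto simp: Z_def)
    then show ?thesis using \<open>y \<in> gfix X\<close> by blast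
  qed
  ultimately have "Z = {0}" by blast
  moreover have "u \<in> Z" using assms by (simp add: Z_def)
  ultimately show ?thesis by blast
qed

end

section \<open>The module\<close>

locale tor_rep = lie_torus X for X :: "('g::ab_group_add, 'n::finite) datum" +
  fixes sV :: "complex \<Rightarrow> 'v::ab_group_add \<Rightarrow> 'v"
    and \<rho> :: "('g, 'n) tor \<Rightarrow> 'v \<Rightarrow> 'v"
    and C0 :: int
  assumes card2: "CARD('n) \<ge> 2"
    and tmod: "tor_module X sV \<rho>"
    and irred: "irreducible_module X sV \<rho>"
    and integ: "integrable_module X sV \<rho>"
    and C0_pos: "C0 > 0"
    and K0: "\<And>v. \<rho> (tK 0 None) v = sV (of_int C0) v"
    and Ki: "\<And>i v. \<rho> (tK 0 (Some i)) v = 0"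
begin

sublocale V: cvs sV
  using tmod by (simp add: tor_module_def cvs_def)

lemma rho_linear: "x \<in> tor X \<Longrightarrow> Vector_Spaces.linear sV sV (\<rho> x)"
  using tmod by (simp add: tor_module_def)

lemma rho_lin_on: "x \<in> tor X \<Longrightarrow> V.lin_on E (\<rho> x)"
  by (rule V.lin_on_linear[OF rho_linear])

lemma rho_add: "x \<in> tor X \<Longrightarrow> y \<in> tor X \<Longrightarrow> \<rho> (x + y) v = \<rho> x v + \<rho> y v"
  using tmod by (simp add: tor_module_def)

lemma rho_scale: "x \<in> tor X \<Longrightarrow> \<rho> (tscale X c x) v = sV c (\<rho> x v)"
  using tmod by (simp add: tor_module_def)

lemma rho_br: "x \<in> tor X \<Longrightarrow> y \<in> tor X \<Longrightarrow> \<rho> (tbracket X x y) v = \<rho> x (\<rho> y v) - \<rho> y (\<rho> x v)"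
  using tmod by (simp add: tor_module_def)

lemma rho_zero: "\<rho> 0 v = 0"
  using rho_scale[of 0 0 v] T.subspace_0[OF tor_subspace] by simp

definition R :: "'g \<Rightarrow> 'n deg \<Rightarrow> 'v \<Rightarrow> 'v" where "R x k = \<rho> (tX x k)"
definition Kw :: "complex ^ 'n option \<Rightarrow> 'n deg \<Rightarrow> 'v \<Rightarrow> 'v" where "Kw w r = \<rho> (tKw w r)"
definition D :: "complex ^ 'n option \<Rightarrow> 'n deg \<Rightarrow> 'v \<Rightarrow> 'v" where "D u r = \<rho> (tD u r)"

definition dvalid :: "complex ^ 'n option \<Rightarrow> 'n deg \<Rightarrow> bool" where
  "dvalid u r \<longleftrightarrow> r \<in> lat X \<and> dot u (cvec r) = 0"

lemma R_lin: "x \<in> gdeg X k \<Longrightarrow> V.lin_on E (R x k)"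
  unfolding R_def by (rule rho_lin_on[OF tX_in_tor])

lemma Kw_lin: "r \<in> lat X \<Longrightarrow> V.lin_on E (Kw w r)"
  unfolding Kw_def by (rule rho_lin_on[OF tKw_in_tor])

lemma D_lin: "dvalid u r \<Longrightarrow> V.lin_on E (D u r)"
  unfolding D_def dvalid_def by (rule rho_lin_on) (simp add: tD_in_tor)

lemma R_zero: "R 0 k v = 0"
  by (simp add: R_def tX_zero rho_zero)

lemma R_add: "x \<in> gdeg X k \<Longrightarrow> y \<in> gdeg X k \<Longrightarrow> R (x + y) k v = R x k v + R y k v"
  by (simp add: R_def tX_add rho_add tX_in_tor)

lemma R_scale: "x \<in> gdeg X k \<Longrightarrow> R (scl c x) k v = sV c (R x k v)"
  by (simp add: R_def rho_scale tX_in_tor flip: tscale_tX)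

lemma Kw_zero: "Kw 0 r v = 0"
  by (simp add: Kw_def tKw_zero rho_zero)

lemma Kw_cvec: "Kw (cvec r) r v = 0"
  by (simp add: Kw_def tKw_cvec rho_zero)

lemma Kw_add: "r \<in> lat X \<Longrightarrow> Kw (w + w') r v = Kw w r v + Kw w' r v"
  by (simp add: Kw_def tKw_add rho_add tKw_in_tor)

lemma Kw_scale: "r \<in> lat X \<Longrightarrow> Kw (c *s w) r v = sV c (Kw w r v)"
  by (simp add: Kw_def rho_scale tKw_in_tor flip: tscale_tKw)

lemma Kw_sum: "r \<in> lat X \<Longrightarrow> finite I \<Longrightarrow> Kw (\<Sum>i\<in>I. f i) r v = (\<Sum>i\<in>I. Kw (f i) r v)"
proof -
  assume r: "r \<in> lat X" and I: "finite I"
  show ?thesis using I by (induction I rule: finite_induct) (simp_all add: Kw_zero Kw_add r)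
qed

lemma Kw_0: "Kw w 0 v = sV (w $ None * of_int C0) v"
proof -
  have "Kw w 0 v = Kw (\<Sum>i\<in>UNIV. w $ i *s axis i 1) 0 v" by (simp add: basis_expansion)
  also have "\<dots> = (\<Sum>i\<in>UNIV. sV (w $ i) (\<rho> (tK 0 i) v))"
    by (simp add: Kw_sum zero_lat Kw_scale) (simp add: Kw_def tK_tKw)
  also have "\<dots> = sV (w $ None) (\<rho> (tK 0 None) v) + (\<Sum>i\<in>UNIV - {None}. sV (w $ i) (\<rho> (tK 0 i) v))"
    by (rule sum.remove) auto
  also have "(\<Sum>i\<in>UNIV - {None}. sV (w $ i) (\<rho> (tK 0 i) v)) = 0"
    by (rule sum.neutral) (auto simp: Ki not_None_eq)
  finally show ?thesis by (simp add: K0)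
qed

lemma R_R:
  assumes "x \<in> gdeg X k" "y \<in> gdeg X l"
  shows "R x k (R y l v) - R y l (R x k v) = R (br x y) (k + l) v + Kw (ifm x y *s cvec k) (k + l) v"
proof -
  have "\<rho> (tbracket X (tX x k) (tX y l)) v = R (br x y) (k + l) v + Kw (ifm x y *s cvec k) (k + l) v"
  \<comment> \<open>Linearity of the action is available only inside \<open>tor X\<close>: either
    the central term is 0, or its degree lies in the lattice.\<close>
  proof (cases "ifm x y = 0")
    case True
    then show ?thesis by (simp add: tbracket_tX_tX' tKw_zero R_def Kw_zero)
  next
    case False
    then have "k + l \<in> lat X" using form_lat assms by blast
    then show ?thesis
      by (simp add: tbracket_tX_tX' rho_add tX_in_tor gdeg_br assms tKw_in_tor R_def Kw_def)
  qed
  then show ?thesis using rho_br[OF tX_in_tor[OF assms(1)] tX_in_tor[OF assms(2)], of v] by (simp add: R_def)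
qed

lemma D_R:
  assumes "dvalid u r" "x \<in> gdeg X k"
  shows "D u r (R x k v) - R x k (D u r v) = sV (dot u (cvec k)) (R x (r + k) v)"
proof -
  have x: "x \<in> gdeg X (r + k)" using assms gdeg_add_lat[of r k] by (simp add: dvalid_def add.commute)
  have "\<rho> (tbracket X (tD u r) (tX x k)) v = sV (dot u (cvec k)) (R x (r + k) v)"
    using R_scale[OF x] by (simp add: tbracket_tD_tX[OF lie_alg] R_def)
  then show ?thesis
    using rho_br[OF tD_in_tor tX_in_tor[OF assms(2)], of r u v] assms(1) by (simp add: R_def D_def dvalid_def)
qed

lemma D_K:
  assumes "dvalid u r" "s \<in> lat X"
  shows "D u r (Kw w s v) - Kw w s (D u r v) = Kw (dot u (cvec s) *s w + dot u w *s cvec r) (r + s) v"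
  using rho_br[OF tD_in_tor tKw_in_tor[OF assms(2)], of r u w v] assms(1)
  by (simp add: Kw_def D_def dvalid_def tbracket_tD_tKw)

lemma K_K: "r \<in> lat X \<Longrightarrow> s \<in> lat X \<Longrightarrow> Kw w r (Kw w' s v) = Kw w' s (Kw w r v)"
  using rho_br[OF tKw_in_tor tKw_in_tor, of r s w w' v] by (simp add: Kw_def tbracket_tKw_tKw rho_zero)

lemma K_R: "r \<in> lat X \<Longrightarrow> x \<in> gdeg X k \<Longrightarrow> Kw w r (R x k v) = R x k (Kw w r v)"
  using rho_br[OF tKw_in_tor tX_in_tor, of r x k w v] by (simp add: Kw_def R_def tbracket_tKw_tX rho_zero)

lemma D_D_valid:
  assumes "dvalid u r" "dvalid v s"
  shows "dvalid (dot u (cvec s) *s v - dot v (cvec r) *s u) (r + s)"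
proof -
  have "dot (dot u (cvec s) *s v - dot v (cvec r) *s u) (cvec (r + s)) = 0"
    using assms by (simp add: dvalid_def dot_diff_left dot_scale_left cvec_add dot_add_right)
  then show ?thesis using assms by (simp add: dvalid_def lat_add)
qed

lemma D_D:
  assumes "dvalid u r" "dvalid u' s"
  shows "D u r (D u' s v) - D u' s (D u r v) =
    D (dot u (cvec s) *s u' - dot u' (cvec r) *s u) (r + s) v + Kw (cocycle X r u s u') (r + s) v"
proof -
  have "tD (dot u (cvec s) *s u' - dot u' (cvec r) *s u) (r + s) \<in> tor X"
    using D_D_valid[OF assms] by (simp add: dvalid_def tD_in_tor)
  moreover have "r + s \<in> lat X" using assms by (simp add: dvalid_def lat_add)
  ultimately show ?thesis
    using rho_br[OF tD_in_tor tD_in_tor, of r u s u' v] assms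
    by (simp add: D_def Kw_def dvalid_def tbracket_tD_tD' rho_add tKw_in_tor)
qed

subsection \<open>Weights of the module\<close>

lemma HH_tor: "HH X \<subseteq> tor X"
  unfolding HH_def
proof (rule T.span_minimal[OF _ tor_subspace])
  have "range td \<subseteq> tor X"
    by (auto intro!: tD_in_tor zero_lat simp: cvec_zero dot_zero_right)
  moreover have "range (tK 0) \<subseteq> tor X" by (auto intro!: tK_in_tor zero_lat)
  moreover have "{tX h 0 |h. h \<in> H} \<subseteq> tor X" using H_fix by (auto intro!: tX_in_tor)
  ultimately show "{tX h 0 |h. h \<in> H} \<union> range (tK 0) \<union> range td \<subseteq> tor X" by blast
qed

lemma tX_HH: "h \<in> H \<Longrightarrow> tX h 0 \<in> HH X"
  and td_HH: "td i \<in> HH X"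
  unfolding HH_def by (blast intro: T.span_base)+

abbreviation "duals \<equiv> dual_space (tscale X) (HH X)"
abbreviation "wsp \<equiv> weight_space X sV \<rho>"

lemma wsp_subspace: "V.subspace (wsp L)"
proof (rule V.subspaceI)
  have l: "V.lin_on UNIV (\<rho> h)" if "h \<in> HH X" for h using that HH_tor by (intro rho_lin_on) blast
  show "0 \<in> wsp L" using V.lin_on_zero[OF l V.subspace_UNIV] by (simp add: weight_space_def)
  show "x + y \<in> wsp L" if "x \<in> wsp L" "y \<in> wsp L" for x y
    using that V.lin_on_add[OF l] by (simp add: weight_space_def V.scale_right_distrib)
  show "sV c x \<in> wsp L" if "x \<in> wsp L" for c x
    using that V.lin_on_scale[OF l] by (simp add: weight_space_def mult.commute)
qed

lemma direct: "is_direct_sum duals wsp"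
  and wsp_finite: "L \<in> duals \<Longrightarrow> \<exists>B. finite B \<and> V.span B = wsp L"
  using integ by (auto simp: integrable_module_def)

lemma decomp:
  "\<exists>c. (\<forall>L\<in>duals. c L \<in> wsp L) \<and> (\<forall>L. L \<notin> duals \<longrightarrow> c L = 0) \<and>
     finite {L. c L \<noteq> 0} \<and> v = (\<Sum>L | c L \<noteq> 0. c L)"
  using direct unfolding is_direct_sum_def by blast

lemma decomp_zero:
  assumes "\<And>L. L \<in> duals \<Longrightarrow> c L \<in> wsp L" "\<And>L. L \<notin> duals \<Longrightarrow> c L = 0"
    "finite S" "\<And>L. L \<notin> S \<Longrightarrow> c L = 0" "(\<Sum>L\<in>S. c L) = 0"
  shows "c L = 0"
proof -
  let ?P = "\<lambda>c. (\<forall>L\<in>duals. c L \<in> wsp L) \<and> (\<forall>L. L \<notin> duals \<longrightarrow> c L = 0) \<and>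
     finite {L. c L \<noteq> 0} \<and> 0 = (\<Sum>L | c L \<noteq> 0. c L)"
  have ex: "\<exists>!c. ?P c" using direct unfolding is_direct_sum_def by (rule spec)
  have sub: "{L. c L \<noteq> 0} \<subseteq> S" using assms(4) by blast
  have "(\<Sum>L | c L \<noteq> 0. c L) = (\<Sum>L\<in>S. c L)"
    by (rule sum.mono_neutral_left[OF assms(3) sub]) simp
  then have "?P c" using assms(1,2,5) finite_subset[OF sub assms(3)] by simp
  then have 1: "(THE c. ?P c) = c" by (rule the1_equality[OF ex])
  have "?P (\<lambda>_. 0)" using V.subspace_0[OF wsp_subspace] by simp
  then have 2: "(THE c. ?P c) = (\<lambda>_. 0)" by (rule the1_equality[OF ex])
  have "c = (\<lambda>_. 0)" by (rule trans[OF 1[symmetric] 2])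
  then show ?thesis by simp
qed

lemma zero_on_weights:
  assumes "V.lin_on UNIV f" "\<And>L v. L \<in> duals \<Longrightarrow> v \<in> wsp L \<Longrightarrow> f v = 0"
  shows "f v = 0"
proof -
  obtain c where c: "\<forall>L\<in>duals. c L \<in> wsp L" "\<forall>L. L \<notin> duals \<longrightarrow> c L = 0"
     "finite {L. c L \<noteq> 0}" "v = (\<Sum>L | c L \<noteq> 0. c L)" using decomp by blast
  have "f v = (\<Sum>L | c L \<noteq> 0. f (c L))"
    unfolding c(4) by (rule V.lin_on_sum[OF assms(1) V.subspace_UNIV c(3)]) simp
  also have "\<dots> = 0" using c(1,2) assms(2) by (intro sum.neutral) blast
  finally show ?thesis .
qed

text \<open>V is a sum of weight spaces, so elements of \<open>HH X\<close> act without Jordan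
  chains: in each weight component (L t - \<mu>)^2 = 0 gives L t = \<mu>.\<close>

lemma V_semisimple:
  assumes "t \<in> HH X" "y = \<rho> t w - sV \<mu> w" "\<rho> t y = sV \<mu> y"
  shows "y = 0"
proof -
  have l: "V.lin_on UNIV (\<rho> t)" using assms(1) HH_tor by (intro rho_lin_on) blast
  obtain c where c: "\<forall>L\<in>duals. c L \<in> wsp L" "\<forall>L. L \<notin> duals \<longrightarrow> c L = 0"
     "finite {L. c L \<noteq> 0}" "w = (\<Sum>L | c L \<noteq> 0. c L)" using decomp by blast
  have tc: "\<rho> t (c L) = sV (L t) (c L)" for L
    using c(1,2) assms(1) V.lin_on_zero[OF l V.subspace_UNIV] by (cases "L \<in> duals") (auto simp: weight_space_def)
  let ?S = "{L. c L \<noteq> 0}"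
  have y: "y = (\<Sum>L\<in>?S. sV (L t - \<mu>) (c L))"
    unfolding assms(2) c(4)
    by (simp add: V.lin_on_sum[OF l V.subspace_UNIV c(3)] tc V.scale_left_diff_distrib sum_subtractf V.scale_sum_right)
  have "0 = \<rho> t y - sV \<mu> y" using assms(3) by simp
  also have "\<rho> t y = (\<Sum>L\<in>?S. sV ((L t - \<mu>) * L t) (c L))"
    unfolding y by (simp add: V.lin_on_sum[OF l V.subspace_UNIV c(3)] tc V.lin_on_scale[OF l])
  also have "sV \<mu> y = (\<Sum>L\<in>?S. sV (\<mu> * (L t - \<mu>)) (c L))"
    unfolding y by (simp add: V.scale_sum_right)
  also have "(\<Sum>L\<in>?S. sV ((L t - \<mu>) * L t) (c L)) - (\<Sum>L\<in>?S. sV (\<mu> * (L t - \<mu>)) (c L)) =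
      (\<Sum>L\<in>?S. sV ((L t - \<mu>) * (L t - \<mu>)) (c L))"
    unfolding sum_subtractf[symmetric] V.scale_left_diff_distrib[symmetric]
    by (intro sum.cong refl arg_cong2[of _ _ _ _ sV]) (simp add: algebra_simps)
  finally have z: "(\<Sum>L\<in>?S. sV ((L t - \<mu>) * (L t - \<mu>)) (c L)) = 0" by simp
  have z2: "sV ((L t - \<mu>) * (L t - \<mu>)) (c L) = 0" for L
    by (rule decomp_zero[where c = "\<lambda>L. sV ((L t - \<mu>) * (L t - \<mu>)) (c L)" and S = ?S])
      (use c z V.subspace_scale[OF wsp_subspace] in auto)
  have "sV (L t - \<mu>) (c L) = 0" for L using z2[of L] by auto
  then show ?thesis unfolding y by (intro sum.neutral) blast
qed

subsection \<open>Faithfulness of the multiloop part\<close>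

lemma ex_nz: "\<exists>v::'v. v \<noteq> 0"
  using irred by (simp add: irreducible_module_def)

abbreviation "m0 \<equiv> int (period X None)"

lemma m0_lat: "(m0, 0) \<in> lat X"
  by (simp add: lat_def split_option_all)

lemma m0_pos: "m0 > 0"
  using period_pos by simp

lemma cvec_None: "cvec k $ None = of_int (fst k)"
  by (cases k) (simp add: cvec_def)

lemma cvec_Some: "cvec k $ Some i = of_int (snd k $ i)"
  by (cases k) (simp add: cvec_def)

lemma gfix_pair: "\<exists>x\<in>gfix X. \<exists>y\<in>gfix X. ifm x y \<noteq> 0"
proof -
  have "h1 \<in> gfix X" using h1_H H_fix by blast
  then obtain y where "y \<in> gdeg X (- 0)" "ifm h1 y \<noteq> 0" using pairing_neg h1_nz by blast
  then show ?thesis using \<open>h1 \<in> gfix X\<close> by auto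
qed

lemma R_R0:
  assumes "a \<in> gfix X" "x \<in> gdeg X k"
  shows "R a 0 (R x k v) - R x k (R a 0 v) = R (br a x) k v"
  using R_R[OF assms, of v] by (simp add: cvec_zero Kw_zero)

text \<open>The kernel is an ideal of the simple algebra \<open>gfix X\<close>. Were it everything,
  perfectness would make gfix act by 0 in all lattice degrees, while the bracket of degrees (m0, 0)
  and (-m0, 0) contains a non-zero multiple of K_0.\<close>

lemma faithful0:
  assumes "x \<in> gfix X" "\<And>v. R x 0 v = 0"
  shows "x = 0"
proof -
  define Z where "Z = {x \<in> gfix X. \<forall>v. R x 0 v = 0}"
  have sub: "G.subspace Z"
    using gdeg_subspace[of 0] by (auto simp: Z_def G.subspace_def R_zero R_add R_scale)
  have "Z = {0} \<or> Z = gfix X"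
  proof (rule gfix_ideal[OF sub])
    show "Z \<subseteq> gfix X" by (auto simp: Z_def)
    show "br a y \<in> Z" if a: "a \<in> gfix X" and y: "y \<in> Z" for a y
    proof -
      have y': "y \<in> gfix X" "\<And>v. R y 0 v = 0" using y by (auto simp: Z_def)
      have "R (br a y) 0 v = R a 0 0" for v using R_R0[OF a y'(1), of v] by (simp add: y'(2))
      moreover have "R a 0 0 = 0" by (rule V.lin_on_zero[OF R_lin[OF a] V.subspace_UNIV])
      ultimately show ?thesis using gdeg_br[OF a y'(1)] by (simp add: Z_def)
    qed
  qed
  moreover have "Z \<noteq> gfix X"
  proof
    assume Z: "Z = gfix X"
    have z: "R x g v = 0" if x: "x \<in> gfix X" and g: "g \<in> lat X" for x g v
    proof -
      have "R x g v = 0 \<and> x \<in> gfix X" if "x \<in> G.span {br x y |x y. x \<in> gfix X \<and> y \<in> gfix X}" for x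
        using that
      proof (induction rule: G.span_induct_alt)
        case base
        then show ?case using G.subspace_0[OF gdeg_subspace] by (simp add: R_zero)
      next
        case (step c x y)
        then obtain a b where ab: "x = br a b" "a \<in> gfix X" "b \<in> gfix X" by blast
        have bg: "b \<in> gdeg X g" using ab gdeg_lat[OF g] by simp
        have R0: "R a 0 w = 0" for w using ab Z by (auto simp: Z_def)
        have "R x g v = 0"
          using R_R0[OF ab(2) bg, of v] V.lin_on_zero[OF R_lin[OF bg] V.subspace_UNIV] by (simp add: R0 ab)
        moreover have "x \<in> gfix X" using gdeg_br[OF ab(2,3)] ab by simp
        ultimately show ?case
          using step G.subspace_add[OF gdeg_subspace] G.subspace_scale[OF gdeg_subspace]
          by (simp add: R_add R_scale gdeg_lat[OF g])
      qed
      then show ?thesis using gfix_perfect x by blast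
    qed
    obtain x y where xy: "x \<in> gfix X" "y \<in> gfix X" "ifm x y \<noteq> 0" using gfix_pair by blast
    obtain v :: 'v where v: "v \<noteq> 0" using ex_nz by blast
    let ?g = "(m0, 0) :: 'n deg"
    have gg: "x \<in> gdeg X ?g" "y \<in> gdeg X (- ?g)"
      by (simp_all only: gdeg_lat[OF m0_lat] gdeg_lat[OF lat_neg[OF m0_lat]] xy)
    have "R (br x y) (?g + - ?g) v + Kw (ifm x y *s cvec ?g) (?g + - ?g) v = 0"
      unfolding R_R[OF gg, symmetric] z[OF xy(1) m0_lat] z[OF xy(2) lat_neg[OF m0_lat]] by (rule diff_self)
    then have "R (br x y) 0 v + Kw (ifm x y *s cvec ?g) 0 v = 0"
      by (simp only: right_minus)
    moreover have "R (br x y) 0 v = 0" using z[OF _ zero_lat] gdeg_br[OF xy(1,2)] by simp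
    ultimately have "Kw (ifm x y *s cvec ?g) 0 v = 0" by simp
    then show False using xy v C0_pos m0_pos by (simp add: Kw_0 cvec_None)
  qed
  ultimately have "Z = {0}" by blast
  moreover have "x \<in> Z" using assms by (simp add: Z_def)
  ultimately show ?thesis by blast
qed

text \<open>Let y pair with x in degree -k. If x acts by 0, then [x, y] acts as the scalar - (x|y)
  k_0 C_0, hence is central in \<open>gfix X\<close> by \<open>faithful0\<close> and so is 0; but
  the scalar is not 0.\<close>

lemma faithful_nz:
  assumes "x \<in> gdeg X k" "\<And>v. R x k v = 0" "fst k \<noteq> 0"
  shows "x = 0"
proof (rule ccontr)
  assume "x \<noteq> 0"
  then obtain y where y: "y \<in> gdeg X (- k)" "ifm x y \<noteq> 0" using pairing_neg assms(1) by blast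
  have u: "br x y \<in> gfix X" using gdeg_br[OF assms(1) y(1)] by simp
  let ?c = "ifm x y * of_int (fst k) * of_int C0"
  have Ru: "R (br x y) 0 v = sV (- ?c) v" for v
  proof -
    have "R (br x y) 0 v + Kw (ifm x y *s cvec k) 0 v = 0"
      using R_R[OF assms(1) y(1), of v] V.lin_on_zero[OF R_lin[OF y(1)] V.subspace_UNIV] by (simp add: assms(2))
    then show ?thesis by (simp add: Kw_0 cvec_None eq_neg_iff_add_eq_0)
  qed
  have "br a (br x y) = 0" if a: "a \<in> gfix X" for a
  proof (rule faithful0)
    show "br a (br x y) \<in> gfix X" using gdeg_br[OF a u] by simp
    show "R (br a (br x y)) 0 v = 0" for v
      using R_R0[OF a u, of v] V.lin_on_scale[OF R_lin[OF a], of v UNIV "- ?c"] by (simp add: Ru)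
  qed
  then have "br x y = 0" using gfix_centre u by blast
  moreover obtain v :: 'v where "v \<noteq> 0" using ex_nz by blast
  ultimately have "- ?c = 0" using Ru[of v] by (simp add: R_zero)
  then show False using y assms(3) C0_pos by simp
qed

text \<open>Faithfulness transfers the diagonalizability of \<open>HH X\<close> on V to the adjoint
  action of the Cartan subalgebra on g.\<close>

lemma faithful:
  assumes x: "x \<in> gdeg X k" and z: "\<And>v. R x k v = 0"
  shows "x = 0"
proof (cases "fst k = 0")
  case False
  then show ?thesis using faithful_nz assms by blast
next
  case k0: True
  show ?thesis
  proof (cases "snd k = 0")
    case True
    then have "k = 0" using k0 by (cases k) (simp add: zero_prod_def)
    then show ?thesis using faithful0 assms by blast
  next
    case False
    then obtain i where i: "snd k $ i \<noteq> 0" by (auto simp: vec_eq_iff)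
    let ?g = "(m0, 0) :: 'n deg" and ?u = "axis (Some i) 1 :: complex ^ 'n option"
    \<comment> \<open>The field t_0^m0 d_i with i >= 1 is divergence-free and moves x, with factor
      k_i, to a degree whose component 0 is not zero.\<close>
    have dv: "dvalid ?u ?g" using m0_lat by (simp add: dvalid_def dot_axis_left cvec_Some)
    have xg: "x \<in> gdeg X (?g + k)" using gdeg_add_lat[OF m0_lat, of k] x by (simp add: add.commute)
    have "R x (?g + k) v = 0" for v
    proof -
      have "sV (dot ?u (cvec k)) (R x (?g + k) v) = 0"
        using D_R[OF dv x, of v] V.lin_on_zero[OF D_lin[OF dv] V.subspace_UNIV] by (simp add: z)
      then show ?thesis using i by (simp add: dot_axis_left cvec_Some)
    qed
    moreover have "fst (?g + k) \<noteq> 0" using k0 m0_pos by simp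
    ultimately show ?thesis using faithful_nz[OF xg] by blast
  qed
qed

text \<open>Elements of H act by scalars on each weight space of V, so their bracket acts by 0 and
  vanishes by faithfulness.\<close>

lemma cartan_abelian:
  assumes "h \<in> H" "h' \<in> H"
  shows "br h h' = 0"
proof (rule faithful0)
  have f: "h \<in> gfix X" "h' \<in> gfix X" using assms H_fix by auto
  show b: "br h h' \<in> gfix X" using gdeg_br[OF f] by simp
  show "R (br h h') 0 v = 0" for v
  proof (rule zero_on_weights[OF R_lin[OF b]])
    fix L v assume "v \<in> wsp L"
    then have w: "R a 0 v = sV (L (tX a 0)) v" if "a \<in> H" for a
      using tX_HH[OF that] by (simp add: weight_space_def R_def)
    have "R h 0 (R h' 0 v) = R h' 0 (R h 0 v)"
      using w[OF assms(1)] w[OF assms(2)] V.lin_on_scale[OF R_lin[OF f(1)], of v UNIV]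
        V.lin_on_scale[OF R_lin[OF f(2)], of v UNIV] by (simp add: mult.commute)
    then show "R (br h h') 0 v = 0" using R_R0[OF f, of v] by simp
  qed
qed

text \<open>A Jordan chain x, y for ad h in g would give, on a weight vector v, the Jordan chain x
  v, y v for h in V.\<close>

lemma ad_semisimple:
  assumes h: "h \<in> H" and x: "x \<in> gdeg X k" and y: "y = br h x - scl \<mu> x" "br h y = scl \<mu> y"
  shows "y = 0"
proof (rule faithful)
  have hf: "h \<in> gfix X" using h H_fix by auto
  have hx: "br h x = scl \<mu> x + y" using y by simp
  show yk: "y \<in> gdeg X k"
    unfolding y(1) using gdeg_br[OF hf x] x
    by (intro G.subspace_diff[OF gdeg_subspace] G.subspace_scale[OF gdeg_subspace]) auto
  show "R y k v = 0" for v
  proof (rule zero_on_weights[OF R_lin[OF yk]])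
    fix L v assume v: "v \<in> wsp L"
    let ?n = "L (tX h 0)"
    have hv: "R h 0 v = sV ?n v" using v tX_HH[OF h] by (simp add: weight_space_def R_def)
    have 1: "R h 0 (R x k v) = sV (?n + \<mu>) (R x k v) + R y k v"
      using R_R0[OF hf x, of v] V.lin_on_scale[OF R_lin[OF x], of v UNIV]
      by (simp add: hx hv R_add R_scale x yk G.subspace_scale[OF gdeg_subspace] algebra_simps V.scale_left_distrib)
    have 2: "R h 0 (R y k v) = sV (?n + \<mu>) (R y k v)"
      using R_R0[OF hf yk, of v] V.lin_on_scale[OF R_lin[OF yk], of v UNIV]
      by (simp add: y(2) hv R_scale yk algebra_simps V.scale_left_distrib)
    show "R y k v = 0"
      by (rule V_semisimple[OF tX_HH[OF h], of _ "R x k v" "?n + \<mu>"]) (use 1 2 in \<open>simp_all add: R_def\<close>)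
  qed
qed

subsection \<open>Weight decomposition of the multiloop part\<close>

lemma gwt_iff: "x \<in> gwt X k a \<longleftrightarrow> x \<in> gdeg X k \<and> wvec a x"
  by (simp add: gwt_def wvec_def)

lemma gdeg_weights: "gdeg X k = G.span {x. \<exists>a\<in>dual_space scl H. x \<in> gwt X k a}"
proof -
  have "gdeg X k = G.span {x \<in> gdeg X k. \<forall>f\<in>br ` H. \<exists>c. f x = scl c x}"
  proof (rule G.simultaneous_span[OF fdim_sub[OF gdeg_subspace]])
    show "G.lin_on (gdeg X k) f \<and> (\<forall>x\<in>gdeg X k. f x \<in> gdeg X k)" if "f \<in> br ` H" for f
      using that H_gdeg_stable[of k] lin_br by (auto simp: Hstable_def)
    show "f (g x) = g (f x)" if "f \<in> br ` H" "g \<in> br ` H" for f g x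
    proof -
      obtain h h' where h: "f = br h" "h \<in> H" "g = br h'" "h' \<in> H" using \<open>f \<in> br ` H\<close> \<open>g \<in> br ` H\<close> by blast
      show ?thesis using br_jacobi[of h h' x] cartan_abelian[OF h(2,4)] by (simp add: h)
    qed
    show "y = 0" if "f \<in> br ` H" "x \<in> gdeg X k" "y = f x - scl \<mu> x" "f y = scl \<mu> y" for f x y \<mu>
    proof -
      obtain h where h: "f = br h" "h \<in> H" using \<open>f \<in> br ` H\<close> by blast
      show ?thesis by (rule ad_semisimple[OF h(2) that(2)]) (use that h in auto)
    qed
  qed
  also have "\<dots> \<subseteq> G.span {x. \<exists>a\<in>dual_space scl H. x \<in> gwt X k a}"
  proof (rule G.span_mono, rule subsetI)
    fix x assume x: "x \<in> {x \<in> gdeg X k. \<forall>f\<in>br ` H. \<exists>c. f x = scl c x}"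
    show "x \<in> {x. \<exists>a\<in>dual_space scl H. x \<in> gwt X k a}"
    proof (cases "x = 0")
      case True
      have "(\<lambda>_. 0) \<in> dual_space scl H" by (simp add: dual_space_def)
      moreover have "x \<in> gwt X k (\<lambda>_. 0)" using True G.subspace_0[OF gdeg_subspace] by (simp add: gwt_def)
      ultimately show ?thesis by blast
    next
      case False
      have "\<forall>h\<in>H. \<exists>c. br h x = scl c x" using x by blast
      then obtain l where "\<forall>h\<in>H. br h x = scl (l h) x" using bchoice by metis
      then have l: "wvec l x" by (simp add: wvec_def)
      then have "x \<in> gwt X k (\<lambda>h. if h \<in> H then l h else 0)" using x by (simp add: gwt_iff wvec_def)
      then show ?thesis using wvec_dual[OF l False] by blast
    qed
  qed
  finally show ?thesis
    using G.span_minimal[OF _ gdeg_subspace, of "{x. \<exists>a\<in>dual_space scl H. x \<in> gwt X k a}" k] by (auto simp: gwt_def)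
qed

lemma form_weights:
  assumes "wvec a x" "wvec b y" "ifm x y \<noteq> 0" "a \<in> dual_space scl H" "b \<in> dual_space scl H"
  shows "b = (\<lambda>h. - a h)"
proof
  fix h
  show "b h = - a h"
  proof (cases "h \<in> H")
    case True
    have "ifm (br x h) y = ifm x (br h y)" by (rule ifm_inv)
    moreover have "br x h = scl (- a h) x" using assms(1) True br_anti[of x h] by (simp add: wvec_def)
    ultimately have "- a h * ifm x y = b h * ifm x y"
      using assms(2) True by (simp add: wvec_def ifm_scale_left ifm_scale_right del: mult_minus_left G.scale_minus_left)
    then have "b h * ifm x y + a h * ifm x y = 0" by (simp only: minus_mult_left[symmetric]) (metis add.right_inverse add.commute)
    then have "(b h + a h) * ifm x y = 0" by (simp only: distrib_right)
    then show ?thesis using assms(3) by (simp add: eq_neg_iff_add_eq_0)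
  next
    case False
    then show ?thesis using assms(4,5) by (simp add: dual_space_def)
  qed
qed

lemma gwt_pair:
  assumes "x \<in> gwt X k a" "a \<in> dual_space scl H" "x \<noteq> 0"
  shows "\<exists>y\<in>gwt X (- k) (\<lambda>h. - a h). ifm x y \<noteq> 0"
proof (rule ccontr)
  assume neg: "\<not> ?thesis"
  have "ifm x y = 0" if "y \<in> gdeg X (- k)" for y
  proof -
    have "y \<in> G.span {x. \<exists>a\<in>dual_space scl H. x \<in> gwt X (- k) a}" using that gdeg_weights by blast
    then show ?thesis
    proof (induction rule: G.span_induct_alt)
      case base then show ?case by simp
    next
      case (step c y z)
      then obtain b where b: "b \<in> dual_space scl H" "y \<in> gwt X (- k) b" by blast
      have "ifm x y = 0"
      proof (rule ccontr)
        assume nz: "ifm x y \<noteq> 0"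
        then have "b = (\<lambda>h. - a h)" using form_weights assms b by (auto simp: gwt_iff)
        then show False using neg nz b by blast
      qed
      then show ?case using step by (simp add: ifm_add_right ifm_scale_right)
    qed
  qed
  then show False using pairing_neg[of x k] assms by (auto simp: gwt_def)
qed

text \<open>The form pairs weight a with weight -a, so both occur; hence both are dominated by the
  maximal root.\<close>

lemma gwt_neg_roots_en:
  assumes "x \<in> gwt X k a" "a \<in> dual_space scl H" "x \<noteq> 0"
  shows "a \<in> roots_en X" "(\<lambda>h. - a h) \<in> roots_en X"
proof -
  show "a \<in> roots_en X" using weight_roots_en[of x k a] assms by (simp add: gwt_iff)
  obtain y where y: "y \<in> gwt X (- k) (\<lambda>h. - a h)" "ifm x y \<noteq> 0" using gwt_pair[OF assms] by blast
  then have "y \<noteq> 0" by (intro notI) simp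
  moreover have "(\<lambda>h. - a h) \<in> dual_space scl H" using assms(2) by (simp add: dual_space_def)
  ultimately show "(\<lambda>h. - a h) \<in> roots_en X" using weight_roots_en[of y "- k"] y by (simp add: gwt_iff)
qed

lemma cartan_pair: "\<exists>h\<in>H. \<exists>h'\<in>H. ifm h h' \<noteq> 0"
proof -
  have d: "(\<lambda>_. 0) \<in> dual_space scl H" by (simp add: dual_space_def)
  have f: "h1 \<in> gfix X" using h1_H H_fix by blast
  then have "h1 \<in> gwt X 0 (\<lambda>_. 0)" using cartan_abelian h1_H by (simp add: gwt_def)
  then obtain y where y: "y \<in> gwt X (- 0) (\<lambda>h. - 0)" "ifm h1 y \<noteq> 0" using gwt_pair[OF _ d h1_nz] by blast
  have "y \<in> H"
  proof (rule H_norm)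
    show "y \<in> gfix X" using y by (simp add: gwt_def)
    show "br y h \<in> H" if "h \<in> H" for h
      using y that br_anti[of y h] G.subspace_0[OF H_subspace] by (simp add: gwt_def)
  qed
  then show ?thesis using y h1_H by blast
qed

lemma gwt0_cartan: "x \<in> gwt X 0 (\<lambda>_. 0) \<longleftrightarrow> x \<in> H"
proof
  assume x: "x \<in> gwt X 0 (\<lambda>_. 0)"
  show "x \<in> H"
  proof (rule H_norm)
    show "x \<in> gfix X" using x by (simp add: gwt_def)
    show "br x h \<in> H" if "h \<in> H" for h
      using x that br_anti[of x h] G.subspace_0[OF H_subspace] by (simp add: gwt_def)
  qed
next
  assume "x \<in> H"
  then show "x \<in> gwt X 0 (\<lambda>_. 0)" using cartan_abelian H_fix by (auto simp: gwt_def)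
qed

lemma gwt_br:
  assumes "x \<in> gwt X k a" "y \<in> gwt X l b"
  shows "br x y \<in> gwt X (k + l) (\<lambda>h. a h + b h)"
  using assms gdeg_br[of x k y l]
  by (simp add: gwt_def br_jacobi br_scale_left br_scale_right G.scale_left_distrib)

text \<open>The weight 0 part of the perfect algebra \<open>gfix X\<close> consists of brackets of
  opposite weights. This reduces an identity between functionals on H to elements [x, y] with x of
  weight a and y of weight -a.\<close>

lemma cartan_brackets:
  assumes "h \<in> H"
  shows "h \<in> G.span {br x y |x y a. a \<in> dual_space scl H \<and> x \<in> gwt X 0 a \<and> y \<in> gwt X 0 (\<lambda>h. - a h)}"
    (is "h \<in> G.span ?N")
proof -
  let ?W = "{z. \<exists>c\<in>dual_space scl H. c \<noteq> (\<lambda>_. 0) \<and> z \<in> gwt X 0 c}"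
  let ?P = "\<lambda>x. \<exists>n\<in>G.span ?N. x - n \<in> G.span ?W"
  have Padd: "?P (x + y)" if xy: "?P x" "?P y" for x y
  proof -
    obtain n n' where n: "n \<in> G.span ?N" "x - n \<in> G.span ?W" "n' \<in> G.span ?N" "y - n' \<in> G.span ?W" using xy by blast
    have "(x - n) + (y - n') \<in> G.span ?W" by (rule G.span_add) (use n in auto)
    moreover have "(x - n) + (y - n') = x + y - (n + n')" by simp
    moreover have "n + n' \<in> G.span ?N" by (rule G.span_add) (use n in auto)
    ultimately show ?thesis by (metis (no_types, lifting))
  qed
  have Pscale: "?P (scl c x)" if Px: "?P x" for c x
  proof -
    obtain n where n: "n \<in> G.span ?N" "x - n \<in> G.span ?W" using Px by blast
    have "scl c (x - n) \<in> G.span ?W" using n(2) by (rule G.span_scale)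
    then have "scl c x - scl c n \<in> G.span ?W" by (simp add: G.scale_right_diff_distrib)
    moreover have "scl c n \<in> G.span ?N" using n(1) by (rule G.span_scale)
    ultimately show ?thesis by blast
  qed
  have P0: "?P 0" using G.span_zero[of ?N] G.span_zero[of ?W] by (intro bexI[of _ 0]) auto
  have gen: "?P (br x y)" if x: "x \<in> gwt X 0 a" "a \<in> dual_space scl H" and y: "y \<in> gwt X 0 b" "b \<in> dual_space scl H" for x y a b
  proof (cases "b = (\<lambda>h. - a h)")
    case True
    then have "br x y \<in> G.span ?N" using x y by (intro G.span_base) blast
    moreover have "br x y - br x y \<in> G.span ?W" using G.span_zero by simp
    ultimately show ?thesis by blast
  next
    case False
    let ?c = "\<lambda>h. a h + b h"
    have c: "?c \<in> dual_space scl H" using x(2) y(2) by (simp add: dual_space_def algebra_simps)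
    have "?c \<noteq> (\<lambda>_. 0)"
    proof
      assume eq: "?c = (\<lambda>_. 0)"
      have "b h = - a h" for h using fun_cong[OF eq, of h] by (simp add: eq_neg_iff_add_eq_0 add.commute)
      then show False using False by blast
    qed
    then have "br x y \<in> G.span ?W" using gwt_br[OF x(1) y(1)] c by (intro G.span_base) auto
    then show ?thesis using G.span_zero[of ?N] by (intro bexI[of _ 0]) auto
  qed
  let ?G = "{x. \<exists>a\<in>dual_space scl H. x \<in> gwt X 0 a}"
  have br1: "?P (br x y)" if y: "y \<in> gfix X" and x: "x \<in> ?G" for x y
  proof -
    have "y \<in> G.span ?G" using y gdeg_weights by blast
    then show ?thesis
    proof (induction rule: G.span_induct_alt)
      case base then show ?case using P0 by simp
    next
      case (step c u w)
      have "?P (br x u)" using gen x step(1) by blast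
      then show ?case using Padd[OF Pscale step(2)] by (simp add: br_add_right br_scale_right)
    qed
  qed
  have br2: "?P (br x y)" if y: "y \<in> gfix X" and x: "x \<in> gfix X" for x y
  proof -
    have "x \<in> G.span ?G" using x gdeg_weights by blast
    then show ?thesis
    proof (induction rule: G.span_induct_alt)
      case base then show ?case using P0 by simp
    next
      case (step c u w)
      have "?P (br u y)" using br1[OF y] step(1) by blast
      then show ?case using Padd[OF Pscale step(2)] by (simp add: br_add_left br_scale_left)
    qed
  qed
  have all: "?P x" if "x \<in> gfix X" for x
  proof -
    have "x \<in> G.span {br x y |x y. x \<in> gfix X \<and> y \<in> gfix X}" using that gfix_perfect by blast
    then show ?thesis
    proof (induction rule: G.span_induct_alt)
      case base then show ?case using P0 .
    next
      case (step c u w)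
      then have "?P u" using br2 by blast
      then show ?case using Padd[OF Pscale step(2)] by simp
    qed
  qed
  have hf: "h \<in> gfix X" using assms H_fix by blast
  obtain n where n: "n \<in> G.span ?N" "h - n \<in> G.span ?W" using all[OF hf] by blast
  have NH: "G.span ?N \<subseteq> H"
  proof (rule G.span_minimal[OF _ H_subspace], rule subsetI)
    fix z assume "z \<in> ?N"
    then obtain x y a where "z = br x y" "x \<in> gwt X 0 a" "y \<in> gwt X 0 (\<lambda>h. - a h)" by blast
    then show "z \<in> H" using gwt_br[of x 0 a y 0 "\<lambda>h. - a h"] gwt0_cartan by simp
  qed
  have hn: "h - n \<in> H" using NH n assms G.subspace_diff[OF H_subspace] by blast
  \<comment> \<open>The difference lies in H and is also a sum of vectors of non-zero weight, hence
    orthogonal to weight 0; but a non-zero element of H has a partner of weight 0.\<close>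
  have "h - n = 0"
  proof (rule ccontr)
    assume nz: "h - n \<noteq> 0"
    have d: "(\<lambda>_. 0) \<in> dual_space scl H" by (simp add: dual_space_def)
    obtain y where y: "y \<in> gwt X (- 0) (\<lambda>h. - 0)" "ifm (h - n) y \<noteq> 0"
      using gwt_pair[OF _ d nz, of 0] gwt0_cartan hn by blast
    have "ifm y z = 0" if "z \<in> G.span ?W" for z
      using that
    proof (induction rule: G.span_induct_alt)
      case base then show ?case by simp
    next
      case (step c u w)
      then obtain b where b: "b \<in> dual_space scl H" "b \<noteq> (\<lambda>_. 0)" "u \<in> gwt X 0 b" by blast
      have "ifm y u = 0"
      proof (rule ccontr)
        assume "ifm y u \<noteq> 0"
        then have "b = (\<lambda>h. - 0)" using form_weights[of "\<lambda>h. 0" y b u] y b d by (auto simp: gwt_iff)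
        then show False using b by simp
      qed
      then show ?case using step by (simp add: ifm_add_right ifm_scale_right)
    qed
    then show False using n y by (simp add: ifm_sym[of _ y])
  qed
  then show ?thesis using n by simp
qed

subsection \<open>Levels\<close>

lemma max_root_ncomb: "a \<in> roots_en X \<Longrightarrow> ncomb (\<lambda>h. max_root X h - a h)"
  using max_rt by (simp add: is_max_root_def)

lemma max_root_ncomb0: "ncomb (max_root X)"
  using max_root_ncomb[of "\<lambda>_. 0"] by (simp add: roots_en_def)

text \<open>The element \<open>h1 + cc d\<^sub>0\<close> takes the value \<open>1\<close> on every affine simple root; its eigenvalues grade the
  algebra so that the positive part is the sum of the positive levels.\<close>

definition cc :: complex where "cc = 1 + max_root X h1"

lemma cc_nat: "\<exists>n::nat. n > 0 \<and> cc = of_nat n"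
proof -
  obtain n :: nat where "max_root X h1 = of_nat n" using ncomb_h1[OF max_root_ncomb0] by blast
  then show ?thesis by (intro exI[of _ "Suc n"]) (simp add: cc_def)
qed

text \<open>By a + j \<delta>_0 = j \<alpha>_0 + (a + j \<beta>_0), only the finite part has to be a
  combination of finite simple roots.\<close>

lemma pos_I:
  assumes "ncomb (\<lambda>h. a h + of_nat j * max_root X h)" "j > 0 \<or> a \<noteq> (\<lambda>_. 0)" "a \<in> dual_space scl H"
  shows "pos X (\<lambda>h. ext_fun X a h + of_int (int j) * delta X None h)"
  unfolding pos_def
proof
  let ?e = "\<lambda>h. ext_fun X a h + of_int (int j) * delta X None h"
  show "?e \<noteq> (\<lambda>_. 0)"
  proof (cases "j > 0")
    case True
    have "Poly_Mapping.lookup (fst (td None :: ('g, 'n) tor)) 0 = 0" "Poly_Mapping.lookup (snd (snd (td None :: ('g, 'n) tor))) 0 $ None = 1"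
      by (simp_all add: tD_def)
    moreover have "a 0 = 0"
    proof -
      have "a (scl 0 0) = 0 * a 0" using assms(3) G.subspace_0[OF H_subspace] unfolding dual_space_def by blast
      then show ?thesis by simp
    qed
    ultimately have "?e (td None) = of_nat j" using td_HH[of None] by (simp add: ext_fun_def delta_def)
    then have nz: "?e (td None) \<noteq> 0" using True by simp
    show ?thesis
    proof
      assume eq: "?e = (\<lambda>_. 0)"
      show False using fun_cong[OF eq, of "td None"] nz by (rule notE[rotated])
    qed
  next
    case False
    then have "a \<noteq> (\<lambda>_. 0)" using assms(2) by simp
    then have "\<exists>h\<in>H. a h \<noteq> 0" using assms(3) by (auto simp: dual_space_def fun_eq_iff)
    then obtain h where h: "h \<in> H" "a h \<noteq> 0" by blast
    have "?e (tX h 0) = a h" using tX_HH[OF h(1)] False by (simp add: ext_fun_def delta_def tX_def)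
    then have nz: "?e (tX h 0) \<noteq> 0" using h by simp
    show ?thesis
    proof
      assume eq: "?e = (\<lambda>_. 0)"
      show False using fun_cong[OF eq, of "tX h 0"] nz by (rule notE[rotated])
    qed
  qed
  obtain c :: "nat \<Rightarrow> nat" where c: "(\<lambda>h. a h + of_nat j * max_root X h) = (\<lambda>h. \<Sum>i=1..rk X. of_nat (c i) * simple_root X i h)"
    using assms(1) by (auto simp: nat_comb_def)
  let ?c = "\<lambda>i. if i = 0 then j else c i"
  have "?e h = (\<Sum>i=0..rk X. of_nat (?c i) * affine_simple X i h)" for h
  proof -
    have split: "(\<Sum>i=0..rk X. of_nat (?c i) * affine_simple X i h) =
        of_nat j * affine_simple X 0 h + (\<Sum>i=1..rk X. of_nat (c i) * affine_simple X i h)"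
      by (simp add: sum.atLeast_Suc_atMost)
    show ?thesis
    proof (cases "h \<in> HH X")
      case True
      let ?x = "Poly_Mapping.lookup (fst h) 0"
      have "a ?x + of_nat j * max_root X ?x = (\<Sum>i=1..rk X. of_nat (c i) * simple_root X i ?x)" using fun_cong[OF c] .
      moreover have "(\<Sum>i=1..rk X. of_nat (c i) * affine_simple X i h) = (\<Sum>i=1..rk X. of_nat (c i) * simple_root X i ?x)"
        using True by (intro sum.cong) (auto simp: affine_simple_def ext_fun_def)
      ultimately show ?thesis unfolding split using True
        by (simp add: affine_simple_def ext_fun_def algebra_simps)
    next
      case False
      have "(\<Sum>i=1..rk X. of_nat (c i) * affine_simple X i h) = 0"
        using False by (intro sum.neutral) (auto simp: affine_simple_def ext_fun_def)
      then show ?thesis unfolding split using False by (simp add: affine_simple_def ext_fun_def delta_def)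
    qed
  qed
  then show "\<exists>c::nat \<Rightarrow> nat. ?e = (\<lambda>h. \<Sum>i=0..rk X. of_nat (c i) * affine_simple X i h)"
    by (intro exI[of _ ?c] ext)
qed

text \<open>The sign of the level decides positivity. For k_0 > 0, a + k_0 \<beta>_0 = (\<beta>_0 -
  (-a)) + (k_0 - 1) \<beta>_0 is a non-negative combination because -a is a weight too, and k_0
  copies of \<alpha>_0 add at least 1; k_0 < 0 is symmetric.\<close>

lemma level_cases:
  assumes "x \<in> gwt X (k0, k) a" "a \<in> dual_space scl H" "x \<noteq> 0"
  shows "\<exists>n::int. a h1 + cc * of_int k0 = of_int n \<and>
    (n > 0 \<longrightarrow> pos X (\<lambda>h. ext_fun X a h + of_int k0 * delta X None h)) \<and>
    (n = 0 \<longrightarrow> k0 = 0 \<and> a = (\<lambda>_. 0))"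
proof -
  note en = gwt_neg_roots_en[OF assms]
  obtain b :: nat where b: "max_root X h1 = of_nat b" using ncomb_h1[OF max_root_ncomb0] by blast
  have cb: "cc = of_int (1 + int b)" by (simp add: cc_def b)
  consider "k0 > 0" | "k0 < 0" | "k0 = 0" "a = (\<lambda>_. 0)" | "k0 = 0" "a \<noteq> (\<lambda>_. 0)" "ncomb a"
    | "k0 = 0" "a \<noteq> (\<lambda>_. 0)" "ncomb (\<lambda>h. - a h)"
    using roots_en_ncomb[OF en(1)] by fastforce
  then show ?thesis
  proof cases
    case 1
    define j where "j = nat k0"
    have j: "k0 = int j" "j > 0" using 1 by (auto simp: j_def)
    have "ncomb (\<lambda>h. (max_root X h - - a h) + of_nat (j - 1) * max_root X h)"
      by (rule ncomb_add[OF max_root_ncomb[OF en(2)] ncomb_mult[OF max_root_ncomb0]])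
    moreover have "(\<lambda>h. (max_root X h - - a h) + of_nat (j - 1) * max_root X h) = (\<lambda>h. a h + of_nat j * max_root X h)"
      using j(2) by (cases j) (auto simp: fun_eq_iff algebra_simps)
    ultimately have nc: "ncomb (\<lambda>h. a h + of_nat j * max_root X h)" by simp
    obtain m :: nat where m: "a h1 + of_nat j * max_root X h1 = of_nat m" using ncomb_h1[OF nc] by blast
    have "a h1 + cc * of_int k0 = of_int (int m + int j)" using m by (simp add: cc_def j algebra_simps)
    moreover have "pos X (\<lambda>h. ext_fun X a h + of_int k0 * delta X None h)"
      using pos_I[OF nc _ assms(2)] j by simp
    moreover have "int m + int j > 0" using j by simp
    ultimately show ?thesis by (intro exI[of _ "int m + int j"]) auto
  next
    case 2
    define j where "j = nat (- k0)"
    have j: "k0 = - int j" "j > 0" using 2 by (auto simp: j_def)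
    have "ncomb (\<lambda>h. (max_root X h - a h) + of_nat (j - 1) * max_root X h)"
      by (rule ncomb_add[OF max_root_ncomb[OF en(1)] ncomb_mult[OF max_root_ncomb0]])
    moreover have "(\<lambda>h. (max_root X h - a h) + of_nat (j - 1) * max_root X h) = (\<lambda>h. - a h + of_nat j * max_root X h)"
      using j(2) by (cases j) (auto simp: fun_eq_iff algebra_simps)
    ultimately have nc: "ncomb (\<lambda>h. - a h + of_nat j * max_root X h)" by simp
    obtain m :: nat where m: "- a h1 + of_nat j * max_root X h1 = of_nat m" using ncomb_h1[OF nc] by blast
    have "a h1 + cc * of_int k0 = - (- a h1 + of_nat j * max_root X h1) - of_nat j" by (simp add: cc_def j algebra_simps)
    also have "\<dots> = of_int (- int m - int j)" unfolding m by simp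
    finally have "a h1 + cc * of_int k0 = of_int (- int m - int j)" .
    then show ?thesis using j by (intro exI[of _ "- int m - int j"]) auto
  next
    case 3
    then show ?thesis by (intro exI[of _ 0]) auto
  next
    case 4
    then obtain m :: nat where m: "a h1 = of_nat m" "m = 0 \<longrightarrow> a = (\<lambda>_. 0)" using ncomb_h1 by blast
    have nc: "ncomb (\<lambda>h. a h + of_nat 0 * max_root X h)" using 4 by simp
    have "pos X (\<lambda>h. ext_fun X a h + of_int k0 * delta X None h)"
      using pos_I[OF nc _ assms(2)] 4 by simp
    then show ?thesis using m 4 by (intro exI[of _ "int m"]) auto
  next
    case 5
    then obtain m :: nat where m: "- a h1 = of_nat m" "m = 0 \<longrightarrow> (\<lambda>h. - a h) = (\<lambda>_. 0)" using ncomb_h1 by blast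
    have "a h1 = - of_nat m" using m(1) by (simp add: minus_equation_iff)
    moreover have "m \<noteq> 0"
    proof
      assume "m = 0"
      then have "(\<lambda>h. - a h) = (\<lambda>_. 0)" using m(2) by simp
      then have "a h = 0" for h using fun_cong[of "\<lambda>h. - a h" "\<lambda>_. 0" h] by simp
      then show False using 5 by auto
    qed
    ultimately show ?thesis using 5 by (intro exI[of _ "- int m"]) auto
  qed
qed

end

section \<open>Injective endomorphisms and diagonal Gram matrices\<close>

context cvs
begin

lemma lin_inj_surj:
  assumes "fdim E" "lin_on E f" "maps E f" "\<And>v. v \<in> E \<Longrightarrow> f v = 0 \<Longrightarrow> v = 0"
  shows "f ` E = E"
proof (rule ccontr)
  assume "f ` E \<noteq> E"
  then obtain x0 where x0: "x0 \<in> E" "x0 \<notin> f ` E" using assms(3) by blast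
  note E = fdim_subspace[OF assms(1)]
  have sub: "subspace (f ` E)"
  proof (rule subspaceI)
    show "0 \<in> f ` E" using lin_on_zero[OF assms(2) E] subspace_0[OF E] by (metis imageI)
    show "x + y \<in> f ` E" if xy: "x \<in> f ` E" "y \<in> f ` E" for x y
    proof -
      obtain a b where "a \<in> E" "b \<in> E" "x = f a" "y = f b" using xy by blast
      then show ?thesis using lin_on_add[OF assms(2), of a b] subspace_add[OF E, of a b] by (metis imageI)
    qed
    show "sc c x \<in> f ` E" if xy: "x \<in> f ` E" for c x
    proof -
      obtain a where "a \<in> E" "x = f a" using xy by blast
      then show ?thesis using lin_on_scale[OF assms(2), of a c] subspace_scale[OF E, of a c] by (metis imageI)
    qed
  qed
  have mF: "maps (f ` E) f" using assms(3) by blast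
  obtain Bs where Bs: "finite Bs" "E \<subseteq> span Bs" using assms(1) by (auto simp: fdim_def)
  obtain c where c: "\<exists>i\<in>{..card Bs}. c i \<noteq> 0" "(\<Sum>i\<in>{..card Bs}. sc (c i) ((f ^^ i) x0)) = 0"
    using dep_family[OF Bs(1), of "{..card Bs}" "\<lambda>i. (f ^^ i) x0"] maps_funpow[OF assms(3) x0(1)] Bs(2) by auto
  \<comment> \<open>the lowest term of the relation shows \<open>x0 \<in> f ` E\<close> after cancelling a power of \<open>f\<close>\<close>
  define k where "k = (LEAST i. c i \<noteq> 0)"
  obtain i0 where i0: "i0 \<le> card Bs" "c i0 \<noteq> 0" using c(1) by blast
  have k: "c k \<noteq> 0" "k \<le> card Bs" "\<And>i. i < k \<Longrightarrow> c i = 0"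
  proof -
    show "c k \<noteq> 0" unfolding k_def by (rule LeastI) (rule i0(2))
    show "k \<le> card Bs" unfolding k_def by (rule order_trans[OF Least_le]) (rule i0(2), rule i0(1))
    show "\<And>i. i < k \<Longrightarrow> c i = 0" using not_less_Least unfolding k_def by blast
  qed
  let ?y = "\<Sum>i\<in>{k..card Bs}. sc (c i) ((f ^^ (i - k)) x0)"
  have fE: "(f ^^ i) x0 \<in> E" for i using maps_funpow[OF assms(3) x0(1)] .
  have yE: "?y \<in> E" by (intro subspace_sum[OF E] subspace_scale[OF E] fE)
  note lk = lin_on_funpow[OF assms(2,3)]
  have "(f ^^ k) ?y = (\<Sum>i\<in>{k..card Bs}. (f ^^ k) (sc (c i) ((f ^^ (i - k)) x0)))"
    by (rule lin_on_sum[OF lk E]) (auto intro: subspace_scale[OF E] fE)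
  also have "\<dots> = (\<Sum>i\<in>{k..card Bs}. sc (c i) ((f ^^ i) x0))"
  proof (rule sum.cong[OF refl])
    fix i assume i: "i \<in> {k..card Bs}"
    have "(f ^^ k) ((f ^^ (i - k)) x0) = (f ^^ (k + (i - k))) x0" by (simp add: funpow_add)
    then show "(f ^^ k) (sc (c i) ((f ^^ (i - k)) x0)) = sc (c i) ((f ^^ i) x0)"
      using lin_on_scale[OF lk fE] i by simp
  qed
  also have "\<dots> = (\<Sum>i\<in>{..card Bs}. sc (c i) ((f ^^ i) x0))"
    by (rule sum.mono_neutral_left) (use k(3) in \<open>auto simp: not_le\<close>)
  finally have fy: "(f ^^ k) ?y = 0" using c(2) by simp
  have "(f ^^ j) z = 0 \<Longrightarrow> z \<in> E \<Longrightarrow> z = 0" for j z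
  proof (induction j arbitrary: z)
    case (Suc j)
    have "f ((f ^^ j) z) = 0" using Suc.prems(1) by simp
    then have "(f ^^ j) z = 0" using assms(4) maps_funpow[OF assms(3) Suc.prems(2)] by blast
    then show ?case using Suc by blast
  qed simp
  then have y0: "?y = 0" using fy yE by blast
  have "?y = sc (c k) x0 + (\<Sum>i\<in>{Suc k..card Bs}. sc (c i) ((f ^^ (i - k)) x0))"
    using k(2) by (simp add: sum.atLeast_Suc_atMost)
  then have "sc (c k) x0 = - (\<Sum>i\<in>{Suc k..card Bs}. sc (c i) ((f ^^ (i - k)) x0))"
    using y0 by (simp add: eq_neg_iff_add_eq_0)
  moreover have "(\<Sum>i\<in>{Suc k..card Bs}. sc (c i) ((f ^^ (i - k)) x0)) \<in> f ` E"
  proof (rule subspace_sum[OF sub], rule subspace_scale[OF sub])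
    fix i assume i: "i \<in> {Suc k..card Bs}"
    then obtain j where "i - k = Suc j" by (cases "i - k") auto
    then show "(f ^^ (i - k)) x0 \<in> f ` E" using fE by simp
  qed
  ultimately have "sc (c k) x0 \<in> f ` E" using subspace_neg[OF sub] by simp
  then have "sc (1 / c k) (sc (c k) x0) \<in> f ` E" using subspace_scale[OF sub] by blast
  then show False using x0 k(1) by simp
qed

text \<open>The maps \<Phi> act as dual functionals with values in the space itself: a diagonal
  matrix without zeros on the diagonal makes the \<open>u m\<close> independent, which a finite span
  cannot hold.\<close>

lemma gram:
  fixes u :: "nat \<Rightarrow> 'a"
  assumes "finite Bs" "\<And>m. u m \<in> span Bs" "\<And>m. lin_on UNIV (\<Phi> m)"
    "\<And>m. \<Phi> m (u m) \<noteq> 0" "\<And>m m'. m \<noteq> m' \<Longrightarrow> \<Phi> m (u m') = 0"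
  shows False
proof -
  obtain c where c: "\<exists>i\<in>{..card Bs}. c i \<noteq> 0" "(\<Sum>i\<in>{..card Bs}. sc (c i) (u i)) = 0"
    using dep_family[OF assms(1), of "{..card Bs}" u] assms(2) by auto
  then obtain i where i: "i \<in> {..card Bs}" "c i \<noteq> 0" by blast
  have "\<Phi> i (\<Sum>j\<in>{..card Bs}. sc (c j) (u j)) = (\<Sum>j\<in>{..card Bs}. sc (c j) (\<Phi> i (u j)))"
    by (subst lin_on_sum[OF assms(3) subspace_UNIV]) (auto simp: lin_on_scale[OF assms(3)])
  also have "\<dots> = sc (c i) (\<Phi> i (u i)) + (\<Sum>j\<in>{..card Bs} - {i}. sc (c j) (\<Phi> i (u j)))"
    by (rule sum.remove) (use i in auto)
  also have "(\<Sum>j\<in>{..card Bs} - {i}. sc (c j) (\<Phi> i (u j))) = 0"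
    by (rule sum.neutral) (use assms(5) in auto)
  finally have "sc (c i) (\<Phi> i (u i)) = 0" using c(2) lin_on_zero[OF assms(3) subspace_UNIV] by simp
  then show False using i assms(4) by simp
qed

end

section \<open>Graded families of operators\<close>

text \<open>The setting of a highest weight argument with sets of homogeneous operators. Two
  summands appear in the commutator because the bracket of two generators is in general a generator
  plus a central element, so the sets need no closure under sums.\<close>

locale graded_action = cvs sc for sc :: "complex \<Rightarrow> 'a::ab_group_add \<Rightarrow> 'a" +
  fixes GG :: "int \<Rightarrow> ('a \<Rightarrow> 'a) set" and L :: "'a \<Rightarrow> 'a" and w0 :: 'a and \<l> :: complex
  assumes GG_lin: "g \<in> GG d \<Longrightarrow> lin_on UNIV g"
    and L_lin: "lin_on UNIV L"
    and GG_br: "g \<in> GG d \<Longrightarrow> g' \<in> GG d' \<Longrightarrow>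
      \<exists>c1\<in>GG (d + d'). \<exists>c2\<in>GG (d + d'). \<forall>v. g (g' v) - g' (g v) = c1 v + c2 v"
    and L_GG: "g \<in> GG d \<Longrightarrow> L (g v) = g (L v) + sc (of_int d) (g v)"
    and GG_irr: "subspace W \<Longrightarrow> (\<And>d g. g \<in> GG d \<Longrightarrow> maps W g) \<Longrightarrow> W = {0} \<or> W = UNIV"
    and w0: "w0 \<noteq> 0" "L w0 = sc \<l> w0" "\<And>d g. d > 0 \<Longrightarrow> g \<in> GG d \<Longrightarrow> g w0 = 0"
begin

definition top_space :: "'a set" where
  "top_space = {v. \<forall>d>0. \<forall>g\<in>GG d. g v = 0}"

definition eig :: "complex \<Rightarrow> 'a set" where
  "eig \<mu> = {v. L v = sc \<mu> v}"

definition low :: "complex \<Rightarrow> 'a set" where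
  "low \<mu> = span (\<Union>j\<in>{1::nat..}. eig (\<mu> - of_nat j))"

lemma top_space_subspace: "subspace top_space"
proof (rule subspaceI)
  show "0 \<in> top_space"
    using lin_on_zero[OF GG_lin subspace_UNIV] by (auto simp: top_space_def)
  show "x + y \<in> top_space" if "x \<in> top_space" "y \<in> top_space" for x y
    unfolding top_space_def
  proof (intro CollectI allI impI ballI)
    fix d g assume d: "(d::int) > 0" "g \<in> GG d"
    show "g (x + y) = 0"
    proof -
      have "g x = 0" "g y = 0" using that d by (auto simp: top_space_def)
      then show ?thesis using lin_on_add[OF GG_lin[OF d(2)], of x y] by simp
    qed
  qed
  show "sc c x \<in> top_space" if "x \<in> top_space" for c x
    unfolding top_space_def
  proof (intro CollectI allI impI ballI)
    fix d g assume d: "(d::int) > 0" "g \<in> GG d"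
    show "g (sc c x) = 0"
    proof -
      have "g x = 0" using that d by (auto simp: top_space_def)
      then show ?thesis using lin_on_scale[OF GG_lin[OF d(2)], of x c] by simp
    qed
  qed
qed

lemma eig_subspace: "subspace (eig \<mu>)"
  using subspace_kernel_on[OF subspace_UNIV L_lin, of \<mu>] by (simp add: eig_def)

lemma eig_GG: "x \<in> eig \<mu> \<Longrightarrow> g \<in> GG d \<Longrightarrow> g x \<in> eig (\<mu> + of_int d)"
  using lin_on_scale[OF GG_lin] by (simp add: eig_def L_GG scale_left_distrib)

lemma top_space_L: "v \<in> top_space \<Longrightarrow> L v - sc \<mu> v \<in> top_space"
proof -
  assume v: "v \<in> top_space"
  have "L v \<in> top_space"
    unfolding top_space_def
  proof (intro CollectI allI impI ballI)
    fix d g assume dg: "(d::int) > 0" "g \<in> GG d"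
    have gv: "g v = 0" using v dg by (simp add: top_space_def)
    have "L (g v) = 0" using lin_on_zero[OF L_lin subspace_UNIV] gv by simp
    then show "g (L v) = 0" using L_GG[OF dg(2), of v] gv by simp
  qed
  then show ?thesis using v by (intro subspace_diff subspace_scale top_space_subspace)
qed

inductive_set desc :: "'a set \<Rightarrow> 'a set" for W where
  desc_base: "w \<in> W \<Longrightarrow> w \<in> desc W"
| desc_step: "x \<in> desc W \<Longrightarrow> d < 0 \<Longrightarrow> g \<in> GG d \<Longrightarrow> g x \<in> desc W"

lemma desc_span_step:
  assumes "x \<in> span (desc W)" "d < 0" "g \<in> GG d"
  shows "g x \<in> span (desc W)"
  using assms(1)
proof (induction rule: span_induct_alt)
  case base
  then show ?case using lin_on_zero[OF GG_lin[OF assms(3)] subspace_UNIV] span_zero by simp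
next
  case (step c x y)
  have "g x \<in> span (desc W)" by (rule span_base) (rule desc_step[OF step(1) assms(2,3)])
  then have "sc c (g x) + g y \<in> span (desc W)" using step(2) by (intro span_add span_scale)
  then show ?case
    by (simp add: lin_on_add[OF GG_lin[OF assms(3)]] lin_on_scale[OF GG_lin[OF assms(3)]])
qed

text \<open>Induction on the number of lowering operators: g is commuted past the last one, and the
  two commutator terms act on a shorter word. For W inside the top space this replaces an ordered
  monomial basis.\<close>

lemma desc_stable:
  assumes "W \<subseteq> top_space" "\<And>g. g \<in> GG 0 \<Longrightarrow> maps W g" "x \<in> desc W" "g \<in> GG d"
  shows "g x \<in> span (desc W)"
  using assms(3,4)
proof (induction arbitrary: g d rule: desc.induct)
  case (desc_base w)
  consider "d > 0" | "d = 0" | "d < 0" by linarith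
  then show ?case
  proof cases
    case 1
    then have "g w = 0" using assms(1) desc_base by (auto simp: top_space_def)
    then show ?thesis using span_zero by simp
  next
    case 2
    then have "g w \<in> W" using assms(2) desc_base by blast
    then show ?thesis by (intro span_base desc.desc_base)
  next
    case 3
    then show ?thesis using desc_base by (intro span_base desc.desc_step[of w W d g] desc.desc_base)
  qed
next
  case (desc_step x e y)
  obtain c1 c2 where c: "c1 \<in> GG (d + e)" "c2 \<in> GG (d + e)" "\<And>v. g (y v) - y (g v) = c1 v + c2 v"
    using GG_br[OF desc_step.prems desc_step.hyps(3)] by blast
  have "y (g x) \<in> span (desc W)"
    by (rule desc_span_step[OF desc_step.IH[OF desc_step.prems] desc_step.hyps(2,3)])
  then have "y (g x) + (c1 x + c2 x) \<in> span (desc W)"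
    by (rule span_add[OF _ span_add[OF desc_step.IH[OF c(1)] desc_step.IH[OF c(2)]]])
  moreover have "g (y x) = y (g x) + (c1 x + c2 x)" using c(3)[of x] by (simp add: algebra_simps)
  ultimately show ?case by simp
qed

text \<open>W generates V by irreducibility, and everything outside W is reached by lowering at
  least once, hence has an eigenvalue strictly below \<mu>.\<close>

lemma cover:
  assumes W: "subspace W" "W \<subseteq> top_space" "W \<subseteq> eig \<mu>" "W \<noteq> {0}" "\<And>g. g \<in> GG 0 \<Longrightarrow> maps W g"
  shows "\<exists>w\<in>W. \<exists>u\<in>low \<mu>. v = w + u"
proof -
  have "span (desc W) = UNIV"
  proof -
    have "maps (span (desc W)) g" if g: "g \<in> GG d" for g d
    proof
      fix x assume "x \<in> span (desc W)"
      then show "g x \<in> span (desc W)"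
      proof (induction rule: span_induct_alt)
        case base
        then show ?case using lin_on_zero[OF GG_lin[OF g] subspace_UNIV] span_zero by simp
      next
        case (step c x y)
        have "g x \<in> span (desc W)" by (rule desc_stable[OF W(2,5) step(1) g])
        then have "sc c (g x) + g y \<in> span (desc W)" using step(2) by (intro span_add span_scale)
        then show ?case by (simp add: lin_on_add[OF GG_lin[OF g]] lin_on_scale[OF GG_lin[OF g]])
      qed
    qed
    then have "span (desc W) = {0} \<or> span (desc W) = UNIV" by (rule GG_irr[OF subspace_span])
    moreover have "span (desc W) \<noteq> {0}"
    proof -
      obtain w where "w \<in> W" "w \<noteq> 0" using W(4) subspace_0[OF W(1)] by blast
      then have "w \<in> span (desc W)" by (intro span_base desc_base)
      then show ?thesis using \<open>w \<noteq> 0\<close> by blast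
    qed
    ultimately show ?thesis by blast
  qed
  moreover have "span (desc W) \<subseteq> {w + u |w u. w \<in> W \<and> u \<in> low \<mu>}"
  proof (rule span_minimal)
    have low_sub: "subspace (low \<mu>)" by (simp add: low_def)
    show "subspace {w + u |w u. w \<in> W \<and> u \<in> low \<mu>}" by (rule subspace_sums[OF W(1) low_sub])
    have lev: "x \<in> W \<or> (\<exists>j\<ge>1. x \<in> eig (\<mu> - of_nat j))" if "x \<in> desc W" for x
      using that
    proof (induction rule: desc.induct)
      case (desc_step x d g)
      have "\<exists>j::nat. x \<in> eig (\<mu> - of_nat j)"
      proof (cases "x \<in> W")
        case True
        then have "x \<in> eig (\<mu> - of_nat 0)" using W(3) by auto
        then show ?thesis by blast
      qed (use desc_step.IH in blast)
      then obtain j :: nat where "x \<in> eig (\<mu> - of_nat j)" by blast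
      then have "g x \<in> eig (\<mu> - of_nat j + of_int d)" by (rule eig_GG) (rule desc_step.hyps)
      moreover have "\<mu> - of_nat j + of_int d = \<mu> - of_nat (j + nat (- d))"
        using desc_step.hyps(2) by (simp add: of_nat_nat)
      moreover have "j + nat (- d) \<ge> 1" using desc_step.hyps(2) by simp
      ultimately show ?case by metis
    qed simp
    show "desc W \<subseteq> {w + u |w u. w \<in> W \<and> u \<in> low \<mu>}"
    proof
      fix x assume "x \<in> desc W"
      then consider "x \<in> W" | j :: nat where "j \<ge> 1" "x \<in> eig (\<mu> - of_nat j)" using lev by blast
      then show "x \<in> {w + u |w u. w \<in> W \<and> u \<in> low \<mu>}"
      proof cases
        case 1
        moreover have "0 \<in> low \<mu>" by (rule subspace_0[OF low_sub])
        ultimately show ?thesis by (intro CollectI exI[of _ x] exI[of _ 0]) simp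
      next
        case 2
        then have "x \<in> low \<mu>" unfolding low_def by (intro span_base) auto
        then show ?thesis using subspace_0[OF W(1)] by (intro CollectI exI[of _ 0] exI[of _ x]) simp
      qed
    qed
  qed
  ultimately have "v \<in> {w + u |w u. w \<in> W \<and> u \<in> low \<mu>}" by blast
  then show ?thesis by blast
qed

text \<open>The product of the factors L - (\<mu> - j) over the list. Each element of
  \<open>low \<mu>\<close> is killed by some such product, while an eigenvector for \<mu> is
  multiplied by the product of the j >= 1; this separates the two.\<close>

definition Lprod :: "complex \<Rightarrow> nat list \<Rightarrow> 'a \<Rightarrow> 'a" where
  "Lprod \<mu> js = foldr (\<lambda>j f v. L (f v) - sc (\<mu> - of_nat j) (f v)) js (\<lambda>v. v)"

lemma Lprod_simps: "Lprod \<mu> [] v = v"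
  "Lprod \<mu> (j # js) v = L (Lprod \<mu> js v) - sc (\<mu> - of_nat j) (Lprod \<mu> js v)"
  by (simp_all add: Lprod_def)

lemma Lprod_lin: "lin_on UNIV (Lprod \<mu> js)"
proof (induction js)
  case (Cons j js)
  then show ?case
    using L_lin by (auto simp: lin_on_def Lprod_simps algebra_simps scale_left_commute)
qed (simp add: lin_on_def Lprod_simps)

lemma Lprod_eig: "x \<in> eig \<nu> \<Longrightarrow> Lprod \<mu> js x = sc (\<Prod>j\<leftarrow>js. \<nu> - \<mu> + of_nat j) x"
proof (induction js)
  case (Cons j js)
  then show ?case
    using lin_on_scale[OF L_lin] by (simp add: Lprod_simps eig_def algebra_simps)
qed (simp add: Lprod_simps)

lemma low_killed: "u \<in> low \<mu> \<Longrightarrow> \<exists>js. (\<forall>j\<in>set js. j \<ge> 1) \<and> Lprod \<mu> js u = 0"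
  unfolding low_def
proof (induction rule: span_induct_alt)
  case base
  then show ?case by (intro exI[of _ "[]"]) (simp add: Lprod_simps)
next
  case (step c x y)
  then obtain j js where j: "j \<ge> 1" "x \<in> eig (\<mu> - of_nat j)" "\<forall>j\<in>set js. j \<ge> 1" "Lprod \<mu> js y = 0" by auto
  have "Lprod \<mu> (j # js) y = 0"
    using j(4) lin_on_zero[OF L_lin subspace_UNIV] by (simp add: Lprod_simps)
  moreover have "Lprod \<mu> (j # js) x = 0" using Lprod_eig[OF j(2), of \<mu> "j # js"] by simp
  ultimately have "Lprod \<mu> (j # js) (sc c x + y) = 0"
    by (simp add: lin_on_add[OF Lprod_lin] lin_on_scale[OF Lprod_lin])
  then show ?case using j by (intro exI[of _ "j # js"]) simp
qed

lemma eig_low: "x \<in> eig \<mu> \<Longrightarrow> x \<in> low \<mu> \<Longrightarrow> x = 0"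
proof -
  assume x: "x \<in> eig \<mu>" "x \<in> low \<mu>"
  obtain js where js: "\<forall>j\<in>set js. j \<ge> 1" "Lprod \<mu> js x = 0" using low_killed[OF x(2)] by blast
  have "(\<Prod>j\<leftarrow>js. of_nat j :: complex) \<noteq> 0" using js(1) by (induction js) auto
  then show "x = 0" using Lprod_eig[OF x(1), of \<mu> js] js(2) by simp
qed

lemma low_shift: "low (\<mu> - of_nat j) \<subseteq> low \<mu>"
  unfolding low_def
proof (rule span_minimal[OF _ subspace_span], rule subsetI)
  fix x assume "x \<in> (\<Union>i\<in>{1::nat..}. eig (\<mu> - of_nat j - of_nat i))"
  then obtain i where i: "i \<ge> 1" "x \<in> eig (\<mu> - of_nat j - of_nat i)" by auto
  moreover have "\<mu> - of_nat j - of_nat i = \<mu> - of_nat (j + i)" by simp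
  ultimately have "x \<in> eig (\<mu> - of_nat (j + i))" "j + i \<ge> 1" by simp_all
  then show "x \<in> span (\<Union>j\<in>{1::nat..}. eig (\<mu> - of_nat j))" by (intro span_base) blast
qed

lemma top_space_stable: "v \<in> top_space \<Longrightarrow> t \<in> GG 0 \<Longrightarrow> t v \<in> top_space"
  unfolding top_space_def
proof (intro CollectI allI impI ballI)
  fix d g assume v: "v \<in> {v. \<forall>d>0. \<forall>g\<in>GG d. g v = 0}" and t: "t \<in> GG 0" and dg: "(d::int) > 0" "g \<in> GG d"
  obtain c1 c2 where c: "c1 \<in> GG (d + 0)" "c2 \<in> GG (d + 0)" "\<forall>v. g (t v) - t (g v) = c1 v + c2 v"
    using GG_br[OF dg(2) t] by blast
  have "g v = 0" "c1 v = 0" "c2 v = 0" using v dg c by auto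
  moreover have "t 0 = 0" by (rule lin_on_zero[OF GG_lin[OF t] subspace_UNIV])
  ultimately show "g (t v) = 0" using spec[OF c(3), of v] by simp
qed

text \<open>While a product of factors L - (l - j) reduces u to 0, the last non-zero intermediate
  vector is an eigenvector in the top space at a level l - j. It would generate V from below, and
  \<open>w0\<close>, of level l, would have no place in it.\<close>

lemma no_lower:
  assumes "u \<in> top_space" "u \<in> low \<l>"
  shows "u = 0"
proof (rule ccontr)
  assume u: "u \<noteq> 0"
  obtain js where js: "\<forall>j\<in>set js. j \<ge> 1" "Lprod \<l> js u = 0" using low_killed[OF assms(2)] by blast
  have top: "Lprod \<l> ks u \<in> top_space" for ks
    by (induction ks) (use assms(1) top_space_L in \<open>auto simp: Lprod_simps\<close>)
  have "\<exists>j\<ge>1. \<exists>u'\<in>top_space. u' \<noteq> 0 \<and> u' \<in> eig (\<l> - of_nat j)"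
    using js
  proof (induction js)
    case Nil
    then show ?case using u by (simp add: Lprod_simps)
  next
    case (Cons j js)
    show ?case
    proof (cases "Lprod \<l> js u = 0")
      case True
      then show ?thesis using Cons by simp
    next
      case False
      moreover have "Lprod \<l> js u \<in> eig (\<l> - of_nat j)" using Cons.prems(2) by (simp add: Lprod_simps eig_def)
      ultimately show ?thesis using top Cons.prems(1) by auto
    qed
  qed
  then obtain j u' where j: "j \<ge> 1" "u' \<in> top_space" "u' \<noteq> 0" "u' \<in> eig (\<l> - of_nat j)" by blast
  let ?W = "top_space \<inter> eig (\<l> - of_nat j)"
  have "\<exists>w\<in>?W. \<exists>u\<in>low (\<l> - of_nat j). w0 = w + u"
  proof (rule cover)
    show "subspace ?W" by (rule subspace_inter[OF top_space_subspace eig_subspace])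
    show "?W \<noteq> {0}" using j by blast
    show "maps ?W g" if "g \<in> GG 0" for g
      using that top_space_stable eig_GG[of _ _ g 0] by auto
  qed auto
  then obtain w x where wx: "w \<in> ?W" "x \<in> low (\<l> - of_nat j)" "w0 = w + x" by blast
  have "w \<in> low \<l>" using wx(1) j(1) unfolding low_def by (intro span_base) auto
  moreover have "x \<in> low \<l>" using wx(2) low_shift by blast
  ultimately have "w0 \<in> low \<l>" unfolding wx(3) low_def by (rule span_add)
  then show False using eig_low[of w0 \<l>] w0 by (simp add: eig_def)
qed

lemma w0_top: "w0 \<in> top_space \<inter> eig \<l>"
  using w0 by (simp add: top_space_def eig_def)

text \<open>By \<open>cover\<close>, v = w + u for every top vector v; then u is both a top vector
  and low, so it is 0.\<close>

lemma top_in_stable: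
  assumes "subspace W" "W \<subseteq> top_space" "W \<subseteq> eig \<l>" "W \<noteq> {0}" "\<And>g. g \<in> GG 0 \<Longrightarrow> maps W g"
  shows "W = top_space"
proof
  show "top_space \<subseteq> W"
  proof
    fix v assume v: "v \<in> top_space"
    obtain w u where wu: "w \<in> W" "u \<in> low \<l>" "v = w + u" using cover[OF assms] by blast
    have "v - w \<in> top_space" using v wu assms(2) by (intro subspace_diff[OF top_space_subspace]) auto
    then have "u = 0" using no_lower wu by simp
    then show "v \<in> W" using wu by simp
  qed
qed (rule assms)

lemma top_eig: "top_space \<subseteq> eig \<l>"
proof -
  have "top_space \<inter> eig \<l> = top_space"
  proof (rule top_in_stable)
    show "subspace (top_space \<inter> eig \<l>)" by (rule subspace_inter[OF top_space_subspace eig_subspace])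
    show "top_space \<inter> eig \<l> \<noteq> {0}" using w0_top w0(1) by blast
    show "maps (top_space \<inter> eig \<l>) g" if "g \<in> GG 0" for g
      using that top_space_stable eig_GG[of _ _ g 0] by auto
  qed auto
  then show ?thesis by blast
qed

theorem top_irreducible:
  assumes "subspace W" "W \<subseteq> top_space" "W \<noteq> {0}" "\<And>g. g \<in> GG 0 \<Longrightarrow> maps W g"
  shows "W = top_space"
  using top_in_stable[OF assms(1,2) _ assms(3,4)] top_eig assms(2) by blast

end

section \<open>Commuting operators normalized by an irreducible family\<close>

locale irr_system = cvs sc for sc :: "complex \<Rightarrow> 'a::ab_group_add \<Rightarrow> 'a" +
  fixes M :: "'a set" and TT :: "('a \<Rightarrow> 'a) set"
  assumes M_sub: "subspace M"
    and TT_lin: "t \<in> TT \<Longrightarrow> lin_on M t" and TT_maps: "t \<in> TT \<Longrightarrow> maps M t"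
    and M_irr: "subspace W \<Longrightarrow> W \<subseteq> M \<Longrightarrow> W \<noteq> {0} \<Longrightarrow> (\<And>t. t \<in> TT \<Longrightarrow> maps W t) \<Longrightarrow> W = M"
    and M_nz: "M \<noteq> {0}"
begin

text \<open>Failure of injectivity on M, meant for linear x. In the commutative algebras considered
  here it is equivalent to local nilpotency, and such elements form a prime ideal.\<close>

definition sing :: "('a \<Rightarrow> 'a) \<Rightarrow> bool" where
  "sing x \<longleftrightarrow> (\<exists>v\<in>M. v \<noteq> 0 \<and> x v = 0)"

inductive_set alg :: "('a \<Rightarrow> 'a) set \<Rightarrow> ('a \<Rightarrow> 'a) set" for B where
  alg_base: "b \<in> B \<Longrightarrow> b \<in> alg B"
| alg_id: "(\<lambda>v. v) \<in> alg B"
| alg_add: "x \<in> alg B \<Longrightarrow> y \<in> alg B \<Longrightarrow> (\<lambda>v. x v + y v) \<in> alg B"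
| alg_scale: "x \<in> alg B \<Longrightarrow> (\<lambda>v. sc c (x v)) \<in> alg B"
| alg_comp: "x \<in> alg B \<Longrightarrow> y \<in> alg B \<Longrightarrow> (\<lambda>v. x (y v)) \<in> alg B"

lemma alg_diff: "x \<in> alg B \<Longrightarrow> y \<in> alg B \<Longrightarrow> (\<lambda>v. x v - y v) \<in> alg B"
  using alg_add[OF _ alg_scale[of y B "-1"], of x] by simp

lemma alg_pow: "x \<in> alg B \<Longrightarrow> x ^^ n \<in> alg B"
proof (induction n)
  case 0
  then show ?case using alg_id by (simp add: id_def)
next
  case (Suc n)
  then show ?case using alg_comp[of x B "x ^^ n"] by (simp add: comp_def)
qed

text \<open>Commutation and stability under commutators are demanded on generators and only on M;
  they extend to the generated algebra by the product rule.\<close>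

definition base_ok :: "('a \<Rightarrow> 'a) set \<Rightarrow> bool" where
  "base_ok B \<longleftrightarrow> (\<forall>b\<in>B. lin_on M b \<and> maps M b) \<and> (\<forall>b\<in>B. \<forall>c\<in>B. \<forall>v\<in>M. b (c v) = c (b v)) \<and>
     (\<forall>t\<in>TT. \<forall>b\<in>B. \<exists>c\<in>alg B. \<forall>v\<in>M. t (b v) - b (t v) = c v)"

end

locale irr_comm = irr_system sc M TT
  for sc :: "complex \<Rightarrow> 'a::ab_group_add \<Rightarrow> 'a" and M :: "'a set" and TT :: "('a \<Rightarrow> 'a) set" +
  fixes B :: "('a \<Rightarrow> 'a) set"
  assumes B_ok: "base_ok B"
begin

abbreviation "CC \<equiv> alg B"

lemma alg_lm: "x \<in> CC \<Longrightarrow> lin_on M x \<and> maps M x"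
proof (induction rule: alg.induct)
  case (alg_base b)
  then show ?case using B_ok by (auto simp: base_ok_def)
next
  case alg_id
  then show ?case by (simp add: lin_on_def)
next
  case (alg_add x y)
  then show ?case using subspace_add[OF M_sub] by (auto simp: lin_on_def algebra_simps)
next
  case (alg_scale x c)
  then show ?case using subspace_scale[OF M_sub] by (auto simp: lin_on_def algebra_simps)
next
  case (alg_comp x y)
  then show ?case by (auto simp: lin_on_def)
qed

lemma CC_lin: "x \<in> CC \<Longrightarrow> lin_on M x"
  and CC_maps: "x \<in> CC \<Longrightarrow> v \<in> M \<Longrightarrow> x v \<in> M"
  using alg_lm by auto

lemma CC_zero: "x \<in> CC \<Longrightarrow> x 0 = 0"
  by (rule lin_on_zero[OF CC_lin M_sub])

lemma CC_comm:
  assumes "x \<in> CC" "y \<in> CC" "v \<in> M"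
  shows "x (y v) = y (x v)"
proof -
  have b: "b (y v) = y (b v)" if "b \<in> B" "y \<in> CC" "v \<in> M" for b y v
    using that(2,3)
  proof (induction arbitrary: v rule: alg.induct)
    case (alg_base c)
    then show ?case using B_ok that(1) by (auto simp: base_ok_def)
  next
    case alg_id
    then show ?case by simp
  next
    case (alg_add x y)
    then show ?case
      using lin_on_add[OF CC_lin[OF alg.alg_base[OF that(1)]]] CC_maps by simp
  next
    case (alg_scale x c)
    then show ?case
      using lin_on_scale[OF CC_lin[OF alg.alg_base[OF that(1)]]] CC_maps by simp
  next
    case (alg_comp x y)
    then show ?case using CC_maps by simp
  qed
  show ?thesis
    using assms(1,3)
  proof (induction arbitrary: v rule: alg.induct)
    case (alg_base c)
    then show ?case using b assms(2) by blast
  next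
    case alg_id
    then show ?case by simp
  next
    case (alg_add x z)
    then show ?case using lin_on_add[OF CC_lin[OF assms(2)]] CC_maps by simp
  next
    case (alg_scale x c)
    then show ?case using lin_on_scale[OF CC_lin[OF assms(2)]] CC_maps by simp
  next
    case (alg_comp x z)
    then show ?case using CC_maps by simp
  qed
qed

lemma CC_deriv:
  assumes "t \<in> TT" "x \<in> CC"
  shows "\<exists>y\<in>CC. \<forall>v\<in>M. t (x v) - x (t v) = y v"
  using assms(2)
proof (induction rule: alg.induct)
  case (alg_base b)
  then show ?case using B_ok assms(1) by (auto simp: base_ok_def)
next
  case alg_id
  have "(\<lambda>v. sc 0 v) \<in> CC" by (rule alg.alg_scale[OF alg.alg_id])
  then show ?case by (intro bexI[of _ "\<lambda>v. sc 0 v"]) auto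
next
  case (alg_add x y)
  then obtain x' y' where d: "x' \<in> CC" "\<forall>v\<in>M. t (x v) - x (t v) = x' v" "y' \<in> CC" "\<forall>v\<in>M. t (y v) - y (t v) = y' v"
    by blast
  have "t (x v + y v) - (x (t v) + y (t v)) = x' v + y' v" if "v \<in> M" for v
  proof -
    have "t (x v + y v) = t (x v) + t (y v)" using lin_on_add[OF TT_lin[OF assms(1)]] CC_maps alg_add that by blast
    then show ?thesis using d that by (metis add_diff_add)
  qed
  then show ?case using alg.alg_add[OF d(1,3)] by (intro bexI[of _ "\<lambda>v. x' v + y' v"]) auto
next
  case (alg_scale x c)
  then obtain x' where d: "x' \<in> CC" "\<forall>v\<in>M. t (x v) - x (t v) = x' v" by blast
  have "t (sc c (x v)) - sc c (x (t v)) = sc c (x' v)" if "v \<in> M" for v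
  proof -
    have "t (sc c (x v)) = sc c (t (x v))" using lin_on_scale[OF TT_lin[OF assms(1)]] CC_maps alg_scale that by blast
    then show ?thesis using d that by (simp add: scale_right_diff_distrib[symmetric])
  qed
  then show ?case using alg.alg_scale[OF d(1)] by (intro bexI[of _ "\<lambda>v. sc c (x' v)"]) auto
next
  case (alg_comp x y)
  then obtain x' y' where d: "x' \<in> CC" "\<forall>v\<in>M. t (x v) - x (t v) = x' v" "y' \<in> CC" "\<forall>v\<in>M. t (y v) - y (t v) = y' v"
    by blast
  have "t (x (y v)) - x (y (t v)) = x' (y v) + x (y' v)" if v: "v \<in> M" for v
  proof -
    have tv: "t v \<in> M" using TT_maps[OF assms(1)] v by blast
    have "t (x (y v)) - x (t (y v)) = x' (y v)" using d(2) CC_maps[OF alg_comp.hyps(2) v] by blast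
    moreover have "x (t (y v)) - x (y (t v)) = x (y' v)"
    proof -
      have "x (t (y v) - y (t v)) = x (t (y v)) - x (y (t v))"
        by (rule lin_on_diff[OF CC_lin[OF alg_comp.hyps(1)] M_sub])
          (use CC_maps[OF alg_comp.hyps(2)] v tv TT_maps[OF assms(1)] in auto)
      then show ?thesis using d(4) v by simp
    qed
    ultimately show ?thesis by (simp add: algebra_simps)
  qed
  moreover have "(\<lambda>v. x' (y v) + x (y' v)) \<in> CC"
    by (rule alg.alg_add[OF alg.alg_comp[OF d(1) alg_comp.hyps(2)] alg.alg_comp[OF alg_comp.hyps(1) d(3)]])
  ultimately show ?case by (intro bexI[of _ "\<lambda>v. x' (y v) + x (y' v)"]) auto
qed

lemma pow_maps: "x \<in> CC \<Longrightarrow> v \<in> M \<Longrightarrow> (x ^^ n) v \<in> M"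
  using CC_maps[OF alg_pow] by blast

lemma pow_deriv:
  assumes t: "t \<in> TT" and x: "x \<in> CC" and y: "y \<in> CC" and d: "\<forall>v\<in>M. t (x v) - x (t v) = y v" and v: "v \<in> M"
  shows "t ((x ^^ n) v) = (x ^^ n) (t v) + sc (of_nat n) ((x ^^ (n - 1)) (y v))"
proof (induction n)
  case 0
  then show ?case by simp
next
  case (Suc n)
  have tv: "t v \<in> M" and yv: "y v \<in> M" using TT_maps[OF t] CC_maps[OF y] v by auto
  have xn: "(x ^^ n) v \<in> M" by (rule pow_maps[OF x v])
  have "t (x ((x ^^ n) v)) = x (t ((x ^^ n) v)) + y ((x ^^ n) v)"
    using bspec[OF d xn] by (simp add: algebra_simps)
  also have "x (t ((x ^^ n) v)) = x ((x ^^ n) (t v)) + sc (of_nat n) (x ((x ^^ (n - 1)) (y v)))"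
    unfolding Suc
    by (subst lin_on_add[OF CC_lin[OF x]])
      (auto simp: pow_maps[OF x] tv yv subspace_scale[OF M_sub] lin_on_scale[OF CC_lin[OF x]])
  also have "sc (of_nat n) (x ((x ^^ (n - 1)) (y v))) = sc (of_nat n) ((x ^^ n) (y v))"
    by (cases n) auto
  also have "y ((x ^^ n) v) = (x ^^ n) (y v)" by (rule CC_comm[OF y alg_pow[OF x] v])
  finally show ?case by (simp add: algebra_simps scale_left_distrib)
qed

section \<open>The alternative between injective and locally nilpotent elements\<close>

lemma pow_zero_le:
  assumes "x \<in> CC" "(x ^^ n) v = 0" "n \<le> m"
  shows "(x ^^ m) v = 0"
proof -
  have "(x ^^ ((m - n) + n)) v = (x ^^ (m - n)) ((x ^^ n) v)" by (simp add: funpow_add)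
  then show ?thesis using assms CC_zero[OF alg_pow[OF assms(1)]] by simp
qed

text \<open>The vectors killed by a power of x form a subspace stable under TT: by the product rule
  x^n a = 0 implies x^(n+1) (t a) = 0, as [t, x] commutes with x. Irreducibility makes it all of
  M.\<close>

lemma sing_nil:
  assumes x: "x \<in> CC" and s: "sing x" and v: "v \<in> M"
  shows "\<exists>n. (x ^^ n) v = 0"
proof -
  define W where "W = {v \<in> M. \<exists>n. (x ^^ n) v = 0}"
  note lp = CC_lin[OF alg_pow[OF x]]
  have "W = M"
  proof (rule M_irr)
    show "subspace W"
    proof (rule subspaceI)
      show "0 \<in> W" using subspace_0[OF M_sub] CC_zero[OF alg_pow[OF x]] by (auto simp: W_def)
      show "a + b \<in> W" if ab: "a \<in> W" "b \<in> W" for a b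
      proof -
        obtain m n where mn: "(x ^^ m) a = 0" "(x ^^ n) b = 0" using ab by (auto simp: W_def)
        have "(x ^^ (max m n)) (a + b) = 0"
          using pow_zero_le[OF x mn(1), of "max m n"] pow_zero_le[OF x mn(2), of "max m n"] ab
          by (subst lin_on_add[OF lp]) (auto simp: W_def)
        then show ?thesis using ab subspace_add[OF M_sub] by (auto simp: W_def)
      qed
      show "sc c a \<in> W" if "a \<in> W" for c a
        using that lin_on_scale[OF lp] subspace_scale[OF M_sub] by (fastforce simp: W_def)
    qed
    show "W \<subseteq> M" by (auto simp: W_def)
    obtain u where u: "u \<in> M" "u \<noteq> 0" "x u = 0" using s by (auto simp: sing_def)
    then have "u \<in> W" by (auto simp: W_def intro!: exI[of _ 1])
    then show "W \<noteq> {0}" using u by blast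
    show "maps W t" if t: "t \<in> TT" for t
    proof
      fix a assume a: "a \<in> W"
      then obtain n where n: "(x ^^ n) a = 0" by (auto simp: W_def)
      have aM: "a \<in> M" using a by (simp add: W_def)
      obtain y where y: "y \<in> CC" "\<forall>v\<in>M. t (x v) - x (t v) = y v" using CC_deriv[OF t x] by blast
      have t0: "t 0 = 0" by (rule lin_on_zero[OF TT_lin[OF t] M_sub])
      have "(x ^^ n) (y a) = 0"
        using CC_comm[OF alg_pow[OF x] y(1) aM, of n] n CC_zero[OF y(1)] by simp
      then have "(x ^^ Suc n) (t a) = 0"
        using pow_deriv[OF t x y aM, of "Suc n"] pow_zero_le[OF x n, of "Suc n"] t0 by simp
      then show "t a \<in> W" using TT_maps[OF t] aM unfolding W_def by blast
    qed
  qed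
  then show ?thesis using v by (auto simp: W_def)
qed

lemma nil_kernel:
  assumes x: "x \<in> CC" and s: "sing x" and v: "v \<in> M" "v \<noteq> 0"
  shows "\<exists>n. (x ^^ n) v \<noteq> 0 \<and> (x ^^ Suc n) v = 0"
proof -
  obtain n where n: "(x ^^ n) v = 0" using sing_nil[OF x s v(1)] by blast
  define i where "i = (LEAST n. (x ^^ n) v = 0)"
  have i: "(x ^^ i) v = 0" unfolding i_def by (rule LeastI[of _ n]) (rule n)
  have "i \<noteq> 0" using i v(2) by (intro notI) simp
  then obtain j where j: "i = Suc j" by (cases i) auto
  have "(x ^^ j) v \<noteq> 0" using not_less_Least[of j "\<lambda>n. (x ^^ n) v = 0"] j unfolding i_def[symmetric] by simp
  then show ?thesis using i j by blast
qed

text \<open>Local nilpotency supplies the common kernel vector: the last non-zero y^n v, for v in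
  the kernel of x, is killed by both.\<close>

lemma sing_add:
  assumes x: "x \<in> CC" "sing x" and y: "y \<in> CC" "sing y"
  shows "sing (\<lambda>v. x v + y v)"
proof -
  obtain v where v: "v \<in> M" "v \<noteq> 0" "x v = 0" using x by (auto simp: sing_def)
  obtain n where n: "(y ^^ n) v \<noteq> 0" "(y ^^ Suc n) v = 0" using nil_kernel[OF y v(1,2)] by blast
  have "x ((y ^^ n) v) = 0"
    using CC_comm[OF x(1) alg_pow[OF y(1)] v(1)] v(3) CC_zero[OF alg_pow[OF y(1)]] by simp
  then show ?thesis using n pow_maps[OF y(1) v(1)] unfolding sing_def by (intro bexI[of _ "(y ^^ n) v"]) auto
qed

lemma sing_scale: "x \<in> CC \<Longrightarrow> sing x \<Longrightarrow> sing (\<lambda>v. sc c (x v))"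
  by (auto simp: sing_def)

lemma sing_diff:
  assumes "x \<in> CC" "sing x" "y \<in> CC" "sing y"
  shows "sing (\<lambda>v. x v - y v)"
  using sing_add[OF assms(1,2) alg_scale[OF assms(3)] sing_scale[OF assms(3,4)], of "-1"] by simp

lemma sing_comp1:
  assumes "x \<in> CC" "sing x" "y \<in> CC"
  shows "sing (\<lambda>v. y (x v))"
proof -
  obtain v where "v \<in> M" "v \<noteq> 0" "x v = 0" using assms(2) unfolding sing_def by blast
  then show ?thesis using CC_zero[OF assms(3)] unfolding sing_def by (intro bexI[of _ v]) simp_all
qed

lemma sing_cancel:
  assumes "y \<in> CC" "\<not> sing y" "x \<in> CC" "sing (\<lambda>v. y (x v))"
  shows "sing x"
  using assms CC_maps unfolding sing_def by blast

lemma sing_cong: "(\<And>v. v \<in> M \<Longrightarrow> x v = y v) \<Longrightarrow> sing x \<longleftrightarrow> sing y"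
  by (auto simp: sing_def)

lemma nonsing_comp: "x \<in> CC \<Longrightarrow> y \<in> CC \<Longrightarrow> \<not> sing x \<Longrightarrow> \<not> sing y \<Longrightarrow> \<not> sing (\<lambda>v. x (y v))"
  using CC_maps unfolding sing_def by blast

lemma nonsing_pow: "x \<in> CC \<Longrightarrow> \<not> sing x \<Longrightarrow> \<not> sing (x ^^ n)"
proof (induction n)
  case 0
  then show ?case by (simp add: sing_def)
next
  case (Suc n)
  have "\<not> sing (\<lambda>v. x ((x ^^ n) v))"
    by (rule nonsing_comp[OF Suc.prems(1) alg_pow[OF Suc.prems(1)] Suc.prems(2) Suc.IH[OF Suc.prems]])
  then show ?case by (simp add: comp_def)
qed

text \<open>The operators f shift degrees and do not preserve E. Each is composed with an injective
  u that returns to E, which changes neither its kernel nor its nilpotency.\<close>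

lemma common_kernel_M:
  assumes "fdim E" "E \<subseteq> M" "v0 \<in> E" "v0 \<noteq> 0"
    "\<And>f. f \<in> FF \<Longrightarrow> \<exists>u\<in>CC. f \<in> CC \<and> sing f \<and> \<not> sing u \<and> (\<forall>x\<in>E. u (f x) \<in> E)"
  shows "\<exists>v\<in>E. v \<noteq> 0 \<and> (\<forall>f\<in>FF. f v = 0)"
proof -
  have "\<exists>u. \<forall>f\<in>FF. u f \<in> CC \<and> f \<in> CC \<and> sing f \<and> \<not> sing (u f) \<and> (\<forall>x\<in>E. u f (f x) \<in> E)"
    by (rule bchoice) (use assms(5) in blast)
  then obtain u where u: "\<And>f. f \<in> FF \<Longrightarrow> u f \<in> CC \<and> f \<in> CC \<and> sing f \<and> \<not> sing (u f) \<and> (\<forall>x\<in>E. u f (f x) \<in> E)"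
    by blast
  let ?g = "\<lambda>f v. u f (f v)"
  have gC: "?g f \<in> CC" if "f \<in> FF" for f using alg_comp[of "u f" B f] u[OF that] by simp
  have "\<exists>v\<in>E. v \<noteq> 0 \<and> (\<forall>g\<in>?g ` FF. g v = 0)"
  proof (rule common_kernel[OF assms(1,3,4)])
    show "lin_on E g \<and> maps E g" if "g \<in> ?g ` FF" for g
      using that gC u lin_on_subset[OF CC_lin assms(2)] by auto
    show "g (h x) = h (g x)" if "g \<in> ?g ` FF" "h \<in> ?g ` FF" "x \<in> E" for g h x
    proof -
      obtain f f' where f: "f \<in> FF" "g = ?g f" "f' \<in> FF" "h = ?g f'" using \<open>g \<in> ?g ` FF\<close> \<open>h \<in> ?g ` FF\<close> by blast
      show ?thesis unfolding f(2,4) by (rule CC_comm[OF gC[OF f(1)] gC[OF f(3)]]) (use that assms(2) in blast)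
    qed
    show "\<exists>n. (g ^^ n) x = 0" if gx: "g \<in> ?g ` FF" "x \<in> E" for g x
    proof -
      obtain f where f: "f \<in> FF" "g = ?g f" using gx by blast
      then have "sing g" using u[OF f(1)] sing_comp1[of f "u f"] by blast
      then show ?thesis using sing_nil[of g x] gC[OF f(1)] f gx assms(2) by blast
    qed
  qed
  then obtain v where v: "v \<in> E" "v \<noteq> 0" "\<forall>f\<in>FF. u f (f v) = 0" by auto
  have "f v = 0" if "f \<in> FF" for f
    using u[OF that] v assms(2) that CC_maps[of f v] unfolding sing_def by blast
  then show ?thesis using v by blast
qed

end

subsection \<open>Homogeneous operators\<close>

locale irr_graded = irr_comm sc M TT B
  for sc :: "complex \<Rightarrow> 'a::ab_group_add \<Rightarrow> 'a" and M :: "'a set" and TT :: "('a \<Rightarrow> 'a) set" and B +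
  fixes Mk :: "int ^ 'n::finite \<Rightarrow> 'a set" and GA :: "(int ^ 'n) set"
  assumes Mk_fdim: "fdim (Mk k)" and Mk_M: "Mk k \<subseteq> M" and Mk_0: "Mk 0 \<noteq> {0}"
begin

definition hom :: "('a \<Rightarrow> 'a) \<Rightarrow> int ^ 'n \<Rightarrow> bool" where
  "hom x b \<longleftrightarrow> (\<forall>k. \<forall>v\<in>Mk k. x v \<in> Mk (k + b))"

text \<open>Injective elements of opposite degrees replace invertible ones. Only some positive
  multiple of each b is demanded, because this weaker form is known before all central operators are
  shown to be injective.\<close>

definition units :: bool where
  "units \<longleftrightarrow> (\<forall>b\<in>GA. \<exists>m>0. \<exists>p\<in>CC. \<exists>q\<in>CC. \<not> sing p \<and> \<not> sing q \<and>
     hom p (of_nat m *s b) \<and> hom q (- (of_nat m *s b)))"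

lemma hom_comp: "hom x a \<Longrightarrow> hom y b \<Longrightarrow> hom (\<lambda>v. x (y v)) (a + b)"
proof -
  assume h: "hom x a" "hom y b"
  have "x (y v) \<in> Mk (k + (a + b))" if "v \<in> Mk k" for k v
  proof -
    have "y v \<in> Mk (k + b)" using h(2) that by (simp add: hom_def)
    then have "x (y v) \<in> Mk (k + b + a)" using h(1) unfolding hom_def by (simp only:)
    then show ?thesis by (simp only: add_ac)
  qed
  then show ?thesis by (simp add: hom_def)
qed

lemma hom_diff: "hom x a \<Longrightarrow> hom y a \<Longrightarrow> hom (\<lambda>v. x v - y v) a"
  using subspace_diff[OF fdim_subspace[OF Mk_fdim]] by (simp add: hom_def)

lemma hom_scale: "hom x a \<Longrightarrow> hom (\<lambda>v. sc c (x v)) a"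
  using subspace_scale[OF fdim_subspace[OF Mk_fdim]] by (simp add: hom_def)

lemma smult_Suc: "(of_nat (Suc n) :: int) *s (b :: int ^ 'n) = b + of_nat n *s b"
  by (simp add: vec_eq_iff algebra_simps)

lemma hom_pow: "hom x a \<Longrightarrow> hom (x ^^ n) (of_nat n *s a)"
proof (induction n)
  case 0
  then show ?case by (simp add: hom_def)
next
  case (Suc n)
  then show ?case
    using hom_comp[OF Suc.prems Suc.IH[OF Suc.prems]] by (simp add: smult_Suc comp_def del: of_nat_Suc)
qed

lemma hom_M: "hom x a \<Longrightarrow> v \<in> Mk k \<Longrightarrow> x v \<in> Mk (k + a)"
  by (simp add: hom_def)

lemma ex_Mk0: "\<exists>v\<in>Mk 0. v \<noteq> 0"
  using Mk_0 subspace_0[OF fdim_subspace[OF Mk_fdim]] by blast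

lemma comp_pow: "x \<in> CC \<Longrightarrow> w \<in> CC \<Longrightarrow> v \<in> M \<Longrightarrow>
    ((\<lambda>v. x (w v)) ^^ R) v = (w ^^ R) ((x ^^ R) v)"
proof (induction R)
  case (Suc R)
  have "((\<lambda>v. x (w v)) ^^ Suc R) v = x (w ((w ^^ R) ((x ^^ R) v)))" using Suc by simp
  also have "\<dots> = x ((w ^^ Suc R) ((x ^^ R) v))" by simp
  also have "\<dots> = (w ^^ Suc R) (x ((x ^^ R) v))"
    by (rule CC_comm[OF Suc.prems(1) alg_pow[OF Suc.prems(2)] pow_maps[OF Suc.prems(1,3)]])
  finally show ?case by simp
qed simp

text \<open>If \<open>[t, x]\<close> were injective, the nilpotency order of \<open>x\<close> would grow by one with every
  application of \<open>t\<close>; the units bound it along the orbit.\<close>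

lemma sing_deriv:
  assumes un: "units" and t: "t \<in> TT" "hom t b" "b \<in> GA" and x: "x \<in> CC" "hom x a" "a \<in> GA" "sing x"
    and y: "y \<in> CC" "\<And>v. v \<in> M \<Longrightarrow> t (x v) - x (t v) = y v"
  shows "sing y"
proof (rule ccontr)
  assume ns: "\<not> sing y"
  obtain m p q where m: "m > 0" "q \<in> CC" "\<not> sing q" "hom q (- (of_nat m *s b))"
    using un t(3) unfolding units_def by blast
  obtain l p' w where l: "l > 0" "w \<in> CC" "\<not> sing w" "hom w (- (of_nat l *s a))"
    using un x(3) unfolding units_def by blast
  \<comment> \<open>\<open>N\<close> has degree 0 and so preserves each finite-dimensional
    component; as w is injective, a bound for \<open>N\<close> is a bound for x.\<close>
  define N where "N = (\<lambda>v. (x ^^ l) (w v))"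
  have NC: "N \<in> CC" unfolding N_def by (rule alg_comp[OF alg_pow[OF x(1)] l(2)])
  have Nh: "hom N 0" using hom_comp[OF hom_pow[OF x(2), of l] l(4)] by (simp add: N_def)
  have Ns: "sing N"
  proof -
    obtain v where v: "v \<in> M" "v \<noteq> 0" "x v = 0" using x(4) by (auto simp: sing_def)
    obtain l' where l': "l = Suc l'" using l(1) by (cases l) auto
    have "(x ^^ l) v = 0" using v(3) CC_zero[OF alg_pow[OF x(1)]] by (simp add: l' funpow_swap1)
    then have "N v = 0"
      unfolding N_def using CC_comm[OF alg_pow[OF x(1)] l(2) v(1)] CC_zero[OF l(2)] by simp
    then show ?thesis using v by (auto simp: sing_def)
  qed
  have "\<exists>Bs. finite Bs \<and> Mk k \<subseteq> span Bs" for k using Mk_fdim by (auto simp: fdim_def)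
  then obtain Bs where Bs: "\<And>k. finite (Bs k)" "\<And>k. Mk k \<subseteq> span (Bs k)" by metis
  \<comment> \<open>One exponent for the degrees 0, b, ..., (m - 1) b. Powers of q, which are
    injective and commute with \<open>N\<close>, carry any degree i b back to one of these.\<close>
  define R where "R = (\<Sum>r<m. card (Bs (of_nat r *s b)))"
  have N0: "(N ^^ R) v = 0" if v: "v \<in> Mk (of_nat r *s b)" and r: "r < m" for v r
  proof -
    have vM: "v \<in> M" using v Mk_M by blast
    obtain n where n: "(N ^^ n) v = 0" using sing_nil[OF NC Ns vM] by blast
    have "maps (Mk (of_nat r *s b)) N" using hom_M[OF Nh] by simp
    then have "(N ^^ card (Bs (of_nat r *s b))) v = 0"
      using nilpotent_bound[OF Bs fdim_subspace[OF Mk_fdim] lin_on_subset[OF CC_lin[OF NC] Mk_M] _ v n] by blast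
    moreover have "card (Bs (of_nat r *s b)) \<le> R"
      unfolding R_def by (rule member_le_sum) (use r in auto)
    ultimately show ?thesis using pow_zero_le[OF NC] by blast
  qed
  have N1: "(N ^^ R) v = 0" if v: "v \<in> Mk (of_nat i *s b)" for v i
  proof -
    have vM: "v \<in> M" using v Mk_M by blast
    let ?j = "i div m"
    have "(q ^^ ?j) v \<in> Mk (of_nat i *s b + of_nat ?j *s (- (of_nat m *s b)))"
      by (rule hom_M[OF hom_pow[OF m(4)] v])
    moreover have "of_nat i *s b + of_nat ?j *s (- (of_nat m *s b)) = of_nat (i mod m) *s b"
    proof -
      have "int i = int (i div m) * int m + int (i mod m)"
        by (metis div_mult_mod_eq of_nat_add of_nat_mult)
      then show ?thesis by (simp add: vec_eq_iff algebra_simps)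
    qed
    ultimately have "(N ^^ R) ((q ^^ ?j) v) = 0" using N0 m(1) by simp
    then have "(q ^^ ?j) ((N ^^ R) v) = 0"
      using CC_comm[OF alg_pow[OF m(2)] alg_pow[OF NC] vM] by simp
    moreover have "\<not> sing (q ^^ ?j)" by (rule nonsing_pow[OF m(2,3)])
    ultimately show ?thesis using pow_maps[OF NC vM] by (auto simp: sing_def)
  qed
  have X1: "(x ^^ (l * R)) v = 0" if v: "v \<in> Mk (of_nat i *s b)" for v i
  proof -
    have vM: "v \<in> M" using v Mk_M by blast
    have "(N ^^ R) v = (w ^^ R) (((x ^^ l) ^^ R) v)"
      unfolding N_def by (rule comp_pow[OF alg_pow[OF x(1)] l(2) vM])
    then have "(w ^^ R) (((x ^^ l) ^^ R) v) = 0" using N1[OF v] by simp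
    moreover have "\<not> sing (w ^^ R)" by (rule nonsing_pow[OF l(2,3)])
    moreover have "((x ^^ l) ^^ R) v \<in> M" by (rule pow_maps[OF alg_pow[OF x(1)] vM])
    ultimately have "((x ^^ l) ^^ R) v = 0" by (auto simp: sing_def)
    then show ?thesis by (simp add: funpow_mult mult.commute)
  qed
  obtain v0 where v0: "v0 \<in> Mk 0" "v0 \<noteq> 0" using ex_Mk0 by blast
  then have v0M: "v0 \<in> M" using Mk_M by blast
  obtain n0 where n0: "(x ^^ n0) v0 \<noteq> 0" "(x ^^ Suc n0) v0 = 0" using nil_kernel[OF x(1,4) v0M v0(2)] by blast
  have t0: "t 0 = 0" by (rule lin_on_zero[OF TT_lin[OF t(1)] M_sub])
  have tM: "(t ^^ i) v0 \<in> Mk (of_nat i *s b)" for i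
    using hom_M[OF hom_pow[OF t(2), of i] v0(1)] by simp
  \<comment> \<open>The product rule shows that each application of t raises the nilpotency order of
    the vector by exactly one if y is injective.\<close>
  have ord: "(x ^^ (n0 + i)) ((t ^^ i) v0) \<noteq> 0 \<and> (x ^^ Suc (n0 + i)) ((t ^^ i) v0) = 0" for i
  proof (induction i)
    case 0
    then show ?case using n0 by simp
  next
    case (Suc i)
    let ?v = "(t ^^ i) v0" and ?n = "Suc (n0 + i)"
    have v: "?v \<in> M" using tM Mk_M by blast
    have d: "\<forall>v\<in>M. t (x v) - x (t v) = y v" using y(2) by blast
    have yx: "(x ^^ k) (y ?v) = y ((x ^^ k) ?v)" for k by (rule CC_comm[OF alg_pow[OF x(1)] y(1) v])
    have "t 0 = (x ^^ ?n) (t ?v) + sc (of_nat ?n) (y ((x ^^ (n0 + i)) ?v))"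
      using pow_deriv[OF t(1) x(1) y(1) d v, of ?n] Suc yx[of "n0 + i"] by simp
    then have 1: "(x ^^ ?n) (t ?v) = - sc (of_nat ?n) (y ((x ^^ (n0 + i)) ?v))"
      unfolding t0 by (simp only: eq_neg_iff_add_eq_0)
    have "y ((x ^^ (n0 + i)) ?v) \<noteq> 0"
      using ns Suc pow_maps[OF x(1) v] by (auto simp: sing_def)
    then have "(x ^^ ?n) (t ?v) \<noteq> 0" unfolding 1 by (simp del: of_nat_Suc)
    moreover have "(x ^^ Suc ?n) (t ?v) = 0"
    proof -
      have z: "(x ^^ Suc ?n) ?v = 0" by (rule pow_zero_le[OF x(1) conjunct2[OF Suc]]) simp
      have "t ((x ^^ Suc ?n) ?v) = (x ^^ Suc ?n) (t ?v) + sc (of_nat (Suc ?n)) ((x ^^ ?n) (y ?v))"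
        using pow_deriv[OF t(1) x(1) y(1) d v, of "Suc ?n"] by (simp only: diff_Suc_1)
      moreover have "(x ^^ ?n) (y ?v) = 0" unfolding yx using Suc CC_zero[OF y(1)] by (simp only:)
      ultimately show ?thesis unfolding z t0 by simp
    qed
    ultimately show ?case by simp
  qed
  have "(x ^^ (n0 + l * R)) ((t ^^ (l * R)) v0) = 0"
    by (rule pow_zero_le[OF x(1) X1[OF tM]]) simp
  then show False using ord[of "l * R"] by blast
qed

text \<open>The pencil of q x and q u on the component of degree 0, where q brings the degree back
  and q u is bijective. This is how every constant of proportionality first arises: some x - \<mu> u
  is not injective.\<close>

lemma eigen_ratio:
  assumes x: "x \<in> CC" "hom x a" and u: "u \<in> CC" "hom u a" "\<not> sing u"
    and q: "q \<in> CC" "hom q (- a)" "\<not> sing q"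
  shows "\<exists>\<mu>. sing (\<lambda>v. x v - sc \<mu> (u v))"
proof -
  obtain v0 where v0: "v0 \<in> Mk 0" "v0 \<noteq> 0" using ex_Mk0 by blast
  \<comment> \<open>\<open>q \<circ> u\<close> is an injective endomorphism of the finite-dimensional space \<open>Mk 0\<close>\<close>
  have "\<exists>v\<in>Mk 0. v \<noteq> 0 \<and> (\<exists>\<mu>. q (x v) = sc \<mu> (q (u v)))"
  proof (rule pencil[OF Mk_fdim])
    have maps0: "maps (Mk 0) (\<lambda>v. q (u v))" "maps (Mk 0) (\<lambda>v. q (x v))"
      using hom_M[OF hom_comp[OF q(2) u(2)]] hom_M[OF hom_comp[OF q(2) x(2)]] by simp_all
    have qu: "(\<lambda>v. q (u v)) \<in> CC" "(\<lambda>v. q (x v)) \<in> CC"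
      by (rule alg_comp[OF q(1) u(1)], rule alg_comp[OF q(1) x(1)])
    show l: "lin_on (Mk 0) (\<lambda>v. q (u v))" "lin_on (Mk 0) (\<lambda>v. q (x v))"
      by (rule lin_on_subset[OF CC_lin[OF qu(1)] Mk_M], rule lin_on_subset[OF CC_lin[OF qu(2)] Mk_M])
    show "v0 \<in> Mk 0" "v0 \<noteq> 0" by (fact v0)+
    have inj: "v = 0" if "v \<in> Mk 0" "q (u v) = 0" for v
      using nonsing_comp[OF q(1) u(1) q(3) u(3)] that Mk_M by (auto simp: sing_def)
    have "(\<lambda>v. q (u v)) ` Mk 0 = Mk 0" by (rule lin_inj_surj[OF Mk_fdim l(1) maps0(1) inj])
    then show "q (x v) \<in> (\<lambda>v. q (u v)) ` Mk 0" if "v \<in> Mk 0" for v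
      using maps0(2) that by blast
  qed
  then obtain v \<mu> where v: "v \<in> Mk 0" "v \<noteq> 0" "q (x v) = sc \<mu> (q (u v))" by blast
  have vM: "v \<in> M" using v Mk_M by blast
  have "q (x v - sc \<mu> (u v)) = 0"
    using v(3) lin_on_diff[OF CC_lin[OF q(1)] M_sub] lin_on_scale[OF CC_lin[OF q(1)]]
      CC_maps[OF x(1) vM] CC_maps[OF u(1) vM] subspace_scale[OF M_sub] by simp
  moreover have "x v - sc \<mu> (u v) \<in> M"
    using CC_maps[OF x(1) vM] CC_maps[OF u(1) vM] subspace_scale[OF M_sub] subspace_diff[OF M_sub] by simp
  ultimately have "x v - sc \<mu> (u v) = 0" using q(3) by (auto simp: sing_def)
  then show ?thesis using v vM by (auto simp: sing_def)
qed

end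

section \<open>Generators of the toroidal algebra by level\<close>

context tor_rep
begin

lemma D_zero: "D 0 r v = 0"
  by (simp add: D_def tD_zero rho_zero)

lemma D_scale: "dvalid u r \<Longrightarrow> D (c *s u) r v = sV c (D u r v)"
  by (simp add: D_def rho_scale tD_in_tor dvalid_def flip: tscale_tD)

lemma dvalid_scale: "dvalid u r \<Longrightarrow> dvalid (c *s u) r"
  by (simp add: dvalid_def dot_scale_left)

lemma d0_valid: "dvalid (axis i 1) 0"
  by (simp add: dvalid_def zero_lat cvec_zero dot_zero_right)

lemma dot_axis_cvec: "dot (axis i 1) (cvec k) = of_int (dcomp k i)"
  by (simp add: dot_axis_left cvec_def)

abbreviation dd :: "'n option \<Rightarrow> 'v \<Rightarrow> 'v" where "dd i \<equiv> D (axis i 1) 0"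

lemma dd_R: "x \<in> gdeg X k \<Longrightarrow> dd i (R x k v) = R x k (dd i v) + sV (of_int (dcomp k i)) (R x k v)"
  using D_R[OF d0_valid, of x k i v] by (simp add: dot_axis_cvec algebra_simps)

lemma dd_K: "r \<in> lat X \<Longrightarrow> dd i (Kw w r v) = Kw w r (dd i v) + sV (of_int (dcomp r i)) (Kw w r v)"
  using D_K[OF d0_valid, of r i w v] Kw_scale[of r "of_int (dcomp r i)" w v]
  by (simp add: dot_axis_cvec cvec_zero algebra_simps)

lemma dd_D: "dvalid u r \<Longrightarrow> dd i (D u r v) = D u r (dd i v) + sV (of_int (dcomp r i)) (D u r v)"
  using D_D[OF d0_valid, of u r i v] D_scale[of u r "of_int (dcomp r i)" v]
  by (simp add: dot_axis_cvec cvec_zero dot_zero_right cocycle_def Kw_zero algebra_simps)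

lemma h_R: "h \<in> H \<Longrightarrow> x \<in> gwt X k a \<Longrightarrow> R h 0 (R x k v) = R x k (R h 0 v) + sV (a h) (R x k v)"
proof -
  assume h: "h \<in> H" and x: "x \<in> gwt X k a"
  have hf: "h \<in> gfix X" using h H_fix by blast
  have xk: "x \<in> gdeg X k" "br h x = scl (a h) x" using x h by (auto simp: gwt_def)
  show ?thesis using R_R0[OF hf xk(1), of v] by (simp add: xk R_scale algebra_simps)
qed

lemma h_K: "h \<in> H \<Longrightarrow> r \<in> lat X \<Longrightarrow> R h 0 (Kw w r v) = Kw w r (R h 0 v)"
  using K_R[of r h 0 w v] H_fix by auto

lemma h_D: "h \<in> H \<Longrightarrow> dvalid u r \<Longrightarrow> R h 0 (D u r v) = D u r (R h 0 v)"
  using D_R[of u r h 0 v] H_fix by (auto simp: cvec_zero dot_zero_right)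

definition shifts :: "('v \<Rightarrow> 'v) \<Rightarrow> ('g \<Rightarrow> complex) \<Rightarrow> 'n deg \<Rightarrow> bool" where
  "shifts g a k \<longleftrightarrow> (\<forall>h\<in>H. \<forall>v. R h 0 (g v) = g (R h 0 v) + sV (a h) (g v)) \<and>
     (\<forall>i v. dd i (g v) = g (dd i v) + sV (of_int (dcomp k i)) (g v))"

lemma shifts_R: "x \<in> gwt X k a \<Longrightarrow> shifts (R x k) a k"
  using dd_R h_R by (auto simp: shifts_def gwt_def)

lemma shifts_K: "r \<in> lat X \<Longrightarrow> shifts (Kw w r) (\<lambda>_. 0) r"
  using dd_K h_K by (simp add: shifts_def)

lemma shifts_D: "dvalid u r \<Longrightarrow> shifts (D u r) (\<lambda>_. 0) r"
  using dd_D h_D by (simp add: shifts_def)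

subsection \<open>Weights and shifts\<close>

lemma HH_fst: "t \<in> HH X \<Longrightarrow> Poly_Mapping.lookup (fst t) 0 \<in> H"
  unfolding HH_def
proof (induction rule: T.span_induct_alt)
  case base
  then show ?case using G.subspace_0[OF H_subspace] by simp
next
  case (step c x y)
  have "Poly_Mapping.lookup (fst x) 0 \<in> H"
    using step(1) G.subspace_0[OF H_subspace] by (auto simp: tX_def tK_def tD_def)
  then show ?case
    using step(2) G.subspace_add[OF H_subspace] G.subspace_scale[OF H_subspace]
    by (cases x) (simp add: tscale_def lookup_add lookup_pm_scale)
qed

lemma fst_tscale: "Poly_Mapping.lookup (fst (tscale X c t)) 0 = scl c (Poly_Mapping.lookup (fst t) 0)"
  by (cases t) (simp add: tscale_def lookup_pm_scale)

lemma snd_tscale: "Poly_Mapping.lookup (snd (snd (tscale X c t))) k = c *s Poly_Mapping.lookup (snd (snd t)) k"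
  by (cases t) (simp add: tscale_def lookup_pm_scale)

lemma HH_add: "x \<in> HH X \<Longrightarrow> y \<in> HH X \<Longrightarrow> x + y \<in> HH X"
  and HH_scale: "x \<in> HH X \<Longrightarrow> tscale X c x \<in> HH X"
  unfolding HH_def by (rule T.span_add, assumption+, rule T.span_scale)

lemma ext_dual:
  assumes "a \<in> dual_space scl H"
  shows "ext_fun X a \<in> duals"
  using assms HH_fst HH_add HH_scale unfolding dual_space_def[of "tscale X"]
  by (auto simp: ext_fun_def lookup_add fst_tscale dual_space_def)

lemma delta_dual: "delta X i \<in> duals"
  using HH_add HH_scale unfolding dual_space_def by (auto simp: delta_def lookup_add snd_tscale)

lemma dual_add: "f \<in> duals \<Longrightarrow> g \<in> duals \<Longrightarrow> (\<lambda>h. f h + g h) \<in> duals"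
  unfolding dual_space_def by (auto simp: algebra_simps)

lemma dual_mult: "f \<in> duals \<Longrightarrow> (\<lambda>h. c * f h) \<in> duals"
  unfolding dual_space_def by (auto simp: algebra_simps)

lemma dual_zero: "(\<lambda>_. 0) \<in> duals"
  by (simp add: dual_space_def)

lemma dual_sum: "finite I \<Longrightarrow> (\<And>i. i \<in> I \<Longrightarrow> f i \<in> duals) \<Longrightarrow> (\<lambda>h. \<Sum>i\<in>I. f i h) \<in> duals"
proof (induction I rule: finite_induct)
  case empty
  then show ?case using dual_zero by simp
next
  case (insert i I)
  then show ?case using dual_add[of "f i" "\<lambda>h. \<Sum>i\<in>I. f i h"] by simp
qed

text \<open>The weight a + \<Sum> k_i \<delta>_i by which an operator of weight a and degree k moves
  weight spaces.\<close>

definition sh :: "('g \<Rightarrow> complex) \<Rightarrow> 'n deg \<Rightarrow> ('g, 'n) tor \<Rightarrow> complex" where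
  "sh a k t = ext_fun X a t + (\<Sum>i\<in>UNIV. of_int (dcomp k i) * delta X i t)"

lemma sh_dual: "a \<in> dual_space scl H \<Longrightarrow> sh a k \<in> duals"
proof -
  assume a: "a \<in> dual_space scl H"
  have "(\<lambda>t. \<Sum>i\<in>UNIV. of_int (dcomp k i) * delta X i t) \<in> duals"
    by (rule dual_sum) (simp_all add: dual_mult delta_dual)
  from dual_add[OF ext_dual[OF a] this] show ?thesis by (simp add: sh_def[abs_def])
qed

lemma dual_at_zero: "a \<in> dual_space scl H \<Longrightarrow> a 0 = 0"
proof -
  assume a: "a \<in> dual_space scl H"
  have "a (scl 0 0) = 0 * a 0" using a G.subspace_0[OF H_subspace] unfolding dual_space_def by blast
  then show ?thesis by simp
qed

lemma zero_dual: "(\<lambda>_. 0) \<in> dual_space scl H"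
  by (simp add: dual_space_def)

lemma sh_tX: "h \<in> H \<Longrightarrow> sh a k (tX h 0) = a h"
  using tX_HH[of h] by (simp add: sh_def ext_fun_def delta_def tX_def)

lemma tK_HH: "tK 0 i \<in> HH X"
  unfolding HH_def by (blast intro: T.span_base)

lemma sh_tK: "a \<in> dual_space scl H \<Longrightarrow> sh a k (tK 0 i) = 0"
  using tK_HH[of i] by (simp add: sh_def ext_fun_def delta_def tK_def dual_at_zero)

lemma sh_td: "a \<in> dual_space scl H \<Longrightarrow> sh a k (td i) = of_int (dcomp k i)"
proof -
  assume a: "a \<in> dual_space scl H"
  have "(\<Sum>j\<in>UNIV. of_int (dcomp k j) * delta X j (td i)) = (\<Sum>j\<in>UNIV. if j = i then of_int (dcomp k j) else 0)"
    using td_HH[of i] by (intro sum.cong refl) (simp add: delta_def tD_def axis_def)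
  then show ?thesis using td_HH[of i] by (simp add: sh_def ext_fun_def tD_def dual_at_zero[OF a])
qed

lemma dual_lin: "f \<in> duals \<Longrightarrow> x \<in> HH X \<Longrightarrow> y \<in> HH X \<Longrightarrow> f (tscale X c x + y) = c * f x + f y"
proof -
  assume f: "f \<in> duals" and xy: "x \<in> HH X" "y \<in> HH X"
  have "f (tscale X c x + y) = f (tscale X c x) + f y"
    using f HH_scale[OF xy(1)] xy(2) unfolding dual_space_def by blast
  moreover have "f (tscale X c x) = c * f x" using f xy(1) unfolding dual_space_def by blast
  ultimately show ?thesis by simp
qed

lemma wt_shift:
  assumes g: "shifts g a k" "V.lin_on UNIV g" and a: "a \<in> dual_space scl H" and L: "L \<in> duals" and v: "v \<in> wsp L"
  shows "g v \<in> wsp (\<lambda>t. L t + sh a k t)"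
proof -
  have w: "\<rho> t v = sV (L t) v" if "t \<in> HH X" for t using v that by (simp add: weight_space_def)
  have gs: "g (sV c v) = sV c (g v)" for c using V.lin_on_scale[OF g(2)] by simp
  have gen: "\<rho> t (g v) = sV (L t + sh a k t) (g v)"
    if t: "t \<in> {tX h 0 | h. h \<in> H} \<union> range (tK 0) \<union> range td" for t
  proof -
    consider h where "t = tX h 0" "h \<in> H" | i where "t = tK 0 i" | i where "t = td i" using t by blast
    then show ?thesis
    proof cases
      case 1
      have "R h 0 v = sV (L t) v" using w[OF tX_HH[OF 1(2)]] by (simp add: R_def 1)
      then have "R h 0 (g v) = sV (L t + a h) (g v)" using g(1) 1 gs by (simp add: shifts_def V.scale_left_distrib)
      then show ?thesis by (simp add: R_def 1 sh_tX)
    next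
      case 2
      have sc: "\<rho> t u = sV (axis i 1 $ None * of_int C0) u" for u
        using Kw_0[of "axis i 1" u] by (simp add: 2 Kw_def tK_tKw)
      have "\<rho> t (g v) = g (\<rho> t v)" unfolding sc by (simp add: gs)
      also have "\<dots> = sV (L t) (g v)" using w[OF tK_HH[of i]] by (simp add: gs 2)
      finally show ?thesis by (simp add: sh_tK[OF a] 2)
    next
      case 3
      have "dd i v = sV (L t) v" using w[OF td_HH[of i]] by (simp add: D_def 3)
      then have "dd i (g v) = sV (L t + of_int (dcomp k i)) (g v)" using g(1) gs by (simp add: shifts_def V.scale_left_distrib)
      then show ?thesis by (simp add: D_def 3 sh_td[OF a])
    qed
  qed
  have "\<rho> t (g v) = sV (L t + sh a k t) (g v) \<and> t \<in> HH X" if "t \<in> HH X" for t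
    using that unfolding HH_def
  proof (induction rule: T.span_induct_alt)
    case base
    have 0: "0 \<in> HH X" unfolding HH_def by (rule T.span_zero)
    have "L 0 = 0" "sh a k 0 = 0"
      using dual_lin[OF L 0 0, of 1] dual_lin[OF sh_dual[OF a] 0 0, of k 1] by simp_all
    then show ?case using rho_zero 0 by (simp add: HH_def)
  next
    case (step c x y)
    have xH: "x \<in> HH X" using step(1) unfolding HH_def by (rule T.span_base)
    have yH: "y \<in> HH X" using step(2) by (simp add: HH_def)
    have tor: "x \<in> tor X" "y \<in> tor X" using xH yH HH_tor by auto
    have "\<rho> (tscale X c x + y) (g v) = sV c (\<rho> x (g v)) + \<rho> y (g v)"
      using rho_add[OF T.subspace_scale[OF tor_subspace tor(1)] tor(2)] rho_scale[OF tor(1)] by simp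
    also have "\<dots> = sV (L (tscale X c x + y) + sh a k (tscale X c x + y)) (g v)"
      using gen[OF step(1)] step(2) dual_lin[OF L xH yH] dual_lin[OF sh_dual[OF a] xH yH]
      by (simp add: algebra_simps V.scale_left_distrib)
    finally show ?case using HH_add[OF HH_scale[OF xH] yH] by (simp add: HH_def)
  qed
  then show ?thesis by (simp add: weight_space_def)
qed

subsection \<open>Level sets of generators\<close>

text \<open>Generators acting on V, sorted by their eigenvalue under h1 + cc d_0. The zero operator
  belongs to every level, so that a vanishing commutator still counts as a member.\<close>

definition gens :: "int \<Rightarrow> ('v \<Rightarrow> 'v) set" where
  "gens d = {\<lambda>v. 0} \<union>
     {R x k | x k a. a \<in> dual_space scl H \<and> x \<in> gwt X k a \<and> a h1 + cc * of_int (fst k) = of_int d} \<union>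
     {Kw w r | w r. r \<in> lat X \<and> cc * of_int (fst r) = of_int d} \<union>
     {D u r | u r. dvalid u r \<and> cc * of_int (fst r) = of_int d}"

lemma gens_zero: "(\<lambda>v. 0) \<in> gens d"
  by (simp add: gens_def)

lemma gens_R: "a \<in> dual_space scl H \<Longrightarrow> x \<in> gwt X k a \<Longrightarrow> a h1 + cc * of_int (fst k) = of_int d \<Longrightarrow> R x k \<in> gens d"
  unfolding gens_def by blast

lemma gens_K: "r \<in> lat X \<Longrightarrow> cc * of_int (fst r) = of_int d \<Longrightarrow> Kw w r \<in> gens d"
  unfolding gens_def by blast

lemma gens_D: "dvalid u r \<Longrightarrow> cc * of_int (fst r) = of_int d \<Longrightarrow> D u r \<in> gens d"
  unfolding gens_def by blast

lemma gens_cases: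
  assumes "g \<in> gens d"
  obtains (zero) "g = (\<lambda>v. 0)"
  | (R) x k a where "g = R x k" "a \<in> dual_space scl H" "x \<in> gwt X k a" "a h1 + cc * of_int (fst k) = of_int d"
  | (K) w r where "g = Kw w r" "r \<in> lat X" "cc * of_int (fst r) = of_int d"
  | (D) u r where "g = D u r" "dvalid u r" "cc * of_int (fst r) = of_int d"
  using assms unfolding gens_def by blast

lemma gens_lin: "g \<in> gens d \<Longrightarrow> V.lin_on E g"
proof (erule gens_cases)
  show "g = (\<lambda>v. 0) \<Longrightarrow> V.lin_on E g" by (simp add: V.lin_on_def)
  show "V.lin_on E g" if "g = R x k" "x \<in> gwt X k a" for x k a using that R_lin by (simp add: gwt_def)
  show "V.lin_on E g" if "g = Kw w r" "r \<in> lat X" for w r using that Kw_lin by simp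
  show "V.lin_on E g" if "g = D u r" "dvalid u r" for u r using that D_lin by simp
qed

lemma gens_neg: "g \<in> gens d \<Longrightarrow> (\<lambda>v. - g v) \<in> gens d"
proof (erule gens_cases)
  show "g = (\<lambda>v. 0) \<Longrightarrow> (\<lambda>v. - g v) \<in> gens d" using gens_zero by simp
next
  fix x k a assume g: "g = R x k" "a \<in> dual_space scl H" "x \<in> gwt X k a" "a h1 + cc * of_int (fst k) = of_int d"
  have xk: "x \<in> gdeg X k" using g by (simp add: gwt_def)
  have "(\<lambda>v. - g v) = R (scl (-1) x) k" unfolding g(1) R_scale[OF xk, abs_def] by (simp add: fun_eq_iff R_scale[OF xk])
  moreover have "scl (-1) x \<in> gwt X k a"
    using g(3) G.subspace_scale[OF gdeg_subspace xk, of "-1"] by (simp add: gwt_def br_neg_right)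
  ultimately show "(\<lambda>v. - g v) \<in> gens d" using gens_R g by metis
next
  fix w r assume g: "g = Kw w r" "r \<in> lat X" "cc * of_int (fst r) = of_int d"
  have "(\<lambda>v. - g v) = Kw ((-1) *s w) r" unfolding g(1) by (rule ext) (simp only: Kw_scale[OF g(2)] V.scale_minus_left V.scale_one)
  then show "(\<lambda>v. - g v) \<in> gens d" using gens_K[OF g(2,3)] by simp
next
  fix u r assume g: "g = D u r" "dvalid u r" "cc * of_int (fst r) = of_int d"
  have "(\<lambda>v. - g v) = D ((-1) *s u) r" unfolding g(1) by (rule ext) (simp only: D_scale[OF g(2)] V.scale_minus_left V.scale_one)
  moreover have "D ((-1) *s u) r \<in> gens d" by (rule gens_D[OF dvalid_scale[OF g(2)] g(3)])
  ultimately show "(\<lambda>v. - g v) \<in> gens d" by simp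
qed

definition brk :: "('v \<Rightarrow> 'v) \<Rightarrow> ('v \<Rightarrow> 'v) \<Rightarrow> int \<Rightarrow> bool" where
  "brk g g' e \<longleftrightarrow> (\<exists>c1\<in>gens e. \<exists>c2\<in>gens e. \<forall>v. g (g' v) - g' (g v) = c1 v + c2 v)"

lemma brkI: "c1 \<in> gens e \<Longrightarrow> c2 \<in> gens e \<Longrightarrow> (\<And>v. g (g' v) - g' (g v) = c1 v + c2 v) \<Longrightarrow> brk g g' e"
  unfolding brk_def by blast

lemma brk_single: "c1 \<in> gens e \<Longrightarrow> (\<And>v. g (g' v) - g' (g v) = c1 v) \<Longrightarrow> brk g g' e"
  by (rule brkI[of c1 _ "\<lambda>v. 0"]) (auto intro: gens_zero)

lemma brk_sym: "brk g g' e \<Longrightarrow> brk g' g e"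
proof -
  assume "brk g g' e"
  then obtain c1 c2 where c: "c1 \<in> gens e" "c2 \<in> gens e" "\<And>v. g (g' v) - g' (g v) = c1 v + c2 v"
    unfolding brk_def by blast
  show ?thesis
  proof (rule brkI[OF gens_neg[OF c(1)] gens_neg[OF c(2)]])
    fix v
    have "g' (g v) - g (g' v) = - (g (g' v) - g' (g v))" by simp
    then show "g' (g v) - g (g' v) = - c1 v + - c2 v" unfolding c(3) by simp
  qed
qed

lemma gens_br:
  assumes g: "g \<in> gens d" and g': "g' \<in> gens e"
  shows "brk g g' (d + e)"
proof -
  have zero_br: "brk (\<lambda>v. 0) f (d + e)" if "V.lin_on UNIV f" for f
    by (rule brk_single[OF gens_zero]) (simp add: V.lin_on_zero[OF that V.subspace_UNIV])
  have RR: "brk (R x k) (R y l) (d + e)"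
    if x: "a \<in> dual_space scl H" "x \<in> gwt X k a" "a h1 + cc * of_int (fst k) = of_int d"
    and y: "b \<in> dual_space scl H" "y \<in> gwt X l b" "b h1 + cc * of_int (fst l) = of_int e" for x k a y l b and d e
  proof -
    have xk: "x \<in> gdeg X k" "y \<in> gdeg X l" using x y by (auto simp: gwt_def)
    show ?thesis
    proof (rule brkI[of "R (br x y) (k + l)" _ "if ifm x y = 0 then (\<lambda>v. 0) else Kw (ifm x y *s cvec k) (k + l)"])
      show "R (br x y) (k + l) \<in> gens (d + e)"
      proof (rule gens_R[OF _ gwt_br[OF x(2) y(2)]])
        show "(\<lambda>h. a h + b h) \<in> dual_space scl H" using x(1) y(1) by (simp add: dual_space_def algebra_simps)
        show "a h1 + b h1 + cc * of_int (fst (k + l)) = of_int (d + e)"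
          using x(3) y(3) by (simp add: algebra_simps)
      qed
      show "(if ifm x y = 0 then (\<lambda>v. 0) else Kw (ifm x y *s cvec k) (k + l)) \<in> gens (d + e)"
      proof (cases "ifm x y = 0")
        case True
        then show ?thesis using gens_zero by simp
      next
        case False
        \<comment> \<open>A non-zero central term requires opposite weights; then the heights cancel
          and the level of the term depends on its degree alone.\<close>
        then have b: "b = (\<lambda>h. - a h)" using form_weights x y by (auto simp: gwt_iff)
        have "cc * of_int (fst (k + l)) = of_int (d + e)" using x(3) y(3) by (simp add: b algebra_simps)
        then show ?thesis using gens_K[OF form_lat[OF xk False]] False by simp
      qed
      show "R x k (R y l v) - R y l (R x k v) =
        R (br x y) (k + l) v + (if ifm x y = 0 then \<lambda>v. 0 else Kw (ifm x y *s cvec k) (k + l)) v" for v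
        using R_R[OF xk, of v] by (simp add: Kw_zero)
    qed
  qed
  have KR: "brk (Kw w r) (R y l) (d + e)" if "r \<in> lat X" "y \<in> gwt X l b" for w r y l b d e
    by (rule brk_single[OF gens_zero]) (use that K_R in \<open>simp add: gwt_def\<close>)
  have KK: "brk (Kw w r) (Kw w' s) (d + e)" if "r \<in> lat X" "s \<in> lat X" for w r w' s d e
    by (rule brk_single[OF gens_zero]) (use that K_K in simp)
  have DR: "brk (D u r) (R y l) (d + e)"
    if u: "dvalid u r" "cc * of_int (fst r) = of_int d"
      and y: "b \<in> dual_space scl H" "y \<in> gwt X l b" "b h1 + cc * of_int (fst l) = of_int e" for u r y l b d e
  proof -
    let ?c = "dot u (cvec l)"
    have yl: "y \<in> gdeg X l" using y by (simp add: gwt_def)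
    have yr: "y \<in> gdeg X (r + l)" using u gdeg_add_lat[of r l] yl by (simp add: dvalid_def add.commute)
    have yw: "scl ?c y \<in> gwt X (r + l) b"
      using y(2) G.subspace_scale[OF gdeg_subspace yr] by (simp add: gwt_def br_scale_right mult.commute)
    show ?thesis
    proof (rule brk_single)
      show "R (scl ?c y) (r + l) \<in> gens (d + e)"
        by (rule gens_R[OF y(1) yw]) (use u(2) y(3) in \<open>simp add: algebra_simps\<close>)
      show "D u r (R y l v) - R y l (D u r v) = R (scl ?c y) (r + l) v" for v
        using D_R[OF u(1) yl, of v] by (simp add: R_scale[OF yr])
    qed
  qed
  have DK: "brk (D u r) (Kw w s) (d + e)"
    if u: "dvalid u r" "cc * of_int (fst r) = of_int d" and s: "s \<in> lat X" "cc * of_int (fst s) = of_int e" for u r w s d e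
  proof (rule brk_single)
    have "r + s \<in> lat X" using u s by (simp add: dvalid_def lat_add)
    then show "Kw (dot u (cvec s) *s w + dot u w *s cvec r) (r + s) \<in> gens (d + e)"
      by (rule gens_K) (use u(2) s(2) in \<open>simp add: algebra_simps\<close>)
    show "D u r (Kw w s v) - Kw w s (D u r v) = Kw (dot u (cvec s) *s w + dot u w *s cvec r) (r + s) v" for v
      by (rule D_K[OF u(1) s(1)])
  qed
  have DD: "brk (D u r) (D u' s) (d + e)"
    if u: "dvalid u r" "cc * of_int (fst r) = of_int d" and s: "dvalid u' s" "cc * of_int (fst s) = of_int e" for u r u' s d e
  proof (rule brkI)
    have l: "cc * of_int (fst (r + s)) = of_int (d + e)" using u(2) s(2) by (simp add: algebra_simps)
    show "D (dot u (cvec s) *s u' - dot u' (cvec r) *s u) (r + s) \<in> gens (d + e)"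
      by (rule gens_D[OF D_D_valid[OF u(1) s(1)] l])
    have "r + s \<in> lat X" using u s by (simp add: dvalid_def lat_add)
    then show "Kw (cocycle X r u s u') (r + s) \<in> gens (d + e)" using l by (rule gens_K)
    show "D u r (D u' s v) - D u' s (D u r v) = D (dot u (cvec s) *s u' - dot u' (cvec r) *s u) (r + s) v +
        Kw (cocycle X r u s u') (r + s) v" for v
      by (rule D_D[OF u(1) s(1)])
  qed
  note lins = gens_lin[OF g', of UNIV] gens_lin[OF g, of UNIV]
  have c: "d + e = e + d" by simp
  show ?thesis
    using g
  proof (cases rule: gens_cases)
    case zero
    then show ?thesis using zero zero_br lins by simp
  next
    case 1: (R x k a)
    show ?thesis using g'
    proof (cases rule: gens_cases)
      case z: zero
      have "brk (\<lambda>v. 0) g (d + e)" using zero_br lins by simp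
      then show ?thesis using brk_sym z by simp
    next
      case (R y l b)
      then show ?thesis using RR 1 by simp
    next
      case (K w r)
      then show ?thesis using brk_sym[OF KR[of r x k a w e d]] 1 by (simp add: c)
    next
      case (D u r)
      then show ?thesis using brk_sym[OF DR[of u r e a x k d]] 1 by (simp add: c)
    qed
  next
    case 1: (K w r)
    show ?thesis using g'
    proof (cases rule: gens_cases)
      case z: zero
      have "brk (\<lambda>v. 0) g (d + e)" using zero_br lins by simp
      then show ?thesis using brk_sym z by simp
    next
      case (R y l b)
      then show ?thesis using KR 1 by simp
    next
      case (K w' s)
      then show ?thesis using KK 1 by simp
    next
      case (D u s)
      then show ?thesis using brk_sym[OF DK[of u s e r d w]] 1 by (simp add: c)
    qed
  next
    case 1: (D u r)
    show ?thesis using g'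
    proof (cases rule: gens_cases)
      case z: zero
      have "brk (\<lambda>v. 0) g (d + e)" using zero_br lins by simp
      then show ?thesis using brk_sym z by simp
    next
      case (R y l b)
      then show ?thesis using DR 1 by simp
    next
      case (K w' s)
      then show ?thesis using DK 1 by simp
    next
      case (D u' s)
      then show ?thesis using DD 1 by simp
    qed
  qed
qed

lemma Kw_level_int: "\<exists>d::int. cc * of_int j = of_int d"
proof -
  obtain n :: nat where "cc = of_nat n" using cc_nat by blast
  then show ?thesis by (intro exI[of _ "int n * j"]) simp
qed

lemma cc_nz: "cc \<noteq> 0"
  using cc_nat by auto

lemma gens_stable_tor:
  assumes W: "V.subspace W" "\<And>d g v. g \<in> gens d \<Longrightarrow> v \<in> W \<Longrightarrow> g v \<in> W" and x: "x \<in> tor X" and w: "w \<in> W"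
  shows "\<rho> x w \<in> W"
proof -
  have RW: "R x k w \<in> W" if "x \<in> gdeg X k" for x k
  proof -
    have "x \<in> G.span {x. \<exists>a\<in>dual_space scl H. x \<in> gwt X k a}" using that gdeg_weights by blast
    then have "x \<in> gdeg X k \<and> R x k w \<in> W"
    proof (induction rule: G.span_induct_alt)
      case base
      then show ?case using G.subspace_0[OF gdeg_subspace] V.subspace_0[OF W(1)] by (simp add: R_zero)
    next
      case (step c x y)
      then obtain a where a: "a \<in> dual_space scl H" "x \<in> gwt X k a" by blast
      have xk: "x \<in> gdeg X k" using a by (simp add: gwt_def)
      have "R x k w \<in> W"
      proof (cases "x = 0")
        case True
        then show ?thesis using V.subspace_0[OF W(1)] by (simp add: R_zero)
      next
        case False
        obtain n :: int where n: "a h1 + cc * of_int (fst k) = of_int n"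
          using level_cases[of x "fst k" "snd k" a] a False by auto
        show ?thesis by (rule W(2)[OF gens_R[OF a n] w])
      qed
      then show ?case
        using step xk G.subspace_add[OF gdeg_subspace] G.subspace_scale[OF gdeg_subspace]
          V.subspace_add[OF W(1)] V.subspace_scale[OF W(1)]
        by (simp add: R_add R_scale)
    qed
    then show ?thesis by simp
  qed
  have "\<rho> x w \<in> W \<and> x \<in> tor X"
    using x unfolding tor_def
  proof (induction rule: T.span_induct_alt)
    case base
    then show ?case using V.subspace_0[OF W(1)] T.span_zero by (simp add: rho_zero)
  next
    case (step c x y)
    have xt: "x \<in> tor X" using step(1) unfolding tor_def by (rule T.span_base)
    have yt: "y \<in> tor X" using step(2) by (simp add: tor_def)
    consider z k where "x = tX z k" "z \<in> gdeg X k" | r i where "x = tK r i" "r \<in> lat X"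
      | u r where "x = tD u r" "r \<in> lat X" "dot u (cvec r) = 0" using step(1) by blast
    then have "\<rho> x w \<in> W"
    proof cases
      case 1
      then show ?thesis using RW by (simp add: R_def)
    next
      case 2
      obtain d where "cc * of_int (fst r) = of_int d" using Kw_level_int by blast
      then show ?thesis using W(2)[OF gens_K[OF 2(2)] w, of d "axis i 1"] by (simp add: 2 Kw_def tK_tKw)
    next
      case 3
      obtain d where "cc * of_int (fst r) = of_int d" using Kw_level_int by blast
      moreover have "dvalid u r" using 3 by (simp add: dvalid_def)
      ultimately show ?thesis using W(2)[OF gens_D w, of u r d] by (simp add: 3 D_def)
    qed
    then have "sV c (\<rho> x w) + \<rho> y w \<in> W" using step(2) V.subspace_add[OF W(1)] V.subspace_scale[OF W(1)] by blast
    moreover have "\<rho> (tscale X c x + y) w = sV c (\<rho> x w) + \<rho> y w"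
      using rho_add[OF T.subspace_scale[OF tor_subspace xt] yt] rho_scale[OF xt] by simp
    ultimately show ?case
      using T.subspace_add[OF tor_subspace T.subspace_scale[OF tor_subspace xt] yt] by (simp add: tor_def)
  qed
  then show ?thesis by simp
qed

lemma gens_irr:
  assumes "V.subspace W" "\<And>d g. g \<in> gens d \<Longrightarrow> \<forall>v\<in>W. g v \<in> W"
  shows "W = {0} \<or> W = UNIV"
  using irred assms gens_stable_tor[OF assms(1)] unfolding irreducible_module_def by blast

definition Lop :: "'v \<Rightarrow> 'v" where
  "Lop v = R h1 0 v + sV cc (dd None v)"

lemma Lop_lin: "V.lin_on UNIV Lop"
proof -
  have "h1 \<in> gfix X" using h1_H H_fix by blast
  note l = R_lin[OF this, of UNIV] D_lin[OF d0_valid, of UNIV None]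
  show ?thesis
    using l by (auto simp: Lop_def V.lin_on_def algebra_simps V.scale_left_commute)
qed

lemma Lop_shift:
  assumes "shifts g a k" "V.lin_on UNIV g"
  shows "Lop (g v) = g (Lop v) + sV (a h1 + cc * of_int (fst k)) (g v)"
proof -
  have k: "dcomp k None = fst k" by (cases k) simp
  have "R h1 0 (g v) = g (R h1 0 v) + sV (a h1) (g v)"
    "dd None (g v) = g (dd None v) + sV (of_int (fst k)) (g v)"
    using assms(1) h1_H by (auto simp: shifts_def k)
  then show ?thesis
    using V.lin_on_add[OF assms(2)] V.lin_on_scale[OF assms(2)]
    by (simp add: Lop_def algebra_simps V.scale_left_distrib)
qed

lemma Lop_gens: "g \<in> gens d \<Longrightarrow> Lop (g v) = g (Lop v) + sV (of_int d) (g v)"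
proof (erule gens_cases)
  show "g = (\<lambda>v. 0) \<Longrightarrow> Lop (g v) = g (Lop v) + sV (of_int d) (g v)"
    using V.lin_on_zero[OF Lop_lin V.subspace_UNIV] by simp
next
  fix x k a assume g: "g = R x k" "x \<in> gwt X k a" "a h1 + cc * of_int (fst k) = of_int d"
  have "x \<in> gdeg X k" using g by (simp add: gwt_def)
  then show "Lop (g v) = g (Lop v) + sV (of_int d) (g v)"
    using Lop_shift[OF shifts_R[OF g(2)] R_lin, of v] g by simp
next
  fix w r assume g: "g = Kw w r" "r \<in> lat X" "cc * of_int (fst r) = of_int d"
  then show "Lop (g v) = g (Lop v) + sV (of_int d) (g v)"
    using Lop_shift[OF shifts_K[OF g(2), of w] Kw_lin[OF g(2)], of v] by simp
next
  fix u r assume g: "g = D u r" "dvalid u r" "cc * of_int (fst r) = of_int d"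
  then show "Lop (g v) = g (Lop v) + sV (of_int d) (g v)"
    using Lop_shift[OF shifts_D[OF g(2)] D_lin[OF g(2)], of v] by simp
qed

lemma pos_level:
  assumes "pos X (\<lambda>h. ext_fun X a h + of_int k0 * delta X None h)" "a \<in> dual_space scl H"
  shows "\<exists>d::int. d > 0 \<and> a h1 + cc * of_int k0 = of_int d"
proof -
  let ?e = "\<lambda>h. ext_fun X a h + of_int k0 * delta X None h"
  \<comment> \<open>The element h1 + cc d_0: each affine simple root takes the value 1 on it, so a
    positive functional takes the sum of its coefficients.\<close>
  let ?t = "tscale X cc (td None) + tX h1 0 :: ('g, 'n) tor"
  obtain c :: "nat \<Rightarrow> nat" where c: "?e \<noteq> (\<lambda>_. 0)" "?e = (\<lambda>h. \<Sum>i=0..rk X. of_nat (c i) * affine_simple X i h)"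
    using assms(1) unfolding pos_def by blast
  have tH: "?t \<in> HH X" by (rule HH_add[OF HH_scale[OF td_HH] tX_HH[OF h1_H]])
  have f1: "Poly_Mapping.lookup (fst ?t) 0 = h1" by (simp add: fst_tscale lookup_add) (simp add: tD_def tX_def)
  have f2: "delta X None ?t = cc" using tH by (simp add: delta_def snd_tscale lookup_add) (simp add: tD_def tX_def)
  have ex: "ext_fun X b ?t = b h1" for b using tH f1 by (simp add: ext_fun_def)
  have as: "affine_simple X i ?t = 1" if "i \<le> rk X" for i
  proof (cases "i = 0")
    case True
    then have a0: "affine_simple X i = (\<lambda>h. - ext_fun X (max_root X) h + delta X None h)"
      by (simp add: affine_simple_def)
    show ?thesis unfolding a0 ex f2 by (simp add: cc_def)
  next
    case False
    then have "i \<in> {1..rk X}" using that by simp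
    then show ?thesis using False h1_simple by (simp only: affine_simple_def ex if_False)
  qed
  have "a h1 + cc * of_int k0 = (\<Sum>i=0..rk X. of_nat (c i) * affine_simple X i ?t)"
    using fun_cong[OF c(2), of ?t] by (simp add: ex f2 mult.commute)
  also have "\<dots> = (\<Sum>i=0..rk X. of_nat (c i))" by (rule sum.cong) (auto simp: as)
  finally have eq: "a h1 + cc * of_int k0 = of_int (int (\<Sum>i=0..rk X. c i))" by simp
  have "(\<Sum>i=0..rk X. c i) \<noteq> 0"
  proof
    assume "(\<Sum>i=0..rk X. c i) = 0"
    then have "?e = (\<lambda>_. 0)" unfolding c(2) by (auto simp: fun_eq_iff intro!: sum.neutral)
    then show False using c(1) by simp
  qed
  then have "int (\<Sum>i=0..rk X. c i) > 0" by linarith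
  then show ?thesis using eq by (intro exI[of _ "int (\<Sum>i=0..rk X. c i)"] conjI)
qed

lemma pm_zero_fst: "(k0 :: int) > 0 \<longleftrightarrow> (\<exists>d::int. d > 0 \<and> cc * of_int k0 = of_int d)"
proof -
  obtain n :: nat where n: "n > 0" "cc = of_nat n" using cc_nat by blast
  have "cc * of_int k0 = of_int (int n * k0)" using n by simp
  then have "(\<exists>d::int. d > 0 \<and> cc * of_int k0 = of_int d) \<longleftrightarrow> int n * k0 > 0"
    by (metis of_int_eq_iff)
  then show ?thesis using n by (simp add: zero_less_mult_iff)
qed

lemma tor_plus_tor: "tor_plus X \<subseteq> tor X"
  unfolding tor_plus_def
  by (rule T.span_minimal[OF _ tor_subspace]) (auto intro: tX_in_tor tK_in_tor tD_in_tor simp: gwt_def)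

text \<open>Positivity of a + k_0 \<delta>_0 and positivity of the level coincide on non-zero weight
  vectors, so the abstract top space applies to M.\<close>

lemma M_space_gens: "M_space X \<rho> = {v. \<forall>d>0. \<forall>g\<in>gens d. g v = 0}"
proof (rule Set.set_eqI, rule iffI)
  fix v assume v: "v \<in> M_space X \<rho>"
  then have kill: "\<rho> x v = 0" if "x \<in> tor_plus X" for x using that by (simp add: M_space_def)
  show "v \<in> {v. \<forall>d>0. \<forall>g\<in>gens d. g v = 0}"
  proof (intro CollectI allI impI ballI)
    fix d :: int and g assume d: "d > 0" and g: "g \<in> gens d"
    show "g v = 0" using g
    proof (cases rule: gens_cases)
      case (R x k a)
      show ?thesis
      proof (cases "x = 0")
        case True
        then show ?thesis using R by (simp add: R_zero)
      next
        case False
        obtain k0 k' where k: "k = (k0, k')" using surj_pair[of k] by blast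
        have "pos X (\<lambda>h. ext_fun X a h + of_int k0 * delta X None h)"
          using level_cases[of x k0 k' a] R False d by (auto simp: k)
        then have "tX x k \<in> tor_plus X" unfolding tor_plus_def using R k by (intro T.span_base) blast
        then show ?thesis using kill R by (simp add: R_def)
      qed
    next
      case (K w r)
      obtain s0 s where r: "r = (s0, s)" using surj_pair[of r] by blast
      have "s0 > 0" using pm_zero_fst[of s0] K d by (auto simp: r)
      then have "tK r i \<in> tor_plus X" for i unfolding tor_plus_def using K r by (intro T.span_base) blast
      then have "tKw w r \<in> tor_plus X"
        unfolding tKw_expand tor_plus_def by (intro T.span_sum T.span_scale) auto
      then show ?thesis using kill K by (simp add: Kw_def)
    next
      case (D u r)
      obtain s0 s where r: "r = (s0, s)" using surj_pair[of r] by blast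
      have "s0 > 0" using pm_zero_fst[of s0] D d by (auto simp: r)
      then have "tD u r \<in> tor_plus X" unfolding tor_plus_def using D r by (intro T.span_base) (auto simp: dvalid_def)
      then show ?thesis using kill D by (simp add: D_def)
    qed simp
  qed
next
  fix v assume "v \<in> {v. \<forall>d>0. \<forall>g\<in>gens d. g v = 0}"
  then have kill: "g v = 0" if "g \<in> gens d" "d > 0" for g d using that by blast
  have "\<rho> x v = 0 \<and> x \<in> tor X" if "x \<in> tor_plus X" for x
    using that unfolding tor_plus_def
  proof (induction rule: T.span_induct_alt)
    case base
    then show ?case using T.subspace_0[OF tor_subspace] by (simp add: rho_zero)
  next
    case (step c x y)
    have "x \<in> tor_plus X" unfolding tor_plus_def by (rule T.span_base[OF step(1)])
    then have xt: "x \<in> tor X" by (rule subsetD[OF tor_plus_tor])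
    consider z k0 k a where "x = tX z (k0, k)" "a \<in> dual_space scl H" "z \<in> gwt X (k0, k) a"
         "pos X (\<lambda>h. ext_fun X a h + of_int k0 * delta X None h)"
      | s0 s i where "x = tK (s0, s) i" "(s0, s) \<in> lat X" "s0 > 0"
      | u r0 r where "x = tD u (r0, r)" "(r0, r) \<in> lat X" "dot u (cvec (r0, r)) = 0" "r0 > 0"
      using step(1) by blast
    then have "\<rho> x v = 0"
    proof cases
      case 1
      obtain d :: int where d: "d > 0" "a h1 + cc * of_int k0 = of_int d" using pos_level[OF 1(4,2)] by blast
      have "R z (k0, k) \<in> gens d" by (rule gens_R[OF 1(2,3)]) (simp add: d)
      then show ?thesis using kill d by (simp add: 1 R_def)
    next
      case 2
      obtain d :: int where d: "d > 0" "cc * of_int s0 = of_int d" using pm_zero_fst[of s0] 2 by blast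
      have "Kw (axis i 1) (s0, s) \<in> gens d" by (rule gens_K[OF 2(2)]) (simp add: d)
      then show ?thesis using kill d by (simp add: 2 Kw_def tK_tKw)
    next
      case 3
      obtain d :: int where d: "d > 0" "cc * of_int r0 = of_int d" using pm_zero_fst[of r0] 3 by blast
      have "D u (r0, r) \<in> gens d" by (rule gens_D) (use 3 d in \<open>simp_all add: dvalid_def\<close>)
      then show ?thesis using kill d by (simp add: 3 D_def)
    qed
    then show ?case
      using step(2) xt rho_add[OF T.subspace_scale[OF tor_subspace xt]] rho_scale[OF xt]
        T.subspace_add[OF tor_subspace] T.subspace_scale[OF tor_subspace] by simp
  qed
  then show "v \<in> M_space X \<rho>" by (simp add: M_space_def)
qed

end

section \<open>The top space\<close>

locale tor_top = tor_rep X sV \<rho> C0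
  for X :: "('g::ab_group_add, 'n::finite) datum" and sV :: "complex \<Rightarrow> 'v::ab_group_add \<Rightarrow> 'v"
    and \<rho> and C0 :: int +
  fixes \<Lambda> :: "('g, 'n) tor \<Rightarrow> complex"
  assumes mweight: "M_weight X sV \<rho> \<Lambda>"
begin

abbreviation "M \<equiv> M_space X \<rho>"

lemma Lam_dual: "\<Lambda> \<in> duals"
  using mweight by (simp add: M_weight_def)

definition w0 :: 'v where "w0 = (SOME v. v \<in> M \<inter> wsp \<Lambda> \<and> v \<noteq> 0)"

lemma w0: "w0 \<in> M" "w0 \<in> wsp \<Lambda>" "w0 \<noteq> 0"
proof -
  have "w0 \<in> M \<inter> wsp \<Lambda> \<and> w0 \<noteq> 0"
    unfolding w0_def by (rule someI_ex) (use mweight in \<open>auto simp: M_weight_def\<close>)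
  then show "w0 \<in> M" "w0 \<in> wsp \<Lambda>" "w0 \<noteq> 0" by auto
qed

lemma graded: "graded_action sV gens Lop w0 (\<Lambda> (tX h1 0) + cc * \<Lambda> (td None))"
proof (unfold_locales, goal_cases)
  case (1 g d) then show ?case by (rule gens_lin)
next
  case 2 then show ?case by (rule Lop_lin)
next
  case (3 g d g' d') then show ?case using gens_br unfolding brk_def by blast
next
  case (4 g d v) then show ?case by (rule Lop_gens)
next
  case (5 W) show ?case by (rule gens_irr[OF 5(1)]) (rule 5(2))
next
  case 6 then show ?case by (rule w0)
next
  case 7
  have "R h1 0 w0 = sV (\<Lambda> (tX h1 0)) w0" "dd None w0 = sV (\<Lambda> (td None)) w0"
    using w0(2) tX_HH[OF h1_H] td_HH[of None] by (auto simp: weight_space_def R_def D_def)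
  then show ?case by (simp add: Lop_def V.scale_left_distrib)
next
  case (8 d g) then show ?case using w0(1) unfolding M_space_gens by blast
qed

lemma M_top: "M = graded_action.top_space gens"
  using graded_action.top_space_def[OF graded] M_space_gens by simp

lemma M_subspace: "V.subspace M"
  unfolding M_top by (rule graded_action.top_space_subspace[OF graded])

lemma M_stable: "t \<in> gens 0 \<Longrightarrow> v \<in> M \<Longrightarrow> t v \<in> M"
  unfolding M_top by (rule graded_action.top_space_stable[OF graded])

lemma M_irreducible:
  "V.subspace W \<Longrightarrow> W \<subseteq> M \<Longrightarrow> W \<noteq> {0} \<Longrightarrow> (\<And>t. t \<in> gens 0 \<Longrightarrow> \<forall>v\<in>W. t v \<in> W) \<Longrightarrow> W = M"
proof -
  assume h: "V.subspace W" "W \<subseteq> M" "W \<noteq> {0}" "\<And>t. t \<in> gens 0 \<Longrightarrow> \<forall>v\<in>W. t v \<in> W"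
  show "W = M"
    unfolding M_top
    by (rule graded_action.top_irreducible[OF graded h(1) _ h(3)]) (use h(2,4) M_top in blast)+
qed

sublocale irr_system sV M "gens 0"
proof (unfold_locales, goal_cases)
  case 1 then show ?case by (rule M_subspace)
next
  case (2 t) then show ?case by (rule gens_lin)
next
  case (3 t) then show ?case using M_stable by blast
next
  case (4 W) then show ?case by (rule M_irreducible)
next
  case 5 then show ?case using w0 by blast
qed

abbreviation "Mk \<equiv> M_deg X sV \<rho> \<Lambda>"

lemma delta_vec_sh: "delta_vec X k t = sh (\<lambda>_. 0) (0, k) t"
proof -
  have "(\<Sum>i\<in>UNIV. of_int (dcomp (0, k) i) * delta X i t) =
      of_int (dcomp (0, k) None) * delta X None t + (\<Sum>i\<in>range Some. of_int (dcomp (0, k) i) * delta X i t)"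
    by (simp add: UNIV_option_conv sum.insert)
  also have "(\<Sum>i\<in>range Some. of_int (dcomp (0, k) i) * delta X i t) = delta_vec X k t"
    by (simp add: sum.reindex delta_vec_def)
  finally show ?thesis by (simp add: sh_def ext_fun_def)
qed

lemma Lk_dual: "(\<lambda>t. \<Lambda> t + delta_vec X k t) \<in> duals"
  unfolding delta_vec_sh by (rule dual_add[OF Lam_dual sh_dual[OF zero_dual]])

lemma Mk_fd: "V.fdim (Mk k)"
proof -
  obtain B where "finite B" "V.span B = wsp (\<lambda>t. \<Lambda> t + delta_vec X k t)" using wsp_finite[OF Lk_dual] by blast
  moreover have "V.subspace (Mk k)"
    unfolding M_deg_def by (rule V.subspace_inter[OF M_subspace wsp_subspace])
  ultimately show ?thesis unfolding V.fdim_def M_deg_def by blast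
qed

lemma Mk_sub: "Mk k \<subseteq> M"
  by (auto simp: M_deg_def)

lemma delta_vec_add: "delta_vec X (k + l) t = delta_vec X k t + delta_vec X l t"
  by (simp add: delta_vec_def algebra_simps sum.distrib)

lemma Mk0: "Mk 0 \<noteq> {0}"
proof -
  have "delta_vec X 0 t = 0" for t by (simp add: delta_vec_def)
  then have "w0 \<in> Mk 0" using w0 by (simp add: M_deg_def)
  then show ?thesis using w0 by blast
qed

lemma shift_Mk:
  assumes "t \<in> gens 0" "shifts t (\<lambda>_. 0) (0, r)" "v \<in> Mk k"
  shows "t v \<in> Mk (k + r)"
proof -
  have v: "v \<in> M" "v \<in> wsp (\<lambda>t. \<Lambda> t + delta_vec X k t)" using assms(3) by (auto simp: M_deg_def)
  have "t v \<in> wsp (\<lambda>h. (\<Lambda> h + delta_vec X k h) + sh (\<lambda>_. 0) (0, r) h)"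
    by (rule wt_shift[OF assms(2) gens_lin[OF assms(1)] zero_dual Lk_dual v(2)])
  then have "t v \<in> wsp (\<lambda>h. \<Lambda> h + delta_vec X (k + r) h)"
    by (simp add: delta_vec_add delta_vec_sh[symmetric] add.assoc)
  then show ?thesis using M_stable[OF assms(1) v(1)] by (simp add: M_deg_def)
qed

lemma R0_gens: "x \<in> gwt X (0, k) (\<lambda>_. 0) \<Longrightarrow> R x (0, k) \<in> gens 0"
  by (rule gens_R[OF zero_dual]) auto

lemma K0_gens: "s \<in> Gam X \<Longrightarrow> Kw w (0, s) \<in> gens 0"
  by (rule gens_K) (auto simp: Gam_lat)

lemma D0_gens: "dvalid u (0, a) \<Longrightarrow> D u (0, a) \<in> gens 0"
  by (rule gens_D) auto

text \<open>Level 0 is the degree zero part T^0: for a non-zero weight vector it forces k_0 = 0 and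
  a = 0, and for the other generators it forces component 0 of the degree to vanish.\<close>

lemma gens0_cases:
  assumes "t \<in> gens 0"
  obtains (zero) "t = (\<lambda>v. 0)"
  | (R) x k where "t = R x (0, k)" "x \<in> gwt X (0, k) (\<lambda>_. 0)"
  | (K) w s where "t = Kw w (0, s)" "s \<in> Gam X"
  | (D) u a where "t = D u (0, a)" "dvalid u (0, a)" "a \<in> Gam X"
  using assms
proof (cases rule: gens_cases)
  case zero
  then show ?thesis using that by blast
next
  case (R x k a)
  show ?thesis
  proof (cases "x = 0")
    case True
    then have "t = (\<lambda>v. 0)" using R by (simp add: fun_eq_iff R_zero)
    then show ?thesis using that by blast
  next
    case False
    obtain k0 k' where k: "k = (k0, k')" using surj_pair[of k] by blast
    have "k0 = 0 \<and> a = (\<lambda>_. 0)" using level_cases[of x k0 k' a] R False by (auto simp: k)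
    then show ?thesis using that(2)[of x k'] R k by simp
  qed
next
  case (K w r)
  obtain s0 s where r: "r = (s0, s)" using surj_pair[of r] by blast
  have "s0 = 0" using K cc_nz by (simp add: r)
  then show ?thesis using that(3)[of w s] K by (simp add: r Gam_lat)
next
  case (D u r)
  obtain s0 s where r: "r = (s0, s)" using surj_pair[of r] by blast
  have "s0 = 0" using D cc_nz by (simp add: r)
  then show ?thesis using that(4)[of u s] D by (simp add: r Gam_lat dvalid_def)
qed

lemma R0_hom: "x \<in> gwt X (0, r) (\<lambda>_. 0) \<Longrightarrow> v \<in> Mk k \<Longrightarrow> R x (0, r) v \<in> Mk (k + r)"
  by (rule shift_Mk[OF R0_gens shifts_R])

lemma K0_hom: "s \<in> Gam X \<Longrightarrow> v \<in> Mk k \<Longrightarrow> Kw w (0, s) v \<in> Mk (k + s)"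
  by (rule shift_Mk[OF K0_gens shifts_K]) (simp_all add: Gam_lat)

lemma D0_hom: "dvalid u (0, a) \<Longrightarrow> v \<in> Mk k \<Longrightarrow> D u (0, a) v \<in> Mk (k + a)"
  by (rule shift_Mk[OF D0_gens shifts_D])

end

section \<open>Integer vectors\<close>

definition idot :: "int ^ 'n \<Rightarrow> int ^ 'n::finite \<Rightarrow> int" where
  "idot f s = (\<Sum>i\<in>UNIV. f $ i * s $ i)"

text \<open>All 2 x 2 minors vanish. In particular 0 is parallel to everything, so non-parallel
  vectors are non-zero.\<close>

definition parallel :: "int ^ 'n \<Rightarrow> int ^ 'n \<Rightarrow> bool" where
  "parallel x y \<longleftrightarrow> (\<forall>i j. x $ i * y $ j = x $ j * y $ i)"

lemma idot_add: "idot f (r + s) = idot f r + idot f s"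
  by (simp add: idot_def algebra_simps sum.distrib)

lemma idot_neg: "idot f (- r) = - idot f r"
  by (simp add: idot_def sum_negf)

lemma idot_smult: "idot f (c *s r) = c * idot f r"
  by (simp add: idot_def sum_distrib_left algebra_simps)

lemma idot_add_left: "idot (f + g) r = idot f r + idot g r"
  by (simp add: idot_def algebra_simps sum.distrib)

lemma idot_neg_left: "idot (- f) r = - idot f r"
  by (simp add: idot_def sum_negf)

lemma dot_option:
  fixes u w :: "complex ^ 'n::finite option"
  shows "dot u w = u $ None * w $ None + (\<Sum>i\<in>UNIV. u $ Some i * w $ Some i)"
  by (simp add: dot_def UNIV_option_conv sum.insert sum.reindex)

lemma dot_cvec: "dot (cvec (0, f)) (cvec (k, s)) = of_int (idot f s)"
  by (simp add: dot_option cvec_def idot_def)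

lemma parallel_sym: "parallel x y \<Longrightarrow> parallel y x"
  unfolding parallel_def by (metis mult.commute)

lemma ex_perp:
  fixes a r :: "int ^ 'n::finite"
  assumes "\<not> parallel a r"
  shows "\<exists>f. idot f a = 0 \<and> idot f r \<noteq> 0"
proof -
  obtain i j where ij: "a $ i * r $ j \<noteq> a $ j * r $ i" using assms by (auto simp: parallel_def)
  then have "i \<noteq> j" by auto
  \<comment> \<open>Pairing with this f is the minor of a and the argument in rows i and j, up to
    sign.\<close>
  define f :: "int ^ 'n" where "f = (\<chi> k. if k = i then a $ j else if k = j then - a $ i else 0)"
  have f: "idot f x = a $ j * x $ i - a $ i * x $ j" for x
  proof -
    have "idot f x = (\<Sum>k\<in>UNIV. (if k = i then a $ j * x $ i else 0) + (if k = j then - (a $ i * x $ j) else 0))"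
      unfolding idot_def by (rule sum.cong) (use \<open>i \<noteq> j\<close> in \<open>auto simp: f_def\<close>)
    also have "\<dots> = a $ j * x $ i - a $ i * x $ j" by (simp add: sum.distrib)
    finally show ?thesis .
  qed
  show ?thesis by (intro exI[of _ f]) (use ij in \<open>auto simp: f\<close>)
qed

text \<open>If neither f nor g serves both r and s, then f + g does.\<close>

lemma ex_perp2:
  fixes a r s :: "int ^ 'n::finite"
  assumes "\<not> parallel a r" "\<not> parallel a s"
  shows "\<exists>f. idot f a = 0 \<and> idot f r \<noteq> 0 \<and> idot f s \<noteq> 0"
proof -
  obtain f g where f: "idot f a = 0" "idot f r \<noteq> 0" and g: "idot g a = 0" "idot g s \<noteq> 0"
    using ex_perp[OF assms(1)] ex_perp[OF assms(2)] by blast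
  consider "idot f s \<noteq> 0" | "idot g r \<noteq> 0" | "idot f s = 0" "idot g r = 0" by blast
  then show ?thesis
  proof cases
    case 1
    then show ?thesis using f by blast
  next
    case 2
    then show ?thesis using g by blast
  next
    case 3
    then have "idot (f + g) a = 0" "idot (f + g) r \<noteq> 0" "idot (f + g) s \<noteq> 0"
      using f g by (simp_all add: idot_add_left)
    then show ?thesis by blast
  qed
qed

section \<open>Lattice points off finitely many lines\<close>

lemma finite_quadratic:
  fixes a b c :: int
  assumes "a \<noteq> 0 \<or> b \<noteq> 0"
  shows "finite {x. c + x * (b + x * a) = 0}"
proof -
  have "[:c, b, a:] \<noteq> 0" using assms by auto
  from poly_roots_finite[OF this] show ?thesis by simp
qed

text \<open>A parabola in the (i, j)-plane with points in the lattice for suitable P. A line meets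
  it in at most finitely many points, so one parameter avoids any finite set of lines.\<close>

definition curve :: "int \<Rightarrow> 'n \<Rightarrow> 'n \<Rightarrow> int \<Rightarrow> int ^ 'n::finite" where
  "curve P i j x = (\<chi> k. if k = i then P * x else if k = j then P * x * x else 0)"

lemma finite_curve:
  assumes "P \<noteq> 0" "i \<noteq> j" "q \<noteq> 0"
  shows "finite {x. parallel q (t - curve P i j x)}"
proof (cases "q $ i = 0 \<and> q $ j = 0")
  case True
  obtain k where k: "q $ k \<noteq> 0" using assms(3) by (auto simp: vec_eq_iff)
  have "{x. parallel q (t - curve P i j x)} \<subseteq> {x. t $ i + x * (- P + x * 0) = 0}"
  proof
    fix x assume "x \<in> {x. parallel q (t - curve P i j x)}"
    then have "q $ k * (t - curve P i j x) $ i = q $ i * (t - curve P i j x) $ k" by (auto simp: parallel_def)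
    then show "x \<in> {x. t $ i + x * (- P + x * 0) = 0}" using k True by (simp add: curve_def mult.commute)
  qed
  then show ?thesis by (rule finite_subset) (rule finite_quadratic, use assms in simp)
next
  case False
  have "{x. parallel q (t - curve P i j x)} \<subseteq>
    {x. (q $ i * t $ j - q $ j * t $ i) + x * (q $ j * P + x * (- q $ i * P)) = 0}"
  proof
    fix x assume "x \<in> {x. parallel q (t - curve P i j x)}"
    then have "q $ i * (t - curve P i j x) $ j = q $ j * (t - curve P i j x) $ i" by (auto simp: parallel_def)
    then show "x \<in> {x. (q $ i * t $ j - q $ j * t $ i) + x * (q $ j * P + x * (- q $ i * P)) = 0}"
      using assms(2) by (simp add: curve_def algebra_simps)
  qed
  then show ?thesis by (rule finite_subset) (rule finite_quadratic, use assms False in auto)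
qed

context tor_top
begin

abbreviation "GX \<equiv> Gam X"

lemma Gam_0: "0 \<in> GX"
  and Gam_add: "r \<in> GX \<Longrightarrow> s \<in> GX \<Longrightarrow> r + s \<in> GX"
  and Gam_neg: "r \<in> GX \<Longrightarrow> - r \<in> GX"
  and Gam_diff: "r \<in> GX \<Longrightarrow> s \<in> GX \<Longrightarrow> r - s \<in> GX"
  and Gam_smult: "r \<in> GX \<Longrightarrow> c *s r \<in> GX"
  by (simp_all add: Gam_def)

text \<open>The parabola needs two different coordinates, and this is where n >= 2 enters. The pair
  (q, t) stands for the line through t in direction q.\<close>

lemma avoid_lines:
  assumes "finite L" "\<And>q t. (q, t) \<in> L \<Longrightarrow> q \<noteq> 0"
  shows "\<exists>r\<in>GX. r \<noteq> 0 \<and> (\<forall>(q, t)\<in>L. \<not> parallel q (t - r))"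
proof -
  obtain i j :: 'n where ij: "i \<noteq> j"
  proof -
    have "\<not> (\<forall>i j::'n. i = j)"
    proof
      assume "\<forall>i j::'n. i = j"
      then have "(UNIV :: 'n set) \<subseteq> {undefined}" by auto
      then have "CARD('n) \<le> 1" using card_mono[of "{undefined :: 'n}" UNIV] by simp
      then show False using card2 by simp
    qed
    then show ?thesis using that by blast
  qed
  define P where "P = int (period X (Some i)) * int (period X (Some j))"
  have P: "P \<noteq> 0" using period_pos[of "Some i"] period_pos[of "Some j"] by (simp add: P_def)
  let ?F = "insert 0 (\<Union>p\<in>L. {x. parallel (fst p) (snd p - curve P i j x)})"
  have "finite ?F" using assms finite_curve[OF P ij] by (auto simp: split_beta)
  then obtain x where x: "x \<notin> ?F" using ex_new_if_finite[of ?F] infinite_UNIV_int by blast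
  have "curve P i j x \<in> GX" using ij by (auto simp: Gam_def curve_def P_def)
  moreover have "curve P i j x \<noteq> 0"
  proof
    assume "curve P i j x = 0"
    then have "curve P i j x $ i = 0" by simp
    then show False using x P by (simp add: curve_def)
  qed
  ultimately show ?thesis using x by (intro bexI[of _ "curve P i j x"]) auto
qed

lemma avoid_points:
  assumes "finite F"
  shows "\<exists>r\<in>GX. r \<noteq> 0 \<and> r \<notin> F"
proof -
  obtain e :: "int ^ 'n" where e: "e \<noteq> 0" using avoid_lines[of "{}"] by auto
  obtain r where r: "r \<in> GX" "r \<noteq> 0" "\<forall>(q, t)\<in>Pair e ` F. \<not> parallel q (t - r)"
    using avoid_lines[of "Pair e ` F"] assms e by blast
  have "parallel e (t - r)" if "t = r" for t using that by (simp add: parallel_def)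
  then show ?thesis using r by blast
qed

lemma avoid_parallel:
  assumes "q \<noteq> 0" "q' \<noteq> 0"
  shows "\<exists>r\<in>GX. r \<noteq> 0 \<and> \<not> parallel q r \<and> \<not> parallel q' r"
proof -
  obtain r where r: "r \<in> GX" "r \<noteq> 0" "\<forall>(q, t)\<in>{(q, 0), (q', 0)}. \<not> parallel q (t - r)"
    using avoid_lines[of "{(q, 0), (q', 0)}"] assms by blast
  have "parallel p r \<Longrightarrow> parallel p (0 - r)" for p by (simp add: parallel_def)
  then show ?thesis using r by blast
qed

section \<open>The central operators on the top space\<close>

definition z :: "int ^ 'n \<Rightarrow> 'v \<Rightarrow> 'v" where "z r = Kw (axis None 1) (0, r)"

lemma z_0: "z 0 v = sV (of_int C0) v"
  using Kw_0[of "axis None 1" v] by (simp add: z_def zero_prod_def)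

lemma z_z: "r \<in> GX \<Longrightarrow> s \<in> GX \<Longrightarrow> z r (z s v) = z s (z r v)"
  unfolding z_def by (rule K_K) (simp_all add: Gam_lat)

lemma z_lin: "r \<in> GX \<Longrightarrow> V.lin_on E (z r)"
  unfolding z_def by (rule Kw_lin) (simp add: Gam_lat)

lemma z_Mk: "r \<in> GX \<Longrightarrow> v \<in> Mk k \<Longrightarrow> z r v \<in> Mk (k + r)"
  unfolding z_def by (rule K0_hom)

lemma z_M: "r \<in> GX \<Longrightarrow> v \<in> M \<Longrightarrow> z r v \<in> M"
  unfolding z_def by (rule M_stable[OF K0_gens])

lemma D0_valid_lat: "dvalid u (0, a) \<Longrightarrow> a \<in> GX"
  by (simp add: dvalid_def Gam_lat)

lemma dvalid_cvec: "a \<in> GX \<Longrightarrow> idot f a = 0 \<Longrightarrow> dvalid (cvec (0, f)) (0, a)"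
  by (simp add: dvalid_def Gam_lat dot_cvec)

lemma dvalid_None: "a \<in> GX \<Longrightarrow> dvalid (axis None 1) (0, a)"
  by (simp add: dvalid_def Gam_lat dot_axis_cvec)

lemma Kw_combine:
  assumes "r \<in> lat X"
  shows "Kw (c *s w + d *s w') r v = sV c (Kw w r v) + sV d (Kw w' r v)"
  using assms by (simp add: Kw_add Kw_scale)

lemma D_z:
  assumes "dvalid u (0, a)" "s \<in> GX"
  shows "D u (0, a) (z s v) - z s (D u (0, a) v) =
    sV (dot u (cvec (0, s))) (z (a + s) v) + sV (u $ None) (Kw (cvec (0, a)) (0, a + s) v)"
proof -
  have l: "(0, a + s) \<in> lat X" using Gam_add[OF D0_valid_lat[OF assms(1)] assms(2)] by (simp add: Gam_lat)
  have "(0, s) \<in> lat X" using assms(2) by (simp add: Gam_lat)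
  from D_K[OF assms(1) this] show ?thesis by (simp add: z_def dot_axis_right Kw_combine[OF l])
qed

lemma D_z_perp:
  assumes "a \<in> GX" "idot f a = 0" "s \<in> GX"
  shows "D (cvec (0, f)) (0, a) (z s v) - z s (D (cvec (0, f)) (0, a) v) = sV (of_int (idot f s)) (z (a + s) v)"
  using D_z[OF dvalid_cvec[OF assms(1,2)] assms(3), of v] by (simp add: dot_cvec cvec_None)

text \<open>For \<alpha> + \<beta> \<noteq> 0 the part along b is a multiple of the differential of
  a monomial and vanishes; for \<alpha> + \<beta> = 0 the degree is 0, where K_1, ..., K_n act by 0.
  Only the K_0 component survives.\<close>

lemma Kw_line:
  assumes "b \<in> GX"
  shows "Kw (c *s cvec (j, \<alpha> *s b)) (0, (\<alpha> + \<beta>) *s b) v = sV (c * of_int j) (z ((\<alpha> + \<beta>) *s b) v)"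
proof -
  let ?t = "(0, (\<alpha> + \<beta>) *s b)"
  have t: "?t \<in> lat X" using Gam_smult[OF assms] by (simp add: Gam_lat)
  show ?thesis
  proof (cases "\<alpha> + \<beta> = 0")
    case True
    then have "Kw w ?t v = Kw w 0 v" for w by (simp add: zero_prod_def)
    then show ?thesis using True by (simp add: Kw_0 z_0 cvec_None)
  next
    case False
    have e: "c *s cvec (j, \<alpha> *s b) = (c * of_int j) *s axis None 1 + (c * of_int \<alpha> / of_int (\<alpha> + \<beta>)) *s cvec ?t"
      (is "?l = ?r")
    proof -
      have "?l $ i = ?r $ i" for i
        using False by (cases i) (simp_all add: cvec_def axis_def del: of_int_add)
      then show ?thesis unfolding vec_eq_iff by blast
    qed
    show ?thesis unfolding e Kw_combine[OF t] by (simp add: Kw_cvec z_def)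
  qed
qed

text \<open>Since a + \<beta>_0 has height >= 0, k_0 > 0 alone makes the level positive.\<close>

lemma R_kills:
  assumes x: "x \<in> gwt X (k0, k) a" and a: "a \<in> dual_space scl H" and k0: "k0 > 0" and v: "v \<in> M"
  shows "R x (k0, k) v = 0"
proof (cases "x = 0")
  case True
  then show ?thesis by (simp add: R_zero)
next
  case False
  have "ncomb (\<lambda>h. max_root X h - (- a h))" by (rule max_root_ncomb[OF gwt_neg_roots_en(2)[OF x a False]])
  then obtain m :: nat where m: "max_root X h1 + a h1 = of_nat m" using ncomb_h1 by fastforce
  obtain b :: nat where b: "max_root X h1 = of_nat b" using ncomb_h1[OF max_root_ncomb0] by blast
  define d where "d = int m + k0 + (k0 - 1) * int b"
  have "a h1 = of_nat m - of_nat b" using m b by (simp add: eq_diff_eq add.commute)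
  then have "a h1 + cc * of_int (fst (k0, k)) = of_int d" by (simp add: d_def cc_def b algebra_simps)
  then have "R x (k0, k) \<in> gens d" by (rule gens_R[OF a x])
  moreover have "d > 0" using k0 by (simp add: d_def add_nonneg_pos add_pos_nonneg)
  ultimately show ?thesis using v unfolding M_space_gens by blast
qed

lemma m0_shift_lat: "p \<in> GX \<Longrightarrow> (m0, p) \<in> lat X" "p \<in> GX \<Longrightarrow> (- m0, p) \<in> lat X"
  by (auto simp: lat_def Gam_def split_option_all)

lemma gwt_lat: "r \<in> lat X \<Longrightarrow> gwt X r a = gwt X 0 a"
  by (simp add: gwt_def gdeg_lat)

lemma A_B:
  assumes x: "x \<in> gfix X" and y: "y \<in> gfix X" and b: "b \<in> GX"
  shows "R x (m0, \<alpha> *s b) (R y (- m0, \<beta> *s b) v) - R y (- m0, \<beta> *s b) (R x (m0, \<alpha> *s b) v) =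
    R (br x y) (0, (\<alpha> + \<beta>) *s b) v + sV (ifm x y * of_int m0) (z ((\<alpha> + \<beta>) *s b) v)"
proof -
  have l: "(m0, \<alpha> *s b) \<in> lat X" "(- m0, \<beta> *s b) \<in> lat X" by (intro m0_shift_lat Gam_smult b)+
  have "x \<in> gdeg X (m0, \<alpha> *s b)" "y \<in> gdeg X (- m0, \<beta> *s b)" using x y gdeg_lat[OF l(1)] gdeg_lat[OF l(2)] by auto
  moreover have "(m0, \<alpha> *s b) + (- m0, \<beta> *s b) = (0, (\<alpha> + \<beta>) *s b)" by (simp add: vec_eq_iff algebra_simps)
  ultimately show ?thesis using R_R[of x "(m0, \<alpha> *s b)" y "(- m0, \<beta> *s b)" v] Kw_line[OF b] by simp
qed

lemma z_R: "s \<in> GX \<Longrightarrow> x \<in> gdeg X k \<Longrightarrow> z s (R x k v) = R x k (z s v)"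
  unfolding z_def by (rule K_R) (simp_all add: Gam_lat)

lemma sh_add: "sh (\<lambda>_. 0) k t + sh a l t = sh a (k + l) t"
  by (simp add: sh_def ext_fun_def dcomp_add distrib_right sum.distrib)

lemma wt_R:
  assumes "x \<in> gwt X k a" "a \<in> dual_space scl H" "L \<in> duals" "v \<in> wsp L"
  shows "R x k v \<in> wsp (\<lambda>t. L t + sh a k t)"
  by (rule wt_shift[OF shifts_R[OF assms(1)] R_lin assms(2-4)]) (use assms(1) in \<open>simp add: gwt_def\<close>)

lemma Mk_wsp: "v \<in> Mk k \<Longrightarrow> v \<in> wsp (\<lambda>t. \<Lambda> t + delta_vec X k t)"
  by (simp add: M_deg_def)

lemma gram_wsp:
  fixes u :: "nat \<Rightarrow> 'v"
  assumes "L \<in> duals" "\<And>m. u m \<in> wsp L" "\<And>m. V.lin_on UNIV (\<Phi> m)"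
    "\<And>m. \<Phi> m (u m) \<noteq> 0" "\<And>m m'. m \<noteq> m' \<Longrightarrow> \<Phi> m (u m') = 0"
  shows False
proof -
  obtain B where B: "finite B" "V.span B = wsp L" using wsp_finite[OF assms(1)] by blast
  show False by (rule V.gram[OF B(1) _ assms(3-5)]) (use assms(2) B(2) in simp)
qed

lemma lin_comp: "V.lin_on UNIV f \<Longrightarrow> V.lin_on UNIV g \<Longrightarrow> V.lin_on UNIV (\<lambda>v. f (g v))"
  by (simp add: V.lin_on_def)

text \<open>Otherwise the vectors \<open>h'(-m\<^sub>0, mb) h'(-m\<^sub>0, -mb) v\<close> would be infinitely many independent vectors
  in one weight space.\<close>

lemma ex_pair_nonzero:
  assumes b: "b \<in> GX" and v: "v \<in> Mk 0" "v \<noteq> 0"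
  shows "\<exists>m::int. m > 0 \<and> z (m *s b) (z (- m *s b) v) \<noteq> 0"
proof (rule ccontr)
  assume "\<not> ?thesis"
  then have f0: "z (m *s b) (z (- m *s b) v) = 0" if "m > 0" for m :: int using that by blast
  have f: "z (m *s b) (z (- m *s b) v) = 0" if "m \<noteq> 0" for m :: int
  proof (cases "m > 0")
    case True
    then show ?thesis by (rule f0)
  next
    case False
    then have "z (- m *s b) (z ((- (- m)) *s b) v) = 0" using that by (intro f0) simp
    then show ?thesis using z_z[OF Gam_smult[OF b, of m] Gam_smult[OF b, of "- m"]] by simp
  qed
  have vM: "v \<in> M" using v Mk_sub by blast
  obtain h h' where h: "h \<in> H" "h' \<in> H" "ifm h h' \<noteq> 0" using cartan_pair by blast
  let ?c = "ifm h h' * of_int m0"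
  have c0: "?c \<noteq> 0" using h m0_pos by simp
  have hf: "h \<in> gfix X" "h' \<in> gfix X" using h H_fix by auto
  define A where "A \<alpha> = R h (m0, \<alpha> *s b)" for \<alpha>
  define B where "B \<beta> = R h' (- m0, \<beta> *s b)" for \<beta>
  have hA: "h \<in> gwt X (m0, \<alpha> *s b) (\<lambda>_. 0)" for \<alpha>
    using gwt_lat[OF m0_shift_lat(1)[OF Gam_smult[OF b]]] gwt0_cartan h by simp
  have hB: "h' \<in> gwt X (- m0, \<beta> *s b) (\<lambda>_. 0)" for \<beta>
    using gwt_lat[OF m0_shift_lat(2)[OF Gam_smult[OF b]]] gwt0_cartan h by simp
  have Alin: "V.lin_on UNIV (A \<alpha>)" for \<alpha> unfolding A_def by (rule R_lin) (use hA in \<open>simp add: gwt_def\<close>)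
  have Blin: "V.lin_on UNIV (B \<alpha>)" for \<alpha> unfolding B_def by (rule R_lin) (use hB in \<open>simp add: gwt_def\<close>)
  have AB: "A \<alpha> (B \<beta> w) = B \<beta> (A \<alpha> w) + sV ?c (z ((\<alpha> + \<beta>) *s b) w)" for \<alpha> \<beta> w
    using A_B[OF hf b, of \<alpha> \<beta> w] cartan_abelian[OF h(1,2)]
    by (simp add: A_def B_def R_zero algebra_simps)
  have zB: "z (\<gamma> *s b) (B \<beta> w) = B \<beta> (z (\<gamma> *s b) w)" for \<gamma> \<beta> w
    unfolding B_def by (rule z_R[OF Gam_smult[OF b]]) (use hB in \<open>simp add: gwt_def\<close>)
  have Av: "A \<alpha> w = 0" if "w \<in> M" for \<alpha> w
    unfolding A_def by (rule R_kills[OF hA zero_dual m0_pos that])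
  have zM: "z (\<gamma> *s b) w \<in> M" if "w \<in> M" for \<gamma> w by (rule z_M[OF Gam_smult[OF b] that])
  have B0: "B \<beta> 0 = 0" for \<beta> by (rule V.lin_on_zero[OF Blin V.subspace_UNIV])
  have Aadd: "A \<alpha> (x + y) = A \<alpha> x + A \<alpha> y" "A \<alpha> (sV c x) = sV c (A \<alpha> x)" for \<alpha> x y c
    using V.lin_on_add[OF Alin, of x y] V.lin_on_scale[OF Alin, of x] by simp_all
  \<comment> \<open>Moving both raising operators to v leaves two products of opposite degrees. By
    the assumption they vanish unless the degree is 0, which happens for \<alpha>' = \<beta> only,
    when indices are positive, and then gives C_0^2.\<close>
  have AABB: "A (- \<alpha>') (A \<alpha>' (B \<beta> (B (- \<beta>) v))) =
      sV (?c ^ 2) (z ((\<alpha>' + \<beta>) *s b) (z (- (\<alpha>' + \<beta>) *s b) v) + z ((\<alpha>' - \<beta>) *s b) (z (- (\<alpha>' - \<beta>) *s b) v))"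
    for \<alpha>' \<beta>
  proof -
    have 1: "A \<alpha> (B \<beta> w) = sV ?c (z ((\<alpha> + \<beta>) *s b) w)" if "w \<in> M" for \<alpha> \<beta> w
      unfolding AB using Av[OF that] B0 by simp
    have "A \<alpha>' (B \<beta> (B (- \<beta>) v)) =
        B \<beta> (sV ?c (z ((\<alpha>' - \<beta>) *s b) v)) + sV ?c (B (- \<beta>) (z ((\<alpha>' + \<beta>) *s b) v))"
      unfolding AB[of \<alpha>' \<beta>] 1[OF vM] zB by simp
    also have "B \<beta> (sV ?c (z ((\<alpha>' - \<beta>) *s b) v)) = sV ?c (B \<beta> (z ((\<alpha>' - \<beta>) *s b) v))"
      by (rule V.lin_on_scale[OF Blin]) simp
    finally have "A (- \<alpha>') (A \<alpha>' (B \<beta> (B (- \<beta>) v))) =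
        sV ?c (A (- \<alpha>') (B \<beta> (z ((\<alpha>' - \<beta>) *s b) v))) + sV ?c (A (- \<alpha>') (B (- \<beta>) (z ((\<alpha>' + \<beta>) *s b) v)))"
      by (simp add: Aadd)
    also have "\<dots> = sV (?c ^ 2) (z ((- \<alpha>' + \<beta>) *s b) (z ((\<alpha>' - \<beta>) *s b) v) + z ((- \<alpha>' - \<beta>) *s b) (z ((\<alpha>' + \<beta>) *s b) v))"
      unfolding 1[OF zM[OF vM]] by (simp add: V.scale_right_distrib power2_eq_square)
    also have "- \<alpha>' + \<beta> = - (\<alpha>' - \<beta>)" by simp
    also have "- \<alpha>' - \<beta> = - (\<alpha>' + \<beta>)" by simp
    finally show ?thesis
      using z_z[OF Gam_smult[OF b, of "\<alpha>' - \<beta>"] Gam_smult[OF b, of "- (\<alpha>' - \<beta>)"]]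
        z_z[OF Gam_smult[OF b, of "\<alpha>' + \<beta>"] Gam_smult[OF b, of "- (\<alpha>' + \<beta>)"]] by (simp add: add.commute)
  qed
  define u where "u m = B (int (Suc m)) (B (- int (Suc m)) v)" for m :: nat
  define \<Phi> where "\<Phi> m = (\<lambda>w. A (- int (Suc m)) (A (int (Suc m)) w))" for m :: nat
  let ?L = "\<lambda>t. \<Lambda> t + delta_vec X 0 t + sh (\<lambda>_. 0) (- 2 * m0, 0) t"
  have Ld: "?L \<in> duals" by (rule dual_add[OF Lk_dual sh_dual[OF zero_dual]])
  show False
  proof (rule gram_wsp[OF Ld, of u \<Phi>])
    show "u m \<in> wsp ?L" for m
    proof -
      let ?b = "int (Suc m)"
      have "B (- ?b) v \<in> wsp (\<lambda>t. \<Lambda> t + delta_vec X 0 t + sh (\<lambda>_. 0) (- m0, - ?b *s b) t)"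
        unfolding B_def by (rule wt_R[OF hB zero_dual Lk_dual Mk_wsp[OF v(1)]])
      then have "u m \<in> wsp (\<lambda>t. (\<Lambda> t + delta_vec X 0 t + sh (\<lambda>_. 0) (- m0, - ?b *s b) t) + sh (\<lambda>_. 0) (- m0, ?b *s b) t)"
        unfolding u_def B_def[of ?b] by (rule wt_R[OF hB zero_dual dual_add[OF Lk_dual sh_dual[OF zero_dual]]])
      moreover have "(- m0, - ?b *s b) + (- m0, ?b *s b) = (- 2 * m0, 0)" by (simp add: vec_eq_iff algebra_simps)
      ultimately show ?thesis by (simp only: add.assoc sh_add)
    qed
    show "V.lin_on UNIV (\<Phi> m)" for m unfolding \<Phi>_def by (rule lin_comp[OF Alin Alin])
    show "\<Phi> m (u m) \<noteq> 0" for m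
    proof -
      have "\<Phi> m (u m) = sV (?c ^ 2) (z (0 *s b) (z (- 0 *s b) v))"
        unfolding \<Phi>_def u_def AABB using f[of "int (Suc m) + int (Suc m)"] by simp
      also have "\<dots> = sV (?c ^ 2 * of_int C0 ^ 2) v" by (simp add: z_0 power2_eq_square mult.assoc)
      finally show ?thesis using c0 C0_pos v(2) by simp
    qed
    show "\<Phi> m (u m') = 0" if "m \<noteq> m'" for m m'
      unfolding \<Phi>_def u_def AABB using f[of "int (Suc m) + int (Suc m')"] f[of "int (Suc m) - int (Suc m')"] that by simp
  qed
qed

end

context tor_top
begin

text \<open>Instances are \<open>h(r)\<close> for \<open>h\<close> in the Cartan subalgebra, \<open>t\<^sup>rd\<^sub>0\<close>, and the products \<open>t\<^sup>pK\<^sub>0 t\<^sup>r\<^sup>-\<^sup>pK\<^sub>0\<close>.  Outside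
  \<open>r = 0\<close> every such family is proportional to \<open>t\<^sup>rK\<^sub>0\<close>.\<close>

definition compatible :: "(int ^ 'n \<Rightarrow> 'v \<Rightarrow> 'v) \<Rightarrow> bool" where
  "compatible y \<longleftrightarrow>
     (\<forall>r\<in>GX. V.lin_on M (y r) \<and> V.maps M (y r) \<and> (\<forall>k. \<forall>v\<in>Mk k. y r v \<in> Mk (k + r))) \<and>
     (\<forall>r\<in>GX. \<forall>s\<in>GX. \<forall>v\<in>M. y r (y s v) = y s (y r v)) \<and>
     (\<forall>r\<in>GX. \<forall>s\<in>GX. \<forall>w. \<forall>v\<in>M. Kw w (0, s) (y r v) = y r (Kw w (0, s) v)) \<and>
     (\<forall>r\<in>GX. \<forall>k. \<forall>x\<in>gwt X (0, k) (\<lambda>_. 0). \<forall>v\<in>M. R x (0, k) (y r v) = y r (R x (0, k) v)) \<and>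
     (\<forall>r\<in>GX. \<forall>u a. \<forall>v\<in>M. dvalid u (0, a) \<longrightarrow>
        D u (0, a) (y r v) - y r (D u (0, a) v) = sV (dot u (cvec (0, r))) (y (a + r) v))"

text \<open>With the zero family, the results of \<open>tor_fam\<close> that concern the central
  operators alone become available without a family.\<close>

lemma compatible_zero: "compatible (\<lambda>r v. 0)"
proof -
  have "Kw w (0, s) 0 = 0" if "s \<in> GX" for w s
    using V.lin_on_zero[OF Kw_lin V.subspace_UNIV, of "(0, s)" w] that by (simp add: Gam_lat)
  moreover have "R x (0, k) 0 = 0" if "x \<in> gwt X (0, k) (\<lambda>_. 0)" for x k
    using V.lin_on_zero[OF R_lin V.subspace_UNIV, of x "(0, k)"] that by (simp add: gwt_def)
  moreover have "D u (0, a) 0 = 0" if "dvalid u (0, a)" for u a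
    by (rule V.lin_on_zero[OF D_lin[OF that] V.subspace_UNIV])
  moreover have "0 \<in> Mk k" for k by (rule V.subspace_0[OF V.fdim_subspace[OF Mk_fd]])
  ultimately show ?thesis
    using V.subspace_0[OF M_subspace] by (simp add: compatible_def V.lin_on_def)
qed

end

locale tor_fam = tor_top X sV \<rho> C0 \<Lambda>
  for X :: "('g::ab_group_add, 'n::finite) datum" and sV :: "complex \<Rightarrow> 'v::ab_group_add \<Rightarrow> 'v"
    and \<rho> and C0 :: int and \<Lambda> +
  fixes y :: "int ^ 'n \<Rightarrow> 'v \<Rightarrow> 'v"
  assumes compat: "compatible y"
begin

lemmas compat_parts = compat[unfolded compatible_def, THEN conjunct1] compat[unfolded compatible_def, THEN conjunct2, THEN conjunct1]
  compat[unfolded compatible_def, THEN conjunct2, THEN conjunct2, THEN conjunct1]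
  compat[unfolded compatible_def, THEN conjunct2, THEN conjunct2, THEN conjunct2, THEN conjunct1]
  compat[unfolded compatible_def, THEN conjunct2, THEN conjunct2, THEN conjunct2, THEN conjunct2]

lemma y_lin: "r \<in> GX \<Longrightarrow> V.lin_on M (y r)"
  and y_M: "r \<in> GX \<Longrightarrow> v \<in> M \<Longrightarrow> y r v \<in> M"
  and y_Mk: "r \<in> GX \<Longrightarrow> v \<in> Mk k \<Longrightarrow> y r v \<in> Mk (k + r)"
  using compat_parts(1) by simp_all

lemma y_y: "r \<in> GX \<Longrightarrow> s \<in> GX \<Longrightarrow> v \<in> M \<Longrightarrow> y r (y s v) = y s (y r v)"
  using compat_parts(2) by blast

lemma y_K: "r \<in> GX \<Longrightarrow> s \<in> GX \<Longrightarrow> v \<in> M \<Longrightarrow> Kw w (0, s) (y r v) = y r (Kw w (0, s) v)"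
  using compat_parts(3) by simp

lemma y_R: "r \<in> GX \<Longrightarrow> x \<in> gwt X (0, k) (\<lambda>_. 0) \<Longrightarrow> v \<in> M \<Longrightarrow> R x (0, k) (y r v) = y r (R x (0, k) v)"
  using compat_parts(4) by simp

lemma y_D: "r \<in> GX \<Longrightarrow> dvalid u (0, a) \<Longrightarrow> v \<in> M \<Longrightarrow>
    D u (0, a) (y r v) - y r (D u (0, a) v) = sV (dot u (cvec (0, r))) (y (a + r) v)"
  using compat_parts(5) by simp

definition BB :: "('v \<Rightarrow> 'v) set" where
  "BB = {Kw w (0, s) | w s. s \<in> GX} \<union> y ` GX"

lemma BB_cases:
  assumes "b \<in> BB"
  obtains w s where "b = Kw w (0, s)" "s \<in> GX" | r where "b = y r" "r \<in> GX"
  using assms unfolding BB_def by blast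

lemma BB_K: "s \<in> GX \<Longrightarrow> Kw w (0, s) \<in> BB"
  and BB_y: "r \<in> GX \<Longrightarrow> y r \<in> BB"
  unfolding BB_def by (blast, simp)

lemma BB_lin: "b \<in> BB \<Longrightarrow> V.lin_on M b \<and> V.maps M b"
proof (erule BB_cases)
  show "V.lin_on M b \<and> V.maps M b" if "b = Kw w (0, s)" "s \<in> GX" for w s
    using that M_stable[OF K0_gens[OF that(2)]] Kw_lin by (simp add: Gam_lat)
  show "V.lin_on M b \<and> V.maps M b" if "b = y r" "r \<in> GX" for r
    using that y_lin y_M by simp
qed

lemma BB_comm:
  assumes "b \<in> BB" "c \<in> BB" "v \<in> M"
  shows "b (c v) = c (b v)"
  using assms(1)
proof (cases rule: BB_cases)
  case b: (1 w s)
  show ?thesis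
    using assms(2) by (cases rule: BB_cases) (use b K_K y_K assms(3) in \<open>auto simp: Gam_lat\<close>)
next
  case b: (2 r)
  show ?thesis
    using assms(2) by (cases rule: BB_cases) (use b y_y y_K assms(3) in auto)
qed

lemma zero_alg: "(\<lambda>v. 0) \<in> alg B"
  using alg_scale[OF alg_id, of 0 B] by simp

lemma base_ok_BB: "base_ok BB"
proof -
  have "\<exists>c\<in>alg BB. \<forall>v\<in>M. t (b v) - b (t v) = c v" if t: "t \<in> gens 0" and b: "b \<in> BB" for t b
    using t
  proof (cases rule: gens0_cases)
    case zero
    have "b 0 = 0" using BB_lin[OF b] V.lin_on_zero[OF _ M_subspace] by blast
    then show ?thesis using zero zero_alg by (intro bexI[of _ "\<lambda>v. 0"]) simp_all
  next
    case (R x k)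
    have "t (b v) - b (t v) = 0" if v: "v \<in> M" for v
      using b
    proof (cases rule: BB_cases)
      case (1 w s)
      have "Kw w (0, s) (R x (0, k) v) = R x (0, k) (Kw w (0, s) v)"
        by (rule K_R) (use R(2) 1(2) in \<open>simp_all add: Gam_lat gwt_def\<close>)
      then show ?thesis by (simp add: R 1)
    next
      case (2 r)
      then show ?thesis using y_R[OF 2(2) R(2) v] by (simp add: R)
    qed
    then show ?thesis using zero_alg by (intro bexI[of _ "\<lambda>v. 0"]) simp_all
  next
    case (K w s)
    have "t (b v) - b (t v) = 0" if v: "v \<in> M" for v
      using BB_comm[OF BB_K[OF K(2)] b v] K by simp
    then show ?thesis using zero_alg by (intro bexI[of _ "\<lambda>v. 0"]) simp_all
  next
    case (D u a)
    show ?thesis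
      using b
    proof (cases rule: BB_cases)
      case (1 w s)
      have "D u (0, a) (b v) - b (D u (0, a) v) =
          Kw (dot u (cvec (0, s)) *s w + dot u w *s cvec (0, a)) (0, a + s) v" for v
        using D_K[OF D(2), of "(0, s)" w v] 1 by (simp add: Gam_lat)
      then show ?thesis
        using alg_base[OF BB_K[OF Gam_add[OF D(3) 1(2)]]]
        by (intro bexI[of _ "Kw (dot u (cvec (0, s)) *s w + dot u w *s cvec (0, a)) (0, a + s)"]) (simp_all add: D)
    next
      case (2 r)
      show ?thesis
        using alg_scale[OF alg_base[OF BB_y[OF Gam_add[OF D(3) 2(2)]]], of "dot u (cvec (0, r))"] y_D[OF 2(2) D(2)]
        by (intro bexI[of _ "\<lambda>v. sV (dot u (cvec (0, r))) (y (a + r) v)"]) (simp_all add: D 2)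
    qed
  qed
  then show ?thesis unfolding base_ok_def using BB_lin BB_comm by blast
qed

sublocale irr_graded sV M "gens 0" BB Mk "Gam X"
proof (unfold_locales, goal_cases)
  case 1 show ?case by (rule base_ok_BB)
next
  case 2 show ?case by (rule Mk_fd)
next
  case 3 show ?case by (rule Mk_sub)
next
  case 4 show ?case by (rule Mk0)
qed

lemma K_CC: "s \<in> GX \<Longrightarrow> Kw w (0, s) \<in> CC"
  by (rule alg_base[OF BB_K])

lemma y_CC: "s \<in> GX \<Longrightarrow> y s \<in> CC"
  by (rule alg_base[OF BB_y])

lemma z_CC: "s \<in> GX \<Longrightarrow> z s \<in> CC"
  unfolding z_def by (rule K_CC)

lemma K_hom: "s \<in> GX \<Longrightarrow> hom (Kw w (0, s)) s"
  unfolding hom_def using K0_hom by blast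

lemma z_hom: "s \<in> GX \<Longrightarrow> hom (z s) s"
  unfolding z_def by (rule K_hom)

lemma y_hom: "s \<in> GX \<Longrightarrow> hom (y s) s"
  unfolding hom_def using y_Mk by blast

lemma D_hom: "dvalid u (0, a) \<Longrightarrow> hom (D u (0, a)) a"
  unfolding hom_def using D0_hom by blast

lemma sing_D:
  assumes "units" "dvalid u (0, a)" "x \<in> CC" "hom x b" "b \<in> GX" "sing x"
    "w \<in> CC" "\<And>v. v \<in> M \<Longrightarrow> D u (0, a) (x v) - x (D u (0, a) v) = w v"
  shows "sing w"
  by (rule sing_deriv[OF assms(1) D0_gens[OF assms(2)] D_hom[OF assms(2)] D0_valid_lat[OF assms(2)] assms(3-8)])

lemma sing_scale_cancel: "sing (\<lambda>v. sV c (x v)) \<Longrightarrow> c \<noteq> 0 \<Longrightarrow> sing x"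
  by (auto simp: sing_def)


end

section \<open>Injectivity of the central operators\<close>

context tor_fam
begin

text \<open>Otherwise all products \<open>z (m b) z (- m b)\<close> are singular. They are commuting
  endomorphisms of the component of degree 0, so some v there is killed by all of them, contrary to
  \<open>ex_pair_nonzero\<close>.\<close>

lemma z_unit:
  assumes b: "b \<in> GX"
  shows "\<exists>m::int. m > 0 \<and> \<not> sing (z (m *s b)) \<and> \<not> sing (z (- m *s b))"
proof (rule ccontr)
  assume "\<not> ?thesis"
  then have s: "sing (z (m *s b)) \<or> sing (z (- m *s b))" if "m > 0" for m :: int using that by blast
  let ?f = "\<lambda>m v. z (m *s b) (z (- m *s b) v)"
  have zC: "z (m *s b) \<in> CC" for m by (rule z_CC[OF Gam_smult[OF b]])
  have fC: "?f m \<in> CC" for m by (rule alg_comp[OF zC zC])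
  have fs: "sing (?f m)" if "m > 0" for m
  proof -
    have "sing (\<lambda>v. z (- m *s b) (z (m *s b) v)) \<longleftrightarrow> sing (?f m)"
      by (rule sing_cong) (rule CC_comm[OF zC zC])
    then show ?thesis using s[OF that] sing_comp1[OF zC _ zC] by blast
  qed
  have fh: "?f m v \<in> Mk 0" if "v \<in> Mk 0" for m v
  proof -
    have "?f m v \<in> Mk (0 + - m *s b + m *s b)" by (intro z_Mk Gam_smult b that)
    moreover have "0 + - m *s b + m *s b = 0" by (simp add: vec_eq_iff)
    ultimately show ?thesis by simp
  qed
  obtain v0 where v0: "v0 \<in> Mk 0" "v0 \<noteq> 0" using ex_Mk0 by blast
  have "\<exists>v\<in>Mk 0. v \<noteq> 0 \<and> (\<forall>f\<in>?f ` {0<..}. f v = 0)"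
  proof (rule common_kernel_M[OF Mk_fd Mk_sub v0])
    show "\<exists>u\<in>CC. f \<in> CC \<and> sing f \<and> \<not> sing u \<and> (\<forall>x\<in>Mk 0. u (f x) \<in> Mk 0)" if ff: "f \<in> ?f ` {0<..}" for f
    proof -
      obtain m where m: "f = ?f m" "m \<in> {0<..}" using ff by (rule imageE) blast
      show ?thesis
        by (rule bexI[OF _ alg_id]) (use m(2) fC fs fh in \<open>simp add: m(1) sing_def\<close>)
    qed
  qed
  then obtain v where v: "v \<in> Mk 0" "v \<noteq> 0" "\<forall>f\<in>?f ` {0<..}. f v = 0" by blast
  obtain m :: int where m: "m > 0" "?f m v \<noteq> 0" using ex_pair_nonzero[OF b v(1,2)] by blast
  have "?f m \<in> ?f ` {0<..}" by (rule imageI) (simp add: m)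
  then show False using bspec[OF v(3)] m(2) by blast
qed

lemma units: units
  unfolding units_def
proof
  fix b assume b: "b \<in> GX"
  obtain m :: int where m: "m > 0" "\<not> sing (z (m *s b))" "\<not> sing (z (- m *s b))" using z_unit[OF b] by blast
  have e: "of_nat (nat m) *s b = m *s b" "- (m *s b) = - m *s b" using m(1) by (simp_all add: vec_eq_iff)
  note zz = z_CC[OF Gam_smult[OF b]] z_hom[OF Gam_smult[OF b]]
  show "\<exists>m>0. \<exists>p\<in>CC. \<exists>q\<in>CC. \<not> sing p \<and> \<not> sing q \<and> hom p (of_nat m *s b) \<and> hom q (- (of_nat m *s b))"
  proof (rule exI[of _ "nat m"], rule conjI)
    show "nat m > 0" using m by simp
    show "\<exists>p\<in>CC. \<exists>q\<in>CC. \<not> sing p \<and> \<not> sing q \<and> hom p (of_nat (nat m) *s b) \<and> hom q (- (of_nat (nat m) *s b))"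
      by (rule bexI[OF _ zz(1)[of m]], rule bexI[OF _ zz(1)[of "- m"]]) (use m zz(2) in \<open>simp only: e simp_thms\<close>)
  qed
qed

text \<open>For b not parallel to r and m with \<open>z (m b)\<close> injective, a field of degree m
  b - r takes \<open>z r\<close> to a non-zero multiple of \<open>z (m b)\<close>; a singular
  \<open>z r\<close> would make this singular by \<open>sing_deriv\<close>.\<close>

lemma z_nonsing:
  assumes r: "r \<in> GX"
  shows "\<not> sing (z r)"
proof (cases "r = 0")
  case True
  then show ?thesis using C0_pos by (auto simp: sing_def z_0)
next
  case False
  show ?thesis
  proof
    assume s: "sing (z r)"
    obtain b where b: "b \<in> GX" "\<not> parallel r b" using avoid_parallel[OF False False] by blast
    obtain m :: int where m: "m > 0" "\<not> sing (z (m *s b))" using z_unit[OF b(1)] by blast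
    let ?a = "m *s b - r"
    have a: "?a \<in> GX" by (intro Gam_diff Gam_smult b r)
    have "\<not> parallel ?a r"
    proof
      assume "parallel ?a r"
      then have "?a $ i * r $ j = ?a $ j * r $ i" for i j unfolding parallel_def by blast
      then have *: "b $ i * r $ j = b $ j * r $ i" for i j using m(1) by (simp add: algebra_simps)
      have "parallel r b"
        unfolding parallel_def
      proof (intro allI)
        show "r $ i * b $ j = r $ j * b $ i" for i j using *[of j i] by (simp only: mult.commute)
      qed
      then show False using b(2) by blast
    qed
    then obtain f where f: "idot f ?a = 0" "idot f r \<noteq> 0" using ex_perp by blast
    have "sing (\<lambda>v. sV (of_int (idot f r)) (z (?a + r) v))"
      by (rule sing_D[OF units dvalid_cvec[OF a f(1)] z_CC[OF r] z_hom[OF r] r s alg_scale[OF z_CC[OF Gam_add[OF a r]]]])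
        (rule D_z_perp[OF a f(1) r])
    then have "sing (z (?a + r))" by (rule sing_scale_cancel) (use f in simp)
    then show False using m(2) by simp
  qed
qed

lemma common_kernel_fam:
  assumes "\<And>f. f \<in> FF \<Longrightarrow> \<exists>b\<in>GX. hom f b \<and> f \<in> CC \<and> sing f"
  shows "\<exists>v\<in>M. v \<noteq> 0 \<and> (\<forall>f\<in>FF. f v = 0)"
proof -
  obtain v0 where v0: "v0 \<in> Mk 0" "v0 \<noteq> 0" using ex_Mk0 by blast
  have "\<exists>v\<in>Mk 0. v \<noteq> 0 \<and> (\<forall>f\<in>FF. f v = 0)"
  proof (rule common_kernel_M[OF Mk_fd Mk_sub v0])
    fix f assume "f \<in> FF"
    then obtain b where b: "b \<in> GX" "hom f b" "f \<in> CC" "sing f" using assms by blast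
    have "z (- b) (f x) \<in> Mk 0" if "x \<in> Mk 0" for x
      using z_Mk[OF Gam_neg[OF b(1)] hom_M[OF b(2) that]] by simp
    then show "\<exists>u\<in>CC. f \<in> CC \<and> sing f \<and> \<not> sing u \<and> (\<forall>x\<in>Mk 0. u (f x) \<in> Mk 0)"
      using b z_CC[OF Gam_neg[OF b(1)]] z_nonsing[OF Gam_neg[OF b(1)]] by blast
  qed
  then show ?thesis using Mk_sub by blast
qed

text \<open>The common kernel of the family is non-zero and stable under the degree zero part, hence all of \<open>M\<close>.\<close>

lemma fam_vanish:
  assumes FF: "\<And>f. f \<in> FF \<Longrightarrow> \<exists>b\<in>GX. hom f b \<and> f \<in> CC \<and> sing f"
    and R: "\<And>f x k v. f \<in> FF \<Longrightarrow> x \<in> gwt X (0, k) (\<lambda>_. 0) \<Longrightarrow> v \<in> M \<Longrightarrow> R x (0, k) (f v) = f (R x (0, k) v)"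
    and D: "\<And>f u a v. f \<in> FF \<Longrightarrow> dvalid u (0, a) \<Longrightarrow> v \<in> M \<Longrightarrow> \<forall>g\<in>FF. g v = 0 \<Longrightarrow>
      D u (0, a) (f v) - f (D u (0, a) v) = 0"
    and f: "f \<in> FF" and v: "v \<in> M"
  shows "f v = 0"
proof -
  define W where "W = {v \<in> M. \<forall>f\<in>FF. f v = 0}"
  have fC: "f \<in> CC" if "f \<in> FF" for f using FF[OF that] by blast
  have f0: "f 0 = 0" if "f \<in> FF" for f by (rule CC_zero[OF fC[OF that]])
  have "W = M"
  proof (rule M_irreducible)
    show "V.subspace W"
    proof (rule V.subspaceI)
      show "0 \<in> W" using V.subspace_0[OF M_subspace] f0 by (simp add: W_def)
      show "x + x' \<in> W" if x: "x \<in> W" "x' \<in> W" for x x'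
      proof -
        have "f (x + x') = 0" if "f \<in> FF" for f
        proof -
          have "x \<in> M" "x' \<in> M" "f x = 0" "f x' = 0" using x that by (auto simp: W_def)
          then show ?thesis using V.lin_on_add[OF CC_lin[OF fC[OF that]], of x x'] by simp
        qed
        then show ?thesis using x V.subspace_add[OF M_subspace, of x x'] by (simp add: W_def)
      qed
      show "sV c x \<in> W" if x: "x \<in> W" for x c
      proof -
        have "f (sV c x) = 0" if "f \<in> FF" for f
        proof -
          have "x \<in> M" "f x = 0" using x that by (auto simp: W_def)
          then show ?thesis using V.lin_on_scale[OF CC_lin[OF fC[OF that]], of x c] by simp
        qed
        then show ?thesis using x V.subspace_scale[OF M_subspace, of x c] by (simp add: W_def)
      qed
    qed
    show "W \<subseteq> M" by (auto simp: W_def)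
    show "W \<noteq> {0}" using common_kernel_fam[OF FF] by (auto simp: W_def)
    fix t assume t: "t \<in> gens 0"
    show "\<forall>v\<in>W. t v \<in> W"
    proof
      fix v assume v: "v \<in> W"
      then have vM: "v \<in> M" and kill': "\<forall>g\<in>FF. g v = 0" by (auto simp: W_def)
      note kill = bspec[OF kill']
      have t0: "t 0 = 0" by (rule V.lin_on_zero[OF gens_lin[OF t] V.subspace_UNIV])
      have "f (t v) = 0" if f: "f \<in> FF" for f
        using t
      proof (cases rule: gens0_cases)
        case zero
        then show ?thesis using f0 f by simp
      next
        case R': (R x k)
        then show ?thesis using R[OF f R'(2) vM] kill[OF f] t0 by simp
      next
        case (K w s)
        then show ?thesis using CC_comm[OF fC[OF f] K_CC[OF K(2), of w] vM] kill[OF f] t0 by simp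
      next
        case D': (D u a)
        have "t (f v) - f (t v) = 0" unfolding D'(1) by (rule D[OF f D'(2) vM kill'])
        then show ?thesis using kill[OF f] t0 by simp
      qed
      then show "t v \<in> W" using M_stable[OF t vM] by (simp add: W_def)
    qed
  qed
  then show ?thesis using f v by (auto simp: W_def)
qed

section \<open>The other central elements vanish\<close>

text \<open>The class of t^(t-a) d(t^a), where the exponent t is the total degree; it is the central
  term that t^a d_0 produces from \<open>z (t - a)\<close>.\<close>

abbreviation exact_K :: "int ^ 'n \<Rightarrow> int ^ 'n \<Rightarrow> 'v \<Rightarrow> 'v" where
  "exact_K a t \<equiv> Kw (cvec (0, a)) (0, t)"

lemma D_exact_K:
  assumes "dvalid u (0, b)" "t \<in> GX"
  shows "D u (0, b) (exact_K a t v) - exact_K a t (D u (0, b) v) =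
    sV (dot u (cvec (0, t))) (exact_K a (b + t) v) + sV (dot u (cvec (0, a))) (exact_K b (b + t) v)"
proof -
  have l: "(0, b + t) \<in> lat X" using Gam_add[OF D0_valid_lat[OF assms(1)] assms(2)] by (simp add: Gam_lat)
  have "(0, t) \<in> lat X" using assms(2) by (simp add: Gam_lat)
  from D_K[OF assms(1) this] show ?thesis by (simp add: Kw_combine[OF l])
qed

lemma exact_K_double:
  assumes "a \<in> GX"
  shows "exact_K a (a + a) v = 0"
proof -
  have t: "(0, a + a) \<in> lat X" using Gam_add[OF assms assms] by (simp add: Gam_lat)
  have "cvec (0, a) = (1/2) *s cvec (0, a + a)"
  proof -
    have "cvec (0, a) $ i = ((1/2) *s cvec (0, a + a)) $ i" for i by (cases i) (simp_all add: cvec_def)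
    then show ?thesis unfolding vec_eq_iff by blast
  qed
  then show ?thesis using Kw_scale[OF t, of "1/2" "cvec (0, a + a)" v] by (simp add: Kw_cvec)
qed

text \<open>The field t^a d_0 commutes with \<open>exact_K a t\<close> and with \<open>z a\<close>,
  and it takes \<open>z (t - a)\<close> to \<open>exact_K a t\<close>. If the latter were injective,
  then z(t-a) z(a) - \<mu> exact_K(a, t) would be singular for some \<mu>, and so would its
  commutator exact_K(a, t) z(a), a product of injective operators.\<close>

lemma exact_K_sing:
  assumes a: "a \<in> GX" and t: "t \<in> GX"
  shows "sing (exact_K a t)"
proof (rule ccontr)
  assume ns: "\<not> sing (exact_K a t)"
  let ?x = "\<lambda>v. z (t - a) (z a v)"
  have ta: "t - a \<in> GX" by (rule Gam_diff[OF t a])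
  have xC: "?x \<in> CC" by (rule alg_comp[OF z_CC[OF ta] z_CC[OF a]])
  have xh: "hom ?x t" using hom_comp[OF z_hom[OF ta] z_hom[OF a]] by simp
  obtain \<mu> where mu: "sing (\<lambda>v. ?x v - sV \<mu> (exact_K a t v))"
    using eigen_ratio[OF xC xh K_CC[OF t] K_hom[OF t] ns z_CC[OF Gam_neg[OF t]] z_hom[OF Gam_neg[OF t]] z_nonsing[OF Gam_neg[OF t]]]
    by blast
  let ?y = "\<lambda>v. ?x v - sV \<mu> (exact_K a t v)"
  have yC: "?y \<in> CC" by (rule alg_diff[OF xC alg_scale[OF K_CC[OF t]]])
  have yh: "hom ?y t" by (rule hom_diff[OF xh hom_scale[OF K_hom[OF t]]])
  let ?w = "\<lambda>v. exact_K a t (z a v)"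
  have wC: "?w \<in> CC" by (rule alg_comp[OF K_CC[OF t] z_CC[OF a]])
  let ?D = "D (axis None 1) (0, a)"
  have Dv: "dvalid (axis None 1) (0, a)" by (rule dvalid_None[OF a])
  have "?D (?y v) - ?y (?D v) = ?w v" if v: "v \<in> M" for v
  proof -
    have Dl: "?D (x - sV c x') = ?D x - sV c (?D x')" for x x' c
      using V.lin_on_diff[OF D_lin[OF Dv] V.subspace_UNIV, of x "sV c x'"] V.lin_on_scale[OF D_lin[OF Dv], of x' UNIV c] by simp
    have d0: "dot (axis None 1) (cvec (0, s)) = 0" for s :: "int ^ 'n" by (simp add: dot_axis_cvec)
    have 1: "?D (z (t - a) w) = z (t - a) (?D w) + exact_K a t w" for w
      using D_z[OF Dv ta, of w] by (simp add: d0 diff_eq_eq add.commute)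
    have 2: "?D (z a w) = z a (?D w)" for w
      using D_z[OF Dv a, of w] unfolding d0 exact_K_double[OF a] by simp
    have 3: "?D (exact_K a t w) = exact_K a t (?D w)" for w
      using D_exact_K[OF Dv t, of a w] by (simp add: d0)
    show ?thesis unfolding Dl 1 2 3 by simp
  qed
  then have "sing ?w" by (rule sing_D[OF units Dv yC yh t mu wC])
  then show False using nonsing_comp[OF K_CC[OF t] z_CC[OF a] ns z_nonsing[OF a]] by simp
qed

text \<open>Commutators with fields stay in the span of the family \<open>exact_K\<close>, whose
  members are all singular; so its common kernel is M.\<close>

lemma exact_K_zero:
  assumes "a \<in> GX" "t \<in> GX" "v \<in> M"
  shows "exact_K a t v = 0"
proof (rule fam_vanish[where FF = "{exact_K a t | a t. a \<in> GX \<and> t \<in> GX}" and f = "exact_K a t" and v = v])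
  show "\<exists>b\<in>GX. hom f b \<and> f \<in> CC \<and> sing f" if "f \<in> {exact_K a t | a t. a \<in> GX \<and> t \<in> GX}" for f
    using that K_CC K_hom exact_K_sing by blast
  show "R x (0, k) (f v) = f (R x (0, k) v)"
    if ff: "f \<in> {exact_K a t | a t. a \<in> GX \<and> t \<in> GX}" and x: "x \<in> gwt X (0, k) (\<lambda>_. 0)" for f x k v
  proof -
    obtain a t where f: "f = exact_K a t" "t \<in> GX" using ff by blast
    show ?thesis unfolding f(1) by (rule K_R[symmetric]) (use f x in \<open>simp_all add: gwt_def Gam_lat\<close>)
  qed
  show "D u (0, b) (f v) - f (D u (0, b) v) = 0"
    if f: "f \<in> {exact_K a t | a t. a \<in> GX \<and> t \<in> GX}" and u: "dvalid u (0, b)"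
      and kill: "\<forall>g\<in>{exact_K a t | a t. a \<in> GX \<and> t \<in> GX}. g v = 0" for f u b v
  proof -
    obtain a t where f: "f = exact_K a t" "a \<in> GX" "t \<in> GX" using f by blast
    have b: "b \<in> GX" by (rule D0_valid_lat[OF u])
    have "exact_K a (b + t) v = 0" "exact_K b (b + t) v = 0" by (rule bspec[OF kill], use f b Gam_add in blast)+
    then show ?thesis unfolding f(1) D_exact_K[OF u f(3)] by simp
  qed
qed (use assms in blast)+

lemma Kw_None:
  assumes "t \<in> GX" "v \<in> M"
  shows "Kw w (0, t) v = sV (w $ None) (z t v)"
proof -
  have t: "(0, t) \<in> lat X" using assms(1) by (simp add: Gam_lat)
  have "Kw (axis (Some i) 1) (0, t) v = 0" for i
  proof -
    let ?P = "int (period X (Some i))"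
    have P: "?P \<noteq> 0" using period_pos[of "Some i"] by simp
    \<comment> \<open>Stretching the coordinate vector by the period puts it into the lattice, so
      that t^t K_i is a multiple of some \<open>exact_K\<close>.\<close>
    have G: "axis i ?P \<in> GX" by (simp add: Gam_def axis_def)
    have "axis (Some i) 1 = (1 / of_int ?P) *s cvec (0, axis i ?P)"
    proof -
      have "axis (Some i) 1 $ j = ((1 / of_int ?P) *s cvec (0, axis i ?P)) $ j" for j
        using P by (cases j) (auto simp: cvec_def axis_def)
      then show ?thesis unfolding vec_eq_iff by blast
    qed
    then show ?thesis using Kw_scale[OF t, of "1 / of_int ?P" "cvec (0, axis i ?P)" v] exact_K_zero[OF G assms] by simp
  qed
  then have s: "Kw (axis i 1) (0, t) v = (if i = None then z t v else 0)" for i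
    by (cases i) (simp_all add: z_def)
  have "Kw w (0, t) v = Kw (\<Sum>i\<in>UNIV. w $ i *s axis i 1) (0, t) v" by (simp add: basis_expansion)
  also have "\<dots> = (\<Sum>i\<in>UNIV. sV (w $ i) (if i = None then z t v else 0))"
    by (simp add: Kw_sum[OF t] Kw_scale[OF t] s)
  also have "\<dots> = (\<Sum>i\<in>UNIV. if i = None then sV (w $ i) (z t v) else 0)"
    by (rule sum.cong) auto
  also have "\<dots> = sV (w $ None) (z t v)" by simp
  finally show ?thesis .
qed

lemma D_z_M:
  assumes "dvalid u (0, a)" "s \<in> GX" "v \<in> M"
  shows "D u (0, a) (z s v) = z s (D u (0, a) v) + sV (dot u (cvec (0, s))) (z (a + s) v)"
proof -
  have "D u (0, a) (z s v) - z s (D u (0, a) v) = sV (dot u (cvec (0, s))) (z (a + s) v)"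
    unfolding D_z[OF assms(1,2)] using exact_K_zero[OF D0_valid_lat[OF assms(1)] Gam_add[OF D0_valid_lat[OF assms(1)] assms(2)] assms(3)]
    by simp
  then show ?thesis by (simp add: diff_eq_eq add.commute)
qed

section \<open>Comparison of a family with the central operators\<close>

text \<open>One \<mu> with y - \<mu> z singular at a single \<open>r0\<close> suffices: a field of
  degree s - r carries singularity from r to any s not parallel to r, and two such steps reach every
  non-zero s. The differences then form a family closed under commutators, which vanishes.\<close>

lemma family_proportional: "\<exists>\<mu>. \<forall>r\<in>GX. r \<noteq> 0 \<longrightarrow> (\<forall>v\<in>M. y r v = sV \<mu> (z r v))"
proof -
  obtain r0 where r0: "r0 \<in> GX" "r0 \<noteq> 0" using avoid_points[of "{}"] by auto
  note n0 = Gam_neg[OF r0(1)]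
  obtain \<mu> where mu: "sing (\<lambda>v. y r0 v - sV \<mu> (z r0 v))"
    using eigen_ratio[OF y_CC[OF r0(1)] y_hom[OF r0(1)] z_CC[OF r0(1)] z_hom[OF r0(1)] z_nonsing[OF r0(1)]
        z_CC[OF n0] z_hom[OF n0] z_nonsing[OF n0]] by blast
  define g where "g s = (\<lambda>v. y s v - sV \<mu> (z s v))" for s
  have gC: "g s \<in> CC" if "s \<in> GX" for s
    unfolding g_def by (rule alg_diff[OF y_CC[OF that] alg_scale[OF z_CC[OF that]]])
  have gh: "hom (g s) s" if "s \<in> GX" for s
    unfolding g_def by (rule hom_diff[OF y_hom[OF that] hom_scale[OF z_hom[OF that]]])
  have Dg: "D u (0, a) (g s v) - g s (D u (0, a) v) = sV (dot u (cvec (0, s))) (g (a + s) v)"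
    if "dvalid u (0, a)" "s \<in> GX" "v \<in> M" for u a s v
  proof -
    have Dl: "D u (0, a) (x - sV c x') = D u (0, a) x - sV c (D u (0, a) x')" for x x' c
      using V.lin_on_diff[OF D_lin[OF that(1)] V.subspace_UNIV, of x "sV c x'"] V.lin_on_scale[OF D_lin[OF that(1)], of x' UNIV c] by simp
    have "D u (0, a) (y s v) = y s (D u (0, a) v) + sV (dot u (cvec (0, s))) (y (a + s) v)"
      using y_D[OF that(2,1,3)] by (simp add: diff_eq_eq add.commute)
    then show ?thesis
      unfolding g_def Dl D_z_M[OF that] by (simp add: algebra_simps V.scale_right_diff_distrib V.scale_left_commute)
  qed
  have step: "sing (g s)" if r: "r \<in> GX" "sing (g r)" and s: "s \<in> GX" "\<not> parallel r s" for r s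
  proof -
    have a: "s - r \<in> GX" by (rule Gam_diff[OF s(1) r(1)])
    have "\<not> parallel (s - r) r"
    proof
      assume "parallel (s - r) r"
      then have "r $ i * s $ j = r $ j * s $ i" for i j unfolding parallel_def by (simp add: algebra_simps)
      then show False using s(2) by (simp add: parallel_def)
    qed
    then obtain f where f: "idot f (s - r) = 0" "idot f r \<noteq> 0" using ex_perp by blast
    have "sing (\<lambda>v. sV (of_int (idot f r)) (g (s - r + r) v))"
    proof (rule sing_D[OF units dvalid_cvec[OF a f(1)] gC[OF r(1)] gh[OF r(1)] r(1) r(2) alg_scale[OF gC[OF Gam_add[OF a r(1)]]]])
      show "D (cvec (0, f)) (0, s - r) (g r v) - g r (D (cvec (0, f)) (0, s - r) v) =
          sV (of_int (idot f r)) (g (s - r + r) v)" if "v \<in> M" for v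
        using Dg[OF dvalid_cvec[OF a f(1)] r(1) that] by (simp add: dot_cvec)
    qed
    then have "sing (g (s - r + r))" by (rule sing_scale_cancel) (use f in simp)
    then show ?thesis by simp
  qed
  have gs: "sing (g s)" if s: "s \<in> GX" "s \<noteq> 0" for s
  proof -
    obtain s' where s': "s' \<in> GX" "\<not> parallel r0 s'" "\<not> parallel s s'" using avoid_parallel[OF r0(2) s(2)] by blast
    have "sing (g s')" by (rule step[OF r0(1) _ s'(1,2)]) (use mu in \<open>simp add: g_def\<close>)
    then show ?thesis using step[OF s'(1) _ s(1)] s'(3) parallel_sym by blast
  qed
  have "g r v = 0" if r: "r \<in> GX" "r \<noteq> 0" and v: "v \<in> M" for r v
  proof (rule fam_vanish[where FF = "{g s | s. s \<in> GX \<and> s \<noteq> 0}" and f = "g r" and v = v])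
    show "\<exists>b\<in>GX. hom f b \<and> f \<in> CC \<and> sing f" if "f \<in> {g s | s. s \<in> GX \<and> s \<noteq> 0}" for f
      using that gC gh gs by blast
    show "R x (0, k) (f v) = f (R x (0, k) v)"
      if f: "f \<in> {g s | s. s \<in> GX \<and> s \<noteq> 0}" and x: "x \<in> gwt X (0, k) (\<lambda>_. 0)" and v: "v \<in> M" for f x k v
    proof -
      obtain s where s: "f = g s" "s \<in> GX" using f by blast
      have xk: "x \<in> gdeg X (0, k)" using x by (simp add: gwt_def)
      have "R x (0, k) (a - sV c b) = R x (0, k) a - sV c (R x (0, k) b)" for a b c
        using V.lin_on_diff[OF R_lin[OF xk] V.subspace_UNIV, of a "sV c b"] V.lin_on_scale[OF R_lin[OF xk], of b UNIV c] by simp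
      then show ?thesis unfolding s(1) g_def using y_R[OF s(2) x v] z_R[OF s(2) xk] by simp
    qed
    show "D u (0, a) (f v) - f (D u (0, a) v) = 0"
      if f: "f \<in> {g s | s. s \<in> GX \<and> s \<noteq> 0}" and u: "dvalid u (0, a)" and v: "v \<in> M"
        and kill: "\<forall>h\<in>{g s | s. s \<in> GX \<and> s \<noteq> 0}. h v = 0" for f u a v
    proof -
      obtain s where s: "f = g s" "s \<in> GX" using f by blast
      have aG: "a \<in> GX" by (rule D0_valid_lat[OF u])
      have "sV (dot u (cvec (0, s))) (g (a + s) v) = 0"
      \<comment> \<open>Degree 0 is not in the family, but it is reached only with factor (u|s) =
        -(u|a) = 0.\<close>
      proof (cases "a + s = 0")
        case True
        then have "cvec (0, s) = (-1) *s cvec (0, a)"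
          by (simp add: vec_eq_iff cvec_def split_option_all add_eq_0_iff)
        then have "dot u (cvec (0, s)) = 0" using u by (simp only: dot_scale_right dvalid_def) simp
        then show ?thesis by simp
      next
        case False
        have "g (a + s) v = 0" by (rule bspec[OF kill]) (use False Gam_add[OF aG s(2)] in blast)
        then show ?thesis by simp
      qed
      then show ?thesis unfolding s(1) Dg[OF u s(2) v] .
    qed
  qed (use r v in blast)+
  then show ?thesis by (intro exI[of _ \<mu>]) (simp add: g_def)
qed

end

section \<open>Products of central operators\<close>

context tor_fam
begin

lemma CC_scale: "x \<in> CC \<Longrightarrow> v \<in> M \<Longrightarrow> x (sV c v) = sV c (x v)"
  by (rule V.lin_on_scale[OF CC_lin])

lemma CC_diff: "x \<in> CC \<Longrightarrow> v \<in> M \<Longrightarrow> w \<in> M \<Longrightarrow> x (v - w) = x v - x w"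
  by (rule V.lin_on_diff[OF CC_lin M_subspace])

text \<open>The defect when the summand a moves from one factor of the product to the other.\<close>

definition ww :: "int ^ 'n \<Rightarrow> int ^ 'n \<Rightarrow> int ^ 'n \<Rightarrow> 'v \<Rightarrow> 'v" where
  "ww r s a = (\<lambda>v. z (a + r) (z s v) - z r (z (a + s) v))"

lemma ww_CC: "r \<in> GX \<Longrightarrow> s \<in> GX \<Longrightarrow> a \<in> GX \<Longrightarrow> ww r s a \<in> CC"
  unfolding ww_def by (rule alg_diff; rule alg_comp; intro z_CC Gam_add)

text \<open>Opposite signs of (f|r) and (f|s) allow powers of \<open>z r\<close> and
  \<open>z s\<close> of total degree t orthogonal to f. The field then commutes with
  \<open>z t\<close>, and the commutator with the product of powers is the defect times lower
  powers, which are injective.\<close>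

lemma ww_sing_opposite:
  assumes rsa: "r \<in> GX" "s \<in> GX" "a \<in> GX"
    and f: "idot f a = 0" "idot f r > 0" "idot f s < 0"
  shows "sing (ww r s a)"
proof -
  obtain p where p: "idot f r = int (Suc p)" using f(2) by (metis Suc_pred zero_less_imp_eq_int of_nat_0_less_iff)
  have "- idot f s > 0" using f(3) by simp
  then obtain q where q': "- idot f s = int (Suc q)" by (metis Suc_pred zero_less_imp_eq_int of_nat_0_less_iff)
  have q: "idot f s = - int (Suc q)" using q' by linarith
  let ?D = "D (cvec (0, f)) (0, a)"
  have Dv: "dvalid (cvec (0, f)) (0, a)" by (rule dvalid_cvec[OF rsa(3) f(1)])
  note Dg = D0_gens[OF Dv]
  \<comment> \<open>The exponents q + 1 and p + 1 are -(f|s) and (f|r), so the contributions to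
    (f|t) cancel.\<close>
  define t where "t = int (Suc q) *s r + int (Suc p) *s s"
  have t: "t \<in> GX" unfolding t_def by (intro Gam_add Gam_smult rsa)
  have ft: "idot f t = 0" by (simp add: t_def idot_add idot_smult p q del: of_nat_Suc)
  let ?P = "z r ^^ q" and ?S = "z s ^^ p" and ?P' = "z r ^^ Suc q" and ?S' = "z s ^^ Suc p"
  note zr = z_CC[OF rsa(1)] and zs = z_CC[OF rsa(2)] and zar = z_CC[OF Gam_add[OF rsa(3,1)]]
    and zas = z_CC[OF Gam_add[OF rsa(3,2)]]
  note PC = alg_pow[OF zr, of q] and SC = alg_pow[OF zs, of p]
    and PC' = alg_pow[OF zr, of "Suc q"] and SC' = alg_pow[OF zs, of "Suc p"]
  let ?x = "\<lambda>v. ?P' (?S' v)"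
  have xC: "?x \<in> CC" by (rule alg_comp[OF PC' SC'])
  have xh: "hom ?x t"
    unfolding t_def by (rule hom_comp[OF hom_pow[OF z_hom[OF rsa(1)]] hom_pow[OF z_hom[OF rsa(2)]]])
  note n = Gam_neg[OF t]
  obtain \<mu> where mu: "sing (\<lambda>v. ?x v - sV \<mu> (z t v))"
    using eigen_ratio[OF xC xh z_CC[OF t] z_hom[OF t] z_nonsing[OF t] z_CC[OF n] z_hom[OF n] z_nonsing[OF n]] by blast
  let ?U = "\<lambda>v. ?P (?S v)"
  have UC: "?U \<in> CC" by (rule alg_comp[OF PC SC])
  let ?w = "\<lambda>v. sV (of_nat (Suc p) * of_nat (Suc q)) (?U (ww r s a v))"
  have wC: "?w \<in> CC" by (rule alg_scale[OF alg_comp[OF UC ww_CC[OF rsa]]])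
  have "sing ?w"
  proof (rule sing_D[OF units Dv _ _ t mu wC])
    show "(\<lambda>v. ?x v - sV \<mu> (z t v)) \<in> CC" by (rule alg_diff[OF xC alg_scale[OF z_CC[OF t]]])
    show "hom (\<lambda>v. ?x v - sV \<mu> (z t v)) t" by (rule hom_diff[OF xh hom_scale[OF z_hom[OF t]]])
    fix v assume v: "v \<in> M"
    have Dl: "?D (x - sV c x') = ?D x - sV c (?D x')" for x x' c
      using V.lin_on_diff[OF D_lin[OF Dv] V.subspace_UNIV, of x "sV c x'"] V.lin_on_scale[OF D_lin[OF Dv], of x' UNIV c] by simp
    have Dt: "?D (z t v) = z t (?D v)" using D_z_perp[OF rsa(3) f(1) t, of v] ft by simp
    define \<gamma> :: complex where "\<gamma> = of_nat (Suc p)"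
    define \<delta> :: complex where "\<delta> = of_nat (Suc q)"
    have fr: "of_int (idot f r) = \<gamma>" "of_int (idot f s) = - \<delta>" by (simp_all add: p q \<gamma>_def \<delta>_def)
    have yr: "(\<lambda>v. sV \<gamma> (z (a + r) v)) \<in> CC" and ys: "(\<lambda>v. sV (- \<delta>) (z (a + s) v)) \<in> CC"
      by (rule alg_scale[OF zar], rule alg_scale[OF zas])
    have dr: "\<forall>v\<in>M. ?D (z r v) - z r (?D v) = sV \<gamma> (z (a + r) v)"
      using D_z_perp[OF rsa(3) f(1) rsa(1)] by (simp add: fr)
    have ds: "\<forall>v\<in>M. ?D (z s v) - z s (?D v) = sV (- \<delta>) (z (a + s) v)"
      using D_z_perp[OF rsa(3) f(1) rsa(2)] by (simp only: fr) simp
    have DM: "?D v \<in> M" by (rule M_stable[OF Dg v])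
    have as: "z (a + s) v \<in> M" and sM: "z s v \<in> M" by (rule CC_maps[OF zas v], rule CC_maps[OF zs v])
    have 1: "?D (?S' v) = ?S' (?D v) + sV (- (\<gamma> * \<delta>)) (?S (z (a + s) v))"
      using pow_deriv[OF Dg zs ys ds v, of "Suc p"]
      by (simp only: diff_Suc_1 CC_scale[OF SC as] V.scale_scale \<gamma>_def mult_minus_right)
    have 2: "?D (?P' w) = ?P' (?D w) + sV (\<gamma> * \<delta>) (?P (z (a + r) w))" if w: "w \<in> M" for w
      using pow_deriv[OF Dg zr yr dr w, of "Suc q"] CC_scale[OF PC CC_maps[OF zar w]]
      by (simp add: \<delta>_def mult.commute del: funpow.simps of_nat_Suc)
    have S'M: "?S' v \<in> M" by (rule CC_maps[OF SC' v])
    have 3: "?P' (?D (?S' v)) = ?x (?D v) + sV (- (\<gamma> * \<delta>)) (?P' (?S (z (a + s) v)))"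
      unfolding 1
      using V.lin_on_add[OF CC_lin[OF PC'], of "?S' (?D v)" "sV (- (\<gamma> * \<delta>)) (?S (z (a + s) v))"]
        CC_maps[OF SC' DM] V.subspace_scale[OF M_subspace CC_maps[OF SC as]] CC_scale[OF PC' CC_maps[OF SC as]]
      by (simp only:)
    have 4: "?P' (?S (z (a + s) v)) = ?U (z r (z (a + s) v))"
    proof -
      have "?P' (?S (z (a + s) v)) = ?P (z r (?S (z (a + s) v)))" by (simp add: funpow_swap1)
      also have "z r (?S (z (a + s) v)) = ?S (z r (z (a + s) v))" by (rule CC_comm[OF zr SC as])
      finally show ?thesis .
    qed
    have 5: "?P (z (a + r) (?S' v)) = ?U (z (a + r) (z s v))"
    proof -
      have "?S' v = ?S (z s v)" by (simp add: funpow_swap1)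
      then show ?thesis using CC_comm[OF zar SC sM] by simp
    qed
    have 6: "?U (ww r s a v) = ?U (z (a + r) (z s v)) - ?U (z r (z (a + s) v))"
      unfolding ww_def by (rule CC_diff[OF UC CC_maps[OF zar sM] CC_maps[OF zr as]])
    have "?D (?x v) - ?x (?D v) = sV (\<gamma> * \<delta>) (?U (ww r s a v))"
      unfolding 2[OF S'M] 3 4 5 6 by (simp add: V.scale_right_diff_distrib del: funpow.simps)
    then show "?D (?x v - sV \<mu> (z t v)) - (?x (?D v) - sV \<mu> (z t (?D v))) = ?w v"
      unfolding Dl Dt by (simp add: \<gamma>_def \<delta>_def del: funpow.simps of_nat_Suc)
  qed
  then have "sing (\<lambda>v. ?U (ww r s a v))" by (rule sing_scale_cancel) (simp del: of_nat_Suc)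
  moreover have "\<not> sing ?U"
    by (rule nonsing_comp[OF PC SC nonsing_pow[OF zr z_nonsing[OF rsa(1)]] nonsing_pow[OF zs z_nonsing[OF rsa(2)]]])
  ultimately show ?thesis using sing_cancel[OF UC _ ww_CC[OF rsa]] by blast
qed

text \<open>Equal signs are reduced to opposite ones by passing through -s: z(-s) ww(r, s) = z(s)
  ww(r, -s) - z(r) ww(s, -s), and both terms on the right are singular.\<close>

lemma ww_sing:
  assumes rsa: "r \<in> GX" "s \<in> GX" "a \<in> GX"
    and f: "idot f a = 0" "idot f r \<noteq> 0" "idot f s \<noteq> 0"
  shows "sing (ww r s a)"
proof -
  have opp: "sing (ww r s a)" if "s \<in> GX" "r \<in> GX" "idot f r * idot f s < 0" for r s
  proof (cases "idot f r > 0")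
    case True
    then have "idot f s < 0" using that by (simp add: mult_less_0_iff)
    then show ?thesis using ww_sing_opposite[OF that(2,1) rsa(3) f(1) True] by blast
  next
    case False
    then have "idot (- f) r > 0" "idot (- f) s < 0" using that by (auto simp: mult_less_0_iff idot_neg_left)
    then show ?thesis using ww_sing_opposite[OF that(2,1) rsa(3), of "- f"] f(1) by (simp add: idot_neg_left)
  qed
  show ?thesis
  proof (cases "idot f r * idot f s < 0")
    case True
    then show ?thesis by (rule opp[OF rsa(2,1)])
  next
    case False
    then have pos: "idot f r * idot f s > 0" using f by (simp add: not_less order_less_le)
    note ns = Gam_neg[OF rsa(2)]
    have 1: "sing (ww r (- s) a)" using opp[OF ns rsa(1)] pos by (simp add: idot_neg)
    have "idot f s * idot f (- s) < 0" using f(3) zero_less_power2[of "idot f s"] by (simp add: idot_neg power2_eq_square)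
    then have 2: "sing (ww s (- s) a)" by (rule opp[OF ns rsa(2)])
    note C = z_CC[OF rsa(1)] z_CC[OF rsa(2)] z_CC[OF ns] z_CC[OF Gam_add[OF rsa(3,1)]] z_CC[OF Gam_add[OF rsa(3,2)]]
      z_CC[OF Gam_add[OF rsa(3) ns]]
    have C1: "ww r (- s) a \<in> CC" "ww s (- s) a \<in> CC" by (intro ww_CC rsa ns)+
    have "sing (\<lambda>v. z s (ww r (- s) a v) - z r (ww s (- s) a v))"
      by (rule sing_diff[OF alg_comp[OF C(2) C1(1)] sing_comp1[OF C1(1) 1 C(2)] alg_comp[OF C(1) C1(2)] sing_comp1[OF C1(2) 2 C(1)]])
    moreover have "z s (ww r (- s) a v) - z r (ww s (- s) a v) = z (- s) (ww r s a v)" if v: "v \<in> M" for v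
    proof -
      note m = CC_maps[OF _ v]
      have d1: "z s (ww r (- s) a v) = z s (z (a + r) (z (- s) v)) - z s (z r (z (a + - s) v))"
        unfolding ww_def by (rule CC_diff) (intro z_M z_CC rsa ns Gam_add v)+
      have d2: "z r (ww s (- s) a v) = z r (z (a + s) (z (- s) v)) - z r (z s (z (a + - s) v))"
        unfolding ww_def by (rule CC_diff) (intro z_M z_CC rsa ns Gam_add v)+
      have d3: "z (- s) (ww r s a v) = z (- s) (z (a + r) (z s v)) - z (- s) (z r (z (a + s) v))"
        unfolding ww_def by (rule CC_diff) (intro z_M z_CC rsa ns Gam_add v)+
      have e1: "z s (z (a + r) (z (- s) v)) = z (- s) (z (a + r) (z s v))"
        using z_z[OF rsa(2) Gam_add[OF rsa(3,1)]] z_z[OF rsa(2) ns] z_z[OF ns Gam_add[OF rsa(3,1)]] by simp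
      have e2: "z s (z r (z (a + - s) v)) = z r (z s (z (a + - s) v))" by (rule z_z[OF rsa(2,1)])
      have e3: "z r (z (a + s) (z (- s) v)) = z (- s) (z r (z (a + s) v))"
        using z_z[OF ns Gam_add[OF rsa(3,2)]] z_z[OF ns rsa(1)] by simp
      show ?thesis unfolding d1 d2 d3 e1 e2 e3 by simp
    qed
    ultimately have "sing (\<lambda>v. z (- s) (ww r s a v))"
      using sing_cong[of "\<lambda>v. z s (ww r (- s) a v) - z r (ww s (- s) a v)" "\<lambda>v. z (- s) (ww r s a v)"] by blast
    then show ?thesis by (rule sing_cancel[OF C(3) z_nonsing[OF ns] ww_CC[OF rsa]])
  qed
qed

definition pp :: "int ^ 'n \<Rightarrow> int ^ 'n \<Rightarrow> int ^ 'n \<Rightarrow> int ^ 'n \<Rightarrow> 'v \<Rightarrow> 'v" where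
  "pp p q p' q' = (\<lambda>v. z p (z q v) - z p' (z q' v))"

lemma pp_CC: "p \<in> GX \<Longrightarrow> q \<in> GX \<Longrightarrow> p' \<in> GX \<Longrightarrow> q' \<in> GX \<Longrightarrow> pp p q p' q' \<in> CC"
  unfolding pp_def by (rule alg_diff; rule alg_comp; intro z_CC)

text \<open>With a = p - p' the difference is a defect \<open>ww p' q a\<close>. The two
  non-parallelism conditions provide f orthogonal to a but to neither p' nor q.\<close>

lemma pp_sing_generic:
  assumes G: "p \<in> GX" "q \<in> GX" "p' \<in> GX" "q' \<in> GX" and s: "p + q = p' + q'"
    and n: "\<not> parallel p p'" "\<not> parallel q q'"
  shows "sing (pp p q p' q')"
proof -
  have a: "p - p' \<in> GX" by (rule Gam_diff[OF G(1,3)])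
  have q': "q' = (p - p') + q" using s by (simp add: algebra_simps)
  have "\<not> parallel (p - p') p'"
  proof
    assume "parallel (p - p') p'"
    then have "parallel p p'" unfolding parallel_def by (simp add: algebra_simps)
    then show False using n by blast
  qed
  moreover have "\<not> parallel (p - p') q"
  proof
    assume h: "parallel (p - p') q"
    have "parallel q q'" unfolding parallel_def
    proof (intro allI)
      fix i j
      have "(p - p') $ i * q $ j = (p - p') $ j * q $ i" using h by (simp only: parallel_def)
      then show "q $ i * q' $ j = q $ j * q' $ i" unfolding q' by (simp add: algebra_simps)
    qed
    then show False using n by blast
  qed
  ultimately obtain f where f: "idot f (p - p') = 0" "idot f p' \<noteq> 0" "idot f q \<noteq> 0" using ex_perp2 by blast
  have "ww p' q (p - p') = pp p q p' q'" by (simp add: ww_def pp_def q')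
  then show ?thesis using ww_sing[OF G(3,2) a f] by simp
qed

text \<open>Both products are compared with a third one of degrees r and t - r, where r avoids the
  four lines that would violate the generic conditions.\<close>

lemma pp_sing:
  assumes G: "p \<in> GX" "q \<in> GX" "p' \<in> GX" "q' \<in> GX" and s: "p + q = p' + q'"
    and n: "p \<noteq> 0" "q \<noteq> 0" "p' \<noteq> 0" "q' \<noteq> 0"
  shows "sing (pp p q p' q')"
proof -
  define t where "t = p + q"
  obtain r where r: "r \<in> GX" "\<forall>(q, t)\<in>{(p, 0), (p', 0), (q, t), (q', t)}. \<not> parallel q (t - r)"
    using avoid_lines[of "{(p, 0), (p', 0), (q, t), (q', t)}"] n by blast
  have n: "\<not> parallel p (0 - r)" "\<not> parallel p' (0 - r)" "\<not> parallel q (t - r)" "\<not> parallel q' (t - r)"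
    using r(2) by (simp_all only: ball_simps prod.case insert_iff empty_iff simp_thms)
  have "parallel x r \<Longrightarrow> parallel x (0 - r)" for x by (simp add: parallel_def)
  then have pr: "\<not> parallel p r" "\<not> parallel p' r" using n(1,2) by metis+
  have t: "t - r \<in> GX" unfolding t_def by (intro Gam_diff Gam_add G r)
  have 1: "sing (pp p q r (t - r))"
    by (rule pp_sing_generic[OF G(1,2) r(1) t _ pr(1) n(3)]) (simp add: t_def)
  have 2: "sing (pp p' q' r (t - r))"
    by (rule pp_sing_generic[OF G(3,4) r(1) t _ pr(2) n(4)]) (simp add: t_def s)
  have "sing (\<lambda>v. pp p q r (t - r) v - pp p' q' r (t - r) v)"
    by (rule sing_diff[OF pp_CC[OF G(1,2) r(1) t] 1 pp_CC[OF G(3,4) r(1) t] 2])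
  then show ?thesis by (simp add: pp_def)
qed

lemma dot_add_zero:
  assumes "dvalid u (0, a)" "a + s = 0"
  shows "dot u (cvec (0, s)) = 0"
proof -
  have "cvec (0, s) = (-1) *s cvec (0, a)"
    using assms(2) by (simp add: vec_eq_iff cvec_def split_option_all add_eq_0_iff)
  then show ?thesis using assms(1) by (simp only: dot_scale_right dvalid_def) simp
qed

lemma dot_cvec_add: "dot u (cvec (0, r + s)) = dot u (cvec (0, r)) + dot u (cvec (0, s))"
  using cvec_add[of "(0, r)" "(0, s)"] by (simp add: dot_add_right)

lemma D_zz:
  assumes "dvalid u (0, a)" "p \<in> GX" "q \<in> GX" "v \<in> M"
  shows "D u (0, a) (z p (z q v)) = z p (z q (D u (0, a) v)) +
    sV (dot u (cvec (0, p))) (z (a + p) (z q v)) + sV (dot u (cvec (0, q))) (z p (z (a + q) v))"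
proof -
  have aG: "a \<in> GX" by (rule D0_valid_lat[OF assms(1)])
  have m: "z q (D u (0, a) v) \<in> M" "z (a + q) v \<in> M"
    by (intro z_M Gam_add aG assms M_stable[OF D0_gens])+
  have "z p (z q (D u (0, a) v) + sV (dot u (cvec (0, q))) (z (a + q) v)) =
      z p (z q (D u (0, a) v)) + sV (dot u (cvec (0, q))) (z p (z (a + q) v))"
    using V.lin_on_add[OF z_lin[OF assms(2), of UNIV]] V.lin_on_scale[OF z_lin[OF assms(2), of UNIV]] by simp
  then show ?thesis
    using D_z_M[OF assms(1,2) z_M[OF assms(3,4)]] D_z_M[OF assms(1,3,4)] by simp
qed

text \<open>The differences of products with equal total degree are singular; they vanish together
  once their commutators with fields are seen to vanish on their common kernel.\<close>

lemma z_prod_eq: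
  assumes G: "p \<in> GX" "q \<in> GX" "p' \<in> GX" "q' \<in> GX" and s: "p + q = p' + q'"
    and n: "p \<noteq> 0" "q \<noteq> 0" "p' \<noteq> 0" "q' \<noteq> 0" and v: "v \<in> M"
  shows "z p (z q v) = z p' (z q' v)"
proof -
  let ?F = "{pp p q p' q' | p q p' q'. p \<in> GX \<and> q \<in> GX \<and> p' \<in> GX \<and> q' \<in> GX \<and> p + q = p' + q' \<and>
    p \<noteq> 0 \<and> q \<noteq> 0 \<and> p' \<noteq> 0 \<and> q' \<noteq> 0}"
  have "pp p q p' q' v = 0"
  proof (rule fam_vanish[where FF = ?F and f = "pp p q p' q'" and v = v])
    show "\<exists>b\<in>GX. hom f b \<and> f \<in> CC \<and> sing f" if f: "f \<in> ?F" for f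
    proof -
      obtain p q p' q' where f: "f = pp p q p' q'" and G: "p \<in> GX" "q \<in> GX" "p' \<in> GX" "q' \<in> GX" and s: "p + q = p' + q'"
        and n: "p \<noteq> 0" "q \<noteq> 0" "p' \<noteq> 0" "q' \<noteq> 0" using f by blast
      have "hom f (p + q)"
        unfolding f pp_def
        by (rule hom_diff[OF hom_comp[OF z_hom[OF G(1)] z_hom[OF G(2)]]])
          (simp only: s hom_comp[OF z_hom[OF G(3)] z_hom[OF G(4)]])
      then show ?thesis using pp_CC[OF G] pp_sing[OF G s n] Gam_add[OF G(1,2)] f by blast
    qed
    show "R x (0, k) (f v) = f (R x (0, k) v)" if f: "f \<in> ?F" and x: "x \<in> gwt X (0, k) (\<lambda>_. 0)" for f x k v
    proof -
      obtain p q p' q' where f: "f = pp p q p' q'" and G: "p \<in> GX" "q \<in> GX" "p' \<in> GX" "q' \<in> GX" using f by blast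
      have xk: "x \<in> gdeg X (0, k)" using x by (simp add: gwt_def)
      show ?thesis
        using V.lin_on_diff[OF R_lin[OF xk] V.subspace_UNIV, of "z p (z q v)" "z p' (z q' v)"]
        by (simp add: f pp_def z_R[OF _ xk, symmetric] G)
    qed
    show "D u (0, a) (f v) - f (D u (0, a) v) = 0"
      if f: "f \<in> ?F" and u: "dvalid u (0, a)" and v: "v \<in> M" and kill: "\<forall>h\<in>?F. h v = 0" for f u a v
    proof -
      obtain p q p' q' where f: "f = pp p q p' q'" and G: "p \<in> GX" "q \<in> GX" "p' \<in> GX" "q' \<in> GX" and s: "p + q = p' + q'"
        and n: "p \<noteq> 0" "q \<noteq> 0" "p' \<noteq> 0" "q' \<noteq> 0" using f by blast
      have a: "a \<in> GX" by (rule D0_valid_lat[OF u])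
      obtain r where r: "r \<in> GX" "r \<noteq> 0" "r \<noteq> a + (p + q)" using avoid_points[of "{a + (p + q)}"] by auto
      \<comment> \<open>On the common kernel every product of total degree a + p + q with non-zero
        degrees takes this value; r is only a reference splitting.\<close>
      define val where "val = z r (z (a + (p + q) - r) v)"
      have eq: "z x (z y v) = val" if xy: "x \<in> GX" "y \<in> GX" "x + y = a + (p + q)" "x \<noteq> 0" "y \<noteq> 0" for x y
      proof -
        have "a + (p + q) - r \<in> GX" by (intro Gam_diff Gam_add a G r)
        then have "pp x y r (a + (p + q) - r) v = 0" by (intro bspec[OF kill]) (use xy r in fastforce)
        then show ?thesis by (simp add: pp_def val_def)
      qed
      \<comment> \<open>The commutator depends only on the total degree p + q; a term in which a
        factor would reach degree 0 has coefficient 0.\<close>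
      have tm: "sV (dot u (cvec (0, x))) (z (a + x) (z y v)) + sV (dot u (cvec (0, y))) (z x (z (a + y) v)) =
          sV (dot u (cvec (0, p + q))) val"
        if xy: "x \<in> GX" "y \<in> GX" "x + y = p + q" "x \<noteq> 0" "y \<noteq> 0" for x y
      proof -
        have "sV (dot u (cvec (0, x))) (z (a + x) (z y v)) = sV (dot u (cvec (0, x))) val"
        proof (cases "a + x = 0")
          case True
          then show ?thesis using dot_add_zero[OF u] by simp
        next
          case False
          have "z (a + x) (z y v) = val"
            by (rule eq[OF Gam_add[OF a xy(1)] xy(2) _ False xy(5)]) (simp add: add.assoc xy(3))
          then show ?thesis by simp
        qed
        moreover have "sV (dot u (cvec (0, y))) (z x (z (a + y) v)) = sV (dot u (cvec (0, y))) val"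
        proof (cases "a + y = 0")
          case True
          then show ?thesis using dot_add_zero[OF u] by simp
        next
          case False
          have "z x (z (a + y) v) = val"
            by (rule eq[OF xy(1) Gam_add[OF a xy(2)] _ xy(4) False]) (simp add: add.left_commute xy(3))
          then show ?thesis by simp
        qed
        ultimately show ?thesis unfolding xy(3)[symmetric] dot_cvec_add V.scale_left_distrib by (simp only:)
      qed
      have "D u (0, a) (f v) = D u (0, a) (z p (z q v)) - D u (0, a) (z p' (z q' v))"
        unfolding f pp_def by (rule V.lin_on_diff[OF D_lin[OF u] V.subspace_UNIV]) simp_all
      also have "\<dots> = f (D u (0, a) v)"
        unfolding D_zz[OF u G(1,2) v] D_zz[OF u G(3,4) v]
        using tm[OF G(1,2) refl n(1,2)] tm[OF G(3,4) s[symmetric] n(3,4)] by (simp add: f pp_def add.assoc)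
      finally show ?thesis by simp
    qed
  qed (use G s n v in blast)+
  then show ?thesis by (simp add: pp_def)
qed

end

section \<open>The structure constants\<close>

context tor_top
begin

lemma tor_famI: "compatible y \<Longrightarrow> tor_fam X sV \<rho> C0 \<Lambda> y"
  by (rule tor_fam.intro[OF tor_top_axioms]) (simp add: tor_fam_axioms_def)

lemmas tor_fam_zero = tor_famI[OF compatible_zero]
lemmas z_prod_indep = tor_fam.z_prod_eq[OF tor_fam_zero]
lemmas K_M = tor_fam.Kw_None[OF tor_fam_zero]
lemmas D_zz_M = tor_fam.D_zz[OF tor_fam_zero]

lemma z_nz: "r \<in> GX \<Longrightarrow> v \<in> M \<Longrightarrow> v \<noteq> 0 \<Longrightarrow> z r v \<noteq> 0"
  using tor_fam.z_nonsing[OF tor_fam_zero] by (auto simp: sing_def)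

lemma z_scale: "r \<in> GX \<Longrightarrow> z r (sV c v) = sV c (z r v)"
  by (rule V.lin_on_scale[OF z_lin[of r UNIV]]) simp_all

lemma z_diff: "r \<in> GX \<Longrightarrow> z r (v - w) = z r v - z r w"
  by (rule V.lin_on_diff[OF z_lin V.subspace_UNIV]) simp_all

lemma z_inj: "r \<in> GX \<Longrightarrow> v \<in> M \<Longrightarrow> w \<in> M \<Longrightarrow> z r v = z r w \<Longrightarrow> v = w"
  using z_nz[of r "v - w"] V.subspace_diff[OF M_subspace, of v w] by (auto simp: z_diff)

lemma fam_multiple:
  assumes "compatible y"
  shows "\<exists>\<mu>. \<forall>r\<in>GX. r \<noteq> 0 \<longrightarrow> (\<forall>v\<in>M. y r v = sV \<mu> (z r v))"
  by (rule tor_fam.family_proportional[OF tor_famI[OF assms]])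

text \<open>On \<open>M\<close> the product \<open>z r (z (t - r) v)\<close> does not depend on \<open>r\<close>; as a function of \<open>t\<close> it is a family
  as in \<open>compatible\<close>.\<close>

definition Q :: "int ^ 'n \<Rightarrow> 'v \<Rightarrow> 'v" where
  "Q t = (let r = (SOME r. r \<in> GX \<and> r \<noteq> 0 \<and> r \<noteq> t) in (\<lambda>v. z r (z (t - r) v)))"

lemma Q_form: "t \<in> GX \<Longrightarrow> \<exists>r\<in>GX. r \<noteq> 0 \<and> t - r \<noteq> 0 \<and> t - r \<in> GX \<and> Q t = (\<lambda>v. z r (z (t - r) v))"
proof -
  assume t: "t \<in> GX"
  have "\<exists>r. r \<in> GX \<and> r \<noteq> 0 \<and> r \<noteq> t" using avoid_points[of "{t}"] by auto
  from someI_ex[OF this] show ?thesis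
    unfolding Q_def Let_def using Gam_diff[OF t] by (intro bexI[of _ "SOME r. r \<in> GX \<and> r \<noteq> 0 \<and> r \<noteq> t"]) auto
qed

lemma Q_eq: "r \<in> GX \<Longrightarrow> s \<in> GX \<Longrightarrow> r \<noteq> 0 \<Longrightarrow> s \<noteq> 0 \<Longrightarrow> v \<in> M \<Longrightarrow> Q (r + s) v = z r (z s v)"
proof -
  assume h: "r \<in> GX" "s \<in> GX" "r \<noteq> 0" "s \<noteq> 0" "v \<in> M"
  obtain p where p: "p \<in> GX" "p \<noteq> 0" "r + s - p \<noteq> 0" "r + s - p \<in> GX" "Q (r + s) = (\<lambda>v. z p (z (r + s - p) v))"
    using Q_form[OF Gam_add[OF h(1,2)]] by blast
  show ?thesis unfolding p(5) by (rule z_prod_indep) (use h p in simp_all)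
qed

lemma compatible_Q: "compatible Q"
  unfolding compatible_def
proof (intro conjI ballI allI impI)
  fix r assume r: "r \<in> GX"
  obtain p where p: "p \<in> GX" "p \<noteq> 0" "r - p \<noteq> 0" "r - p \<in> GX" "Q r = (\<lambda>v. z p (z (r - p) v))"
    using Q_form[OF r] by blast
  show "V.lin_on M (Q r)"
    unfolding p(5) using z_lin[OF p(1), of UNIV] z_lin[OF p(4), of UNIV] by (simp add: V.lin_on_def)
  show "Q r v \<in> M" if "v \<in> M" for v unfolding p(5) by (intro z_M p that)
  show "Q r v \<in> Mk (k + r)" if "v \<in> Mk k" for v k
    unfolding p(5) using z_Mk[OF p(1) z_Mk[OF p(4) that]] by (simp add: add.assoc)
  show "Kw w (0, s) (Q r v) = Q r (Kw w (0, s) v)" if "s \<in> GX" for s w v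
    unfolding p(5) z_def using K_K[of "(0, s)"] that p(1,4) by (simp add: Gam_lat)
  show "R x (0, k) (Q r v) = Q r (R x (0, k) v)" if "x \<in> gwt X (0, k) (\<lambda>_. 0)" for x k v
    unfolding p(5) using z_R[OF p(1)] z_R[OF p(4)] that by (simp add: gwt_def)
  show "Q r (Q s v) = Q s (Q r v)" if s: "s \<in> GX" for s v
  proof -
    obtain q where q: "q \<in> GX" "s - q \<in> GX" "Q s = (\<lambda>v. z q (z (s - q) v))" using Q_form[OF s] by blast
    show ?thesis
      unfolding p(5) q(3)
      using z_z[OF p(4) q(1)] z_z[OF p(4) q(2)] z_z[OF p(1) q(1)] z_z[OF p(1) q(2)] by simp
  qed
next
  fix r u a v assume r: "r \<in> GX" and v: "v \<in> M" and u: "dvalid u (0, a)"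
  have a: "a \<in> GX" by (rule D0_valid_lat[OF u])
  \<comment> \<open>The exclusions keep p, r - p, a + p and a + r - p non-zero, so that every
    product below is a value of \<open>Q\<close>.\<close>
  obtain p where p: "p \<in> GX" "p \<noteq> 0" "p \<notin> {r, - a, a + r}" using avoid_points[of "{r, - a, a + r}"] by auto
  define q where "q = r - p"
  have q: "q \<in> GX" "q \<noteq> 0" "p + q = r" using p Gam_diff[OF r p(1)] by (auto simp: q_def)
  have "a + q = (a + r) - p" by (simp add: q_def)
  then have aq: "a + q \<noteq> 0" using p(3) by (simp only: right_minus_eq) auto
  have ap: "a + p \<in> GX" "a + p \<noteq> 0" "a + q \<in> GX"
    using p q(1) Gam_add[OF a] by (simp_all add: add_eq_0_iff)
  have e: "a + p + q = a + r" "p + (a + q) = a + r" using q(3) by (simp_all add: algebra_simps)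
  have 1: "Q r w = z p (z q w)" if "w \<in> M" for w using Q_eq[OF p(1) q(1) p(2) q(2) that] q(3) by simp
  have 2: "z (a + p) (z q v) = Q (a + r) v" using Q_eq[OF ap(1) q(1) ap(2) q(2) v] e(1) by simp
  have 3: "z p (z (a + q) v) = Q (a + r) v" using Q_eq[OF p(1) ap(3) p(2) aq v] e(2) by simp
  have 4: "dot u (cvec (0, r)) = dot u (cvec (0, p)) + dot u (cvec (0, q))"
    using cvec_add[of "(0, p)" "(0, q)"] q(3) by (simp add: dot_add_right)
  show "D u (0, a) (Q r v) - Q r (D u (0, a) v) = sV (dot u (cvec (0, r))) (Q (a + r) v)"
    unfolding 1[OF v] 1[OF M_stable[OF D0_gens[OF u] v]] D_zz_M[OF u p(1) q(1) v] 2 3 4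
    by (simp add: V.scale_left_distrib)
qed

lemma H_gwt: "h \<in> H \<Longrightarrow> r \<in> GX \<Longrightarrow> h \<in> gwt X (0, r) (\<lambda>_. 0)"
  using gwt_lat[of "(0, r)"] gwt0_cartan by (simp add: Gam_lat)

lemma Kw_cvec_M: "t \<in> GX \<Longrightarrow> v \<in> M \<Longrightarrow> Kw (c *s cvec (0, k)) (0, t) v = 0"
  using K_M[of t v "c *s cvec (0, k)"] by (simp add: cvec_None)

lemma compatible_Cartan:
  assumes h: "h \<in> H"
  shows "compatible (\<lambda>r. R h (0, r))"
  unfolding compatible_def
proof (intro conjI ballI allI impI)
  fix r assume r: "r \<in> GX"
  note hr = H_gwt[OF h r]
  have hd: "h \<in> gdeg X (0, r)" using hr by (simp add: gwt_def)
  show "V.lin_on M (R h (0, r))" by (rule R_lin[OF hd])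
  show "R h (0, r) v \<in> M" if "v \<in> M" for v by (rule M_stable[OF R0_gens[OF hr] that])
  show "R h (0, r) v \<in> Mk (k + r)" if "v \<in> Mk k" for k v by (rule R0_hom[OF hr that])
  show "Kw w (0, s) (R h (0, r) v) = R h (0, r) (Kw w (0, s) v)" if "s \<in> GX" for s w v
    by (rule K_R[OF _ hd]) (use that in \<open>simp add: Gam_lat\<close>)
  show "R x (0, k) (R h (0, r) v) = R h (0, r) (R x (0, k) v)"
    if x: "x \<in> gwt X (0, k) (\<lambda>_. 0)" and v: "v \<in> M" for x k v
  proof -
    have xd: "x \<in> gdeg X (0, k)" and "br h x = 0" using x h by (simp_all add: gwt_def)
    then have b: "br x h = 0" using br_anti[of x h] by simp
    \<comment> \<open>The central term is a combination of K_1, ..., K_n only, and these vanish on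
      M.\<close>
    have "Kw (ifm x h *s cvec (0, k)) ((0, k) + (0, r)) v = 0"
    proof (cases "ifm x h = 0")
      case True
      then show ?thesis by (simp add: Kw_zero)
    next
      case False
      have "(0, k + r) \<in> lat X" using form_lat[OF xd hd False] by simp
      then show ?thesis using Kw_cvec_M[of "k + r" v] v by (simp add: Gam_lat)
    qed
    then show ?thesis using R_R[OF xd hd, of v] by (simp add: b R_zero)
  qed
  show "R h (0, r) (R h (0, s) v) = R h (0, s) (R h (0, r) v)" if s: "s \<in> GX" and v: "v \<in> M" for s v
  proof -
    have sd: "h \<in> gdeg X (0, s)" using H_gwt[OF h s] by (simp add: gwt_def)
    show ?thesis
      using R_R[OF hd sd, of v] Kw_cvec_M[OF Gam_add[OF r s] v] by (simp add: br_self R_zero)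
  qed
  show "D u (0, a) (R h (0, r) v) - R h (0, r) (D u (0, a) v) = sV (dot u (cvec (0, r))) (R h (0, a + r) v)"
    if "dvalid u (0, a)" for u a v
    using D_R[OF that hd, of v] by simp
qed

abbreviation "Ed r \<equiv> D (axis None 1) (0, r)"

text \<open>The coefficient vector of the cocycle is a multiple of \<open>cvec (0, a)\<close>,
  without K_0 component, so the cocycle is invisible on M.\<close>

lemma compatible_d0: "compatible Ed"
  unfolding compatible_def
proof (intro conjI ballI allI impI)
  fix r assume r: "r \<in> GX"
  note Dv = dvalid_None[OF r]
  have d0: "dot (axis None 1) (cvec (0, s)) = 0" for s :: "int ^ 'n" by (simp add: dot_axis_cvec)
  show "V.lin_on M (Ed r)" by (rule D_lin[OF Dv])
  show "Ed r v \<in> M" if "v \<in> M" for v by (rule M_stable[OF D0_gens[OF Dv] that])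
  show "Ed r v \<in> Mk (k + r)" if "v \<in> Mk k" for k v by (rule D0_hom[OF Dv that])
  show "Kw w (0, s) (Ed r v) = Ed r (Kw w (0, s) v)" if s: "s \<in> GX" and v: "v \<in> M" for s w v
  proof -
    have "(0, s) \<in> lat X" using s by (simp add: Gam_lat)
    from D_K[OF Dv this, of w v] show ?thesis
      using Kw_cvec_M[OF Gam_add[OF r s] v] by (simp add: d0)
  qed
  show "R x (0, k) (Ed r v) = Ed r (R x (0, k) v)" if "x \<in> gwt X (0, k) (\<lambda>_. 0)" for x k v
    using D_R[OF Dv, of x "(0, k)" v] that by (simp add: d0 gwt_def)
  show "Ed r (Ed s v) = Ed s (Ed r v)" if s: "s \<in> GX" and v: "v \<in> M" for s v
    using D_D[OF Dv dvalid_None[OF s], of v] Kw_cvec_M[OF Gam_add[OF r s] v]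
    by (simp add: d0 cocycle_def D_zero Kw_zero)
  show "D u (0, a) (Ed r v) - Ed r (D u (0, a) v) = sV (dot u (cvec (0, r))) (Ed (a + r) v)"
    if u: "dvalid u (0, a)" and v: "v \<in> M" for u a v
  proof -
    have a: "a \<in> GX" by (rule D0_valid_lat[OF u])
    show ?thesis
      using D_D[OF u Dv, of v] Kw_cvec_M[OF Gam_add[OF a r] v] D_scale[OF dvalid_None[OF Gam_add[OF a r]]]
      by (simp add: d0 cocycle_def Kw_zero)
  qed
qed

definition lam :: complex where
  "lam = (SOME l. \<forall>r\<in>GX. r \<noteq> 0 \<longrightarrow> (\<forall>v\<in>M. Q r v = sV l (z r v)))"

lemma Q_lam: "r \<in> GX \<Longrightarrow> r \<noteq> 0 \<Longrightarrow> v \<in> M \<Longrightarrow> Q r v = sV lam (z r v)"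
  using someI_ex[OF fam_multiple[OF compatible_Q]] unfolding lam_def by blast

lemma zz_lam:
  assumes "r \<in> GX" "s \<in> GX" "r \<noteq> 0" "s \<noteq> 0" "r + s \<noteq> 0" "v \<in> M"
  shows "z r (z s v) = sV lam (z (r + s) v)"
  using Q_eq[OF assms(1-4,6)] Q_lam[OF Gam_add[OF assms(1,2)] assms(5,6)] by simp

text \<open>A product of two injective operators is not zero.\<close>

lemma lam_nz: "lam \<noteq> 0"
proof
  assume l: "lam = 0"
  obtain r where r: "r \<in> GX" "r \<noteq> 0" using avoid_points[of "{}"] by auto
  obtain s where s: "s \<in> GX" "s \<noteq> 0" "s \<noteq> - r" using avoid_points[of "{- r}"] by auto
  have "r + s \<noteq> 0" using s(3) by (simp add: add_eq_0_iff)
  then have "z r (z s w0) = 0" using zz_lam[OF r(1) s(1) r(2) s(2) _ w0(1)] l by simp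
  then show False using z_nz[OF r(1) z_M[OF s(1) w0(1)] z_nz[OF s(1) w0(1,3)]] by blast
qed

text \<open>Multiply by an auxiliary injective \<open>z s\<close>: z(r) z(-r) z(s) avoids degree 0
  at each step, so the generic rule applies twice and gives lam^2 z(s).\<close>

lemma zz_neg:
  assumes r: "r \<in> GX" "r \<noteq> 0" and v: "v \<in> M"
  shows "z r (z (- r) v) = sV (lam ^ 2) v"
proof -
  obtain s where s: "s \<in> GX" "s \<noteq> 0" "s \<noteq> r" using avoid_points[of "{r}"] by auto
  note nr = Gam_neg[OF r(1)]
  have e: "z s (z r (z (- r) v)) = z r (z (- r) (z s v))"
    using z_z[OF s(1) r(1)] z_z[OF s(1) nr] by simp
  also have "z (- r) (z s v) = sV lam (z (- r + s) v)"
    by (rule zz_lam[OF nr s(1) _ s(2) _ v]) (use r s in \<open>simp_all add: add_eq_0_iff\<close>)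
  also have "z r (sV lam (z (- r + s) v)) = sV lam (z r (z (- r + s) v))" by (rule z_scale[OF r(1)])
  also have "z r (z (- r + s) v) = sV lam (z (r + (- r + s)) v)"
    by (rule zz_lam[OF r(1) Gam_add[OF nr s(1)] r(2) _ _ v]) (use s in \<open>simp_all add: add_eq_0_iff\<close>)
  finally have "z s (z r (z (- r) v)) = z s (sV (lam ^ 2) v)"
    by (simp add: power2_eq_square z_scale[OF s(1)])
  then show ?thesis
    by (rule z_inj[OF s(1) z_M[OF r(1) z_M[OF nr v]] V.subspace_scale[OF M_subspace v]])
qed

section \<open>The action of the Cartan subalgebra\<close>

text \<open>The factor \<open>lam\<close> compensates for the normalization of the bases, in which
  \<open>z r\<close> carries one basis to \<open>lam\<close> times the next.\<close>

definition al :: "'g \<Rightarrow> complex" where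
  "al h = (if h \<in> H then lam * (SOME \<mu>. \<forall>r\<in>GX. r \<noteq> 0 \<longrightarrow> (\<forall>v\<in>M. R h (0, r) v = sV \<mu> (z r v))) else 0)"

lemma R_al:
  assumes "h \<in> H" "r \<in> GX" "r \<noteq> 0" "v \<in> M"
  shows "R h (0, r) v = sV (al h / lam) (z r v)"
  using someI_ex[OF fam_multiple[OF compatible_Cartan[OF assms(1)]]] assms lam_nz unfolding al_def by simp

lemma al_unique:
  assumes h: "h \<in> H" and c: "\<And>r v. r \<in> GX \<Longrightarrow> r \<noteq> 0 \<Longrightarrow> v \<in> M \<Longrightarrow> R h (0, r) v = sV (c / lam) (z r v)"
  shows "al h = c"
proof -
  obtain r where r: "r \<in> GX" "r \<noteq> 0" using avoid_points[of "{}"] by auto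
  have "sV (al h / lam) (z r w0) = sV (c / lam) (z r w0)" 
    by (rule trans[OF R_al[OF h r w0(1), symmetric] c[OF r w0(1)]])
  then show ?thesis using z_nz[OF r(1) w0(1,3)] lam_nz by simp
qed

lemma al_dual: "al \<in> dual_space scl H"
proof -
  have d: "h \<in> gdeg X (0, r)" if "h \<in> H" "r \<in> GX" for h r using H_gwt[OF that] by (simp add: gwt_def)
  have "al (x + y) = al x + al y" if "x \<in> H" "y \<in> H" for x y
  proof (rule al_unique)
    show "x + y \<in> H" by (rule G.subspace_add[OF H_subspace that])
    show "R (x + y) (0, r) v = sV ((al x + al y) / lam) (z r v)" if r: "r \<in> GX" "r \<noteq> 0" "v \<in> M" for r v
      using R_add[OF d[OF \<open>x \<in> H\<close> r(1)] d[OF \<open>y \<in> H\<close> r(1)], of v] R_al[OF \<open>x \<in> H\<close> r] R_al[OF \<open>y \<in> H\<close> r]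
      by (simp add: add_divide_distrib V.scale_left_distrib)
  qed
  moreover have "al (scl c x) = c * al x" if "x \<in> H" for c x
  proof (rule al_unique)
    show "scl c x \<in> H" by (rule G.subspace_scale[OF H_subspace that])
    show "R (scl c x) (0, r) v = sV (c * al x / lam) (z r v)" if r: "r \<in> GX" "r \<noteq> 0" "v \<in> M" for r v
      using R_scale[OF d[OF \<open>x \<in> H\<close> r(1)], of c v] R_al[OF \<open>x \<in> H\<close> r] by simp
  qed
  moreover have "al x = 0" if "x \<notin> H" for x using that by (simp add: al_def)
  ultimately show ?thesis by (simp add: dual_space_def)
qed

lemma R0_Mk: "h \<in> H \<Longrightarrow> v \<in> Mk k \<Longrightarrow> R h (0, 0) v = sV (\<Lambda> (tX h 0)) v"
proof -
  assume h: "h \<in> H" and v: "v \<in> Mk k"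
  have "delta_vec X k (tX h 0) = 0" unfolding delta_vec_sh sh_tX[OF h] ..
  then have "\<rho> (tX h 0) v = sV (\<Lambda> (tX h 0)) v"
    using Mk_wsp[OF v] tX_HH[OF h] by (simp add: weight_space_def)
  moreover have "R h (0, 0) v = \<rho> (tX h 0) v" by (simp add: R_def zero_prod_def)
  ultimately show ?thesis by simp
qed

lemma dual_uminus: "a \<in> dual_space scl H \<Longrightarrow> (\<lambda>h. - a h) \<in> dual_space scl H"
  by (simp add: dual_space_def)

text \<open>The vectors \<open>y(-m\<^sub>0, mb) t\<^sup>-\<^sup>m\<^sup>b K\<^sub>0 v\<close> lie in one finite-dimensional weight space, so the Gram matrix
  obtained by applying \<open>t\<^sup>m\<^sup>b K\<^sub>0 x(m\<^sub>0, -mb)\<close> is degenerate: its diagonal and off-diagonal entries agree.\<close>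

lemma Lam_al_bracket:
  assumes a: "a \<in> dual_space scl H" and x: "x \<in> gwt X 0 a" and y: "y \<in> gwt X 0 (\<lambda>h. - a h)"
  shows "\<Lambda> (tX (br x y) 0) + ifm x y * of_int m0 * of_int C0 = al (br x y) + lam * (ifm x y * of_int m0)"
proof (rule ccontr)
  assume ne: "\<not> ?thesis"
  define h where "h = br x y"
  define c where "c = ifm x y * of_int m0"
  have hH: "h \<in> H" using gwt_br[OF x y] gwt0_cartan by (simp add: h_def)
  obtain b where b: "b \<in> GX" "b \<noteq> 0" using avoid_points[of "{}"] by auto
  obtain v where v: "v \<in> Mk 0" "v \<noteq> 0" using Mk0 V.subspace_0[OF V.fdim_subspace[OF Mk_fd]] by blast
  have vM: "v \<in> M" using v Mk_sub by blast
  note Gb = Gam_smult[OF b(1)]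
  define A where "A \<alpha> = R x (m0, \<alpha> *s b)" for \<alpha>
  define B where "B \<beta> = R y (- m0, \<beta> *s b)" for \<beta>
  have xA: "x \<in> gwt X (m0, \<alpha> *s b) a" for \<alpha> using gwt_lat[OF m0_shift_lat(1)[OF Gb]] x by simp
  have yB: "y \<in> gwt X (- m0, \<beta> *s b) (\<lambda>h. - a h)" for \<beta> using gwt_lat[OF m0_shift_lat(2)[OF Gb]] y by simp
  have Alin: "V.lin_on UNIV (A \<alpha>)" for \<alpha> unfolding A_def by (rule R_lin) (use xA in \<open>simp add: gwt_def\<close>)
  have Blin: "V.lin_on UNIV (B \<alpha>)" for \<alpha> unfolding B_def by (rule R_lin) (use yB in \<open>simp add: gwt_def\<close>)
  have xy: "x \<in> gfix X" "y \<in> gfix X" using x y by (simp_all add: gwt_def)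
  have AB: "A \<alpha> (B \<beta> w) = R h (0, (\<alpha> + \<beta>) *s b) w + sV c (z ((\<alpha> + \<beta>) *s b) w)" if w: "w \<in> M" for \<alpha> \<beta> w
  proof -
    have "A \<alpha> w = 0" unfolding A_def by (rule R_kills[OF xA a m0_pos w])
    then have "B \<beta> (A \<alpha> w) = 0" using V.lin_on_zero[OF Blin V.subspace_UNIV] by simp
    then show ?thesis using A_B[OF xy b(1), of \<alpha> \<beta> w] by (simp add: A_def B_def h_def c_def)
  qed
  have sb: "m *s b \<noteq> 0" if "m \<noteq> 0" for m :: int using b(2) that by (auto simp: vec_eq_iff)
  let ?z = "\<lambda>m. z (m *s b)"
  define \<Psi> where "\<Psi> m = (\<lambda>w. ?z m (A (- m) w))" for m
  define U where "U m = B m (?z (- m) v)" for m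
  \<comment> \<open>The two kinds of Gram entries. On the diagonal the bracket lands in degree 0 and
    acts through \<Lambda> and C_0; off the diagonal it acts through \<open>al\<close> and
    \<open>lam\<close>.\<close>
  define off where "off = (al h / lam + c) * lam * lam ^ 2"
  define dg where "dg = (\<Lambda> (tX h 0) + c * of_int C0) * lam ^ 2"
  have zv: "?z (- m) v \<in> M" "?z (- m) v \<in> Mk (- m *s b)" for m
    using z_M[OF Gb vM] z_Mk[OF Gb v(1)] by simp_all
  have pn: "?z m (?z (- m) v) = sV (lam ^ 2) v" if "m \<noteq> 0" for m
  proof -
    have "- (m *s b) = - m *s b" by (simp add: vec_eq_iff)
    then show ?thesis using zz_neg[OF Gb sb[OF that] vM] by simp
  qed
  have diag: "\<Psi> m (U m) = sV dg v" if "m \<noteq> 0" for m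
  proof -
    have "A (- m) (U m) = sV (\<Lambda> (tX h 0) + c * of_int C0) (?z (- m) v)"
      unfolding U_def AB[OF zv(1)] using R0_Mk[OF hH zv(2)] by (simp add: z_0 V.scale_left_distrib)
    then show ?thesis unfolding \<Psi>_def using pn[OF that] by (simp add: z_scale[OF Gb] dg_def)
  qed
  have offd: "\<Psi> m (U m') = sV off v" if "m \<noteq> 0" "m' \<noteq> 0" "m \<noteq> m'" for m m'
  proof -
    have nz: "- m + m' \<noteq> 0" using that by simp
    have "A (- m) (U m') = sV (al h / lam + c) (?z (- m + m') (?z (- m') v))"
      unfolding U_def AB[OF zv(1)] R_al[OF hH Gb sb[OF nz] zv(1)] by (simp add: V.scale_left_distrib)
    also have "?z (- m + m') (?z (- m') v) = sV lam (z ((- m + m') *s b + - m' *s b) v)"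
    proof (rule zz_lam[OF Gb Gb sb[OF nz] sb _ vM])
      show "- m' \<noteq> 0" using that by simp
      have "(- m + m') *s b + - m' *s b = - m *s b" by (simp add: vec_eq_iff algebra_simps)
      then show "(- m + m') *s b + - m' *s b \<noteq> 0" using sb[of "- m"] that by simp
    qed
    also have "(- m + m') *s b + - m' *s b = - m *s b" by (simp add: vec_eq_iff algebra_simps)
    finally show ?thesis unfolding \<Psi>_def using pn[OF that(1)] by (simp add: z_scale[OF Gb] off_def)
  qed
  have "off = (al h + lam * c) * lam ^ 2" using lam_nz by (simp add: off_def field_simps)
  then have do: "dg - off \<noteq> 0" using ne lam_nz by (simp add: dg_def h_def c_def)
  let ?L = "\<lambda>t. \<Lambda> t + sh (\<lambda>h. - a h) (- m0, 0) t"
  have Ld: "?L \<in> duals" by (rule dual_add[OF Lam_dual sh_dual[OF dual_uminus[OF a]]])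
  have UL: "U m \<in> wsp ?L" for m
  proof -
    have "U m \<in> wsp (\<lambda>t. (\<Lambda> t + delta_vec X (- m *s b) t) + sh (\<lambda>h. - a h) (- m0, m *s b) t)"
      unfolding U_def B_def by (rule wt_R[OF yB dual_uminus[OF a] Lk_dual Mk_wsp[OF zv(2)]])
    moreover have "(0, - m *s b) + (- m0, m *s b) = (- m0, 0)" by (simp add: vec_eq_iff)
    ultimately show ?thesis by (simp only: delta_vec_sh add.assoc sh_add)
  qed
  \<comment> \<open>Subtracting the vector of index 1 from all others cancels the constant
    off-diagonal entries. The remaining indices start at 2 to avoid this reference and the
    exceptional index 0.\<close>
  define k where "k i = int i + 2" for i :: nat
  have k: "k i \<noteq> 0" "k i \<noteq> 1" "k i = k j \<longleftrightarrow> i = j" for i j by (simp_all add: k_def)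
  have \<Psi>lin: "V.lin_on UNIV (\<Psi> m)" for m unfolding \<Psi>_def by (rule lin_comp[OF z_lin[OF Gb] Alin])
  have \<Psi>d: "\<Psi> m (w - w') = \<Psi> m w - \<Psi> m w'" for m w w'
    by (rule V.lin_on_diff[OF \<Psi>lin V.subspace_UNIV]) simp_all
  show False
  proof (rule gram_wsp[OF Ld, of "\<lambda>i. U (k i) - U 1" "\<lambda>i. \<Psi> (k i)"])
    show "U (k i) - U 1 \<in> wsp ?L" for i by (rule V.subspace_diff[OF wsp_subspace UL UL])
    show "V.lin_on UNIV (\<Psi> (k i))" for i by (rule \<Psi>lin)
    show "\<Psi> (k i) (U (k i) - U 1) \<noteq> 0" for i
      unfolding \<Psi>d diag[OF k(1)] offd[OF k(1) one_neq_zero k(2)] V.scale_left_diff_distrib[symmetric]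
      using do v(2) by simp
    show "\<Psi> (k i) (U (k j) - U 1) = 0" if "i \<noteq> j" for i j
    proof -
      have "k i \<noteq> k j" using that k(3) by blast
      then show ?thesis unfolding \<Psi>d offd[OF k(1) one_neq_zero k(2)] using offd[OF k(1) k(1)] by simp
    qed
  qed
qed

lemma al_0: "al 0 = 0"
  by (rule dual_at_zero[OF al_dual])

lemma tX_lin: "\<Lambda> (tX 0 0) = 0"
  "x \<in> H \<Longrightarrow> y \<in> H \<Longrightarrow> \<Lambda> (tX (x + y) 0) = \<Lambda> (tX x 0) + \<Lambda> (tX y 0)"
  "x \<in> H \<Longrightarrow> \<Lambda> (tX (scl c x) 0) = c * \<Lambda> (tX x 0)"
proof -
  have 0: "0 \<in> HH X" unfolding HH_def by (rule T.span_zero)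
  have "\<Lambda> 0 = 0" using dual_lin[OF Lam_dual 0 0, of 1] by simp
  then show "\<Lambda> (tX 0 0) = 0" by (simp add: tX_zero)
  show "\<Lambda> (tX (x + y) 0) = \<Lambda> (tX x 0) + \<Lambda> (tX y 0)" if "x \<in> H" "y \<in> H"
    using dual_lin[OF Lam_dual tX_HH[OF that(1)] tX_HH[OF that(2)], of 1] by (simp add: tX_add)
  show "\<Lambda> (tX (scl c x) 0) = c * \<Lambda> (tX x 0)" if "x \<in> H"
    using dual_lin[OF Lam_dual tX_HH[OF that] 0, of c] \<open>\<Lambda> 0 = 0\<close> by (simp add: tscale_tX)
qed

text \<open>For x and y in H the bracket vanishes, and \<open>Lam_al_bracket\<close> compares the
  central terms only.\<close>

lemma lam_C0: "lam = of_int C0"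
proof -
  obtain h h' where h: "h \<in> H" "h' \<in> H" "ifm h h' \<noteq> 0" using cartan_pair by blast
  have "h \<in> gwt X 0 (\<lambda>_. 0)" "h' \<in> gwt X 0 (\<lambda>h. - 0)" using h gwt0_cartan by simp_all
  from Lam_al_bracket[OF zero_dual this] have "ifm h h' * of_int m0 * of_int C0 = lam * (ifm h h' * of_int m0)"
    by (simp add: cartan_abelian[OF h(1,2)] tX_lin al_0)
  then show ?thesis using h m0_pos by simp
qed

text \<open>With lam = C_0 the central terms cancel in \<open>Lam_al_bracket\<close>, and the
  brackets of opposite weights span H.\<close>

lemma Lam_al: "h \<in> H \<Longrightarrow> \<Lambda> (tX h 0) = al h"
proof -
  assume h: "h \<in> H"
  let ?N = "{br x y |x y a. a \<in> dual_space scl H \<and> x \<in> gwt X 0 a \<and> y \<in> gwt X 0 (\<lambda>h. - a h)}"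
  let ?W = "{h \<in> H. \<Lambda> (tX h 0) = al h}"
  have al: "al (x + y) = al x + al y" if "x \<in> H" "y \<in> H" for x y
    using al_dual that unfolding dual_space_def by blast
  have al': "al (scl c x) = c * al x" if "x \<in> H" for x c
    using al_dual that unfolding dual_space_def by blast
  have "G.span ?N \<subseteq> ?W"
  proof (rule G.span_minimal)
    show "?N \<subseteq> ?W"
    proof
      fix g assume "g \<in> ?N"
      then obtain x y a where g: "g = br x y" "a \<in> dual_space scl H" "x \<in> gwt X 0 a" "y \<in> gwt X 0 (\<lambda>h. - a h)" by blast
      have "g \<in> H" using gwt_br[OF g(3,4)] gwt0_cartan by (simp add: g(1))
      moreover have "\<Lambda> (tX g 0) = al g" using Lam_al_bracket[OF g(2-4)] by (simp add: g(1) lam_C0 mult.commute)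
      ultimately show "g \<in> ?W" by simp
    qed
    show "G.subspace ?W"
    proof (rule G.subspaceI)
      show "0 \<in> ?W" using G.subspace_0[OF H_subspace] by (simp add: tX_lin al_0)
      show "x + y \<in> ?W" if "x \<in> ?W" "y \<in> ?W" for x y
        using that G.subspace_add[OF H_subspace, of x y] by (simp add: tX_lin al)
      show "scl c x \<in> ?W" if "x \<in> ?W" for c x
        using that G.subspace_scale[OF H_subspace, of x c] by (simp add: tX_lin al')
    qed
  qed
  then show ?thesis using cartan_brackets[OF h] by blast
qed

text \<open>Outside H both sides hold by the convention that functionals vanish off their domain; so
  the equivalence applies to the coroots, which come from a description operator, without locating
  them in H.\<close>

lemma Lam_al_zero_iff: "al h = 0 \<longleftrightarrow> \<Lambda> (tX h 0) = 0"
proof (cases "h \<in> H")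
  case True
  then show ?thesis by (simp add: Lam_al)
next
  case False
  have "tX h 0 \<notin> HH X"
  proof
    assume "tX h 0 \<in> HH X"
    from HH_fst[OF this] show False using False by (simp add: tX_def)
  qed
  then have "\<Lambda> (tX h 0) = 0" using Lam_dual unfolding dual_space_def by blast
  then show ?thesis using False by (simp add: al_def)
qed

section \<open>Bases of the graded components\<close>

lemma z_rho: "\<rho> (tK (0, r) None) = z r"
  by (simp add: z_def Kw_def tK_tKw)

lemma z_module_hom: "r \<in> GX \<Longrightarrow> module_hom sV sV (z r)"
  unfolding z_rho[symmetric]
  by (rule linear_iff_module_hom[THEN iffD1, OF rho_linear[OF tK_in_tor]]) (simp add: Gam_lat)

lemma z_inj_on: "r \<in> GX \<Longrightarrow> inj_on (z r) (Mk k)"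
  by (rule inj_onI) (use z_inj Mk_sub in blast)

text \<open>\<open>z (- r)\<close> is an inverse up to the non-zero scalar lam^2, or C_0^2 for r =
  0.\<close>

lemma z_image: "r \<in> GX \<Longrightarrow> z r ` Mk k = Mk (k + r)"
proof
  assume r: "r \<in> GX"
  show "z r ` Mk k \<subseteq> Mk (k + r)" using z_Mk[OF r] by blast
  show "Mk (k + r) \<subseteq> z r ` Mk k"
  proof
    fix w assume w: "w \<in> Mk (k + r)"
    then have wM: "w \<in> M" using Mk_sub by blast
    obtain c where c: "c \<noteq> 0" "z r (z (- r) w) = sV c w"
    proof (cases "r = 0")
      case True
      then have "z r (z (- r) w) = sV (of_int C0 * of_int C0) w" by (simp add: z_0)
      then show ?thesis using that[of "of_int C0 * of_int C0"] C0_pos by simp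
    next
      case False
      then show ?thesis using that[of "lam ^ 2"] zz_neg[OF r False wM] lam_nz by simp
    qed
    have "w = z r (sV (1 / c) (z (- r) w))" using c by (simp add: z_scale[OF r])
    moreover have "sV (1 / c) (z (- r) w) \<in> Mk k"
      using V.subspace_scale[OF V.fdim_subspace[OF Mk_fd]] z_Mk[OF Gam_neg[OF r] w] by simp
    ultimately show "w \<in> z r ` Mk k" by blast
  qed
qed

lemma basis_image:
  assumes r: "r \<in> GX" and c: "c \<noteq> 0" and B: "indexed_basis sV p v (Mk k)"
  shows "indexed_basis sV p (\<lambda>i. sV c (z r (v i))) (Mk (k + r))"
proof -
  let ?f = "\<lambda>w. sV c (z r w)"
  have lin: "module_hom sV sV ?f"
    using z_module_hom[OF r] unfolding module_hom_iff by (simp add: V.scale_right_distrib V.scale_left_commute)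
  have b: "inj_on v {1..p}" "\<not> V.dependent (v ` {1..p})" "V.span (v ` {1..p}) = Mk k"
    using B by (auto simp: indexed_basis_def)
  have inj: "inj_on ?f (V.span (v ` {1..p}))"
    unfolding b(3) using z_inj_on[OF r, of k] c by (auto simp: inj_on_def)
  have vs: "v ` {1..p} \<subseteq> V.span (v ` {1..p})" by (rule V.span_superset)
  have im: "(\<lambda>i. ?f (v i)) ` {1..p} = ?f ` (v ` {1..p})" by (simp add: image_image)
  have "inj_on (\<lambda>i. ?f (v i)) {1..p}"
    using comp_inj_on[OF b(1) inj_on_subset[OF inj vs]] by (simp add: comp_def)
  moreover have "\<not> V.dependent ((\<lambda>i. ?f (v i)) ` {1..p})"
    unfolding im by (rule module_hom.independent_injective_image[OF lin b(2) inj])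
  moreover have "V.span ((\<lambda>i. ?f (v i)) ` {1..p}) = Mk (k + r)"
  proof -
    have "V.span (?f ` (v ` {1..p})) = ?f ` Mk k" using module_hom.span_image[OF lin] b(3) by simp
    also have "\<dots> = sV c ` Mk (k + r)" unfolding z_image[OF r, symmetric] by (simp add: image_image)
    also have "\<dots> = Mk (k + r)"
    proof
      note s = V.subspace_scale[OF V.fdim_subspace[OF Mk_fd]]
      show "sV c ` Mk (k + r) \<subseteq> Mk (k + r)" using s by blast
      show "Mk (k + r) \<subseteq> sV c ` Mk (k + r)"
      proof
        fix w assume "w \<in> Mk (k + r)"
        then have "sV (1 / c) w \<in> Mk (k + r)" by (rule s)
        then show "w \<in> sV c ` Mk (k + r)" using c by (intro image_eqI[of _ _ "sV (1 / c) w"]) simp_all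
      qed
    qed
    finally show ?thesis unfolding im .
  qed
  ultimately show ?thesis by (simp add: indexed_basis_def)
qed

lemma dim_shift:
  assumes r: "r \<in> GX"
  shows "V.dim (Mk k) = V.dim (Mk (k + r))"
proof -
  obtain B where B: "B \<subseteq> Mk k" "\<not> V.dependent B" "Mk k \<subseteq> V.span B" "card B = V.dim (Mk k)" using V.basis_exists by blast
  have sp: "V.span B = Mk k" by (rule V.span_subspace[OF B(1,3) V.fdim_subspace[OF Mk_fd]])
  note h = z_module_hom[OF r]
  have "\<not> V.dependent (z r ` B)"
    by (rule module_hom.independent_injective_image[OF h B(2)]) (simp add: sp z_inj_on[OF r])
  moreover have "V.span (z r ` B) = Mk (k + r)"
    using module_hom.span_image[OF h] sp z_image[OF r] by simp
  ultimately have "V.dim (V.span (z r ` B)) = card (z r ` B)"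
    by (intro trans[OF V.dim_span V.dim_eq_card_independent])
  also have "card (z r ` B) = card B" by (rule card_image[OF inj_on_subset[OF z_inj_on[OF r] B(1)]])
  finally show ?thesis using B(4) \<open>V.span (z r ` B) = Mk (k + r)\<close> by simp
qed

lemma indexed_basis_mem: "indexed_basis sV p v W \<Longrightarrow> i \<in> {1..p} \<Longrightarrow> v i \<in> W"
  using V.span_superset[of "v ` {1..p}"] by (auto simp: indexed_basis_def)

text \<open>The basis at s = 0 is not divided by \<open>lam\<close>, the others are. The factor is
  \<open>lam\<close> nevertheless in the two exceptional cases: for s = 0 by definition, and for r +
  s = 0 because lam^2 / lam = lam.\<close>

lemma z_bases:
  assumes s: "s \<in> GX" and r: "r \<in> GX" "r \<noteq> 0" and w: "w \<in> M"
    and v: "v k = w" "\<And>s. s \<in> GX \<Longrightarrow> s \<noteq> 0 \<Longrightarrow> v (k + s) = sV (1 / lam) (z s w)"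
  shows "z r (v (k + s)) = sV lam (v (k + s + r))"
proof (cases "s = 0")
  case True
  then show ?thesis using v(2)[OF r] lam_nz by (simp add: v(1))
next
  case False
  have e: "z r (v (k + s)) = sV (1 / lam) (z r (z s w))" using v(2)[OF s False] by (simp add: z_scale[OF r(1)])
  show ?thesis
  proof (cases "r + s = 0")
    case True
    then have sr: "s = - r" by (simp add: add_eq_0_iff)
    show ?thesis
      using zz_neg[OF r w] lam_nz unfolding e unfolding sr by (simp add: v(1) power2_eq_square)
  next
    case f: False
    have "v (k + s + r) = sV (1 / lam) (z (r + s) w)"
      using v(2)[OF Gam_add[OF r(1) s] f] by (simp only: add_ac)
    then show ?thesis unfolding e using zz_lam[OF r(1) s r(2) False f w] by simp
  qed
qed

end

context tor_top
begin

lemma indexed_basis_cong: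
  assumes "\<And>i. i \<in> {1..p} \<Longrightarrow> v i = w i"
  shows "indexed_basis sV p v W \<longleftrightarrow> indexed_basis sV p w W"
proof -
  have "v ` {1..p} = w ` {1..p}" by (rule image_cong) (use assms in auto)
  moreover have "inj_on v {1..p} \<longleftrightarrow> inj_on w {1..p}" by (rule inj_on_cong) (use assms in auto)
  ultimately show ?thesis by (simp add: indexed_basis_def)
qed

end

theorem proposition3p10:
  fixes X :: "('g::ab_group_add, 'n::finite) datum"
    and sV :: "complex \<Rightarrow> 'v::ab_group_add \<Rightarrow> 'v"
    and \<rho> :: "('g, 'n) tor \<Rightarrow> 'v \<Rightarrow> 'v"
    and C0 :: int
    and \<Lambda> :: "('g, 'n) tor \<Rightarrow> complex"
  assumes "CARD('n) \<ge> 2"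
    and "lie_torus_datum X"
    and "tor_module X sV \<rho>"
    and "irreducible_module X sV \<rho>"
    and "integrable_module X sV \<rho>"
    and "C0 > 0"
    and "\<And>v. \<rho> (tK 0 None) v = sV (of_int C0) v"
    and "\<And>i v. \<rho> (tK 0 (Some i)) v = 0"
    and "M_weight X sV \<rho> \<Lambda>"
  shows
    "(\<forall>r\<in>Gam X. \<forall>w\<in>M_space X \<rho>. w \<noteq> 0 \<longrightarrow> \<rho> (tK (0, r) None) w \<noteq> 0) \<and>
     (\<exists>(ls :: int ^ 'n \<Rightarrow> int ^ 'n \<Rightarrow> complex) (l :: complex) (\<mu> :: complex).
        (\<forall>r\<in>Gam X. \<forall>s\<in>Gam X. \<forall>w\<in>M_space X \<rho>.
           \<rho> (tK (0, r) None) (\<rho> (tK (0, s) None) w) = sV (ls r s) (\<rho> (tK (0, r + s) None) w)) \<and>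
        (\<forall>r\<in>Gam X. \<forall>s\<in>Gam X. r \<noteq> 0 \<longrightarrow> s \<noteq> 0 \<longrightarrow> r + s \<noteq> 0 \<longrightarrow> ls r s = l) \<and>
        (\<forall>r\<in>Gam X. r \<noteq> 0 \<longrightarrow> ls r (- r) = \<mu>) \<and>
        (\<forall>r\<in>Gam X. ls 0 r = of_int C0) \<and>
        \<mu> * of_int C0 = l ^ 2 \<and> l ^ 2 \<noteq> 0 \<and>
        (\<forall>k. \<forall>r\<in>Gam X.
           vector_space.dim sV (M_deg X sV \<rho> \<Lambda> k) = vector_space.dim sV (M_deg X sV \<rho> \<Lambda> (k + r))) \<and>
        (\<forall>(p :: int ^ 'n \<Rightarrow> nat) (v :: nat \<Rightarrow> int ^ 'n \<Rightarrow> 'v).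
           (\<forall>k. p k = vector_space.dim sV (M_deg X sV \<rho> \<Lambda> k)) \<and>
           (\<forall>k\<in>fund_box X. indexed_basis sV (p k) (\<lambda>i. v i k) (M_deg X sV \<rho> \<Lambda> k)) \<and>
           (\<forall>k\<in>fund_box X. \<forall>i\<in>{1..p k}. \<forall>s\<in>Gam X. s \<noteq> 0 \<longrightarrow>
              v i (k + s) = sV (1 / l) (\<rho> (tK (0, s) None) (v i k))) \<longrightarrow>
           (\<forall>k\<in>fund_box X. \<forall>s\<in>Gam X.
              indexed_basis sV (p k) (\<lambda>i. v i (k + s)) (M_deg X sV \<rho> \<Lambda> (k + s))) \<and>
           (\<forall>k\<in>fund_box X. \<forall>r\<in>Gam X. \<forall>s\<in>Gam X. r \<noteq> 0 \<longrightarrow> (\<forall>i\<in>{1..p k}.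
              \<rho> (tK (0, r) None) (v i (k + s)) = sV l (v i (k + s + r)))) \<and>
           (\<exists>\<alpha>\<in>dual_space (scal X) (cartan X).
              (\<forall>h\<in>cartan X. \<forall>k\<in>fund_box X. \<forall>r\<in>Gam X. \<forall>s\<in>Gam X. r \<noteq> 0 \<longrightarrow> (\<forall>i\<in>{1..p k}.
                 \<rho> (tX h (0, r)) (v i (k + s)) = sV (\<alpha> h) (v i (k + s + r)))) \<and>
              (\<forall>i\<in>{1..rk X}. \<alpha> (coroot X (simple_root X i)) = 0 \<longleftrightarrow>
                 \<Lambda> (tX (coroot X (simple_root X i)) 0) = 0)) \<and>
           (\<exists>\<Lambda>d :: complex. \<forall>k\<in>fund_box X. \<forall>r\<in>Gam X. \<forall>s\<in>Gam X. r \<noteq> 0 \<longrightarrow> (\<forall>i\<in>{1..p k}.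
              \<rho> (tD (axis None 1) (0, r)) (v i (k + s)) = sV \<Lambda>d (v i (k + s + r))))) \<and>
        (\<forall>k. \<forall>w\<in>M_deg X sV \<rho> \<Lambda> k. \<rho> (td None) w = sV (\<Lambda> (td None)) w))"
proof -
  interpret tor_top X sV \<rho> C0 \<Lambda>
    by (intro tor_top.intro tor_rep.intro lie_torus.intro tor_rep_axioms.intro tor_top_axioms.intro) (fact assms)+
  \<comment> \<open>z(r) z(-r) = lam^2 has to be \<mu> times \<open>z 0\<close>, which is the scalar
    C_0.\<close>
  define mu where "mu = lam ^ 2 / of_int C0"
  \<comment> \<open>The case s = 0 gets C_0 as well, since the scalar \<open>z 0\<close> may stand
    on either side.\<close>
  define ls :: "int ^ 'n \<Rightarrow> int ^ 'n \<Rightarrow> complex" where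
    "ls r s = (if r = 0 \<or> s = 0 then of_int C0 else if r + s = 0 then mu else lam)" for r s
  have mu: "mu * of_int C0 = lam ^ 2" using C0_pos by (simp add: mu_def)
  obtain \<mu>E where E: "\<And>r w. r \<in> GX \<Longrightarrow> r \<noteq> 0 \<Longrightarrow> w \<in> M \<Longrightarrow> Ed r w = sV \<mu>E (z r w)"
    using fam_multiple[OF compatible_d0] by blast
  have zz: "z r (z s w) = sV (ls r s) (z (r + s) w)" if h: "r \<in> GX" "s \<in> GX" "w \<in> M" for r s w
  proof -
    consider "r = 0" | "r \<noteq> 0" "s = 0" | "r \<noteq> 0" "s \<noteq> 0" "r + s = 0" | "r \<noteq> 0" "s \<noteq> 0" "r + s \<noteq> 0" by blast
    then show ?thesis
    proof cases
      case 3
      then have "s = - r" by (simp add: add_eq_0_iff)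
      then show ?thesis using zz_neg[OF h(1) 3(1) h(3)] 3 mu by (simp add: ls_def z_0)
    next
      case 4
      then show ?thesis using zz_lam[OF h(1,2) 4 h(3)] by (simp add: ls_def)
    qed (simp_all add: ls_def z_0 z_scale h)
  qed
  have d0: "\<rho> (td None) w = sV (\<Lambda> (td None)) w" if w: "w \<in> Mk k" for k w
  proof -
    have "delta_vec X k (td None) = 0" unfolding delta_vec_sh sh_td[OF zero_dual] by simp
    then show ?thesis using Mk_wsp[OF w] td_HH[of None] by (simp add: weight_space_def)
  qed
  show ?thesis
    unfolding z_rho
  proof (rule conjI, goal_cases)
    case 1
    show ?case using z_nz by blast
  next
    case 2
    show ?case
    proof (rule exI[of _ ls], rule exI[of _ lam], rule exI[of _ mu], intro conjI, goal_cases)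
      case 8
      show ?case
      proof (intro allI impI, elim conjE, goal_cases)
        case (1 p v)
        note b = 1(2) and vs = 1(3)
        have basis: "indexed_basis sV (p k) (\<lambda>i. v i (k + s)) (Mk (k + s))" if k: "k \<in> fund_box X" and s: "s \<in> GX" for k s
        proof (cases "s = 0")
          case True
          then show ?thesis using b k by simp
        next
          case False
          have "indexed_basis sV (p k) (\<lambda>i. v i (k + s)) (Mk (k + s)) \<longleftrightarrow>
              indexed_basis sV (p k) (\<lambda>i. sV (1 / lam) (z s (v i k))) (Mk (k + s))"
            by (rule indexed_basis_cong) (use vs k s False in blast)
          then show ?thesis using basis_image[OF s, of "1 / lam"] b k lam_nz by simp
        qed
        have vM: "v i (k + s) \<in> M" if "k \<in> fund_box X" "s \<in> GX" "i \<in> {1..p k}" for i k s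
          using indexed_basis_mem[OF basis[OF that(1,2)] that(3)] Mk_sub by blast
        have zv: "z r (v i (k + s)) = sV lam (v i (k + s + r))"
          if k: "k \<in> fund_box X" and r: "r \<in> GX" "r \<noteq> 0" and s: "s \<in> GX" and i: "i \<in> {1..p k}" for k r s i
        proof (rule z_bases[OF s r, where v = "v i" and k = k])
          show "v i k \<in> M" using vM[OF k Gam_0 i] by simp
          show "v i (k + s) = sV (1 / lam) (z s (v i k))" if "s \<in> GX" "s \<noteq> 0" for s
            using vs k i that by blast
        qed (rule refl)
        have hv: "\<rho> (tX h (0, r)) (v i (k + s)) = sV (al h) (v i (k + s + r))"
          if "h \<in> H" "k \<in> fund_box X" "r \<in> GX" "s \<in> GX" "r \<noteq> 0" "i \<in> {1..p k}" for h k r s i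
          using R_al[OF that(1,3,5) vM[OF that(2,4,6)]] zv[OF that(2,3,5,4,6)] lam_nz by (simp add: R_def)
        \<comment> \<open>The constant is \<open>\<mu>E\<close> times \<open>lam\<close>: t^r d_0 is
          \<open>\<mu>E\<close> times \<open>z r\<close>, and \<open>z r\<close> shifts the bases
          with factor \<open>lam\<close>.\<close>
        have Ev: "\<rho> (tD (axis None 1) (0, r)) (v i (k + s)) = sV (\<mu>E * lam) (v i (k + s + r))"
          if "k \<in> fund_box X" "r \<in> GX" "s \<in> GX" "r \<noteq> 0" "i \<in> {1..p k}" for k r s i
          using E[OF that(2,4) vM[OF that(1,3,5)]] zv[OF that(1,2,4,3,5)] by (simp add: D_def)
        show ?case
        proof (intro conjI, goal_cases)
          case 1
          show ?case using basis by blast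
        next
          case 2
          show ?case using zv by blast
        next
          case 3
          show ?case by (intro bexI[OF _ al_dual] conjI ballI impI hv Lam_al_zero_iff)
        next
          case 4
          show ?case by (intro exI[of _ "\<mu>E * lam"] ballI impI Ev)
        qed
      qed
    next
      case 1
      show ?case using zz by blast
    next
      case 5
      show ?case by (rule mu)
    next
      case 6
      show ?case using lam_nz by simp
    next
      case 7
      show ?case using dim_shift by blast
    next
      case 9
      show ?case using d0 by blast
    qed (simp_all add: ls_def)
  qed
qed

end
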